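(* Let $\varepsilon>0$. Then: (i) For each $x\in\mathbb{T}^n$ there exists $\xi\in\mathbb{R}^n$ such that every accumulation point of $\{\phi^s_{L,c,\varepsilon}(x,\xi)\}_{s\le0}$ as $s\to-\infty$ belongs to $\tilde{\mathcal{M}}^\varepsilon_\alpha(c)$; if $v^\varepsilon$ is differentiable at $x$, one can take $\xi=H_p(x,c+v^\varepsilon_x(x))$. (ii) $\phi^s_{L,c,\varepsilon}(\tilde{\mathcal{M}}^\varepsilon_\alpha(c))=\tilde{\mathcal{M}}^\varepsilon_\alpha(c)$ for all $s\in\mathbb{R}$. (iii) For each $x\in\mathbb{T}^n$ there exists $p\in\mathbb{R}^n$ such that $\phi^s_{H,c,\varepsilon}(x,p)\in\mathrm{graph}(c+v^\varepsilon_x)$ for all $s<0$ and every accumulation point of $\{\phi^s_{H,c,\varepsilon}(x,p)\}_{s\le0}$ as $s\to-\infty$ belongs to $\tilde{\mathcal{M}}^{\varepsilon\ast}_\alpha(c)$; if $v^\varepsilon$ is differentiable at $x$, one can take $p=c+v^\varepsilon_x(x)$. (iv) $\tilde{\mathcal{M}}^{\varepsilon\ast}_\alpha(c)\subset\mathrm{graph}(c+v^\varepsilon_x)$ and $\phi^s_{H,c,\varepsilon}(\tilde{\mathcal{M}}^{\varepsilon\ast}_\alpha(c))=\tilde{\mathcal{M}}^{\varepsilon\ast}_\alpha(c)$ for all $s\in\mathbb{R}$.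
   Context: $H:\mathbb{T}^n\times\mathbb{R}^n\to\mathbb{R}$ is $C^2$, $H_{pp}$ is positive definite, $H(x,p)/|p|\to+\infty$ as $|p|\to\infty$ uniformly in $x$; $L(x,\xi)=\sup_p\{\xi\cdot p-H(x,p)\}$. $c\in\mathbb{R}^n$ is fixed, $h(c)$ is the unique constant for which $H(x,c+v_x)=h(c)$ has a viscosity solution on $\mathbb{T}^n$. For $\varepsilon>0$, $v^\varepsilon$ is the unique viscosity solution of $\varepsilon v^\varepsilon+H(x,c+v^\varepsilon_x)=h(c)$ on $\mathbb{T}^n$; for all $x$, $T>0$, $v^\varepsilon(x)=\inf\{\int_{-T}^0e^{\varepsilon s}(L(\gamma,\gamma')-c\cdot\gamma'+h(c))ds+e^{-\varepsilon T}v^\varepsilon(\gamma(-T))\}$ over absolutely continuous $\gamma:[-T,0]\to\mathbb{T}^n$, $\gamma(0)=x$. A minimizing curve for $v^\varepsilon(x)$ is $\gamma^\varepsilon:(-\infty,0]\to\mathbb{T}^n$, $\gamma^\varepsilon(0)=x$, attaining this infimum on every $[-T,0]$. $\mathcal{M}^\varepsilon_\alpha(c)$ is the closure of the set of all $\alpha$-limit points (limits of $\gamma^\varepsilon(\tau_j)$, $\tau_j\to-\infty$) of minimizing curves for $v^\varepsilon(x)$, $x\in\mathbb{T}^n$; $v^\varepsilon$ is differentiable on it, and $\tilde{\mathcal{M}}^\varepsilon_\alpha(c):=\{(x,H_p(x,c+v^\varepsilon_x(x))):x\in\mathcal{M}^\varepsilon_\alpha(c)\}$, $\tilde{\mathcal{M}}^{\varepsilon\ast}_\alpha(c):=\{(x,c+v^\varepsilon_x(x)):x\in\mathcal{M}^\varepsilon_\alpha(c)\}$.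 $\mathrm{graph}(c+v^\varepsilon_x):=\{(x,c+v^\varepsilon_x(x)): v^\varepsilon\text{ differentiable at }x\}$. $\phi^s_{L,c,\varepsilon}$ is the flow on $\mathbb{T}^n\times\mathbb{R}^n$, $(x(0),x'(0))\mapsto(x(s),x'(s))$, of $\frac{d}{ds}L_\xi(x,x')=L_x(x,x')-\varepsilon L_\xi(x,x')+\varepsilon c$; $\phi^s_{H,c,\varepsilon}$ is the flow of $x'=H_p(x,p)$, $p'=-H_x(x,p)+\varepsilon c-\varepsilon p$. *)

theory Defs
  imports "HOL-Analysis.Analysis"
begin

text \<open>The torus T^n is handled through its universal cover R^n = real^'n: functions on
T^n are Z^n-periodic functions on R^n, subsets of T^n are Z^n-invariant subsets of R^n,
curves on T^n are represented by their lifts to R^n.\<close>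

definition int_vec :: "real^'n \<Rightarrow> bool" where
  "int_vec k \<longleftrightarrow> (\<forall>i. k $ i \<in> \<int>)"

definition periodic_fun :: "(real^'n \<Rightarrow> 'b) \<Rightarrow> bool" where
  "periodic_fun f \<longleftrightarrow> (\<forall>x k. int_vec k \<longrightarrow> f (x + k) = f x)"

definition C2_fun :: "('a::real_normed_vector \<Rightarrow> real) \<Rightarrow> bool" where
  "C2_fun f \<longleftrightarrow> (\<exists>(f' :: 'a \<Rightarrow> 'a \<Rightarrow>\<^sub>L real) (f'' :: 'a \<Rightarrow> 'a \<Rightarrow>\<^sub>L ('a \<Rightarrow>\<^sub>L real)).
      (\<forall>z. (f has_derivative blinfun_apply (f' z)) (at z)) \<and>
      (\<forall>z. (f' has_derivative blinfun_apply (f'' z)) (at z)) \<and>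
      continuous_on UNIV f'')"

definition C1_fun :: "('a::real_normed_vector \<Rightarrow> real) \<Rightarrow> bool" where
  "C1_fun f \<longleftrightarrow> (\<exists>(f' :: 'a \<Rightarrow> 'a \<Rightarrow>\<^sub>L real).
      (\<forall>z. (f has_derivative blinfun_apply (f' z)) (at z)) \<and> continuous_on UNIV f')"

text \<open>Gradient of a real function on R^n at a point (meaningful where differentiable).\<close>
definition grad :: "(real^'n \<Rightarrow> real) \<Rightarrow> real^'n \<Rightarrow> real^'n" where
  "grad f x = (SOME g. (f has_derivative (\<lambda>h. g \<bullet> h)) (at x))"

definition Hp :: "(real^'n \<Rightarrow> real^'n \<Rightarrow> real) \<Rightarrow> real^'n \<Rightarrow> real^'n \<Rightarrow> real^'n" where
  "Hp H x p = grad (\<lambda>q. H x q) p"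

definition Hx :: "(real^'n \<Rightarrow> real^'n \<Rightarrow> real) \<Rightarrow> real^'n \<Rightarrow> real^'n \<Rightarrow> real^'n" where
  "Hx H x p = grad (\<lambda>y. H y p) x"

definition tonelli_ham :: "(real^'n \<Rightarrow> real^'n \<Rightarrow> real) \<Rightarrow> bool" where
  "tonelli_ham H \<longleftrightarrow>
     C2_fun (\<lambda>z. H (fst z) (snd z)) \<and>
     (\<forall>p. periodic_fun (\<lambda>x. H x p)) \<and>
     (\<forall>x p. \<exists>D. ((\<lambda>q. Hp H x q) has_derivative D) (at p) \<and>
                 (\<forall>w. w \<noteq> 0 \<longrightarrow> w \<bullet> D w > 0)) \<and>
     (\<forall>M. \<exists>R. \<forall>x p. norm p \<ge> R \<longrightarrow> H x p \<ge> M * norm p)"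

definition lagr :: "(real^'n \<Rightarrow> real^'n \<Rightarrow> real) \<Rightarrow> real^'n \<Rightarrow> real^'n \<Rightarrow> real" where
  "lagr H x \<xi> = (SUP p. \<xi> \<bullet> p - H x p)"

definition Lx :: "(real^'n \<Rightarrow> real^'n \<Rightarrow> real) \<Rightarrow> real^'n \<Rightarrow> real^'n \<Rightarrow> real^'n" where
  "Lx H x \<xi> = grad (\<lambda>y. lagr H y \<xi>) x"

definition Lxi :: "(real^'n \<Rightarrow> real^'n \<Rightarrow> real) \<Rightarrow> real^'n \<Rightarrow> real^'n \<Rightarrow> real^'n" where
  "Lxi H x \<xi> = grad (\<lambda>\<eta>. lagr H x \<eta>) \<xi>"

definition visc_sol ::
  "(real^'n \<Rightarrow> real^'n \<Rightarrow> real) \<Rightarrow> real^'n \<Rightarrow> real \<Rightarrow> real \<Rightarrow> (real^'n \<Rightarrow> real) \<Rightarrow> bool" where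
  "visc_sol H c eps a v \<longleftrightarrow>
     continuous_on UNIV v \<and> periodic_fun v \<and>
     (\<forall>x \<phi>. C1_fun \<phi> \<and> (\<exists>e>0. \<forall>y. dist y x < e \<longrightarrow> v y - \<phi> y \<le> v x - \<phi> x)
        \<longrightarrow> eps * v x + H x (c + grad \<phi> x) \<le> a) \<and>
     (\<forall>x \<phi>. C1_fun \<phi> \<and> (\<exists>e>0. \<forall>y. dist y x < e \<longrightarrow> v y - \<phi> y \<ge> v x - \<phi> x)
        \<longrightarrow> eps * v x + H x (c + grad \<phi> x) \<ge> a)"

definition hcrit :: "(real^'n \<Rightarrow> real^'n \<Rightarrow> real) \<Rightarrow> real^'n \<Rightarrow> real" where
  "hcrit H c = (THE a. \<exists>v. visc_sol H c 0 a v)"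

definition veps :: "(real^'n \<Rightarrow> real^'n \<Rightarrow> real) \<Rightarrow> real^'n \<Rightarrow> real \<Rightarrow> real^'n \<Rightarrow> real" where
  "veps H c eps = (THE v. visc_sol H c eps (hcrit H c) v)"

definition abs_cont_on :: "real \<Rightarrow> real \<Rightarrow> (real \<Rightarrow> 'a::real_normed_vector) \<Rightarrow> bool" where
  "abs_cont_on lo hi \<gamma> \<longleftrightarrow>
     (\<forall>e>0. \<exists>d>0. \<forall>(m::nat) (a::nat\<Rightarrow>real) b.
        (\<forall>i<m. lo \<le> a i \<and> a i \<le> b i \<and> b i \<le> hi) \<and>
        (\<forall>i<m. \<forall>j<m. i \<noteq> j \<longrightarrow> b i \<le> a j \<or> b j \<le> a i) \<and>
        (\<Sum>i<m. b i - a i) < d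
        \<longrightarrow> (\<Sum>i<m. norm (\<gamma> (b i) - \<gamma> (a i))) < e)"

text \<open>Discounted action integrand on [-T,0] and admissible curves (abs. continuous with
finite action; curves with non-integrable integrand have action +infinity, since the
integrand is bounded below, and are therefore irrelevant for the infimum).\<close>
definition integrand ::
  "(real^'n \<Rightarrow> real^'n \<Rightarrow> real) \<Rightarrow> real^'n \<Rightarrow> real \<Rightarrow> real \<Rightarrow> (real \<Rightarrow> real^'n) \<Rightarrow> real \<Rightarrow> real" where
  "integrand H c eps T \<gamma> s =
     exp (eps * s) * (lagr H (\<gamma> s) (vector_derivative \<gamma> (at s within {-T..0}))
        - c \<bullet> vector_derivative \<gamma> (at s within {-T..0}) + hcrit H c)"

definition admissible ::
  "(real^'n \<Rightarrow> real^'n \<Rightarrow> real) \<Rightarrow> real^'n \<Rightarrow> real \<Rightarrow> real \<Rightarrow> (real \<Rightarrow> real^'n) \<Rightarrow> bool" where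
  "admissible H c eps T \<gamma> \<longleftrightarrow>
     abs_cont_on (-T) 0 \<gamma> \<and> integrand H c eps T \<gamma> absolutely_integrable_on {-T..0}"

definition action ::
  "(real^'n \<Rightarrow> real^'n \<Rightarrow> real) \<Rightarrow> real^'n \<Rightarrow> real \<Rightarrow> real \<Rightarrow> (real \<Rightarrow> real^'n) \<Rightarrow> real" where
  "action H c eps T \<gamma> =
     integral {-T..0} (integrand H c eps T \<gamma>) + exp (- eps * T) * veps H c eps (\<gamma> (-T))"

definition minimizing ::
  "(real^'n \<Rightarrow> real^'n \<Rightarrow> real) \<Rightarrow> real^'n \<Rightarrow> real \<Rightarrow> real^'n \<Rightarrow> (real \<Rightarrow> real^'n) \<Rightarrow> bool" where
  "minimizing H c eps x \<gamma> \<longleftrightarrow> \<gamma> 0 = x \<and>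
     (\<forall>T>0. admissible H c eps T \<gamma> \<and>
        (\<forall>\<eta>. \<eta> 0 = x \<and> admissible H c eps T \<eta> \<longrightarrow> action H c eps T \<gamma> \<le> action H c eps T \<eta>))"

text \<open>alpha-limit points in T^n (as a Z^n-invariant subset of R^n).\<close>
definition alpha_limits :: "(real \<Rightarrow> real^'n) \<Rightarrow> (real^'n) set" where
  "alpha_limits \<gamma> = {y. \<exists>\<tau> k. filterlim \<tau> at_bot sequentially \<and> (\<forall>j. int_vec (k j)) \<and>
                          ((\<lambda>j. \<gamma> (\<tau> j) + k j) \<longlonglongrightarrow> y)}"

definition Malpha :: "(real^'n \<Rightarrow> real^'n \<Rightarrow> real) \<Rightarrow> real^'n \<Rightarrow> real \<Rightarrow> (real^'n) set" where
  "Malpha H c eps = closure (\<Union>x. \<Union>{alpha_limits \<gamma> | \<gamma>. minimizing H c eps x \<gamma>})"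

definition Malpha_tilde :: "(real^'n \<Rightarrow> real^'n \<Rightarrow> real) \<Rightarrow> real^'n \<Rightarrow> real \<Rightarrow> ((real^'n) \<times> (real^'n)) set" where
  "Malpha_tilde H c eps =
     {(x, Hp H x (c + grad (veps H c eps) x)) | x. x \<in> Malpha H c eps}"

definition Malpha_star :: "(real^'n \<Rightarrow> real^'n \<Rightarrow> real) \<Rightarrow> real^'n \<Rightarrow> real \<Rightarrow> ((real^'n) \<times> (real^'n)) set" where
  "Malpha_star H c eps = {(x, c + grad (veps H c eps) x) | x. x \<in> Malpha H c eps}"

definition graph_grad :: "(real^'n \<Rightarrow> real^'n \<Rightarrow> real) \<Rightarrow> real^'n \<Rightarrow> real \<Rightarrow> ((real^'n) \<times> (real^'n)) set" where
  "graph_grad H c eps =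
     {(x, c + grad (veps H c eps) x) | x. veps H c eps differentiable (at x)}"

definition alpha_acc :: "(real \<Rightarrow> (real^'n) \<times> (real^'n)) \<Rightarrow> ((real^'n) \<times> (real^'n)) set" where
  "alpha_acc \<Gamma> = {w. \<exists>\<tau> k. filterlim \<tau> at_bot sequentially \<and> (\<forall>j. int_vec (k j)) \<and>
                          ((\<lambda>j. (fst (\<Gamma> (\<tau> j)) + k j, snd (\<Gamma> (\<tau> j)))) \<longlonglongrightarrow> w)}"

definition EL_traj ::
  "(real^'n \<Rightarrow> real^'n \<Rightarrow> real) \<Rightarrow> real^'n \<Rightarrow> real \<Rightarrow> real set \<Rightarrow> (real \<Rightarrow> (real^'n) \<times> (real^'n)) \<Rightarrow> bool" where
  "EL_traj H c eps I \<Gamma> \<longleftrightarrow> continuous_on I \<Gamma> \<and>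
     (\<forall>t\<in>I. ((\<lambda>s. fst (\<Gamma> s)) has_vector_derivative snd (\<Gamma> t)) (at t within I) \<and>
            ((\<lambda>s. Lxi H (fst (\<Gamma> s)) (snd (\<Gamma> s))) has_vector_derivative
               (Lx H (fst (\<Gamma> t)) (snd (\<Gamma> t)) - eps *\<^sub>R Lxi H (fst (\<Gamma> t)) (snd (\<Gamma> t)) + eps *\<^sub>R c))
               (at t within I))"

definition H_traj ::
  "(real^'n \<Rightarrow> real^'n \<Rightarrow> real) \<Rightarrow> real^'n \<Rightarrow> real \<Rightarrow> real set \<Rightarrow> (real \<Rightarrow> (real^'n) \<times> (real^'n)) \<Rightarrow> bool" where
  "H_traj H c eps I \<Gamma> \<longleftrightarrow>
     (\<forall>t\<in>I. (\<Gamma> has_vector_derivative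
        (Hp H (fst (\<Gamma> t)) (snd (\<Gamma> t)),
         - Hx H (fst (\<Gamma> t)) (snd (\<Gamma> t)) + eps *\<^sub>R c - eps *\<^sub>R snd (\<Gamma> t))) (at t within I))"

definition flow_image ::
  "(real set \<Rightarrow> (real \<Rightarrow> 'a) \<Rightarrow> bool) \<Rightarrow> real \<Rightarrow> 'a set \<Rightarrow> 'a set" where
  "flow_image traj s A = {\<Gamma> s | \<Gamma>. traj {min 0 s..max 0 s} \<Gamma> \<and> \<Gamma> 0 \<in> A}"

text \<open>The backward orbit of z (s \<le> 0) exists, and all its accumulation points as
 s -> -infinity lie in A (for every such trajectory; trajectories are unique).\<close>
definition backward_orbit_prop ::
  "(real set \<Rightarrow> (real \<Rightarrow> 'a) \<Rightarrow> bool) \<Rightarrow> 'a \<Rightarrow> ((real \<Rightarrow> 'a) \<Rightarrow> bool) \<Rightarrow> bool" where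
  "backward_orbit_prop traj z P \<longleftrightarrow>
     (\<exists>\<Gamma>. traj {..0} \<Gamma> \<and> \<Gamma> 0 = z) \<and> (\<forall>\<Gamma>. traj {..0} \<Gamma> \<and> \<Gamma> 0 = z \<longrightarrow> P \<Gamma>)"

end

theory Submission
  imports Defs "HOL-Complex_Analysis.Great_Picard"
begin

text \<open>
  The constant h(c) enters only as a number a, since the discounted equation is uniquely
  solvable for every right-hand side (doubling of variables). A solution v is obtained as a limit
  of the semi-discrete problems
  \<open>u x = min {(1 - eps h) u (x - h \<xi>) + h l(x, \<xi>) | norm \<xi> \<le> R}\<close> with \<open>l = L - c \<bullet> \<xi> + a\<close>, solved
  by Tarski's theorem in a class of periodic, equi-Lipschitz, uniformly semiconcave functions. The
  discrete optimal orbits converge to Lipschitz curves that are calibrated in a derivative-free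
  form, which is stable under pointwise limits. Coercivity makes the limit independent of
  large R, so v is dominated along segments of every speed and, by differentiating almost
  everywhere, along every absolutely continuous curve. Hence calibrated and minimizing curves
  coincide.

  Along a calibrated curve that can be continued forward, every supergradient q of v satisfies the
  equality case of Fenchel's inequality with each limit velocity, so q is unique, v is differentiable
  there and the curve has velocity \<open>Hp(x, c + grad v)\<close>. Comparing the curve with its translates gives the
  momentum equation, so the lift \<open>(x, c + grad v)\<close> is an orbit of the Hamiltonian system. Limits of
  backward shifts of minimizing curves are calibrated on the whole line and consist of limit points,
  which gives the invariance statements; the Legendre transform carries everything to the
  Euler--Lagrange flow.
\<close>

section \<open>Absolutely continuous functions of a real variable\<close>

text \<open>Competitors in the action are merely absolutely continuous, and v need not be
  differentiable at any point of such a curve. The chain rule is therefore replaced by one-variable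
  theory: v along the curve is itself absolutely continuous, its derivative is compared with
  segments of the same velocity, and the fundamental theorem of calculus turns this into an
  inequality for the action. The regularity of v comes from the discount alone. One step of the
  scheme maps a bound K for Lipschitz constants or supergradients to (1 - eps h) K + h C, with C the
  corresponding bound for \<open>ell\<close>; K = C / eps is its fixed point for every step h. The
  same arithmetic turns an error e in the first-order expansion of \<open>ell\<close> into the error
  e / eps for v, a modulus of semiconcavity that survives h tending to 0. Semiconcavity provides
  supergradients at every point, with closed graph, and so a unique supergradient is already a
  derivative. Truncating velocities at R is harmless: supergradients are controlled by
  \<open>P0\<close>, which only velocities of norm at most 1 enter, and the optimal velocities for
  such momenta are bounded by \<open>R0\<close>.\<close>

lemma Vitali_intervals:
  fixes E U :: "real set"
  assumes "open U" "E \<subseteq> U"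
    and fine: "\<forall>x\<in>E. \<forall>d>0. \<exists>p q. p < x \<and> x < q \<and> q - p < d \<and> Q p q"
  shows "\<exists>C :: (real \<times> real) set. countable C \<and>
    (\<forall>p q. (p, q) \<in> C \<longrightarrow> p < q \<and> {p..q} \<subseteq> U \<and> Q p q) \<and>
    disjoint_family_on (\<lambda>i. {fst i..snd i}) C \<and>
    negligible (E - (\<Union>i\<in>C. {fst i<..<snd i}))"
proof -
  define K where "K = {(p, q). p < q \<and> {p..q} \<subseteq> U \<and> Q p q}"
  define ce where "ce = (\<lambda>i::real \<times> real. (fst i + snd i) / 2)"
  define ra where "ra = (\<lambda>i::real \<times> real. (snd i - fst i) / 2)"
  have cb: "cball (ce i) (ra i) = {fst i..snd i}" for i
    unfolding ce_def ra_def cball_eq_atLeastAtMost by (simp add: field_simps)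
  have 1: "0 < ra i" if "i \<in> K" for i
    using that by (auto simp: K_def ra_def)
  have 2: "\<exists>i. i \<in> K \<and> x \<in> cball (ce i) (ra i) \<and> ra i < d" if xE: "x \<in> E" and d0: "0 < d" for x d
  proof -
    obtain r where r: "r > 0" "ball x r \<subseteq> U"
      using openE[OF \<open>open U\<close>] \<open>E \<subseteq> U\<close> xE by (metis subsetD)
    obtain p q where pq: "p < x" "x < q" "q - p < min d r" "Q p q"
      using bspec[OF fine xE] d0 r by (metis min_less_iff_conj)
    have "{p..q} \<subseteq> ball x r"
      using pq by (auto simp: dist_real_def)
    then have "(p, q) \<in> K"
      using r pq by (auto simp: K_def)
    moreover have "x \<in> cball (ce (p, q)) (ra (p, q))"
      unfolding cb using pq by auto
    moreover have "ra (p, q) < d"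
      using pq by (auto simp: ra_def)
    ultimately show ?thesis by blast
  qed
  obtain C where C: "countable C" "C \<subseteq> K"
    "pairwise (\<lambda>i j. disjnt (cball (ce i) (ra i)) (cball (ce j) (ra j))) C"
    "negligible (E - (\<Union>i \<in> C. cball (ce i) (ra i)))"
    using Vitali_covering_theorem_cballs[of K ra E ce, OF 1 2] by blast
  \<comment> \<open>Closed and open intervals differ only in endpoints, and C is countable: a null
    set. Disjointness is wanted for the closed intervals, the covering for the open ones, whose
    union is open.\<close>
  have "countable ((\<Union>i\<in>C. {fst i, snd i}))"
    using C(1) by auto
  then have "negligible ((E - (\<Union>i \<in> C. cball (ce i) (ra i))) \<union> (\<Union>i\<in>C. {fst i, snd i}))"
    using C(4) by (metis negligible_Un countable_imp_null_set_lborel negligible_iff_null_sets null_sets_completionI)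
  then have "negligible (E - (\<Union>i\<in>C. {fst i<..<snd i}))"
    by (rule negligible_subset) (auto simp: cb, metis fst_conv order_le_less snd_conv)
  moreover have "disjoint_family_on (\<lambda>i. {fst i..snd i}) C"
    using C(3) unfolding pairwise_def disjoint_family_on_def cb disjnt_def by blast
  ultimately show ?thesis
    using C(1,2) by (intro exI[of _ C]) (auto simp: K_def)
qed

text \<open>The condition concerns open intervals around x, so for an arbitrary predicate Q the set
  is a countable intersection of unions of open intervals, a G-delta set.\<close>

lemma fine_borel:
  fixes Q :: "real \<Rightarrow> real \<Rightarrow> bool"
  shows "{x. \<forall>d>0. \<exists>p q. p < x \<and> x < q \<and> q - p < d \<and> Q p q} \<in> sets borel"
proof -
  have "{x. \<forall>d>0. \<exists>p q. p < x \<and> x < q \<and> q - p < d \<and> Q p q} =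
      (\<Inter>n::nat. \<Union>i\<in>{i. snd i - fst i < inverse (Suc n) \<and> Q (fst i) (snd i)}. {fst i<..<snd i})"
    (is "?A = ?B")
  proof
    show "?A \<subseteq> ?B"
    proof clarify
      fix x :: real and n :: nat
      assume *: "\<forall>d>0. \<exists>p q. p < x \<and> x < q \<and> q - p < d \<and> Q p q"
      then obtain p q where "p < x" "x < q" "q - p < inverse (Suc n)" "Q p q"
        by (meson inverse_positive_iff_positive of_nat_0_less_iff zero_less_Suc)
      then show "x \<in> (\<Union>i\<in>{i. snd i - fst i < inverse (real (Suc n)) \<and> Q (fst i) (snd i)}. {fst i<..<snd i})"
        by (intro UN_I[of "(p, q)"]) auto
    qed
    show "?B \<subseteq> ?A"
    proof (clarify)
      fix x d :: real
      assume x: "x \<in> ?B" and "d > 0"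
      obtain n :: nat where n: "inverse (Suc n) < d"
        using reals_Archimedean \<open>d > 0\<close> by blast
      from x have "x \<in> (\<Union>i\<in>{i. snd i - fst i < inverse (real (Suc n)) \<and> Q (fst i) (snd i)}. {fst i<..<snd i})"
        by blast
      then obtain i where "snd i - fst i < inverse (Suc n)" "Q (fst i) (snd i)" "fst i < x" "x < snd i"
        by auto
      then show "\<exists>p q. p < x \<and> x < q \<and> q - p < d \<and> Q p q"
        using n by (intro exI[of _ "fst i"] exI[of _ "snd i"]) auto
    qed
  qed
  also have "?B \<in> sets borel"
  proof (intro sets.countable_INT' borel_open)
    show "range (\<lambda>n::nat. \<Union>i\<in>{i. snd i - fst i < inverse (real (Suc n)) \<and> Q (fst i) (snd i)}. {fst i<..<snd i})
      \<subseteq> sets borel"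
      by (intro image_subsetI borel_open open_UN) auto
  qed auto
  finally show ?thesis .
qed

lemma measure_Icc_sum:
  fixes M :: "real measure" and C :: "(real \<times> real) set"
  assumes "countable C" "disjoint_family_on (\<lambda>i. {fst i..snd i}) C"
    and sets: "sets M = sets borel"
  shows "emeasure M (\<Union>i\<in>C. {fst i..snd i}) = (\<integral>\<^sup>+i. emeasure M {fst i..snd i} \<partial>count_space C)"
  using assms by (intro emeasure_UN_countable) (auto simp: sets)

section \<open>Differentiability almost everywhere of continuous monotone functions\<close>

context
  fixes F :: "real \<Rightarrow> real"
  assumes mono: "\<And>x y. x \<le> y \<Longrightarrow> F x \<le> F y" and cont: "continuous_on UNIV F"
begin

text \<open>Essentially a superlevel set of the upper derivate, with quotients over intervals that
  straddle x. This form suits both the Vitali covering and \<open>fine_borel\<close>; one-sided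
  quotients are recovered by continuity in \<open>one_sided_le\<close>.\<close>

definition upper_fine :: "real \<Rightarrow> real set" where
  "upper_fine v = {x. \<forall>d>0. \<exists>p q. p < x \<and> x < q \<and> q - p < d \<and> F q - F p > v * (q - p)}"

definition lower_fine :: "real \<Rightarrow> real set" where
  "lower_fine u = {x. \<forall>d>0. \<exists>p q. p < x \<and> x < q \<and> q - p < d \<and> F q - F p < u * (q - p)}"

text \<open>Disjoint Vitali intervals inside U fill E up to a null set, and on each of them the
  Stieltjes measure of F exceeds v times the length.\<close>

lemma upper_fine_measure:
  assumes E: "E \<in> sets borel" "E \<subseteq> U" "open U" "E \<subseteq> upper_fine v" "v \<ge> 0"
  shows "ennreal v * emeasure lborel E \<le> emeasure (interval_measure F) U"
proof -
  have fine: "\<forall>x\<in>E. \<forall>d>0. \<exists>p q. p < x \<and> x < q \<and> q - p < d \<and> F q - F p > v * (q - p)"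
    using E(4) unfolding upper_fine_def by blast
  obtain C :: "(real \<times> real) set" where C: "countable C"
    "\<forall>p q. (p, q) \<in> C \<longrightarrow> p < q \<and> {p..q} \<subseteq> U \<and> F q - F p > v * (q - p)"
    "disjoint_family_on (\<lambda>i. {fst i..snd i}) C"
    "negligible (E - (\<Union>i\<in>C. {fst i<..<snd i}))"
    using Vitali_intervals[OF E(3,2) fine] by (elim exE conjE) (rule that)
  let ?I = "\<Union>i\<in>C. {fst i..snd i}"
  have I: "?I \<in> sets borel" using C(1) by auto
  have "negligible (E - ?I)"
    using C(4) by (rule negligible_subset) auto
  then have "E - ?I \<in> null_sets lborel"
    using E I by (simp add: negligible_iff_null_sets null_sets_completion_iff)
  then have "emeasure lborel E \<le> emeasure lborel (?I \<union> (E - ?I))"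
    using E I by (intro emeasure_mono) auto
  also have "\<dots> = emeasure lborel ?I"
    using I \<open>E - ?I \<in> null_sets lborel\<close> by (intro emeasure_Un_null_set) auto
  finally have "ennreal v * emeasure lborel E \<le> ennreal v * emeasure lborel ?I"
    by (rule mult_left_mono) auto
  also have "\<dots> = ennreal v * (\<integral>\<^sup>+i. emeasure lborel {fst i..snd i} \<partial>count_space C)"
    using measure_Icc_sum[OF C(1,3), of lborel] by simp
  also have "\<dots> = (\<integral>\<^sup>+i. ennreal v * emeasure lborel {fst i..snd i} \<partial>count_space C)"
    by (rule nn_integral_cmult[symmetric]) auto
  also have "\<dots> \<le> (\<integral>\<^sup>+i. emeasure (interval_measure F) {fst i..snd i} \<partial>count_space C)"
  proof (rule nn_integral_mono)
    fix i assume "i \<in> space (count_space C)"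
    then have i: "fst i < snd i" "F (snd i) - F (fst i) > v * (snd i - fst i)"
      using C(2)[rule_format, of "fst i" "snd i"] by auto
    then show "ennreal v * emeasure lborel {fst i..snd i} \<le> emeasure (interval_measure F) {fst i..snd i}"
      using \<open>v \<ge> 0\<close> by (subst emeasure_interval_measure_Icc[OF _ mono cont])
        (auto simp: ennreal_mult[symmetric] intro: ennreal_leI)
  qed
  also have "\<dots> = emeasure (interval_measure F) ?I"
    using measure_Icc_sum[OF C(1,3), of "interval_measure F"] by simp
  also have "\<dots> \<le> emeasure (interval_measure F) U"
    using E(3) by (intro emeasure_mono) (use C(2) in fastforce)+
  finally show ?thesis .
qed

text \<open>The Vitali intervals now bound the Stieltjes measure from above, but only on the open
  set U' that they cover. As U' still contains almost all of E, \<open>upper_fine_measure\<close>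
  can be applied inside U' afterwards.\<close>

lemma lower_fine_measure:
  assumes E: "E \<subseteq> U" "open U" "E \<subseteq> lower_fine u" "u \<ge> 0"
  obtains U' where "open U'" "U' \<subseteq> U" "negligible (E - U')"
    "emeasure (interval_measure F) U' \<le> ennreal u * emeasure lborel U"
proof -
  have fine: "\<forall>x\<in>E. \<forall>d>0. \<exists>p q. p < x \<and> x < q \<and> q - p < d \<and> F q - F p < u * (q - p)"
    using E(3) unfolding lower_fine_def by blast
  obtain C :: "(real \<times> real) set" where C: "countable C"
    "\<forall>p q. (p, q) \<in> C \<longrightarrow> p < q \<and> {p..q} \<subseteq> U \<and> F q - F p < u * (q - p)"
    "disjoint_family_on (\<lambda>i. {fst i..snd i}) C"
    "negligible (E - (\<Union>i\<in>C. {fst i<..<snd i}))"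
    using Vitali_intervals[OF E(2,1) fine] by (elim exE conjE) (rule that)
  let ?I = "\<Union>i\<in>C. {fst i..snd i}" and ?U = "\<Union>i\<in>C. {fst i<..<snd i}"
  have I: "?I \<in> sets borel" using C(1) by auto
  have "emeasure (interval_measure F) ?U \<le> emeasure (interval_measure F) ?I"
    using I by (intro emeasure_mono) fastforce+
  also have "\<dots> = (\<integral>\<^sup>+i. emeasure (interval_measure F) {fst i..snd i} \<partial>count_space C)"
    using measure_Icc_sum[OF C(1,3), of "interval_measure F"] by simp
  also have "\<dots> \<le> (\<integral>\<^sup>+i. ennreal u * emeasure lborel {fst i..snd i} \<partial>count_space C)"
  proof (rule nn_integral_mono)
    fix i assume "i \<in> space (count_space C)"
    then have i: "fst i < snd i" "F (snd i) - F (fst i) < u * (snd i - fst i)"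
      using C(2)[rule_format, of "fst i" "snd i"] by auto
    then show "emeasure (interval_measure F) {fst i..snd i} \<le> ennreal u * emeasure lborel {fst i..snd i}"
      using \<open>u \<ge> 0\<close> by (subst emeasure_interval_measure_Icc[OF _ mono cont])
        (auto simp: ennreal_mult[symmetric] intro: ennreal_leI)
  qed
  also have "\<dots> = ennreal u * (\<integral>\<^sup>+i. emeasure lborel {fst i..snd i} \<partial>count_space C)"
    by (rule nn_integral_cmult) auto
  also have "\<dots> = ennreal u * emeasure lborel ?I"
    using measure_Icc_sum[OF C(1,3), of lborel] by simp
  also have "\<dots> \<le> ennreal u * emeasure lborel U"
    using E(2) by (intro mult_left_mono emeasure_mono) (use C(2) in fastforce)+
  finally have "emeasure (interval_measure F) ?U \<le> ennreal u * emeasure lborel U" .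
  moreover have "?U \<subseteq> U"
    using C(2) by fastforce
  ultimately show ?thesis
    using C(4) by (intro that[of ?U]) auto
qed

text \<open>Lebesgue's double covering. Let m be the measure of the set and W an open superset of
  measure at most m + \<delta>. Intervals with quotient below u give U' of Stieltjes measure at most
  u (m + \<delta>); intervals with quotient above v inside U' give v m as a lower bound. So v m
  \<le> u (m + \<delta>) for every \<delta>, which forces m = 0.\<close>

lemma fine_gap_negligible:
  assumes "u < v"
  shows "negligible (lower_fine u \<inter> upper_fine v \<inter> {a<..<b})"
proof (cases "u > 0")
  case False
  have "lower_fine u = {}"
  proof -
    have False if "p < x" "x < q" "F q - F p < u * (q - p)" for p x q
      using mono[of p q] that False mult_nonpos_nonneg[of u "q - p"] by auto
    then have "x \<notin> lower_fine u" for x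
      unfolding lower_fine_def by (auto intro!: exI[of _ 1])
    then show ?thesis by blast
  qed
  then show ?thesis by simp
next
  case True
  define E where "E = lower_fine u \<inter> upper_fine v \<inter> {a<..<b}"
  have E: "E \<in> sets borel"
    unfolding E_def lower_fine_def upper_fine_def
    by (intro sets.Int fine_borel) auto
  have "emeasure lborel E \<le> emeasure lborel {a<..<b}"
    by (rule emeasure_mono) (auto simp: E_def)
  also have "\<dots> < \<infinity>" by (cases "a \<le> b") auto
  finally have fin: "emeasure lborel E < \<infinity>" .
  define m where "m = measure lborel E"
  have mE: "emeasure lborel E = ennreal m"
    using fin by (simp add: m_def emeasure_eq_ennreal_measure)
  have m0: "m \<ge> 0" by (simp add: m_def)
  have "v * m \<le> u * (m + \<delta>)" if \<delta>: "\<delta> > 0" for \<delta>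
  proof -
    obtain W where W: "open W" "E \<subseteq> W" "emeasure lborel (W - E) < ennreal \<delta>"
      using outer_regular_lborel[OF E \<delta>] by metis
    obtain U' where U': "open U'" "U' \<subseteq> W" "negligible (E - U')"
      "emeasure (interval_measure F) U' \<le> ennreal u * emeasure lborel W"
      using lower_fine_measure[of E W u] W True E_def by auto
    have "E - U' \<in> null_sets lborel"
      using U'(1,3) E by (simp add: negligible_iff_null_sets null_sets_completion_iff)
    then have "emeasure lborel ((E \<inter> U') \<union> (E - U')) = emeasure lborel (E \<inter> U')"
      using E U'(1) by (intro emeasure_Un_null_set) auto
    then have "emeasure lborel E = emeasure lborel (E \<inter> U')"
      by (simp add: Int_Diff_Un)
    then have "ennreal v * emeasure lborel E = ennreal v * emeasure lborel (E \<inter> U')" by simp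
    also have "\<dots> \<le> emeasure (interval_measure F) U'"
      using E U'(1) True assms by (intro upper_fine_measure) (auto simp: E_def)
    also have "\<dots> \<le> ennreal u * emeasure lborel W" by (rule U'(4))
    also have "emeasure lborel W = emeasure lborel (E \<union> (W - E))"
      using W by (simp add: Un_absorb1)
    also have "\<dots> \<le> emeasure lborel E + emeasure lborel (W - E)"
      using E W by (intro emeasure_subadditive) auto
    also have "\<dots> \<le> ennreal m + ennreal \<delta>"
      using W(3) by (intro add_mono) (auto simp: mE)
    also have "\<dots> = ennreal (m + \<delta>)" using m0 that by simp
    finally have "ennreal v * ennreal m \<le> ennreal u * ennreal (m + \<delta>)"
      unfolding mE by (simp add: mult_left_mono)
    then show ?thesis
      using True assms m0 \<delta> by (simp add: ennreal_mult[symmetric] del: ennreal_plus)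
  qed
  then have lim: "v * m - u * m \<le> u * \<delta>" if "\<delta> > 0" for \<delta>
    using that by (force simp: algebra_simps)
  have "m = 0"
  proof (rule ccontr)
    assume "m \<noteq> 0"
    then have *: "(v - u) * m > 0" using m0 assms by simp
    then have "v * m - u * m \<le> u * ((v - u) * m / (2 * u))"
      using lim[of "(v - u) * m / (2 * u)"] True by simp
    also have "\<dots> = (v - u) * m / 2" using True by simp
    also have "\<dots> < (v - u) * m" using * by linarith
    also have "\<dots> = v * m - u * m" by (rule left_diff_distrib)
    finally show False by simp
  qed
  then have "E \<in> null_sets lborel" using mE E by auto
  then show ?thesis
    unfolding E_def[symmetric] negligible_iff_null_sets
    by (simp add: E null_sets_completion_iff)
qed

text \<open>For every n, n times the measure of the set is at most the finite increment F b - F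
  a.\<close>

lemma fine_infinite_negligible: "negligible ((\<Inter>n::nat. upper_fine n) \<inter> {a<..<b})"
proof -
  define E where "E = (\<Inter>n::nat. upper_fine n) \<inter> {a<..<b}"
  have "upper_fine n \<in> sets borel" for n
    unfolding upper_fine_def by (rule fine_borel)
  then have E: "E \<in> sets borel"
    unfolding E_def by (intro sets.Int sets.countable_INT') auto
  have "emeasure lborel E \<le> emeasure lborel {a<..<b}"
    by (rule emeasure_mono) (auto simp: E_def)
  also have "\<dots> < \<infinity>" by (cases "a \<le> b") auto
  finally have fin: "emeasure lborel E < \<infinity>" .
  define m where "m = measure lborel E"
  have mE: "emeasure lborel E = ennreal m"
    using fin by (simp add: m_def emeasure_eq_ennreal_measure)
  have m0: "m \<ge> 0" by (simp add: m_def)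
  have "m = 0"
  proof (cases "a < b")
    case False then show ?thesis by (simp add: m_def E_def)
  next
    case ab: True
    have "real n * m \<le> F b - F a" for n :: nat
    proof -
      have "ennreal n * emeasure lborel E \<le> emeasure (interval_measure F) {a<..<b}"
        using E by (intro upper_fine_measure) (auto simp: E_def)
      also have "\<dots> \<le> emeasure (interval_measure F) {a..b}"
        by (rule emeasure_mono) auto
      also have "\<dots> = ennreal (F b - F a)"
        using ab by (intro emeasure_interval_measure_Icc[OF _ mono cont]) auto
      finally show ?thesis
        using m0 mono[of a b] ab by (simp add: mE ennreal_mult[symmetric] del: ennreal_of_nat_eq_real_of_nat)
    qed
    show ?thesis
    proof (rule ccontr)
      assume "m \<noteq> 0"
      then obtain n :: nat where "F b - F a < real n * m"
        using reals_Archimedean3[of m] m0 by force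
      then show False using \<open>real n * m \<le> F b - F a\<close> by simp
    qed
  qed
  then have "E \<in> null_sets lborel" using mE E by auto
  then show ?thesis
    unfolding E_def[symmetric] negligible_iff_null_sets
    by (simp add: E null_sets_completion_iff)
qed

lemma upper_fine_antimono: "v' \<le> v \<Longrightarrow> upper_fine v \<subseteq> upper_fine v'"
proof
  fix x assume v: "v' \<le> v" and x: "x \<in> upper_fine v"
  show "x \<in> upper_fine v'"
    unfolding upper_fine_def
  proof clarify
    fix d :: real assume "d > 0"
    then obtain p q where pq: "p < x" "x < q" "q - p < d" "F q - F p > v * (q - p)"
      using x unfolding upper_fine_def by blast
    have "v' * (q - p) \<le> v * (q - p)" using v pq by (intro mult_right_mono) auto
    then show "\<exists>p q. p < x \<and> x < q \<and> q - p < d \<and> F q - F p > v' * (q - p)"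
      using pq by (intro exI[of _ p] exI[of _ q]) linarith+
  qed
qed

text \<open>Widening the interval by h on both sides and letting h tend to 0 admits x as an
  endpoint; the limit uses continuity of F.\<close>

lemma one_sided_le:
  assumes d: "d > 0" "\<And>p q. p < x \<Longrightarrow> x < q \<Longrightarrow> q - p < d \<Longrightarrow> F q - F p \<le> v * (q - p)"
    and pq: "p \<le> x" "x \<le> q" "q - p < d"
  shows "F q - F p \<le> v * (q - p)"
proof -
  have lim: "((\<lambda>h. F (q + h) - F (p - h) - v * ((q + h) - (p - h))) \<longlongrightarrow> F (q + 0) - F (p - 0) - v * ((q + 0) - (p - 0))) (at_right 0)"
    by (intro tendsto_intros continuous_on_tendsto_compose[OF cont]) auto
  have "eventually (\<lambda>h. h \<in> {0<..<(d - (q - p)) / 2}) (at_right (0::real))"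
    using pq by (intro eventually_at_right_real) auto
  then have "eventually (\<lambda>h. F (q + h) - F (p - h) - v * ((q + h) - (p - h)) \<le> 0) (at_right 0)"
  proof eventually_elim
    case (elim h)
    then show ?case using pq d(2)[of "p - h" "q + h"] by auto
  qed
  then have "F (q + 0) - F (p - 0) - v * ((q + 0) - (p - 0)) \<le> 0"
    by (intro tendsto_upperbound[OF lim]) auto
  then show ?thesis by simp
qed

lemma one_sided_ge:
  assumes d: "d > 0" "\<And>p q. p < x \<Longrightarrow> x < q \<Longrightarrow> q - p < d \<Longrightarrow> F q - F p \<ge> v * (q - p)"
    and pq: "p \<le> x" "x \<le> q" "q - p < d"
  shows "F q - F p \<ge> v * (q - p)"
proof -
  have lim: "((\<lambda>h. F (q + h) - F (p - h) - v * ((q + h) - (p - h))) \<longlongrightarrow> F (q + 0) - F (p - 0) - v * ((q + 0) - (p - 0))) (at_right 0)"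
    by (intro tendsto_intros continuous_on_tendsto_compose[OF cont]) auto
  have "eventually (\<lambda>h. h \<in> {0<..<(d - (q - p)) / 2}) (at_right (0::real))"
    using pq by (intro eventually_at_right_real) auto
  then have "eventually (\<lambda>h. F (q + h) - F (p - h) - v * ((q + h) - (p - h)) \<ge> 0) (at_right 0)"
  proof eventually_elim
    case (elim h)
    then show ?case using pq d(2)[of "p - h" "q + h"] by auto
  qed
  then have "F (q + 0) - F (p - 0) - v * ((q + 0) - (p - 0)) \<ge> 0"
    by (intro tendsto_lowerbound[OF lim]) auto
  then show ?thesis by simp
qed

text \<open>The derivative is the supremum D of all v with x in \<open>upper_fine v\<close>. From
  above, D + e/2 is excluded by the choice of D. From below, a number r between D - e/2 and D - e/3
  is taken rational, since only countably many gaps can be discarded.\<close>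

lemma differentiable_off_gaps:
  assumes fin: "x \<notin> (\<Inter>n::nat. upper_fine n)"
    and gap: "\<And>u v. u \<in> \<rat> \<Longrightarrow> v \<in> \<rat> \<Longrightarrow> u < v \<Longrightarrow> x \<notin> lower_fine u \<inter> upper_fine v"
  shows "F differentiable (at x)"
proof -
  obtain N :: nat where N: "x \<notin> upper_fine N" using fin by auto
  define A where "A = {v. x \<in> upper_fine v}"
  have bdd: "v \<le> N" if "v \<in> A" for v
    using that N upper_fine_antimono[of N v] unfolding A_def by (cases "v \<le> N") auto
  have "x \<in> upper_fine (-1)"
    unfolding upper_fine_def
  proof clarify
    fix d :: real assume "d > 0"
    then show "\<exists>p q. p < x \<and> x < q \<and> q - p < d \<and> - 1 * (q - p) < F q - F p"
      using mono[of "x - d/3" "x + d/3"] by (intro exI[of _ "x - d/3"] exI[of _ "x + d/3"]) auto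
  qed
  then have ne: "A \<noteq> {}" by (auto simp: A_def)
  have bA: "bdd_above A" using bdd by (auto simp: bdd_above_def)
  define D where "D = Sup A"
  have "\<exists>d>0. \<forall>y. 0 < \<bar>y - x\<bar> \<and> \<bar>y - x\<bar> < d \<longrightarrow> \<bar>(F y - F x) / (y - x) - D\<bar> < e" if e: "e > 0" for e
  proof -
    have "D + e/2 \<notin> A"
      using cSup_upper[OF _ bA, of "D + e/2"] e by (auto simp: D_def[symmetric])
    then obtain d1 where d1: "d1 > 0"
      "\<And>p q. p < x \<Longrightarrow> x < q \<Longrightarrow> q - p < d1 \<Longrightarrow> F q - F p \<le> (D + e/2) * (q - p)"
      unfolding A_def upper_fine_def by (force simp: not_less)
    obtain v where v: "v \<in> A" "v > D - e/3"
      using less_cSup_iff[OF ne bA, of "D - e/3"] e by (auto simp: D_def)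
    obtain r where r: "r \<in> \<rat>" "D - e/2 < r" "r < D - e/3"
      using Rats_dense_in_real[of "D - e/2" "D - e/3"] e by auto
    obtain r' where r': "r' \<in> \<rat>" "r < r'" "r' < v"
      using Rats_dense_in_real[of r v] r v by auto
    have "x \<in> upper_fine r'"
      using upper_fine_antimono[of r' v] v(1) r'(3) by (auto simp: A_def)
    then have "x \<notin> lower_fine r"
      using gap[of r r'] r r' by auto
    then obtain d2 where d2: "d2 > 0"
      "\<And>p q. p < x \<Longrightarrow> x < q \<Longrightarrow> q - p < d2 \<Longrightarrow> F q - F p \<ge> r * (q - p)"
      unfolding lower_fine_def by (force simp: not_less)
    show ?thesis
    proof (intro exI[of _ "min d1 d2"] conjI allI impI)
      fix y assume y: "0 < \<bar>y - x\<bar> \<and> \<bar>y - x\<bar> < min d1 d2"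
      have "r \<le> (F y - F x) / (y - x) \<and> (F y - F x) / (y - x) \<le> D + e/2"
      proof (cases "x < y")
        case True
        have "F y - F x \<le> (D + e/2) * (y - x)"
          using True y by (intro one_sided_le[OF d1]) auto
        moreover have "F y - F x \<ge> r * (y - x)"
          using True y by (intro one_sided_ge[OF d2]) auto
        ultimately show ?thesis
          using True by (simp add: pos_le_divide_eq pos_divide_le_eq)
      next
        case False
        then have "y < x" using y by auto
        moreover have "(F y - F x) / (y - x) = (F x - F y) / (x - y)"
          by (metis minus_diff_eq minus_divide_divide)
        moreover have "F x - F y \<le> (D + e/2) * (x - y)"
          using \<open>y < x\<close> y by (intro one_sided_le[OF d1]) auto
        moreover have "F x - F y \<ge> r * (x - y)"
          using \<open>y < x\<close> y by (intro one_sided_ge[OF d2]) auto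
        ultimately show ?thesis
          by (simp add: pos_le_divide_eq pos_divide_le_eq)
      qed
      then show "\<bar>(F y - F x) / (y - x) - D\<bar> < e"
        using r e by (simp only: abs_less_iff) linarith
    qed (use d1 d2 in auto)
  qed
  then have "((\<lambda>y. (F y - F x) / (y - x)) \<longlongrightarrow> D) (at x)"
    unfolding LIM_def by (simp add: dist_real_def)
  then have "(F has_field_derivative D) (at x)"
    by (simp add: has_field_derivative_iff)
  then show ?thesis
    by (auto simp: differentiable_def has_field_derivative_def)
qed

lemma mono_differentiable_AE_aux: "negligible {x \<in> {a<..<b}. \<not> F differentiable (at x)}"
proof -
  let ?R = "{i \<in> \<rat> \<times> \<rat>. fst i < snd i}"
  let ?B = "\<Union>i\<in>?R. lower_fine (fst i) \<inter> upper_fine (snd i) \<inter> {a<..<b}"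
  have "countable ?R"
    by (rule countable_subset[of _ "\<rat> \<times> \<rat>"]) (auto simp: countable_rat)
  then have "negligible ?B"
    by (intro negligible_countable_Union) (auto intro: fine_gap_negligible)
  then have "negligible (?B \<union> ((\<Inter>n::nat. upper_fine n) \<inter> {a<..<b}))"
    using fine_infinite_negligible by (rule negligible_Un)
  then show ?thesis
  proof (rule negligible_subset)
    show "{x \<in> {a<..<b}. \<not> F differentiable (at x)} \<subseteq> ?B \<union> ((\<Inter>n::nat. upper_fine n) \<inter> {a<..<b})"
    proof (rule subsetI, rule ccontr)
      fix x assume x: "x \<in> {x \<in> {a<..<b}. \<not> F differentiable (at x)}"
        and "x \<notin> ?B \<union> ((\<Inter>n::nat. upper_fine n) \<inter> {a<..<b})"
      then have "x \<notin> (\<Inter>n::nat. upper_fine n)"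
        and "\<And>u v. u \<in> \<rat> \<Longrightarrow> v \<in> \<rat> \<Longrightarrow> u < v \<Longrightarrow> x \<notin> lower_fine u \<inter> upper_fine v"
        by force+
      then show False using differentiable_off_gaps x by blast
    qed
  qed
qed

end

text \<open>Constant extension beyond the ends reduces this to a function on the whole line;
  differentiability at interior points is unaffected.\<close>

lemma mono_continuous_differentiable_AE:
  fixes F :: "real \<Rightarrow> real"
  assumes mono: "\<And>x y. \<lbrakk>a \<le> x; x \<le> y; y \<le> b\<rbrakk> \<Longrightarrow> F x \<le> F y" and cont: "continuous_on {a..b} F"
  shows "negligible {x \<in> {a<..<b}. \<not> F differentiable (at x)}"
proof (cases "a < b")
  case True
  define G where "G = (\<lambda>x. F (max a (min b x)))"
  have G: "negligible {x \<in> {a<..<b}. \<not> G differentiable (at x)}"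
  proof (rule mono_differentiable_AE_aux)
    show "G x \<le> G y" if "x \<le> y" for x y
      unfolding G_def using that True by (intro mono) auto
    show "continuous_on UNIV G"
      unfolding G_def using True
      by (intro continuous_on_compose2[OF cont] continuous_intros) auto
  qed
  have "F differentiable (at x)" if x: "x \<in> {a<..<b}" and "G differentiable (at x)" for x
  proof -
    have "eventually (\<lambda>y. y \<in> {a<..<b}) (nhds x)"
      using x by (intro eventually_nhds_in_open) auto
    then have ev: "eventually (\<lambda>y. G y = F y) (nhds x)"
      by eventually_elim (auto simp: G_def)
    obtain D where "(G has_derivative D) (at x)"
      using \<open>G differentiable (at x)\<close> by (auto simp: differentiable_def)
    then have "(F has_derivative D) (at x)"
      using has_derivative_transform_eventually[of G D x UNIV F] ev
      by (simp add: eventually_nhds_conv_at)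
    then show ?thesis by (auto simp: differentiable_def)
  qed
  then show ?thesis
    by (intro negligible_subset[OF G]) auto
qed simp

section \<open>Absolute continuity through finite families of non-overlapping intervals\<close>

definition nonoverlap :: "nat \<Rightarrow> (nat \<Rightarrow> real) \<Rightarrow> (nat \<Rightarrow> real) \<Rightarrow> bool" where
  "nonoverlap m A B \<longleftrightarrow> (\<forall>i<m. \<forall>j<m. i \<noteq> j \<longrightarrow> B i \<le> A j \<or> B j \<le> A i)"

definition subfam :: "real \<Rightarrow> real \<Rightarrow> nat \<Rightarrow> (nat \<Rightarrow> real) \<Rightarrow> (nat \<Rightarrow> real) \<Rightarrow> bool" where
  "subfam lo hi m A B \<longleftrightarrow> (\<forall>i<m. lo \<le> A i \<and> A i \<le> B i \<and> B i \<le> hi) \<and> nonoverlap m A B"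

lemma abs_cont_onD:
  assumes "abs_cont_on lo hi f" "e > 0"
  obtains d where "d > 0" "\<And>m A B. subfam lo hi m A B \<Longrightarrow> (\<Sum>i<m. B i - A i) < d
    \<Longrightarrow> (\<Sum>i<m. norm (f (B i) - f (A i))) < e"
proof -
  obtain d where d: "d > 0" "\<forall>(m::nat) (a::nat\<Rightarrow>real) b.
        (\<forall>i<m. lo \<le> a i \<and> a i \<le> b i \<and> b i \<le> hi) \<and>
        (\<forall>i<m. \<forall>j<m. i \<noteq> j \<longrightarrow> b i \<le> a j \<or> b j \<le> a i) \<and>
        (\<Sum>i<m. b i - a i) < d
        \<longrightarrow> (\<Sum>i<m. norm (f (b i) - f (a i))) < e"
    using assms unfolding abs_cont_on_def by auto
  show ?thesis
    using d by (intro that[of d]) (auto simp: subfam_def nonoverlap_def)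
qed

lemma abs_cont_onI:
  assumes "\<And>e. e > 0 \<Longrightarrow> \<exists>d>0. \<forall>m A B. subfam lo hi m A B \<longrightarrow> (\<Sum>i<m. B i - A i) < d
    \<longrightarrow> (\<Sum>i<m. norm (f (B i) - f (A i))) < e"
  shows "abs_cont_on lo hi f"
  unfolding abs_cont_on_def
proof (intro allI impI)
  fix e :: real assume "e > 0"
  then obtain d where "d > 0" "\<forall>m A B. subfam lo hi m A B \<longrightarrow> (\<Sum>i<m. B i - A i) < d
    \<longrightarrow> (\<Sum>i<m. norm (f (B i) - f (A i))) < e"
    using assms by blast
  then show "\<exists>d>0. \<forall>(m::nat) (a::nat\<Rightarrow>real) b.
        (\<forall>i<m. lo \<le> a i \<and> a i \<le> b i \<and> b i \<le> hi) \<and>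
        (\<forall>i<m. \<forall>j<m. i \<noteq> j \<longrightarrow> b i \<le> a j \<or> b j \<le> a i) \<and>
        (\<Sum>i<m. b i - a i) < d
        \<longrightarrow> (\<Sum>i<m. norm (f (b i) - f (a i))) < e"
    by (intro exI[of _ d]) (auto simp: subfam_def nonoverlap_def)
qed

lemma abs_cont_on_subinterval:
  assumes "abs_cont_on lo hi f" "lo \<le> lo'" "hi' \<le> hi"
  shows "abs_cont_on lo' hi' f"
proof (rule abs_cont_onI)
  fix e :: real assume "e > 0"
  with assms(1) obtain d where d: "d > 0" "\<And>m A B. subfam lo hi m A B \<Longrightarrow> (\<Sum>i<m. B i - A i) < d
    \<Longrightarrow> (\<Sum>i<m. norm (f (B i) - f (A i))) < e"
    using abs_cont_onD by blast
  have "subfam lo hi m A B" if "subfam lo' hi' m A B" for m A B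
    using that assms by (force simp: subfam_def)
  then show "\<exists>d>0. \<forall>m A B. subfam lo' hi' m A B \<longrightarrow> (\<Sum>i<m. B i - A i) < d
    \<longrightarrow> (\<Sum>i<m. norm (f (B i) - f (A i))) < e"
    using d by blast
qed

text \<open>Serves for coordinates, translates, v along a curve and the discounted value: in each
  case increments are bounded by those of a known curve plus a multiple of elapsed time.\<close>

lemma abs_cont_on_dominated:
  assumes "abs_cont_on lo hi g" "C1 \<ge> 0" "C2 \<ge> 0"
    and bound: "\<And>a b. lo \<le> a \<Longrightarrow> a \<le> b \<Longrightarrow> b \<le> hi \<Longrightarrow> norm (f b - f a) \<le> C1 * norm (g b - g a) + C2 * (b - a)"
  shows "abs_cont_on lo hi f"
proof (rule abs_cont_onI)
  fix e :: real assume e: "e > 0"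
  have "e / (2 * (C1 + 1)) > 0" using e assms(2) by simp
  with assms(1) obtain d where d: "d > 0" "\<And>m A B. subfam lo hi m A B \<Longrightarrow> (\<Sum>i<m. B i - A i) < d
    \<Longrightarrow> (\<Sum>i<m. norm (g (B i) - g (A i))) < e / (2 * (C1 + 1))"
    using abs_cont_onD by blast
  define d' where "d' = min d (e / (2 * (C2 + 1)))"
  have "d' > 0" using d e assms(3) by (simp add: d'_def)
  moreover have "(\<Sum>i<m. norm (f (B i) - f (A i))) < e"
    if "subfam lo hi m A B" "(\<Sum>i<m. B i - A i) < d'" for m A B
  proof -
    have "(\<Sum>i<m. norm (f (B i) - f (A i))) \<le> (\<Sum>i<m. C1 * norm (g (B i) - g (A i)) + C2 * (B i - A i))"
      using that(1) by (intro sum_mono bound) (auto simp: subfam_def)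
    also have "\<dots> = C1 * (\<Sum>i<m. norm (g (B i) - g (A i))) + C2 * (\<Sum>i<m. B i - A i)"
      by (simp add: sum.distrib sum_distrib_left)
    also have "\<dots> \<le> C1 * (e / (2 * (C1 + 1))) + C2 * (e / (2 * (C2 + 1)))"
      using d(2)[OF that(1)] that(2) assms
      by (intro add_mono mult_left_mono) (auto simp: d'_def)
    also have "C1 * (e / (2 * (C1 + 1))) < e / 2"
      using e assms(2) by (simp add: field_simps)
    also have "C2 * (e / (2 * (C2 + 1))) < e / 2"
      using e assms(3) by (simp add: field_simps)
    finally show ?thesis by simp
  qed
  ultimately show "\<exists>d>0. \<forall>m A B. subfam lo hi m A B \<longrightarrow> (\<Sum>i<m. B i - A i) < d
    \<longrightarrow> (\<Sum>i<m. norm (f (B i) - f (A i))) < e"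
    by blast
qed

lemma Lipschitz_abs_cont_on:
  assumes "C \<ge> 0" "\<And>a b. lo \<le> a \<Longrightarrow> a \<le> b \<Longrightarrow> b \<le> hi \<Longrightarrow> norm (f b - f a) \<le> C * (b - a)"
  shows "abs_cont_on lo hi f"
proof (rule abs_cont_on_dominated[of lo hi "\<lambda>_. 0::real" 0 C])
  show "abs_cont_on lo hi (\<lambda>_. 0::real)"
    by (auto simp: abs_cont_on_def intro: exI[of _ 1])
qed (use assms in auto)

lemma nonoverlap_length:
  assumes "nonoverlap m A B" "\<And>i. i < m \<Longrightarrow> A i \<le> B i \<and> {A i<..<B i} \<subseteq> W" "W \<in> lmeasurable"
  shows "(\<Sum>i<m. B i - A i) \<le> measure lebesgue W"
proof -
  have "(\<Sum>i<m. B i - A i) = (\<Sum>i<m. measure lebesgue {A i<..<B i})"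
    using assms(2) by (intro sum.cong) auto
  also have "\<dots> = measure lebesgue (\<Union>i<m. {A i<..<B i})"
  proof (rule measure_finite_Union[symmetric])
    show "disjoint_family_on (\<lambda>i. {A i<..<B i}) {..<m}"
      using assms(1) unfolding disjoint_family_on_def nonoverlap_def by fastforce
    show "emeasure lebesgue {A i<..<B i} \<noteq> \<infinity>" if "i \<in> {..<m}" for i
      using that assms(2) by auto
  qed auto
  also have "\<dots> \<le> measure lebesgue W"
    using assms(2,3) by (intro measure_mono_fmeasurable) auto
  finally show ?thesis .
qed

lemma subfam_length:
  assumes "subfam lo hi m A B" "lo \<le> hi"
  shows "(\<Sum>i<m. B i - A i) \<le> hi - lo"
proof -
  have "(\<Sum>i<m. B i - A i) \<le> measure lebesgue {lo..hi}"
    using assms(1) by (intro nonoverlap_length) (fastforce simp: subfam_def)+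
  then show ?thesis using assms by simp
qed

text \<open>Truncating with min and max keeps the index set; an interval on the other side of x
  degenerates to the point x and contributes 0.\<close>

lemma subfam_split:
  fixes f :: "real \<Rightarrow> 'a::real_normed_vector"
  assumes "subfam lo hi m A B" "lo \<le> x" "x \<le> hi"
  shows "subfam lo x m (\<lambda>i. min (A i) x) (\<lambda>i. min (B i) x)"
    and "subfam x hi m (\<lambda>i. max (A i) x) (\<lambda>i. max (B i) x)"
    and "(\<Sum>i<m. norm (f (B i) - f (A i))) \<le>
      (\<Sum>i<m. norm (f (min (B i) x) - f (min (A i) x))) + (\<Sum>i<m. norm (f (max (B i) x) - f (max (A i) x)))"
proof -
  show "subfam lo x m (\<lambda>i. min (A i) x) (\<lambda>i. min (B i) x)"
    unfolding subfam_def nonoverlap_def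
  proof (intro conjI allI impI)
    fix i j assume "i < m" "j < m" "i \<noteq> j"
    then have "B i \<le> A j \<or> B j \<le> A i" using assms(1) by (auto simp: subfam_def nonoverlap_def)
    then show "min (B i) x \<le> min (A j) x \<or> min (B j) x \<le> min (A i) x" by auto
  qed (use assms in \<open>auto simp: subfam_def\<close>)
  show "subfam x hi m (\<lambda>i. max (A i) x) (\<lambda>i. max (B i) x)"
    unfolding subfam_def nonoverlap_def
  proof (intro conjI allI impI)
    fix i j assume "i < m" "j < m" "i \<noteq> j"
    then have "B i \<le> A j \<or> B j \<le> A i" using assms(1) by (auto simp: subfam_def nonoverlap_def)
    then show "max (B i) x \<le> max (A j) x \<or> max (B j) x \<le> max (A i) x" by auto
  qed (use assms in \<open>auto simp: subfam_def le_max_iff_disj\<close>)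
  have "norm (f (B i) - f (A i)) \<le> norm (f (min (B i) x) - f (min (A i) x)) + norm (f (max (B i) x) - f (max (A i) x))"
    if "i < m" for i
  proof -
    have "A i \<le> B i" using assms(1) that by (auto simp: subfam_def)
    then show ?thesis
      using norm_triangle_ineq[of "f x - f (A i)" "f (B i) - f x"]
      by (cases "B i \<le> x"; cases "A i \<le> x") (auto simp: min_def max_def)
  qed
  then have "(\<Sum>i<m. norm (f (B i) - f (A i))) \<le>
    (\<Sum>i<m. norm (f (min (B i) x) - f (min (A i) x)) + norm (f (max (B i) x) - f (max (A i) x)))"
    by (intro sum_mono) auto
  then show "(\<Sum>i<m. norm (f (B i) - f (A i))) \<le>
      (\<Sum>i<m. norm (f (min (B i) x) - f (min (A i) x))) + (\<Sum>i<m. norm (f (max (B i) x) - f (max (A i) x)))"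
    by (simp add: sum.distrib)
qed

lemma abs_cont_on_bounded_variation:
  fixes f :: "real \<Rightarrow> 'a::real_normed_vector"
  assumes "abs_cont_on lo hi f"
  obtains K where "\<And>m A B. subfam lo hi m A B \<Longrightarrow> (\<Sum>i<m. norm (f (B i) - f (A i))) \<le> K"
proof -
  obtain d where d: "d > 0" "\<And>m A B. subfam lo hi m A B \<Longrightarrow> (\<Sum>i<m. B i - A i) < d
    \<Longrightarrow> (\<Sum>i<m. norm (f (B i) - f (A i))) < 1"
    using abs_cont_onD[OF assms, of 1] by auto
  \<comment> \<open>The interval is cut into windows of length d/2. A family inside one window has
    total length below d and hence contributes less than 1; k counts the windows.\<close>
  have ind: "(\<Sum>i<m. norm (f (B i) - f (A i))) \<le> real k"
    if "subfam lo y m A B" "lo \<le> y" "y \<le> hi" "y \<le> lo + real k * (d / 2)" for y k m A B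
    using that
  proof (induction k arbitrary: y m A B)
    case 0
    then have "y = lo" by simp
    have "A i = lo \<and> B i = lo" if "i < m" for i
      using 0(1) that unfolding subfam_def \<open>y = lo\<close> by force
    then have "(\<Sum>i<m. norm (f (B i) - f (A i))) = (\<Sum>i<m. 0)"
      by (intro sum.cong) auto
    then show ?case by simp
  next
    case (Suc k)
    show ?case
    proof (cases "y \<le> lo + real k * (d / 2)")
      case True
      then show ?thesis using Suc.IH[OF Suc.prems(1-3)] by simp
    next
      case False
      define x where "x = lo + real k * (d / 2)"
      have x: "lo \<le> x" "x \<le> y" using False d(1) by (auto simp: x_def)
      note S = subfam_split(1,2)[OF Suc.prems(1) x] subfam_split(3)[OF Suc.prems(1) x, where f = f]
      have 1: "(\<Sum>i<m. norm (f (min (B i) x) - f (min (A i) x))) \<le> real k"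
        using x Suc.prems(3) by (intro Suc.IH[OF S(1)]) (auto simp: x_def)
      have "(\<Sum>i<m. max (B i) x - max (A i) x) \<le> y - x"
        by (rule subfam_length[OF S(2) x(2)])
      also have "\<dots> < d"
      proof -
        have "real (Suc k) * (d / 2) = real k * (d / 2) + d / 2" by (simp add: algebra_simps)
        then show ?thesis using Suc.prems(4) d(1) unfolding x_def by linarith
      qed
      finally have "(\<Sum>i<m. norm (f (max (B i) x) - f (max (A i) x))) < 1"
      proof (intro d(2))
        show "subfam lo hi m (\<lambda>i. max (A i) x) (\<lambda>i. max (B i) x)"
          using S(2) x Suc.prems(3) by (force simp: subfam_def)
      qed
      then show ?thesis using S(3) 1 by simp
    qed
  qed
  obtain k :: nat where k: "hi - lo \<le> real k * (d / 2)"
    using reals_Archimedean3[of "d / 2"] d(1) by (meson half_gt_zero less_imp_le)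
  show ?thesis
  proof (cases "lo \<le> hi")
    case True
    then show ?thesis using ind[of hi _ _ _ k] k by (intro that[of "real k"]) auto
  next
    case False
    have m0: "m = 0" if "subfam lo hi m A B" for m A B
    proof (rule ccontr)
      assume "m \<noteq> 0"
      then have "lo \<le> A 0 \<and> A 0 \<le> B 0 \<and> B 0 \<le> hi" using that by (auto simp: subfam_def)
      then show False using False by linarith
    qed
    have "(\<Sum>i<m. norm (f (B i) - f (A i))) \<le> 0" if "subfam lo hi m A B" for m A B
      using m0[OF that] by simp
    then show ?thesis by (rule that)
  qed
qed

lemma subfam_single: "lo \<le> x \<Longrightarrow> x \<le> y \<Longrightarrow> y \<le> hi \<Longrightarrow> subfam lo hi (Suc 0) (\<lambda>_. x) (\<lambda>_. y)"
  by (auto simp: subfam_def nonoverlap_def)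

lemma abs_cont_on_continuous:
  fixes f :: "real \<Rightarrow> 'a::real_normed_vector"
  assumes "abs_cont_on lo hi f"
  shows "continuous_on {lo..hi} f"
  unfolding continuous_on_iff
proof (intro ballI allI impI)
  fix x e :: real assume x: "x \<in> {lo..hi}" and "e > 0"
  obtain d where d: "d > 0" "\<And>m A B. subfam lo hi m A B \<Longrightarrow> (\<Sum>i<m. B i - A i) < d
    \<Longrightarrow> (\<Sum>i<m. norm (f (B i) - f (A i))) < e"
    using abs_cont_onD[OF assms \<open>e > 0\<close>] by blast
  have *: "norm (f b - f a) < e" if "lo \<le> a" "a \<le> b" "b \<le> hi" "b - a < d" for a b
    using d(2)[OF subfam_single[of lo a b hi]] that by simp
  have "dist (f y) (f x) < e" if "y \<in> {lo..hi}" "dist y x < d" for y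
    using *[of x y] *[of y x] x that
    by (cases "x \<le> y") (auto simp: dist_norm norm_minus_commute)
  then show "\<exists>d>0. \<forall>x'\<in>{lo..hi}. dist x' x < d \<longrightarrow> dist (f x') (f x) < e"
    using d(1) by blast
qed

text \<open>Jordan decomposition f = V - (V - f) with V the total variation function. Both parts are
  monotone, and continuous because absolute continuity makes the variation over short intervals
  small.\<close>

lemma abs_cont_on_differentiable_AE_real:
  fixes f :: "real \<Rightarrow> real"
  assumes ac: "abs_cont_on lo hi f"
  shows "negligible {x \<in> {lo<..<hi}. \<not> f differentiable (at x)}"
proof -
  define S where "S = (\<lambda>x. {(\<Sum>i<m. norm (f (B i) - f (A i))) | m A B. subfam lo x m A B})"
  define V where "V = (\<lambda>x. Sup (S x))"
  have Vd: "V x = Sup (S x)" for x by (simp add: V_def)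
  have ne: "S x \<noteq> {}" for x
  proof -
    have "subfam lo x 0 (\<lambda>_. 0) (\<lambda>_. 0)" by (auto simp: subfam_def nonoverlap_def)
    then show ?thesis by (auto simp: S_def)
  qed
  obtain K where K: "\<And>m A B. subfam lo hi m A B \<Longrightarrow> (\<Sum>i<m. norm (f (B i) - f (A i))) \<le> K"
    using abs_cont_on_bounded_variation[OF ac] by blast
  have up: "subfam lo y m A B" if "subfam lo x m A B" "x \<le> y" for x y m A B
    using that by (auto simp: subfam_def)
  have bdd: "bdd_above (S x)" if "x \<le> hi" for x
    unfolding bdd_above_def S_def using K up[OF _ that] by blast
  have inc: "V x + norm (f y - f x) \<le> V y" if "lo \<le> x" "x \<le> y" "y \<le> hi" for x y
  proof -
    have "z \<le> V y - norm (f y - f x)" if "z \<in> S x" for z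
    proof -
      from that obtain m A B where z: "z = (\<Sum>i<m. norm (f (B i) - f (A i)))" "subfam lo x m A B"
        unfolding S_def by blast
      have "subfam lo y (Suc m) (A(m := x)) (B(m := y))"
      proof -
        have "\<forall>i<m. lo \<le> A i \<and> A i \<le> B i \<and> B i \<le> x \<and> B i \<le> y"
          using z(2) \<open>x \<le> y\<close> by (force simp: subfam_def)
        then show ?thesis
          using z(2) \<open>lo \<le> x\<close> \<open>x \<le> y\<close> unfolding subfam_def nonoverlap_def
          by (auto simp: less_Suc_eq)
      qed
      moreover have "(\<Sum>i<Suc m. norm (f ((B(m := y)) i) - f ((A(m := x)) i))) = z + norm (f y - f x)"
        by (simp add: z)
      ultimately have "z + norm (f y - f x) \<in> S y"
        unfolding S_def mem_Collect_eq
        by (intro exI[of _ "Suc m"] exI[of _ "A(m := x)"] exI[of _ "B(m := y)"] conjI) auto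
      then have "z + norm (f y - f x) \<le> V y"
        unfolding Vd using bdd[OF \<open>y \<le> hi\<close>] by (intro cSup_upper)
      then show ?thesis by simp
    qed
    then have "V x \<le> V y - norm (f y - f x)"
      unfolding Vd[of x] by (intro cSup_least ne)
    then show ?thesis by simp
  qed
  have mono: "V x \<le> V y" if "lo \<le> x" "x \<le> y" "y \<le> hi" for x y
    using inc[OF that] norm_ge_zero[of "f y - f x"] by linarith
  have cont: "continuous_on {lo..hi} V"
    unfolding continuous_on_iff
  proof (intro ballI allI impI)
    fix x e :: real assume x: "x \<in> {lo..hi}" and "e > 0"
    then have "e / 2 > 0" by simp
    then obtain d where d: "d > 0" "\<And>m A B. subfam lo hi m A B \<Longrightarrow> (\<Sum>i<m. B i - A i) < d
      \<Longrightarrow> (\<Sum>i<m. norm (f (B i) - f (A i))) < e / 2"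
      using abs_cont_onD[OF ac] by blast
    have *: "V b \<le> V a + e / 2" if ab: "lo \<le> a" "a \<le> b" "b \<le> hi" "b - a < d" for a b
      unfolding Vd[of b]
    proof (rule cSup_least[OF ne])
      fix z assume "z \<in> S b"
      then obtain m A B where z: "z = (\<Sum>i<m. norm (f (B i) - f (A i)))" "subfam lo b m A B"
        unfolding S_def by blast
      note sp = subfam_split(1,2)[OF z(2) ab(1,2)] subfam_split(3)[OF z(2) ab(1,2), where f = f]
      have "(\<Sum>i<m. norm (f (min (B i) a) - f (min (A i) a))) \<le> V a"
      proof -
        have "(\<Sum>i<m. norm (f (min (B i) a) - f (min (A i) a))) \<in> S a"
          unfolding S_def mem_Collect_eq
          by (intro exI[of _ m] exI[of _ "\<lambda>i. min (A i) a"] exI[of _ "\<lambda>i. min (B i) a"] conjI refl sp(1))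
        then show ?thesis unfolding Vd using bdd[of a] ab by (intro cSup_upper) auto
      qed
      moreover have "(\<Sum>i<m. norm (f (max (B i) a) - f (max (A i) a))) < e / 2"
      proof (rule d(2))
        show "subfam lo hi m (\<lambda>i. max (A i) a) (\<lambda>i. max (B i) a)"
          using sp(2) ab by (force simp: subfam_def)
        show "(\<Sum>i<m. max (B i) a - max (A i) a) < d"
          using subfam_length[OF sp(2)] ab by simp
      qed
      ultimately show "z \<le> V a + e / 2" using sp(3) z(1) by simp
    qed
    have "dist (V y) (V x) < e" if "y \<in> {lo..hi}" "dist y x < d" for y
      using *[of x y] *[of y x] mono[of x y] mono[of y x] x that \<open>e > 0\<close>
      by (cases "x \<le> y") (auto simp: dist_real_def)
    then show "\<exists>d>0. \<forall>x'\<in>{lo..hi}. dist x' x < d \<longrightarrow> dist (V x') (V x) < e"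
      using d(1) by blast
  qed
  have 1: "negligible {x \<in> {lo<..<hi}. \<not> V differentiable (at x)}"
    using mono cont by (rule mono_continuous_differentiable_AE)
  have 2: "negligible {x \<in> {lo<..<hi}. \<not> (\<lambda>x. V x - f x) differentiable (at x)}"
  proof (rule mono_continuous_differentiable_AE)
    show "V x - f x \<le> V y - f y" if "lo \<le> x" "x \<le> y" "y \<le> hi" for x y
      using inc[OF that] by (auto simp: abs_le_iff)
    show "continuous_on {lo..hi} (\<lambda>x. V x - f x)"
      by (intro continuous_intros cont abs_cont_on_continuous[OF ac])
  qed
  have "f differentiable (at x)" if "V differentiable (at x)" "(\<lambda>x. V x - f x) differentiable (at x)" for x
    using differentiable_diff[OF that] by simp
  then show ?thesis
    using negligible_Un[OF 1 2] by (elim negligible_subset) auto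
qed

lemma has_vector_derivative_componentwise:
  fixes f :: "real \<Rightarrow> real^'n"
  assumes "\<And>i. ((\<lambda>s. f s $ i) has_real_derivative f' $ i) (at x within S)"
  shows "(f has_vector_derivative f') (at x within S)"
  unfolding has_vector_derivative_def has_derivative_componentwise_within[of f]
proof
  fix b :: "real^'n" assume "b \<in> Basis"
  then obtain i where "b = axis i 1" by (auto simp: Basis_vec_def)
  then show "((\<lambda>x. f x \<bullet> b) has_derivative (\<lambda>x. x *\<^sub>R f' \<bullet> b)) (at x within S)"
    using assms[of i, unfolded has_field_derivative_def]
    by (simp add: inner_axis mult.commute[of _ "f' $ i"])
qed

lemma abs_cont_on_differentiable_AE:
  fixes f :: "real \<Rightarrow> real^'n"
  assumes ac: "abs_cont_on lo hi f"
  shows "negligible {x \<in> {lo<..<hi}. \<not> f differentiable (at x)}"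
proof -
  have "abs_cont_on lo hi (\<lambda>s. f s $ i)" for i
    using ac by (rule abs_cont_on_dominated[of lo hi f 1 0])
      (auto simp flip: vector_minus_component intro: component_le_norm_cart)
  then have neg: "negligible {x \<in> {lo<..<hi}. \<not> (\<lambda>s. f s $ i) differentiable (at x)}" for i
    by (rule abs_cont_on_differentiable_AE_real)
  have "negligible (\<Union>i. {x \<in> {lo<..<hi}. \<not> (\<lambda>s. f s $ i) differentiable (at x)})"
    by (intro negligible_Union finite_imageI finite) (use neg in blast)
  then show ?thesis
  proof (rule negligible_subset, intro subsetI)
    fix x assume "x \<in> {x \<in> {lo<..<hi}. \<not> f differentiable (at x)}"
    moreover have "f differentiable (at x)" if *: "\<And>i. (\<lambda>s. f s $ i) differentiable (at x)"
    proof -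
      have "\<forall>i. \<exists>D. ((\<lambda>s. f s $ i) has_real_derivative D) (at x)"
        using * by (simp add: real_differentiable_def)
      then obtain D where D: "\<And>i. ((\<lambda>s. f s $ i) has_real_derivative D i) (at x)" by metis
      have "(f has_vector_derivative (\<chi> i. D i)) (at x)"
        by (rule has_vector_derivative_componentwise) (simp add: D)
      then show ?thesis by (rule differentiableI_vector)
    qed
    ultimately show "x \<in> (\<Union>i. {x \<in> {lo<..<hi}. \<not> (\<lambda>s. f s $ i) differentiable (at x)})"
      by auto
  qed
qed

text \<open>A direct gauge argument. At good points the gauge comes from differentiability. Near the
  null set it keeps the partition intervals inside an open set of measure below the \<delta> of
  absolute continuity, so their increments of f add up to little; setting the integrand to 0 there
  removes its Riemann terms.\<close>

theorem abs_cont_on_has_integral: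
  fixes f :: "real \<Rightarrow> real"
  assumes ac: "abs_cont_on a b f" and ab: "a \<le> b" and N: "negligible N"
    and deriv: "\<And>x. x \<in> {a<..<b} - N \<Longrightarrow> (f has_real_derivative f' x) (at x)"
  shows "(f' has_integral (f b - f a)) {a..b}"
proof -
  \<comment> \<open>The endpoints join the null set, since \<open>deriv\<close> speaks of interior
    points only.\<close>
  define N' where "N' = insert a (insert b N)"
  have N': "negligible N'" using N by (simp add: N'_def)
  define g where "g = (\<lambda>x. if x \<in> N' then 0 else f' x)"
  have "(g has_integral (f b - f a)) {a..b}"
    unfolding has_integral_real
  proof (intro allI impI)
    fix e :: real assume e: "e > 0"
    define e' where "e' = e / (2 * (b - a + 1))"
    have e': "e' > 0" using e ab by (simp add: e'_def)
    have e2: "e / 2 > 0" using e by simp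
    obtain d where d: "d > 0" "\<And>m A B. subfam a b m A B \<Longrightarrow> (\<Sum>i<m. B i - A i) < d
      \<Longrightarrow> (\<Sum>i<m. norm (f (B i) - f (A i))) < e / 2"
      using abs_cont_onD[OF ac e2] by metis
    have N'l: "N' \<in> sets lebesgue" using N' by (simp add: negligible_imp_sets)
    obtain W where W: "open W" "N' \<subseteq> W" "(W - N') \<in> lmeasurable" "emeasure lebesgue (W - N') < ennreal d"
      using sets_lebesgue_outer_open[OF N'l d(1)] by metis
    have N'0: "N' \<in> null_sets lebesgue" using N' by (simp add: negligible_iff_null_sets)
    have WU: "W = (W - N') \<union> N'" using W by auto
    have "(W - N') \<union> N' \<in> lmeasurable"
      by (rule fmeasurable.Un[OF W(3) negligible_imp_measurable[OF N']])
    then have Wm: "W \<in> lmeasurable" using WU by simp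
    have "emeasure lebesgue ((W - N') \<union> N') = emeasure lebesgue (W - N')"
      using W(3) N'0 by (intro emeasure_Un_null_set fmeasurableD)
    then have "emeasure lebesgue W = emeasure lebesgue (W - N')" using WU by simp
    then have mW: "measure lebesgue W < d"
      using W(4) Wm d(1) by (metis emeasure_eq_measure2 ennreal_less_iff measure_nonneg)
    have "\<exists>r>0. (x \<in> N' \<longrightarrow> ball x r \<subseteq> W) \<and> (x \<in> {a..b} - N' \<longrightarrow>
        (\<forall>y. \<bar>y - x\<bar> < r \<longrightarrow> \<bar>f y - f x - f' x * (y - x)\<bar> \<le> e' * \<bar>y - x\<bar>))" for x
    proof (cases "x \<in> N'")
      case True
      then show ?thesis using W(1,2) by (meson DiffD2 openE subsetD)
    next
      case F: False
      show ?thesis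
      proof (cases "x \<in> {a..b}")
        case True
        then have "(f has_derivative (\<lambda>h. f' x * h)) (at x)"
          using deriv[of x] F by (auto simp: N'_def has_field_derivative_def)
        then show ?thesis
          using has_derivative_at_alt[of f "(\<lambda>h. f' x * h)" x] e' F by (auto simp: real_norm_def)
      qed (use F in \<open>auto intro: exI[of _ 1]\<close>)
    qed
    then obtain r where r: "\<And>x. r x > 0" "\<And>x. x \<in> N' \<Longrightarrow> ball x (r x) \<subseteq> W"
      "\<And>x y. x \<in> {a..b} - N' \<Longrightarrow> \<bar>y - x\<bar> < r x \<Longrightarrow> \<bar>f y - f x - f' x * (y - x)\<bar> \<le> e' * \<bar>y - x\<bar>"
      by metis
    define G where "G = (\<lambda>x. ball x (r x))"
    have G: "gauge G" using r(1) by (auto simp: gauge_def G_def)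
    have main: "norm ((\<Sum>(x,k)\<in>D. measure lborel k *\<^sub>R g x) - (f b - f a)) < e"
      if D: "D tagged_division_of {a..b}" "G fine D" for D
    proof -
      have fin: "finite D" using D(1) by (rule tagged_division_of_finite)
      define t where "t = (\<lambda>(x, k). measure lborel k * g x - (f (Sup k) - f (Inf k)))"
      have "(\<Sum>(x,k)\<in>D. f (Sup k) - f (Inf k)) = f b - f a"
        using additive_tagged_division_1[OF ab D(1)] .
      then have eq: "(\<Sum>(x,k)\<in>D. measure lborel k *\<^sub>R g x) - (f b - f a) = (\<Sum>i\<in>D. t i)"
        unfolding t_def by (simp add: sum_subtractf case_prod_beta)
      have k: "\<exists>u v. k = {u..v} \<and> u \<le> v \<and> x \<in> {u..v} \<and> {u..v} \<subseteq> {a..b} \<and> {u..v} \<subseteq> ball x (r x)"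
        if xkD: "(x, k) \<in> D" for x k
      proof -
        obtain u v where "k = cbox u v" using tagged_division_ofD(4)[OF D(1) xkD] by blast
        moreover have "x \<in> k" "k \<subseteq> {a..b}" using tagged_division_ofD(2,3)[OF D(1) xkD] by auto
        moreover have "k \<subseteq> ball x (r x)" using D(2) xkD by (auto simp: fine_def G_def)
        ultimately show ?thesis by auto
      qed
      \<comment> \<open>Degenerate intervals are left out: a point may lie inside another interval
        although the interiors are disjoint, so they could violate
        \<open>nonoverlap\<close>.\<close>
      define D1 where "D1 = {i\<in>D. fst i \<in> N' \<and> interior (snd i) \<noteq> {}}"
      have t0: "\<bar>t i\<bar> \<le> e' * measure lborel (snd i)" if i: "i \<in> D - D1" for i
      proof -
        obtain x kk where xk: "i = (x, kk)" by (cases i)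
        then obtain u v where uv: "kk = {u..v}" "u \<le> v" "x \<in> {u..v}" "{u..v} \<subseteq> {a..b}" "{u..v} \<subseteq> ball x (r x)"
          using k i by blast
        have t: "t i = (v - u) * g x - (f v - f u)"
          using uv by (simp add: t_def xk)
        show ?thesis
        proof (cases "x \<in> N'")
          case True
          then have "interior kk = {}" using i by (auto simp: D1_def xk)
          then have "u = v" using uv(1,2) by (auto simp: interior_atLeastAtMost_real)
          then show ?thesis using t uv by (simp add: xk)
        next
          case False
          have xa: "x \<in> {a..b} - N'" using False uv by auto
          have du: "\<bar>u - x\<bar> < r x" "\<bar>v - x\<bar> < r x"
          proof -
            have "u \<in> ball x (r x)" "v \<in> ball x (r x)" using uv(2,5) by auto
            then show "\<bar>u - x\<bar> < r x" "\<bar>v - x\<bar> < r x"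
              by (auto simp: dist_real_def abs_minus_commute)
          qed
          have "\<bar>f u - f x - f' x * (u - x)\<bar> \<le> e' * (x - u)" "\<bar>f v - f x - f' x * (v - x)\<bar> \<le> e' * (v - x)"
            using r(3)[OF xa du(1)] r(3)[OF xa du(2)] uv by auto
          moreover have "t i = (f u - f x - f' x * (u - x)) - (f v - f x - f' x * (v - x))"
            using t False by (simp add: g_def algebra_simps)
          ultimately have "\<bar>t i\<bar> \<le> e' * (x - u) + e' * (v - x)" by linarith
          then show ?thesis using uv by (simp add: xk algebra_simps)
        qed
      qed
      have "(\<Sum>i\<in>D - D1. \<bar>t i\<bar>) \<le> (\<Sum>i\<in>D - D1. e' * measure lborel (snd i))"
        by (intro sum_mono t0)
      also have "\<dots> \<le> (\<Sum>i\<in>D. e' * measure lborel (snd i))"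
        using fin e' by (intro sum_mono2) auto
      also have "\<dots> = e' * (\<Sum>(x,k)\<in>D. measure lborel k)"
        by (simp add: sum_distrib_left case_prod_beta)
      also have "(\<Sum>(x,k)\<in>D. measure lborel k) = b - a"
        using additive_content_tagged_division[of D a b] D(1) ab by simp
      also have "e' * (b - a) < e / 2"
        using e ab by (simp add: e'_def field_simps)
      finally have s1: "(\<Sum>i\<in>D - D1. \<bar>t i\<bar>) < e / 2" .
      have finD1: "finite D1" using fin by (simp add: D1_def)
      obtain h where h: "bij_betw h {..<card D1} D1"
        using ex_bij_betw_nat_finite[OF finD1] by (auto simp: atLeast0LessThan)
      define A where "A = (\<lambda>i. Inf (snd (h i)))"
      define B where "B = (\<lambda>i. Sup (snd (h i)))"
      have hi: "h i \<in> D1" if "i < card D1" for i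
        using h that by (auto simp: bij_betw_def)
      have AB: "snd (h i) = {A i..B i} \<and> A i < B i \<and> {A i..B i} \<subseteq> {a..b} \<and> {A i..B i} \<subseteq> W" if "i < card D1" for i
      proof -
        have "(fst (h i), snd (h i)) \<in> D" "fst (h i) \<in> N'" "interior (snd (h i)) \<noteq> {}"
          using hi[OF that] by (auto simp: D1_def)
        then obtain u v where uv: "snd (h i) = {u..v}" "u \<le> v" "{u..v} \<subseteq> {a..b}" "{u..v} \<subseteq> ball (fst (h i)) (r (fst (h i)))"
          using k by blast
        moreover have "u < v"
          using \<open>interior (snd (h i)) \<noteq> {}\<close> uv by (auto simp: interior_atLeastAtMost_real)
        ultimately show ?thesis
          using r(2)[OF \<open>fst (h i) \<in> N'\<close>] by (auto simp: A_def B_def)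
      qed
      have no: "nonoverlap (card D1) A B"
        unfolding nonoverlap_def
      proof (intro allI impI)
        fix i j assume ij: "i < card D1" "j < card D1" "i \<noteq> j"
        then have "h i \<noteq> h j" using h by (auto simp: bij_betw_def inj_on_def)
        moreover have "h i \<in> D" "h j \<in> D" using hi ij by (auto simp: D1_def)
        ultimately have "interior (snd (h i)) \<inter> interior (snd (h j)) = {}"
          using tagged_division_ofD(5)[OF D(1), of "fst (h i)" "snd (h i)" "fst (h j)" "snd (h j)"]
          by (metis prod.collapse)
        then have disj: "{A i<..<B i} \<inter> {A j<..<B j} = {}"
          using AB ij by (simp add: interior_atLeastAtMost_real)
        show "B i \<le> A j \<or> B j \<le> A i"
        proof (rule ccontr)
          assume "\<not> (B i \<le> A j \<or> B j \<le> A i)"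
          then have "max (A i) (A j) < min (B i) (B j)" using AB ij by auto
          then obtain z where "max (A i) (A j) < z" "z < min (B i) (B j)" using dense by blast
          then show False using disj by auto
        qed
      qed
      have "(\<Sum>i<card D1. B i - A i) \<le> measure lebesgue W"
        using AB Wm by (intro nonoverlap_length[OF no]) fastforce+
      then have "(\<Sum>i<card D1. norm (f (B i) - f (A i))) < e / 2"
        using mW no AB by (intro d(2)) (fastforce simp: subfam_def)+
      also have "(\<Sum>i<card D1. norm (f (B i) - f (A i))) = (\<Sum>i<card D1. \<bar>t (h i)\<bar>)"
      proof (rule sum.cong)
        fix i assume "i \<in> {..<card D1}"
        then have "fst (h i) \<in> N'" using hi by (auto simp: D1_def)
        then show "norm (f (B i) - f (A i)) = \<bar>t (h i)\<bar>"
          by (simp add: t_def A_def B_def g_def case_prod_beta)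
      qed simp
      also have "\<dots> = (\<Sum>i\<in>D1. \<bar>t i\<bar>)"
        by (rule sum.reindex_bij_betw[OF h])
      finally have s2: "(\<Sum>i\<in>D1. \<bar>t i\<bar>) < e / 2" .
      have "\<bar>\<Sum>i\<in>D. t i\<bar> \<le> (\<Sum>i\<in>D. \<bar>t i\<bar>)" by (rule sum_abs)
      also have "\<dots> = (\<Sum>i\<in>D - D1. \<bar>t i\<bar>) + (\<Sum>i\<in>D1. \<bar>t i\<bar>)"
        using fin by (intro sum.subset_diff) (auto simp: D1_def)
      also have "\<dots> < e" using s1 s2 by simp
      finally show ?thesis unfolding eq by simp
    qed
    show "\<exists>\<gamma>. gauge \<gamma> \<and> (\<forall>\<D>. \<D> tagged_division_of {a..b} \<and> \<gamma> fine \<D> \<longrightarrow>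
        norm ((\<Sum>(x,k)\<in>\<D>. measure lborel k *\<^sub>R g x) - (f b - f a)) < e)"
      by (intro exI[of _ G] conjI allI impI G main) auto
  qed
  then show ?thesis
    by (rule has_integral_spike[OF N', rotated]) (auto simp: g_def)
qed

section \<open>Gradients and periodic functions\<close>

lemma grad_eqI:
  assumes "(f has_derivative (\<lambda>h. g \<bullet> h)) (at x)"
  shows "grad f x = g"
  unfolding grad_def
proof (rule some_equality[where P = "\<lambda>g. (f has_derivative (\<lambda>h. g \<bullet> h)) (at x)", OF assms])
  fix g' assume "(f has_derivative (\<lambda>h. g' \<bullet> h)) (at x)"
  then have "(\<lambda>h. g' \<bullet> h) = (\<lambda>h. g \<bullet> h)"
    using assms by (rule has_derivative_unique)
  then have "g' \<bullet> h = g \<bullet> h" for h by metis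
  then show "g' = g" using vector_eq_rdot by blast
qed

lemma linear_real_as_inner:
  fixes \<phi> :: "'a::euclidean_space \<Rightarrow> real"
  assumes "linear \<phi>"
  obtains g where "\<phi> = (\<lambda>h. g \<bullet> h)"
proof (rule that[of "adjoint \<phi> 1"])
  show "\<phi> = (\<lambda>h. adjoint \<phi> 1 \<bullet> h)"
    using adjoint_works[OF assms, of _ 1] by (auto simp: inner_commute)
qed

lemma grad_works:
  fixes f :: "real^'n \<Rightarrow> real"
  assumes "f differentiable (at x)"
  shows "(f has_derivative (\<lambda>h. grad f x \<bullet> h)) (at x)"
proof -
  obtain D where D: "(f has_derivative D) (at x)"
    using assms by (auto simp: differentiable_def)
  obtain g where "D = (\<lambda>h. g \<bullet> h)"
    using linear_real_as_inner[OF has_derivative_linear[OF D]] by blast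
  with D show ?thesis using grad_eqI by metis
qed

lemma int_vec_reduce:
  fixes x :: "real^'n"
  obtains k where "int_vec k" "x - k \<in> cbox 0 1"
proof
  let ?k = "\<chi> i. real_of_int \<lfloor>x $ i\<rfloor>"
  show "int_vec ?k" by (simp add: int_vec_def)
  show "x - ?k \<in> cbox 0 1"
    unfolding mem_box_cart by (auto simp: le_of_int_ceiling of_int_floor_le) linarith
qed

lemma periodic_funD: "periodic_fun f \<Longrightarrow> int_vec k \<Longrightarrow> f (x + k) = f x"
  by (simp add: periodic_fun_def)

lemma periodic_fun_diff: "periodic_fun f \<Longrightarrow> int_vec k \<Longrightarrow> f (x - k) = f x"
  using periodic_funD[of f k "x - k"] by simp

lemma has_derivative_periodic:
  fixes f :: "real^'n \<Rightarrow> real"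
  assumes "periodic_fun f" "int_vec k" "(f has_derivative D) (at x)"
  shows "(f has_derivative D) (at (x + k))"
proof -
  have "((\<lambda>y. f (y - k)) has_derivative D) (at (x + k))"
  proof -
    have "((\<lambda>y. y - k) has_derivative (\<lambda>h. h)) (at (x + k))"
      by (auto intro!: derivative_eq_intros)
    then show ?thesis
      using has_derivative_compose[of "\<lambda>y. y - k" "\<lambda>h. h" "x + k" UNIV f D] assms(3) by simp
  qed
  then show ?thesis
    using periodic_fun_diff[OF assms(1,2)] by simp
qed

lemma periodic_bounded:
  fixes g :: "real^'n \<Rightarrow> 'a::euclidean_space \<Rightarrow> 'b::real_normed_vector"
  assumes cont: "continuous_on UNIV (\<lambda>z. g (fst z) (snd z))"
    and per: "\<And>p. periodic_fun (\<lambda>x. g x p)"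
  shows "\<exists>B>0. \<forall>x p. norm p \<le> R \<longrightarrow> norm (g x p) \<le> B"
proof -
  have "compact ((\<lambda>z. g (fst z) (snd z)) ` (cbox 0 1 \<times> cball 0 R))"
    by (intro compact_continuous_image continuous_on_subset[OF cont] compact_Times) auto
  then obtain B where B: "B > 0" "\<And>y. y \<in> (\<lambda>z. g (fst z) (snd z)) ` (cbox 0 1 \<times> cball 0 R) \<Longrightarrow> norm y \<le> B"
    using compact_imp_bounded bounded_pos by metis
  have "norm (g x p) \<le> B" if "norm p \<le> R" for x p
  proof -
    obtain k where k: "int_vec k" "x - k \<in> cbox 0 1" using int_vec_reduce by blast
    have "g x p = g (x - k) p" using periodic_fun_diff[OF per k(1)] by simp
    then show ?thesis using B(2)[of "g (x - k) p"] k that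
      by (force simp: image_iff)
  qed
  then show ?thesis using B(1) by blast
qed

lemma periodic_uniformly_continuous:
  fixes g :: "real^'n \<Rightarrow> 'a::euclidean_space \<Rightarrow> 'b::real_normed_vector"
  assumes cont: "continuous_on UNIV (\<lambda>z. g (fst z) (snd z))"
    and per: "\<And>p. periodic_fun (\<lambda>x. g x p)" and e: "e > 0"
  shows "\<exists>d>0. \<forall>x y p q. norm p \<le> R \<longrightarrow> norm q \<le> R \<longrightarrow> norm (y - x) < d \<longrightarrow>
     norm (q - p) < d \<longrightarrow> norm (g y q - g x p) < e"
proof -
  \<comment> \<open>The unit cell is enlarged by 1 on each side: after x is moved into the cell, y
    moved by the same integer vector stays in the box because |y - x| < 1.\<close>
  let ?S = "cbox (\<chi> i. -1) (\<chi> i. 2) \<times> cball 0 R :: ((real^'n) \<times> 'a) set"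
  have "uniformly_continuous_on ?S (\<lambda>z. g (fst z) (snd z))"
    by (intro compact_uniformly_continuous continuous_on_subset[OF cont] compact_Times) auto
  then obtain d where d: "d > 0" "\<And>z z'. z \<in> ?S \<Longrightarrow> z' \<in> ?S \<Longrightarrow> dist z' z < d \<Longrightarrow>
      dist (g (fst z') (snd z')) (g (fst z) (snd z)) < e"
    using e unfolding uniformly_continuous_on_def by metis
  show ?thesis
  proof (intro exI[of _ "min (d / 2) 1"] conjI allI impI)
    fix x y :: "real^'n" and p q :: 'a
    assume *: "norm p \<le> R" "norm q \<le> R" "norm (y - x) < min (d / 2) 1" "norm (q - p) < min (d / 2) 1"
    obtain k where k: "int_vec k" "x - k \<in> cbox 0 1" using int_vec_reduce by blast
    have c: "0 \<le> (x - k) $ i \<and> (x - k) $ i \<le> 1" for i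
      using k(2) by (auto simp: mem_box_cart)
    have xk: "x - k \<in> cbox (\<chi> i. -1) (\<chi> i. 2)"
      unfolding mem_box_cart
    proof (intro allI conjI)
      fix i show "(\<chi> i. -1) $ i \<le> (x - k) $ i" "(x - k) $ i \<le> (\<chi> i. 2) $ i" using c[of i] by auto
    qed
    have c': "\<bar>(y - x) $ i\<bar> \<le> 1" for i
      using component_le_norm_cart[of "y - x" i] * by linarith
    have yk: "y - k \<in> cbox (\<chi> i. -1) (\<chi> i. 2)"
      unfolding mem_box_cart
    proof (intro allI conjI)
      fix i show "(\<chi> i. -1) $ i \<le> (y - k) $ i" "(y - k) $ i \<le> (\<chi> i. 2) $ i"
        using c[of i] c'[of i] by auto
    qed
    have "dist (y - k, q) (x - k, p) \<le> norm (y - x) + norm (q - p)"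
      using norm_Pair_le[of "y - x" "q - p"] by (simp add: dist_norm)
    also have "\<dots> < d" using * by auto
    finally have "dist (g (y - k) q) (g (x - k) p) < e"
      using d(2)[of "(x - k, p)" "(y - k, q)"] xk yk * by auto
    then show "norm (g y q - g x p) < e"
      using periodic_fun_diff[OF per k(1)] by (simp add: dist_norm)
  qed (use d in auto)
qed

lemma locally_Lipschitz_continuous:
  fixes g :: "'a::real_normed_vector \<Rightarrow> 'b::real_normed_vector"
  assumes "\<And>R. \<exists>B. \<forall>z z'. norm z \<le> R \<longrightarrow> norm z' \<le> R \<longrightarrow> norm (g z' - g z) \<le> B * norm (z' - z)"
  shows "continuous_on UNIV g"
proof (rule continuous_at_imp_continuous_on, rule ballI)
  fix z :: 'a
  obtain B where B: "\<And>y y'. norm y \<le> norm z + 1 \<Longrightarrow> norm y' \<le> norm z + 1 \<Longrightarrow> norm (g y' - g y) \<le> B * norm (y' - y)"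
    using assms by metis
  have "\<bar>B\<bar>-lipschitz_on (ball z 1) g"
  proof (rule lipschitz_onI)
    fix x y assume "x \<in> ball z 1" "y \<in> ball z 1"
    then have "norm x \<le> norm z + 1" "norm y \<le> norm z + 1"
      using norm_triangle_ineq2[of x z] norm_triangle_ineq2[of y z]
      by (auto simp: dist_norm norm_minus_commute)
    then have "norm (g x - g y) \<le> B * norm (x - y)" using B by blast
    also have "\<dots> \<le> \<bar>B\<bar> * norm (x - y)" by (intro mult_right_mono) auto
    finally show "dist (g x) (g y) \<le> \<bar>B\<bar> * dist x y" by (simp add: dist_norm)
  qed simp
  then have "continuous_on (ball z 1) g" by (rule lipschitz_on_continuous_on)
  then show "continuous (at z) g"
    by (simp add: continuous_on_eq_continuous_at)
qed

section \<open>Tonelli Hamiltonians and the Legendre transform\<close>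

locale tonelli =
  fixes H :: "real^'n \<Rightarrow> real^'n \<Rightarrow> real"
  assumes tonelli: "tonelli_ham H"
begin

lemma H_periodic: "int_vec k \<Longrightarrow> H (x + k) p = H x p"
  using tonelli by (simp add: tonelli_ham_def periodic_fun_def)

lemma H_periodic_fun: "periodic_fun (\<lambda>x. H x p)"
  by (simp add: periodic_fun_def H_periodic)

lemma C2_data:
  "\<exists>(f' :: (real^'n) \<times> (real^'n) \<Rightarrow> ((real^'n) \<times> (real^'n)) \<Rightarrow>\<^sub>L real) f''.
    (\<forall>z. ((\<lambda>z. H (fst z) (snd z)) has_derivative blinfun_apply (f' z)) (at z)) \<and>
    (\<forall>z. (f' has_derivative blinfun_apply (f'' z)) (at z)) \<and>
    continuous_on UNIV f''"
  using tonelli unfolding tonelli_ham_def C2_fun_def by (elim conjE)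

text \<open>One choice of the full derivative as a bounded linear form at each point; it is
  differentiable with continuous derivative by \<open>D2H_ex\<close>.\<close>

definition DH :: "(real^'n) \<times> (real^'n) \<Rightarrow> ((real^'n) \<times> (real^'n)) \<Rightarrow>\<^sub>L real" where
  "DH = (SOME f'. \<exists>f''. (\<forall>z. ((\<lambda>z. H (fst z) (snd z)) has_derivative blinfun_apply (f' z)) (at z)) \<and>
    (\<forall>z. (f' has_derivative blinfun_apply (f'' z)) (at z)) \<and> continuous_on UNIV f'')"

lemma DH: "((\<lambda>z. H (fst z) (snd z)) has_derivative blinfun_apply (DH z)) (at z)"
  and D2H_ex: "\<exists>f''. (\<forall>z. (DH has_derivative blinfun_apply (f'' z)) (at z)) \<and> continuous_on UNIV f''"
  using someI_ex[OF C2_data, folded DH_def] by blast+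

lemma H_has_derivative_p: "((\<lambda>q. H x q) has_derivative (\<lambda>u. Hp H x p \<bullet> u)) (at p)"
  and DH_p: "DH (x, p) (0, u) = Hp H x p \<bullet> u"
proof -
  have "((\<lambda>y. (x, y)) has_derivative (\<lambda>u. (0, u))) (at p)"
    by (auto intro!: derivative_eq_intros)
  from has_derivative_compose[OF this DH]
  have D: "((\<lambda>q. H x q) has_derivative (\<lambda>u. DH (x, p) (0, u))) (at p)" by simp
  then show D': "((\<lambda>q. H x q) has_derivative (\<lambda>u. Hp H x p \<bullet> u)) (at p)"
    unfolding Hp_def by (intro grad_works) (auto simp: differentiable_def)
  show "DH (x, p) (0, u) = Hp H x p \<bullet> u"
    using fun_cong[OF has_derivative_unique[OF D D']] .
qed

lemma H_has_derivative_x: "((\<lambda>y. H y p) has_derivative (\<lambda>u. Hx H x p \<bullet> u)) (at x)"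
  and DH_x: "DH (x, p) (u, 0) = Hx H x p \<bullet> u"
proof -
  have "((\<lambda>y. (y, p)) has_derivative (\<lambda>u. (u, 0))) (at x)"
    by (auto intro!: derivative_eq_intros)
  from has_derivative_compose[OF this DH]
  have D: "((\<lambda>y. H y p) has_derivative (\<lambda>u. DH (x, p) (u, 0))) (at x)" by simp
  then show D': "((\<lambda>y. H y p) has_derivative (\<lambda>u. Hx H x p \<bullet> u)) (at x)"
    unfolding Hx_def by (intro grad_works) (auto simp: differentiable_def)
  show "DH (x, p) (u, 0) = Hx H x p \<bullet> u"
    using fun_cong[OF has_derivative_unique[OF D D']] .
qed

lemma H_continuous: "continuous_on UNIV (\<lambda>z. H (fst z) (snd z))"
  by (intro continuous_at_imp_continuous_on ballI has_derivative_continuous[OF DH])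

text \<open>\<open>Hp\<close> and \<open>Hx\<close> are the two components of \<open>DH\<close>,
  which is Lipschitz on balls because its derivative is bounded there. Used for continuity at once
  and for uniqueness of Hamiltonian trajectories later.\<close>

lemma Hx_Hp_local_Lipschitz:
  obtains B where "B > 0" "\<And>z z'. norm z \<le> R \<Longrightarrow> norm z' \<le> R \<Longrightarrow>
    norm (Hp H (fst z') (snd z') - Hp H (fst z) (snd z)) \<le> B * norm (z' - z) \<and>
    norm (Hx H (fst z') (snd z') - Hx H (fst z) (snd z)) \<le> B * norm (z' - z)"
proof -
  obtain f'' where f: "\<forall>z. (DH has_derivative blinfun_apply (f'' z)) (at z)" "continuous_on UNIV f''"
    using D2H_ex by blast
  have "compact (f'' ` cball 0 R)"
    by (intro compact_continuous_image continuous_on_subset[OF f(2)]) auto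
  then obtain B where B: "B > 0" "\<And>z. z \<in> cball 0 R \<Longrightarrow> norm (f'' z) \<le> B"
    using compact_imp_bounded bounded_pos by (metis imageI)
  have lip: "norm (DH z' - DH z) \<le> B * norm (z' - z)" if "norm z \<le> R" "norm z' \<le> R" for z z'
  proof (rule differentiable_bound[of "cball 0 R" DH "\<lambda>z. blinfun_apply (f'' z)"])
    show "onorm (blinfun_apply (f'' x)) \<le> B" if "x \<in> cball 0 R" for x
      using B(2)[OF that] by (simp add: norm_blinfun.rep_eq)
  qed (use that f(1) in \<open>auto intro: has_derivative_at_withinI\<close>)
  \<comment> \<open>a and a' represent \<open>DH z\<close> and \<open>DH z'\<close> on a coordinate
    copy of R^n; testing with a' - a itself bounds their distance by the operator norm.\<close>
  have *: "norm (a' - a) \<le> norm (DH z' - DH z)"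
    if ab: "\<And>u. a \<bullet> u = DH z (i u)" "\<And>u. a' \<bullet> u = DH z' (i u)" "\<And>u. norm (i u) = norm u"
    for a a' :: "real^'n" and z z' and i :: "real^'n \<Rightarrow> (real^'n) \<times> (real^'n)"
  proof -
    let ?d = "a' - a"
    have "norm ?d * norm ?d = ?d \<bullet> ?d" by (simp add: dot_square_norm power2_eq_square)
    also have "\<dots> = (DH z' - DH z) (i ?d)" by (simp add: inner_diff_left ab blinfun.diff_left)
    also have "\<dots> \<le> norm (DH z' - DH z) * norm (i ?d)"
      using norm_blinfun[of "DH z' - DH z" "i ?d"] by simp
    finally have "norm ?d * norm ?d \<le> norm (DH z' - DH z) * norm ?d" by (simp add: ab)
    then show ?thesis by (cases "norm ?d = 0") auto
  qed
  show ?thesis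
  proof (rule that[OF B(1)])
    fix z z' :: "(real^'n) \<times> (real^'n)" assume z: "norm z \<le> R" "norm z' \<le> R"
    have "norm (Hp H (fst z') (snd z') - Hp H (fst z) (snd z)) \<le> norm (DH z' - DH z)"
      by (rule *[of _ z "\<lambda>u. (0, u)"]) (auto simp: DH_p[symmetric] norm_Pair)
    moreover have "norm (Hx H (fst z') (snd z') - Hx H (fst z) (snd z)) \<le> norm (DH z' - DH z)"
      by (rule *[of _ z "\<lambda>u. (u, 0)"]) (auto simp: DH_x[symmetric] norm_Pair)
    ultimately show "norm (Hp H (fst z') (snd z') - Hp H (fst z) (snd z)) \<le> B * norm (z' - z) \<and>
      norm (Hx H (fst z') (snd z') - Hx H (fst z) (snd z)) \<le> B * norm (z' - z)"
      using lip[OF z] by linarith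
  qed
qed

lemma Hp_continuous: "continuous_on UNIV (\<lambda>z. Hp H (fst z) (snd z))"
proof (rule locally_Lipschitz_continuous)
  show "\<exists>B. \<forall>z z'. norm z \<le> R \<longrightarrow> norm z' \<le> R \<longrightarrow>
    norm (Hp H (fst z') (snd z') - Hp H (fst z) (snd z)) \<le> B * norm (z' - z)" for R
    by (rule Hx_Hp_local_Lipschitz[of R]) blast
qed

lemma Hx_continuous: "continuous_on UNIV (\<lambda>z. Hx H (fst z) (snd z))"
proof (rule locally_Lipschitz_continuous)
  show "\<exists>B. \<forall>z z'. norm z \<le> R \<longrightarrow> norm z' \<le> R \<longrightarrow>
    norm (Hx H (fst z') (snd z') - Hx H (fst z) (snd z)) \<le> B * norm (z' - z)" for R
    by (rule Hx_Hp_local_Lipschitz[of R]) blast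
qed

lemma Hp_periodic: "int_vec k \<Longrightarrow> Hp H (x + k) p = Hp H x p"
  by (simp add: Hp_def H_periodic)

lemma Hx_periodic: "int_vec k \<Longrightarrow> Hx H (x + k) p = Hx H x p"
  unfolding Hx_def[of H "x + k"]
  by (rule grad_eqI) (rule has_derivative_periodic[OF H_periodic_fun _ H_has_derivative_x])

lemma Hp_bounded: "\<exists>C>0. \<forall>x p. norm p \<le> R \<longrightarrow> norm (Hp H x p) \<le> C"
  by (rule periodic_bounded[OF Hp_continuous]) (simp add: periodic_fun_def Hp_periodic)

lemma Hx_bounded: "\<exists>C>0. \<forall>x p. norm p \<le> R \<longrightarrow> norm (Hx H x p) \<le> C"
  by (rule periodic_bounded[OF Hx_continuous]) (simp add: periodic_fun_def Hx_periodic)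

lemma H_Lipschitz_x:
  "\<exists>C>0. \<forall>x y p. norm p \<le> R \<longrightarrow> \<bar>H y p - H x p\<bar> \<le> C * norm (y - x)"
proof -
  obtain C where C: "C > 0" "\<And>x p. norm p \<le> R \<Longrightarrow> norm (Hx H x p) \<le> C"
    using Hx_bounded[of R] by blast
  have "norm (H y p - H x p) \<le> C * norm (y - x)" if p: "norm p \<le> R" for x y p
  proof (rule differentiable_bound[of UNIV "\<lambda>y. H y p" "\<lambda>y u. Hx H y p \<bullet> u"])
    show "onorm (\<lambda>u. Hx H z p \<bullet> u) \<le> C" for z
      using C(2)[OF p, of z] onorm_inner_right[OF bounded_linear_ident, of "Hx H z p"]
      by (simp add: onorm_id)
  qed (use H_has_derivative_x in \<open>auto intro: has_derivative_at_withinI\<close>)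
  then show ?thesis using C(1) by (metis real_norm_def)
qed

lemma H_bounded: "\<exists>C>0. \<forall>x p. norm p \<le> R \<longrightarrow> \<bar>H x p\<bar> \<le> C"
  using periodic_bounded[OF H_continuous H_periodic_fun, of R] unfolding real_norm_def .

lemma H_superlinear:
  "\<exists>R>0. \<forall>x p. norm p \<ge> R \<longrightarrow> H x p \<ge> M * norm p"
proof -
  obtain R where "\<forall>x p. norm p \<ge> R \<longrightarrow> H x p \<ge> M * norm p"
    using tonelli unfolding tonelli_ham_def by metis
  then show ?thesis by (intro exI[of _ "max R 1"]) auto
qed

text \<open>On the segment from p in the direction d = q - p the derivative of H is strictly
  increasing, because H_pp is positive definite; the mean value theorem compares its value at some z
  > 0 with that at 0.\<close>

lemma H_strictly_convex:
  assumes "p \<noteq> q"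
  shows "H x q > H x p + Hp H x p \<bullet> (q - p)"
proof -
  define d where "d = q - p"
  have d: "d \<noteq> 0" using assms by (simp add: d_def)
  have line: "((\<lambda>t. p + t *\<^sub>R d) has_derivative (\<lambda>s. s *\<^sub>R d)) (at t)" for t
    by (auto intro!: derivative_eq_intros)
  have 1: "((\<lambda>t. H x (p + t *\<^sub>R d)) has_real_derivative Hp H x (p + t *\<^sub>R d) \<bullet> d) (at t)" for t
    using has_derivative_compose[OF line H_has_derivative_p]
    by (simp add: has_field_derivative_def mult_commute_abs)
  have 2: "\<exists>y. ((\<lambda>t. Hp H x (p + t *\<^sub>R d) \<bullet> d) has_real_derivative y) (at t) \<and> y > 0" for t
  proof -
    obtain D where D: "((\<lambda>q. Hp H x q) has_derivative D) (at (p + t *\<^sub>R d))" "d \<bullet> D d > 0"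
      using tonelli d unfolding tonelli_ham_def by blast
    have "((\<lambda>t. Hp H x (p + t *\<^sub>R d) \<bullet> d) has_derivative (\<lambda>s. D (s *\<^sub>R d) \<bullet> d)) (at t)"
      using has_derivative_compose[OF line D(1)] by (intro has_derivative_inner_left)
    moreover have "D (s *\<^sub>R d) \<bullet> d = (d \<bullet> D d) * s" for s
      using linear_cmul[OF has_derivative_linear[OF D(1)], of s d] by (simp add: inner_commute)
    ultimately show ?thesis using D(2) by (auto simp: has_field_derivative_def)
  qed
  obtain z where z: "0 < z" "z < 1" "H x (p + 1 *\<^sub>R d) - H x (p + 0 *\<^sub>R d) = (1 - 0) * (Hp H x (p + z *\<^sub>R d) \<bullet> d)"
    using MVT2[of 0 1 "\<lambda>t. H x (p + t *\<^sub>R d)" "\<lambda>t. Hp H x (p + t *\<^sub>R d) \<bullet> d"] 1 by auto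
  have "Hp H x (p + 0 *\<^sub>R d) \<bullet> d < Hp H x (p + z *\<^sub>R d) \<bullet> d"
    by (rule DERIV_pos_imp_increasing[OF z(1)]) (use 2 in blast)
  then show ?thesis using z by (simp add: d_def)
qed

lemma H_convex: "H x q \<ge> H x p + Hp H x p \<bullet> (q - p)"
  using H_strictly_convex[of p q x] by (cases "p = q") auto

lemma Hp_inj: "Hp H x p = Hp H x q \<Longrightarrow> p = q"
proof (rule ccontr)
  assume eq: "Hp H x p = Hp H x q" and "p \<noteq> q"
  then have "H x p + Hp H x q \<bullet> (q - p) < H x q" "H x q + Hp H x q \<bullet> (p - q) < H x p"
    using H_strictly_convex[of p q x] H_strictly_convex[of q p x] by auto
  then show False by (simp add: inner_diff_right)
qed

text \<open>p is a maximizer of \<xi> . p - H x p. Superlinearity confines it to a ball independent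
  of x: for |q| > B the function is at most -|q| \<le> -C0, which does not exceed its value at
  0.\<close>

lemma Hp_surj_bounded:
  "\<exists>B>0. \<forall>x \<xi>. norm \<xi> \<le> R \<longrightarrow> (\<exists>p. norm p \<le> B \<and> Hp H x p = \<xi>)"
proof -
  obtain C0 where C0: "C0 > 0" "\<And>x. \<bar>H x 0\<bar> \<le> C0"
    using H_bounded[of 0] by auto
  obtain R1 where R1: "R1 > 0" "\<And>x p. norm p \<ge> R1 \<Longrightarrow> H x p \<ge> (\<bar>R\<bar> + 1) * norm p"
    using H_superlinear by blast
  define B where "B = max R1 C0 + 1"
  have B: "B > 0" using C0 by (simp add: B_def)
  have "\<exists>p. norm p \<le> B \<and> Hp H x p = \<xi>" if \<xi>: "norm \<xi> \<le> R" for x \<xi>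
  proof -
    define f where "f = (\<lambda>p. \<xi> \<bullet> p - H x p)"
    have "continuous_on UNIV (\<lambda>p. H x p)"
      using continuous_at_imp_continuous_on H_has_derivative_p has_derivative_continuous by blast
    then have "continuous_on (cball 0 B) f"
      unfolding f_def by (intro continuous_intros) (auto elim: continuous_on_subset)
    then obtain p where p: "p \<in> cball 0 B" "\<And>q. q \<in> cball 0 B \<Longrightarrow> f q \<le> f p"
      using continuous_attains_sup[of "cball 0 B" f] B by auto
    have far: "f q \<le> f p" for q
    proof (cases "norm q \<le> B")
      case True then show ?thesis using p by simp
    next
      case False
      then have q: "norm q \<ge> R1" "norm q \<ge> C0" by (auto simp: B_def)
      have "\<xi> \<bullet> q \<le> norm \<xi> * norm q" by (rule norm_cauchy_schwarz)
      also have "\<dots> \<le> \<bar>R\<bar> * norm q" using \<xi> by (intro mult_right_mono) auto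
      finally have "f q \<le> - norm q" using R1(2)[OF q(1), of x] by (simp add: f_def algebra_simps)
      also have "\<dots> \<le> f 0" using C0(2)[of x] q by (auto simp: f_def)
      also have "\<dots> \<le> f p" using p(2)[of 0] B by simp
      finally show ?thesis .
    qed
    have "(f has_derivative (\<lambda>u. \<xi> \<bullet> u - Hp H x p \<bullet> u)) (at p)"
      unfolding f_def by (intro derivative_intros H_has_derivative_p)
    then have "(\<lambda>u. \<xi> \<bullet> u - Hp H x p \<bullet> u) = (\<lambda>u. 0)"
      by (rule has_derivative_local_max) (use far in auto)
    then have "(\<xi> - Hp H x p) \<bullet> u = 0" for u by (metis inner_diff_left)
    then have "Hp H x p = \<xi>" by (metis all_zero_iff eq_iff_diff_eq_0)
    then show ?thesis using p by auto
  qed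
  then show ?thesis using B by blast
qed

text \<open>Inverse of the Legendre map from p to \<open>Hp H x p\<close>; by \<open>Lxi_eq\<close>
  it is the derivative of the Lagrangian in the velocity.\<close>

definition mom :: "real^'n \<Rightarrow> real^'n \<Rightarrow> real^'n" where
  "mom x \<xi> = (THE p. Hp H x p = \<xi>)"

lemma Hp_mom [simp]: "Hp H x (mom x \<xi>) = \<xi>"
proof -
  obtain p where "Hp H x p = \<xi>" using Hp_surj_bounded[of "norm \<xi>"] by blast
  then show ?thesis
    unfolding mom_def by (rule theI[of "\<lambda>p. Hp H x p = \<xi>"]) (metis Hp_inj \<open>Hp H x p = \<xi>\<close>)
qed

lemma mom_Hp [simp]: "mom x (Hp H x p) = p"
  by (rule Hp_inj[OF Hp_mom])

lemma mom_bounded: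
  "\<exists>B>0. \<forall>x \<xi>. norm \<xi> \<le> R \<longrightarrow> norm (mom x \<xi>) \<le> B"
proof -
  obtain B where B: "B > 0" "\<forall>x \<xi>. norm \<xi> \<le> R \<longrightarrow> (\<exists>p. norm p \<le> B \<and> Hp H x p = \<xi>)"
    using Hp_surj_bounded[of R] by blast
  have "norm (mom x \<xi>) \<le> B" if \<xi>: "norm \<xi> \<le> R" for x \<xi>
  proof -
    obtain p where "norm p \<le> B" "Hp H x p = \<xi>" using B(2) \<xi> by blast
    then show ?thesis using mom_Hp[of x p] by simp
  qed
  then show ?thesis using B(1) by blast
qed

lemma mom_periodic: "int_vec k \<Longrightarrow> mom (x + k) \<xi> = mom x \<xi>"
  by (simp add: mom_def Hp_periodic)

text \<open>Closed graph argument: the graph is cut out by the closed equation Hp = \<xi>, and over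
  bounded velocities \<open>mom\<close> takes values in a compact ball.\<close>

lemma mom_continuous: "continuous_on UNIV (\<lambda>z. mom (fst z) (snd z))"
proof (rule continuous_at_imp_continuous_on, rule ballI)
  fix z :: "(real^'n) \<times> (real^'n)"
  define R where "R = norm (snd z) + 1"
  obtain B where B: "B > 0" "\<And>x \<xi>. norm \<xi> \<le> R \<Longrightarrow> norm (mom x \<xi>) \<le> B"
    using mom_bounded by blast
  let ?S = "UNIV \<times> cball 0 R :: ((real^'n) \<times> (real^'n)) set"
  have "continuous_on ?S (\<lambda>z. mom (fst z) (snd z))"
  proof (rule continuous_from_closed_graph[of "cball 0 B"])
    have "closed {w. Hp H (fst (fst w)) (snd w) = snd (fst w)}"
      by (intro closed_Collect_eq continuous_intros
          continuous_on_compose2[OF Hp_continuous, of _ "\<lambda>w. (fst (fst w), snd w)", simplified])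
    moreover have "(\<lambda>z. (z, mom (fst z) (snd z))) ` ?S =
        (?S \<times> cball 0 B) \<inter> {w. Hp H (fst (fst w)) (snd w) = snd (fst w)}"
    proof
      show "(\<lambda>z. (z, mom (fst z) (snd z))) ` ?S \<subseteq>
        (?S \<times> cball 0 B) \<inter> {w. Hp H (fst (fst w)) (snd w) = snd (fst w)}"
        using B(2) by auto
      show "(?S \<times> cball 0 B) \<inter> {w. Hp H (fst (fst w)) (snd w) = snd (fst w)} \<subseteq>
        (\<lambda>z. (z, mom (fst z) (snd z))) ` ?S"
        by (auto simp: image_iff)
    qed
    moreover have "closed (?S \<times> cball 0 B :: (((real^'n) \<times> (real^'n)) \<times> (real^'n)) set)"
      by (intro closed_Times) auto
    ultimately show "closed ((\<lambda>z. (z, mom (fst z) (snd z))) ` ?S)"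
      by (simp add: closed_Int)
  qed (use B(2) in auto)
  then have "continuous_on (UNIV \<times> ball 0 R) (\<lambda>z. mom (fst z) (snd z))"
    by (rule continuous_on_subset) auto
  moreover have "open (UNIV \<times> ball 0 R :: ((real^'n) \<times> (real^'n)) set)" by (intro open_Times) auto
  moreover have "z \<in> UNIV \<times> ball 0 R" by (cases z) (auto simp: R_def)
  ultimately show "continuous (at z) (\<lambda>z. mom (fst z) (snd z))"
    using continuous_on_eq_continuous_at by blast
qed

lemma lagr_eq: "lagr H x \<xi> = \<xi> \<bullet> mom x \<xi> - H x (mom x \<xi>)"
  and Fenchel: "\<xi> \<bullet> p \<le> lagr H x \<xi> + H x p"
proof -
  have *: "\<xi> \<bullet> q - H x q \<le> \<xi> \<bullet> mom x \<xi> - H x (mom x \<xi>)" for q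
    using H_convex[of x "mom x \<xi>" q] by (simp add: inner_diff_right)
  show eq: "lagr H x \<xi> = \<xi> \<bullet> mom x \<xi> - H x (mom x \<xi>)"
    unfolding lagr_def using * by (intro cSup_eq_maximum) auto
  show "\<xi> \<bullet> p \<le> lagr H x \<xi> + H x p"
    using *[of p] eq by simp
qed

lemma Fenchel_eq: "lagr H x (Hp H x p) = Hp H x p \<bullet> p - H x p"
  unfolding lagr_eq mom_Hp ..

text \<open>By strict convexity \<open>mom x \<xi>\<close> is the only momentum that realizes
  equality in Fenchel's inequality.\<close>

lemma Fenchel_equality_imp:
  assumes "lagr H x \<xi> + H x p \<le> \<xi> \<bullet> p"
  shows "\<xi> = Hp H x p"
proof -
  have "mom x \<xi> = p"
  proof (rule ccontr)
    assume "mom x \<xi> \<noteq> p"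
    from H_strictly_convex[OF this, of x] show False
      using assms lagr_eq[of x \<xi>] by (simp add: inner_diff_right)
  qed
  then show ?thesis using Hp_mom[of x \<xi>] by simp
qed

lemma lagr_periodic: "int_vec k \<Longrightarrow> lagr H (x + k) \<xi> = lagr H x \<xi>"
  by (simp add: lagr_def H_periodic)

lemma lagr_continuous: "continuous_on UNIV (\<lambda>z. lagr H (fst z) (snd z))"
proof -
  have "continuous_on UNIV (\<lambda>z. (fst z, mom (fst z) (snd z)))"
    by (intro continuous_on_Pair mom_continuous continuous_on_fst continuous_on_id)
  from continuous_on_compose2[OF H_continuous this]
  have "continuous_on UNIV (\<lambda>z. H (fst z) (mom (fst z) (snd z)))" by simp
  then show ?thesis
    unfolding lagr_eq by (intro continuous_intros mom_continuous)
qed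

lemma lagr_bounded:
  "\<exists>C>0. \<forall>x \<xi>. norm \<xi> \<le> R \<longrightarrow> \<bar>lagr H x \<xi>\<bar> \<le> C"
proof -
  have "periodic_fun (\<lambda>x. lagr H x \<xi>)" for \<xi> by (simp add: periodic_fun_def lagr_periodic)
  then show ?thesis
    using periodic_bounded[OF lagr_continuous, of R] unfolding real_norm_def by blast
qed

text \<open>Fenchel's inequality tested with the momentum M sgn \<xi>, on which H is bounded
  uniformly in x.\<close>

lemma lagr_superlinear:
  "\<exists>C>0. \<forall>x \<xi>. lagr H x \<xi> \<ge> M * norm \<xi> - C"
proof -
  obtain C where C: "C > 0" "\<And>x p. norm p \<le> \<bar>M\<bar> \<Longrightarrow> \<bar>H x p\<bar> \<le> C"
    using H_bounded by blast
  have "lagr H x \<xi> \<ge> M * norm \<xi> - C" for x \<xi>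
  proof -
    let ?p = "M *\<^sub>R sgn \<xi>"
    have 1: "norm ?p \<le> \<bar>M\<bar>" by (simp add: norm_sgn)
    have "\<xi> \<bullet> ?p = M * norm \<xi>"
      by (cases "\<xi> = 0") (simp_all add: sgn_div_norm dot_square_norm power2_eq_square)
    then show ?thesis using Fenchel[of \<xi> ?p x] C(2)[OF 1, of x] by linarith
  qed
  then show ?thesis using C(1) by blast
qed

lemma lagr_Lipschitz_x:
  "\<exists>C>0. \<forall>x y \<xi>. norm \<xi> \<le> R \<longrightarrow> \<bar>lagr H y \<xi> - lagr H x \<xi>\<bar> \<le> C * norm (y - x)"
proof -
  obtain B where B: "B > 0" "\<And>x \<xi>. norm \<xi> \<le> R \<Longrightarrow> norm (mom x \<xi>) \<le> B"
    using mom_bounded by blast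
  obtain C where C: "C > 0" "\<And>x y p. norm p \<le> B \<Longrightarrow> \<bar>H y p - H x p\<bar> \<le> C * norm (y - x)"
    using H_Lipschitz_x by blast
  have *: "lagr H y \<xi> - lagr H x \<xi> \<le> C * norm (y - x)" if "norm \<xi> \<le> R" for x y \<xi>
    using lagr_eq[of y \<xi>] Fenchel[of \<xi> "mom y \<xi>" x] C(2)[OF B(2)[OF that], of x y y] by (simp add: norm_minus_commute abs_le_iff)
  have "\<bar>lagr H y \<xi> - lagr H x \<xi>\<bar> \<le> C * norm (y - x)" if "norm \<xi> \<le> R" for x y \<xi>
    using *[OF that, of x y] *[OF that, of y x] by (simp add: abs_le_iff norm_minus_commute)
  then show ?thesis using C(1) by blast
qed

text \<open>Envelope theorem with a uniform modulus: the momentum optimal at x bounds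
  \<open>lagr\<close> at y from below, the one optimal at y bounds it from above, and the two
  momenta are close. Uniformity in x and in bounded \<xi> later becomes the common modulus of
  semiconcavity of the solution.\<close>

lemma lagr_expansion:
  assumes "e > 0"
  shows "\<exists>d>0. \<forall>x y \<xi>. norm \<xi> \<le> R \<longrightarrow> norm (y - x) < d \<longrightarrow>
    \<bar>lagr H y \<xi> - lagr H x \<xi> + Hx H x (mom x \<xi>) \<bullet> (y - x)\<bar> \<le> e * norm (y - x)"
proof -
  obtain B where B: "B > 0" "\<And>x \<xi>. norm \<xi> \<le> R \<Longrightarrow> norm (mom x \<xi>) \<le> B"
    using mom_bounded by blast
  obtain d1 where d1: "d1 > 0" "\<And>x y p q. norm p \<le> B \<Longrightarrow> norm q \<le> B \<Longrightarrow> norm (y - x) < d1 \<Longrightarrow>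
     norm (q - p) < d1 \<Longrightarrow> norm (Hx H y q - Hx H x p) < e"
    using periodic_uniformly_continuous[OF Hx_continuous _ assms, of B] Hx_periodic
    unfolding periodic_fun_def by blast
  obtain d2 where d2: "d2 > 0" "\<And>x y p q. norm p \<le> R \<Longrightarrow> norm q \<le> R \<Longrightarrow> norm (y - x) < d2 \<Longrightarrow>
     norm (q - p) < d2 \<Longrightarrow> norm (mom y q - mom x p) < d1"
    using periodic_uniformly_continuous[OF mom_continuous _ d1(1), of R] mom_periodic
    unfolding periodic_fun_def by blast
  have mvt: "\<exists>z. norm (z - x) \<le> norm (y - x) \<and> H y p - H x p = Hx H z p \<bullet> (y - x)" for x y p
  proof -
    have line: "((\<lambda>t. x + t *\<^sub>R (y - x)) has_derivative (\<lambda>s. s *\<^sub>R (y - x))) (at t)" for t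
      by (auto intro!: derivative_eq_intros)
    have 1: "((\<lambda>t. H (x + t *\<^sub>R (y - x)) p) has_real_derivative Hx H (x + t *\<^sub>R (y - x)) p \<bullet> (y - x)) (at t)" for t
      using has_derivative_compose[OF line H_has_derivative_x]
      by (simp add: has_field_derivative_def mult_commute_abs)
    obtain t where "0 < t" "t < 1" "H (x + 1 *\<^sub>R (y - x)) p - H (x + 0 *\<^sub>R (y - x)) p = (1 - 0) * (Hx H (x + t *\<^sub>R (y - x)) p \<bullet> (y - x))"
      using MVT2[of 0 1 "\<lambda>t. H (x + t *\<^sub>R (y - x)) p" "\<lambda>t. Hx H (x + t *\<^sub>R (y - x)) p \<bullet> (y - x)"] 1 by auto
    then show ?thesis
      by (intro exI[of _ "x + t *\<^sub>R (y - x)"]) (auto intro: mult_left_le_one_le)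
  qed
  show ?thesis
  proof (intro exI[of _ "min d1 d2"] conjI allI impI)
    fix x y \<xi> :: "real^'n" assume \<xi>: "norm \<xi> \<le> R" and y: "norm (y - x) < min d1 d2"
    let ?p = "mom x \<xi>" and ?q = "mom y \<xi>"
    obtain z where z: "norm (z - x) \<le> norm (y - x)" "H y ?p - H x ?p = Hx H z ?p \<bullet> (y - x)"
      using mvt by blast
    obtain z' where z': "norm (z' - x) \<le> norm (y - x)" "H y ?q - H x ?q = Hx H z' ?q \<bullet> (y - x)"
      using mvt by blast
    have "lagr H y \<xi> - lagr H x \<xi> + Hx H x ?p \<bullet> (y - x) \<ge> - ((Hx H z ?p - Hx H x ?p) \<bullet> (y - x))"
      using Fenchel[of \<xi> ?p y] lagr_eq[of x \<xi>] z(2) by (simp add: inner_diff_left)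
    moreover have "norm (Hx H z ?p - Hx H x ?p) < e"
      using \<xi> y z d1(1) by (intro d1(2) B(2)) auto
    then have "(Hx H z ?p - Hx H x ?p) \<bullet> (y - x) \<le> e * norm (y - x)"
      by (intro order_trans[OF norm_cauchy_schwarz] mult_right_mono) auto
    moreover have "lagr H y \<xi> - lagr H x \<xi> + Hx H x ?p \<bullet> (y - x) \<le> (Hx H x ?p - Hx H z' ?q) \<bullet> (y - x)"
      using Fenchel[of \<xi> ?q x] lagr_eq[of y \<xi>] z'(2) by (simp add: inner_diff_left)
    moreover have "norm (?q - ?p) < d1" using \<xi> y d2(1) by (intro d2(2)) auto
    then have "norm (Hx H z' ?q - Hx H x ?p) < e"
      using \<xi> y z' by (intro d1(2) B(2)) auto
    then have "(Hx H x ?p - Hx H z' ?q) \<bullet> (y - x) \<le> e * norm (y - x)"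
      by (intro order_trans[OF norm_cauchy_schwarz] mult_right_mono) (auto simp: norm_minus_commute)
    ultimately show "\<bar>lagr H y \<xi> - lagr H x \<xi> + Hx H x ?p \<bullet> (y - x)\<bar> \<le> e * norm (y - x)"
      by (simp add: abs_le_iff)
  qed (use d1 d2 in auto)
qed

lemma Lx_eq: "Lx H x \<xi> = - Hx H x (mom x \<xi>)"
  unfolding Lx_def
proof (rule grad_eqI, unfold has_derivative_at_alt, intro conjI allI impI)
  show "bounded_linear (\<lambda>h. - Hx H x (mom x \<xi>) \<bullet> h)" by (rule bounded_linear_inner_right)
  fix e :: real assume "e > 0"
  then obtain d where d: "d > 0" "\<And>x y \<xi>'. norm \<xi>' \<le> norm \<xi> \<Longrightarrow> norm (y - x) < d \<Longrightarrow>
    \<bar>lagr H y \<xi>' - lagr H x \<xi>' + Hx H x (mom x \<xi>') \<bullet> (y - x)\<bar> \<le> e * norm (y - x)"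
    using lagr_expansion[of e "norm \<xi>"] by blast
  show "\<exists>d>0. \<forall>y. norm (y - x) < d \<longrightarrow>
    norm (lagr H y \<xi> - lagr H x \<xi> - - Hx H x (mom x \<xi>) \<bullet> (y - x)) \<le> e * norm (y - x)"
    using d(1) d(2)[of \<xi> _ x] by (intro exI[of _ d]) auto
qed

text \<open>Envelope argument in the velocity: the remainder lies between 0 and (mom x \<eta> - mom
  x \<xi>) . (\<eta> - \<xi>), which is small by continuity of \<open>mom\<close>.\<close>

lemma Lxi_eq: "Lxi H x \<xi> = mom x \<xi>"
  unfolding Lxi_def
proof (rule grad_eqI, unfold has_derivative_at_alt, intro conjI allI impI)
  show "bounded_linear (\<lambda>h. mom x \<xi> \<bullet> h)" by (rule bounded_linear_inner_right)
  fix e :: real assume e: "e > 0"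
  have "continuous (at \<xi>) (\<lambda>\<eta>. mom x \<eta>)"
    using continuous_on_compose2[OF mom_continuous, of UNIV "\<lambda>\<eta>. (x, \<eta>)"]
    by (simp add: continuous_on_eq_continuous_at continuous_intros)
  then obtain d where d: "d > 0" "\<And>\<eta>. norm (\<eta> - \<xi>) < d \<Longrightarrow> norm (mom x \<eta> - mom x \<xi>) < e"
    using e unfolding continuous_at_eps_delta dist_norm by metis
  have "norm (lagr H x \<eta> - lagr H x \<xi> - mom x \<xi> \<bullet> (\<eta> - \<xi>)) \<le> e * norm (\<eta> - \<xi>)" if "norm (\<eta> - \<xi>) < d" for \<eta>
  proof -
    have "lagr H x \<eta> - lagr H x \<xi> - mom x \<xi> \<bullet> (\<eta> - \<xi>) \<ge> 0"
      using Fenchel[of \<eta> "mom x \<xi>" x] lagr_eq[of x \<xi>] by (simp add: inner_diff_right inner_commute[of "mom x \<xi>"])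
    moreover have "lagr H x \<eta> - lagr H x \<xi> - mom x \<xi> \<bullet> (\<eta> - \<xi>) \<le> (mom x \<eta> - mom x \<xi>) \<bullet> (\<eta> - \<xi>)"
      using Fenchel[of \<xi> "mom x \<eta>" x] lagr_eq[of x \<eta>] by (simp add: inner_diff_right inner_diff_left inner_commute[of "mom x \<xi>"] inner_commute[of "mom x \<eta>"])
    moreover have "(mom x \<eta> - mom x \<xi>) \<bullet> (\<eta> - \<xi>) \<le> e * norm (\<eta> - \<xi>)"
      using d(2)[OF that] by (intro order_trans[OF norm_cauchy_schwarz] mult_right_mono) auto
    ultimately show ?thesis by simp
  qed
  then show "\<exists>d>0. \<forall>y. norm (y - \<xi>) < d \<longrightarrow>
    norm (lagr H x y - lagr H x \<xi> - mom x \<xi> \<bullet> (y - \<xi>)) \<le> e * norm (y - \<xi>)"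
    using d(1) by blast
qed

end

section \<open>Compactness of almost equi-Lipschitz sequences\<close>

text \<open>Arzela-Ascoli for functions that are Lipschitz up to a vanishing defect \<delta> n. The
  defect is there for step curves made from discrete orbits, which jump. Convergence on a countable
  dense set spreads to all points by the almost Lipschitz bound.\<close>

lemma Lipschitz_compactness:
  fixes f :: "nat \<Rightarrow> 'a::euclidean_space \<Rightarrow> 'b::euclidean_space"
  assumes lip: "\<And>n x y. norm (f n x - f n y) \<le> K * norm (x - y) + \<delta> n"
    and \<delta>: "\<delta> \<longlonglongrightarrow> 0" and K: "K \<ge> 0" and B: "\<And>n. norm (f n 0) \<le> B"
  shows "\<exists>r g. strict_mono (r :: nat \<Rightarrow> nat) \<and> (\<forall>x. (\<lambda>n. f (r n) x) \<longlonglongrightarrow> g x) \<and>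
    (\<forall>x y. norm (g x - g y) \<le> K * norm (x - y))"
proof -
  obtain \<Delta> where \<Delta>: "\<Delta> > 0" "\<And>n. norm (\<delta> n) \<le> \<Delta>"
    using convergent_imp_bounded[OF \<delta>] unfolding bounded_pos by auto
  \<comment> \<open>Pointwise bound for the sequence. Dividing by it gives the uniform bound 1 with
    which the diagonal selection on D is carried out.\<close>
  define m where "m = (\<lambda>x::'a. \<bar>B\<bar> + K * norm x + \<Delta>)"
  have m: "m x > 0" for x using \<Delta>(1) K by (simp add: m_def add_nonneg_pos)
  have fm: "norm (f n x) \<le> m x" for n x
  proof -
    have "norm (f n x) \<le> norm (f n 0) + norm (f n x - f n 0)"
      using norm_triangle_ineq[of "f n 0" "f n x - f n 0"] by simp
    also have "\<dots> \<le> m x"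
      using B[of n] lip[of n x 0] \<Delta>(2)[of n] by (simp add: m_def)
    finally show ?thesis .
  qed
  obtain D :: "'a set" where D: "countable D" "\<And>U. open U \<Longrightarrow> U \<noteq> {} \<Longrightarrow> \<exists>d\<in>D. d \<in> U"
    using countable_dense_exists by metis
  have "norm (f n x /\<^sub>R m x) \<le> 1" for n x
    using fm[of n x] m[of x] by (simp add: field_simps)
  then obtain r :: "nat \<Rightarrow> nat" where r: "strict_mono r"
    "\<And>x. x \<in> D \<Longrightarrow> \<exists>l. (\<lambda>n. f (r n) x /\<^sub>R m x) \<longlonglongrightarrow> l"
    using function_convergent_subsequence[OF D(1), of "\<lambda>n x. f n x /\<^sub>R m x" 1] by blast
  have "convergent (\<lambda>n. f (r n) x)" if "x \<in> D" for x
  proof -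
    from r(2)[OF that] obtain l where "(\<lambda>n. f (r n) x /\<^sub>R m x) \<longlonglongrightarrow> l" ..
    then have "(\<lambda>n. m x *\<^sub>R (f (r n) x /\<^sub>R m x)) \<longlonglongrightarrow> m x *\<^sub>R l" by (intro tendsto_intros)
    then show ?thesis using m[of x] by (auto simp: convergent_def)
  qed
  then have cD: "Cauchy (\<lambda>n. f (r n) x)" if "x \<in> D" for x
    using that by (simp add: convergent_Cauchy)
  have \<delta>r: "(\<lambda>n. \<delta> (r n)) \<longlonglongrightarrow> 0"
    using LIMSEQ_subseq_LIMSEQ[OF \<delta> r(1)] by (simp add: o_def)
  have "Cauchy (\<lambda>n. f (r n) x)" for x
  proof (rule metric_CauchyI)
    fix e :: real assume e: "e > 0"
    have "e / (6 * (K + 1)) > 0" using e K by (intro divide_pos_pos) auto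
    then have "ball x (e / (6 * (K + 1))) \<noteq> {}" by (metis centre_in_ball empty_iff)
    then obtain d where d: "d \<in> D" "dist x d < e / (6 * (K + 1))"
      using D(2)[OF open_ball, of x "e / (6 * (K + 1))"] by auto
    have Kd: "K * norm (x - d) \<le> e / 6"
    proof -
      have "K * norm (x - d) \<le> (K + 1) * (e / (6 * (K + 1)))"
        using d(2) K by (intro mult_mono) (auto simp: dist_norm)
      also have "\<dots> = e / 6" using K by (simp add: divide_simps)
      finally show ?thesis .
    qed
    obtain N1 where N1: "\<And>m n. m \<ge> N1 \<Longrightarrow> n \<ge> N1 \<Longrightarrow> dist (f (r m) d) (f (r n) d) < e / 6"
      using metric_CauchyD[OF cD[OF d(1)], of "e / 6"] e by auto
    have "eventually (\<lambda>n. \<delta> (r n) < e / 6) sequentially"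
      using \<delta>r e by (intro order_tendstoD(2)[of _ 0]) auto
    then obtain N2 where N2: "\<And>n. n \<ge> N2 \<Longrightarrow> \<delta> (r n) < e / 6"
      unfolding eventually_sequentially by blast
    have "dist (f (r m) x) (f (r n) x) < e" if "m \<ge> max N1 N2" "n \<ge> max N1 N2" for m n
    proof -
      have 1: "dist (f (r k) x) (f (r k) d) < e / 3" if "k \<ge> N2" for k
        using lip[of "r k" x d] N2[OF that] Kd by (simp add: dist_norm)
      have "dist (f (r m) x) (f (r n) x) \<le> dist (f (r m) x) (f (r m) d) + dist (f (r m) d) (f (r n) d) + dist (f (r n) x) (f (r n) d)"
        using dist_triangle[of "f (r m) x" "f (r n) x" "f (r m) d"] dist_triangle[of "f (r m) d" "f (r n) x" "f (r n) d"]
        by (simp add: dist_commute)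
      then show ?thesis using 1[of m] 1[of n] N1[of m n] that e by simp
    qed
    then show "\<exists>M. \<forall>m\<ge>M. \<forall>n\<ge>M. dist (f (r m) x) (f (r n) x) < e" by blast
  qed
  then have "\<forall>x. \<exists>l. (\<lambda>n. f (r n) x) \<longlonglongrightarrow> l"
    by (simp add: Cauchy_convergent_iff convergent_def)
  then obtain g where g: "\<And>x. (\<lambda>n. f (r n) x) \<longlonglongrightarrow> g x" by metis
  have "norm (g x - g y) \<le> K * norm (x - y)" for x y
  proof -
    have "(\<lambda>n. norm (f (r n) x - f (r n) y)) \<longlonglongrightarrow> norm (g x - g y)"
      by (intro tendsto_intros g)
    moreover have "(\<lambda>n. K * norm (x - y) + \<delta> (r n)) \<longlonglongrightarrow> K * norm (x - y) + 0"
      by (intro tendsto_intros \<delta>r)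
    ultimately show ?thesis
      using LIMSEQ_le lip by fastforce
  qed
  then show ?thesis using r(1) g by blast
qed

lemma tendsto_Lipschitz_args:
  fixes f :: "nat \<Rightarrow> 'a::real_normed_vector \<Rightarrow> 'b::real_normed_vector"
  assumes lip: "\<And>n x y. norm (f n x - f n y) \<le> K * norm (x - y)"
    and f: "\<And>x. (\<lambda>n. f n x) \<longlonglongrightarrow> g x" and x: "X \<longlonglongrightarrow> x"
  shows "(\<lambda>n. f n (X n)) \<longlonglongrightarrow> g x"
proof -
  have "(\<lambda>n. K * norm (X n - x)) \<longlonglongrightarrow> K * norm (x - x)"
    by (intro tendsto_intros x)
  then have "(\<lambda>n. K * norm (X n - x)) \<longlonglongrightarrow> 0" by simp
  then have "(\<lambda>n. f n (X n) - f n x) \<longlonglongrightarrow> 0"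
    by (rule Lim_null_comparison[rotated]) (use lip in auto)
  from tendsto_add[OF this f[of x]] show ?thesis by simp
qed

lemma bounded_subseq:
  fixes q :: "nat \<Rightarrow> 'a::euclidean_space"
  assumes "\<And>n. norm (q n) \<le> K"
  shows "\<exists>l r. strict_mono (r :: nat \<Rightarrow> nat) \<and> (\<lambda>n. q (r n)) \<longlonglongrightarrow> l \<and> norm l \<le> K"
proof -
  have "compact (cball (0::'a) K)" by simp
  then obtain l r where "l \<in> cball 0 K" "strict_mono (r :: nat \<Rightarrow> nat)" "(q \<circ> r) \<longlonglongrightarrow> l"
    using assms unfolding compact_def by (metis mem_cball_0)
  then show ?thesis by (auto simp: o_def)
qed

section \<open>The semi-discrete discounted problem\<close>

locale discounted = tonelli H for H :: "real^'n \<Rightarrow> real^'n \<Rightarrow> real" +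
  fixes c :: "real^'n" and a eps :: real
  assumes eps: "eps > 0"
begin

definition ell :: "real^'n \<Rightarrow> real^'n \<Rightarrow> real" where
  "ell x \<xi> = lagr H x \<xi> - c \<bullet> \<xi> + a"

lemma ell_periodic: "int_vec k \<Longrightarrow> ell (x + k) \<xi> = ell x \<xi>"
  by (simp add: ell_def lagr_periodic)

lemma ell_ge: "ell x \<xi> \<ge> (p - c) \<bullet> \<xi> + (a - H x p)"
  using Fenchel[of \<xi> p x] by (simp add: ell_def inner_diff_left inner_commute[of \<xi> p])

lemma ell_lower_bound: "\<exists>B>0. \<forall>x \<xi>. ell x \<xi> \<ge> - (eps * B)"
proof -
  obtain C where C: "C > 0" "\<And>x p. norm p \<le> norm c \<Longrightarrow> \<bar>H x p\<bar> \<le> C"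
    using H_bounded[of "norm c"] by blast
  have "ell x \<xi> \<ge> - (eps * ((C + \<bar>a\<bar>) / eps))" for x \<xi>
    using ell_ge[where p = c and x = x and \<xi> = \<xi>] C(2)[of c x] eps by (simp add: abs_le_iff) linarith
  then show ?thesis using C(1) eps by (intro exI[of _ "(C + \<bar>a\<bar>) / eps"]) auto
qed

text \<open>Normalized so that the lower bound -B0 reproduces itself in the scheme: (1 - eps h)(-B0)
  + h (-(eps B0)) = -B0.\<close>

definition B0 :: real where "B0 = (SOME B. B > 0 \<and> (\<forall>x \<xi>. ell x \<xi> \<ge> - (eps * B)))"

lemma B0: "B0 > 0" "ell x \<xi> \<ge> - (eps * B0)"
proof -
  have "B0 > 0 \<and> (\<forall>x \<xi>. ell x \<xi> \<ge> - (eps * B0))"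
    unfolding B0_def by (rule someI_ex[OF ell_lower_bound])
  then show "B0 > 0" "ell x \<xi> \<ge> - (eps * B0)" by auto
qed

lemma ell_continuous: "continuous_on UNIV (\<lambda>\<xi>. ell x \<xi>)"
proof -
  have "continuous_on UNIV (\<lambda>\<xi>::real^'n. (x, \<xi>))" by (intro continuous_intros)
  from continuous_on_compose2[OF lagr_continuous this] show ?thesis
    unfolding ell_def by (intro continuous_intros) simp
qed

lemma ell_const:
  "\<exists>C>0. (\<forall>x y \<xi>. norm \<xi> \<le> R \<longrightarrow> \<bar>ell y \<xi> - ell x \<xi>\<bar> \<le> C * norm (y - x)) \<and>
     (\<forall>x \<xi>. norm \<xi> \<le> R \<longrightarrow> norm (Hx H x (mom x \<xi>)) \<le> C)"
proof -
  obtain C1 where C1: "C1 > 0" "\<And>x y \<xi>. norm \<xi> \<le> R \<Longrightarrow> \<bar>lagr H y \<xi> - lagr H x \<xi>\<bar> \<le> C1 * norm (y - x)"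
    using lagr_Lipschitz_x[of R] by blast
  obtain B where B: "B > 0" "\<And>x \<xi>. norm \<xi> \<le> R \<Longrightarrow> norm (mom x \<xi>) \<le> B"
    using mom_bounded[of R] by blast
  obtain C2 where C2: "C2 > 0" "\<And>x p. norm p \<le> B \<Longrightarrow> norm (Hx H x p) \<le> C2"
    using Hx_bounded[of B] by blast
  have "\<bar>ell y \<xi> - ell x \<xi>\<bar> \<le> max C1 C2 * norm (y - x)" if "norm \<xi> \<le> R" for x y \<xi>
    using C1(2)[OF that, of y x] mult_right_mono[of C1 "max C1 C2" "norm (y - x)"]
    by (simp add: ell_def)
  moreover have "norm (Hx H x (mom x \<xi>)) \<le> max C1 C2" if "norm \<xi> \<le> R" for x \<xi>
    using C2(2)[OF B(2)[OF that], of x x] by simp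
  ultimately show ?thesis using C1(1) by (intro exI[of _ "max C1 C2"]) auto
qed

text \<open>A condition on the displacement w instead of a radius: the discrete solutions for all
  steps satisfy the same semiconcavity statement for exactly these w, so that no modulus has to be
  fixed before the limit.\<close>

definition expn :: "real \<Rightarrow> real \<Rightarrow> real^'n \<Rightarrow> bool" where
  "expn R e w \<longleftrightarrow> (\<forall>x \<xi>. norm \<xi> \<le> R \<longrightarrow> ell (x + w) \<xi> \<le> ell x \<xi> - Hx H x (mom x \<xi>) \<bullet> w + e * norm w)"

lemma expn_ex: "e > 0 \<Longrightarrow> \<exists>d>0. \<forall>w. norm w < d \<longrightarrow> expn R e w"
proof -
  assume "e > 0"
  then obtain d where d: "d > 0" "\<And>x y \<xi>. norm \<xi> \<le> R \<Longrightarrow> norm (y - x) < d \<Longrightarrow>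
    \<bar>lagr H y \<xi> - lagr H x \<xi> + Hx H x (mom x \<xi>) \<bullet> (y - x)\<bar> \<le> e * norm (y - x)"
    using lagr_expansion[of e R] by blast
  have "expn R e w" if "norm w < d" for w
    unfolding expn_def
  proof (intro allI impI)
    fix x \<xi> :: "real^'n" assume "norm \<xi> \<le> R"
    from d(2)[OF this, of "x + w" x] that
    show "ell (x + w) \<xi> \<le> ell x \<xi> - Hx H x (mom x \<xi>) \<bullet> w + e * norm w"
      by (simp add: ell_def)
  qed
  then show ?thesis using d(1) by blast
qed

end

section \<open>The one-step operator with velocities bounded by R, its invariant class and a fixed
  point\<close>

locale scheme = discounted H c a eps for H :: "real^'n \<Rightarrow> real^'n \<Rightarrow> real" and c a eps +
  fixes R K h :: real
  assumes R: "R > 0" and K: "K > 0" and h: "h > 0" "eps * h < 1"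
    and Kx: "\<And>x y \<xi>. norm \<xi> \<le> R \<Longrightarrow> \<bar>ell y \<xi> - ell x \<xi>\<bar> \<le> eps * K * norm (y - x)"
    and Kg: "\<And>x \<xi>. norm \<xi> \<le> R \<Longrightarrow> norm (Hx H x (mom x \<xi>)) \<le> eps * K"
begin

text \<open>Chosen to be preserved by \<open>T\<close> and by infima of nonempty families. The error
  e / eps is the sum of the geometric series of terms h e (1 - eps h)^j, the discounted errors of
  the single steps.\<close>

definition adm :: "(real^'n \<Rightarrow> real) \<Rightarrow> bool" where
  "adm u \<longleftrightarrow> (\<forall>x y. \<bar>u x - u y\<bar> \<le> K * norm (x - y)) \<and> periodic_fun u \<and> (\<forall>x. u x \<ge> - B0) \<and>
    (\<forall>x. \<exists>q. norm q \<le> K \<and> (\<forall>e w. e \<ge> 0 \<longrightarrow> expn R e w \<longrightarrow> u (x + w) \<le> u x + q \<bullet> w + e / eps * norm w))"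

text \<open>One step of dynamic programming, with exp (- eps h) replaced by its first-order value 1
  - eps h.\<close>

definition cost :: "(real^'n \<Rightarrow> real) \<Rightarrow> real^'n \<Rightarrow> real^'n \<Rightarrow> real" where
  "cost u x \<xi> = (1 - eps * h) * u (x - h *\<^sub>R \<xi>) + h * ell x \<xi>"

definition T :: "(real^'n \<Rightarrow> real) \<Rightarrow> real^'n \<Rightarrow> real" where
  "T u x = (INF \<xi>\<in>cball 0 R. cost u x \<xi>)"

lemma adm_continuous: "adm u \<Longrightarrow> continuous_on UNIV u"
proof -
  assume "adm u"
  then have "K-lipschitz_on UNIV u"
    using K by (intro lipschitz_onI) (auto simp: adm_def dist_norm)
  then show ?thesis by (rule lipschitz_on_continuous_on)
qed

lemma T_attained:
  assumes "adm u"
  shows "\<exists>\<xi>. norm \<xi> \<le> R \<and> T u x = cost u x \<xi> \<and> (\<forall>\<eta>. norm \<eta> \<le> R \<longrightarrow> cost u x \<xi> \<le> cost u x \<eta>)"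
proof -
  have "continuous_on UNIV (\<lambda>\<xi>. u (x - h *\<^sub>R \<xi>))"
    by (rule continuous_on_compose2[OF adm_continuous[OF assms]]) (auto intro!: continuous_intros)
  then have "continuous_on UNIV (\<lambda>\<xi>. cost u x \<xi>)"
    unfolding cost_def by (intro continuous_intros ell_continuous)
  then have "continuous_on (cball 0 R) (\<lambda>\<xi>. cost u x \<xi>)"
    by (rule continuous_on_subset) simp
  moreover have "cball (0::real^'n) R \<noteq> {}" using R by simp
  ultimately obtain \<xi> where \<xi>: "\<xi> \<in> cball 0 R" "\<forall>\<eta>\<in>cball 0 R. cost u x \<xi> \<le> cost u x \<eta>"
    using continuous_attains_inf[OF compact_cball] by blast
  have "T u x = cost u x \<xi>"
    unfolding T_def using \<xi> by (intro cInf_eq_minimum) auto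
  then show ?thesis using \<xi> by (intro exI[of _ \<xi>]) auto
qed

lemma T_le: "adm u \<Longrightarrow> norm \<xi> \<le> R \<Longrightarrow> T u x \<le> cost u x \<xi>"
  using T_attained[of u x] by metis

lemma T_mono:
  assumes "adm u" "adm u'" "\<And>x. u x \<le> u' x"
  shows "T u x \<le> T u' x"
proof -
  obtain \<xi> where \<xi>: "norm \<xi> \<le> R" "T u' x = cost u' x \<xi>" using T_attained[OF assms(2)] by blast
  have "cost u x \<xi> \<le> cost u' x \<xi>"
    unfolding cost_def using assms(3) h by (intro add_mono mult_left_mono) auto
  then show ?thesis using T_le[OF assms(1) \<xi>(1), of x] \<xi>(2) by simp
qed

text \<open>Each bound b of the class satisfies (1 - eps h) b + h (eps b) = b, and the data
  contribute at most eps b per unit time by \<open>Kx\<close>, \<open>Kg\<close> and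
  \<open>B0\<close>.\<close>

lemma adm_T: assumes u: "adm u" shows "adm (T u)"
proof -
  have lip: "\<bar>u x - u y\<bar> \<le> K * norm (x - y)" for x y using u by (simp add: adm_def)
  have h1: "1 - eps * h \<ge> 0" using h by simp
  have *: "T u x - T u y \<le> K * norm (x - y)" for x y
  proof -
    obtain \<xi> where \<xi>: "norm \<xi> \<le> R" "T u y = cost u y \<xi>" using T_attained[OF u] by blast
    have "T u x - T u y \<le> cost u x \<xi> - cost u y \<xi>" using T_le[OF u \<xi>(1), of x] \<xi>(2) by simp
    also have "\<dots> = (1 - eps * h) * (u (x - h *\<^sub>R \<xi>) - u (y - h *\<^sub>R \<xi>)) + h * (ell x \<xi> - ell y \<xi>)"
      by (simp add: cost_def algebra_simps)
    also have "\<dots> \<le> (1 - eps * h) * (K * norm (x - y)) + h * (eps * K * norm (x - y))"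
      using lip[of "x - h *\<^sub>R \<xi>" "y - h *\<^sub>R \<xi>"] Kx[OF \<xi>(1), of x y] h1 h(1)
      by (intro add_mono mult_left_mono) auto
    also have "\<dots> = K * norm (x - y)" by (simp add: algebra_simps)
    finally show ?thesis .
  qed
  have "\<bar>T u x - T u y\<bar> \<le> K * norm (x - y)" for x y
    using *[of x y] *[of y x] by (simp add: abs_le_iff norm_minus_commute)
  moreover have "periodic_fun (T u)"
  proof -
    have "periodic_fun u" using u by (simp add: adm_def)
    then have "u (x + k - h *\<^sub>R \<xi>) = u (x - h *\<^sub>R \<xi>)" if "int_vec k" for x k \<xi>
      using periodic_funD[of u k "x - h *\<^sub>R \<xi>"] that by (simp add: algebra_simps)
    then show ?thesis by (simp add: periodic_fun_def T_def cost_def ell_periodic)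
  qed
  moreover have "T u x \<ge> - B0" for x
  proof -
    obtain \<xi> where \<xi>: "norm \<xi> \<le> R" "T u x = cost u x \<xi>" using T_attained[OF u] by blast
    have "(1 - eps * h) * (- B0) + h * (- (eps * B0)) \<le> cost u x \<xi>"
      unfolding cost_def using h1 h(1) u B0(2)[of x \<xi>] by (intro add_mono mult_left_mono) (auto simp: adm_def)
    then show ?thesis using \<xi>(2) by (simp add: algebra_simps)
  qed
  moreover have "\<exists>q. norm q \<le> K \<and> (\<forall>e w. e \<ge> 0 \<longrightarrow> expn R e w \<longrightarrow> T u (x + w) \<le> T u x + q \<bullet> w + e / eps * norm w)" for x
  proof -
    obtain \<xi> where \<xi>: "norm \<xi> \<le> R" "T u x = cost u x \<xi>" using T_attained[OF u] by blast
    obtain q where q: "norm q \<le> K" "\<And>e w. e \<ge> 0 \<Longrightarrow> expn R e w \<Longrightarrow>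
        u (x - h *\<^sub>R \<xi> + w) \<le> u (x - h *\<^sub>R \<xi>) + q \<bullet> w + e / eps * norm w"
      using u unfolding adm_def by blast
    \<comment> \<open>One Euler step of the discounted momentum equation dq/ds = - Hx - eps q,
      started from a supergradient q at the foot point x - h \<xi>.\<close>
    define q' where "q' = (1 - eps * h) *\<^sub>R q - h *\<^sub>R Hx H x (mom x \<xi>)"
    have "norm q' \<le> (1 - eps * h) * norm q + h * norm (Hx H x (mom x \<xi>))"
      unfolding q'_def using norm_triangle_ineq4[of "(1 - eps * h) *\<^sub>R q" "h *\<^sub>R Hx H x (mom x \<xi>)"] h1 h(1) by simp
    also have "\<dots> \<le> (1 - eps * h) * K + h * (eps * K)"
      using q(1) Kg[OF \<xi>(1), of x] h1 h(1) by (intro add_mono mult_left_mono) auto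
    also have "\<dots> = K" by (simp add: algebra_simps)
    finally have "norm q' \<le> K" .
    moreover have "T u (x + w) \<le> T u x + q' \<bullet> w + e / eps * norm w" if e: "e \<ge> 0" and ex: "expn R e w" for e w
    proof -
      have "ell (x + w) \<xi> \<le> ell x \<xi> - Hx H x (mom x \<xi>) \<bullet> w + e * norm w"
        using ex \<xi>(1) by (simp add: expn_def)
      then have "cost u (x + w) \<xi> \<le> (1 - eps * h) * (u (x - h *\<^sub>R \<xi>) + q \<bullet> w + e / eps * norm w) +
          h * (ell x \<xi> - Hx H x (mom x \<xi>) \<bullet> w + e * norm w)"
        unfolding cost_def using q(2)[OF e ex] h1 h(1)
        by (intro add_mono mult_left_mono) (auto simp: algebra_simps)
      also have "\<dots> = cost u x \<xi> + q' \<bullet> w + e / eps * norm w"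
      proof -
        define k where "k = e / eps"
        have "e = eps * k" using eps by (simp add: k_def)
        then show ?thesis
          unfolding k_def[symmetric] by (simp add: cost_def q'_def algebra_simps inner_diff_left)
      qed
      finally show ?thesis using T_le[OF u \<xi>(1), of "x + w"] \<xi>(2) by simp
    qed
    ultimately show ?thesis by blast
  qed
  ultimately show ?thesis unfolding adm_def by blast
qed

text \<open>The least fixed point is taken (infimum of supersolutions) because semiconcavity survives
  infima but not suprema.\<close>

lemma discrete_solution: "\<exists>u. adm u \<and> T u = u"
proof -
  define Z where "Z = {u. adm u \<and> (\<forall>x. T u x \<le> u x)}"
  obtain C where C: "C > 0" "\<And>x \<xi>. norm \<xi> \<le> 0 \<Longrightarrow> \<bar>lagr H x \<xi>\<bar> \<le> C"
    using lagr_bounded[of 0] by blast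
  \<comment> \<open>The constant M is a supersolution: the velocity 0 is allowed, and ell x 0 \<le>
    C + |a| = eps M.\<close>
  define M where "M = (C + \<bar>a\<bar>) / eps"
  have M: "M \<ge> 0" using C(1) eps by (simp add: M_def)
  have admM: "adm (\<lambda>_. M)"
    unfolding adm_def
  proof (intro conjI allI)
    show "\<exists>q. norm q \<le> K \<and> (\<forall>e w. e \<ge> 0 \<longrightarrow> expn R e w \<longrightarrow> M \<le> M + q \<bullet> w + e / eps * norm w)" for x :: "real^'n"
      using K eps by (intro exI[of _ 0]) auto
  qed (use K M B0(1) in \<open>auto simp: periodic_fun_def\<close>)
  have "T (\<lambda>_. M) x \<le> M" for x
  proof -
    have "ell x 0 \<le> eps * M" using C(2)[of 0 x] eps abs_ge_self[of a] abs_ge_self[of "lagr H x 0"] by (simp add: ell_def M_def)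
    then have "cost (\<lambda>_. M) x 0 \<le> (1 - eps * h) * M + h * (eps * M)"
      unfolding cost_def using h by (intro add_mono mult_left_mono) auto
    also have "\<dots> = M" by (simp add: algebra_simps)
    finally show ?thesis using T_le[OF admM, of 0 x] R by simp
  qed
  then have MZ: "(\<lambda>_. M) \<in> Z" using admM by (simp add: Z_def)
  define v where "v = (\<lambda>x. INF u\<in>Z. u x)"
  have bdd: "bdd_below ((\<lambda>u. u x) ` Z)" for x
    unfolding bdd_below_def by (intro exI[of _ "- B0"]) (auto simp: Z_def adm_def)
  have vle: "v x \<le> u x" if "u \<in> Z" for u x
    unfolding v_def using that bdd by (intro cINF_lower)
  have gev: "b \<le> v x" if "\<And>u. u \<in> Z \<Longrightarrow> b \<le> u x" for b x
    unfolding v_def using that MZ by (intro cINF_greatest) auto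
  have Zd: "adm u" "T u x \<le> u x" if "u \<in> Z" for u x
    using that by (auto simp: Z_def)
  have admv: "adm v"
    unfolding adm_def
  proof (intro conjI allI)
    have *: "v x - v y \<le> K * norm (x - y)" for x y
    proof -
      have "v x - K * norm (x - y) \<le> v y"
      proof (rule gev)
        fix u assume u: "u \<in> Z"
        then have "\<bar>u x - u y\<bar> \<le> K * norm (x - y)" using Zd(1) by (simp add: adm_def)
        then show "v x - K * norm (x - y) \<le> u y" using vle[OF u, of x] by linarith
      qed
      then show ?thesis by simp
    qed
    show "\<bar>v x - v y\<bar> \<le> K * norm (x - y)" for x y
      using *[of x y] *[of y x] by (simp add: abs_le_iff norm_minus_commute)
    show "periodic_fun v"
      unfolding periodic_fun_def v_def
    proof (intro allI impI INF_cong refl)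
      fix x k :: "real^'n" and u assume "int_vec k" "u \<in> Z"
      then show "u (x + k) = u x" using Zd(1)[of u] by (simp add: adm_def periodic_fun_def)
    qed
    show "- B0 \<le> v x" for x using Zd(1) by (intro gev) (auto simp: adm_def)
    fix x
    \<comment> \<open>The infimum at x need not be attained. A minimizing sequence has bounded
      supergradients at x, and any limit of these serves for v.\<close>
    have "\<exists>u\<in>Z. u x < v x + inverse (real (Suc n))" for n
    proof (rule ccontr)
      assume "\<not> (\<exists>u\<in>Z. u x < v x + inverse (real (Suc n)))"
      then have "v x + inverse (real (Suc n)) \<le> v x" by (intro gev) (auto simp: not_less)
      then show False by simp
    qed
    then obtain U where U: "\<And>n. U n \<in> Z" "\<And>n. U n x < v x + inverse (real (Suc n))" by metis
    have "\<forall>n. \<exists>q. norm q \<le> K \<and> (\<forall>e w. e \<ge> 0 \<longrightarrow> expn R e w \<longrightarrow> U n (x + w) \<le> U n x + q \<bullet> w + e / eps * norm w)"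
      using Zd(1)[OF U(1)] by (simp add: adm_def)
    then obtain q where q: "\<And>n. norm (q n) \<le> K" "\<And>n e w. e \<ge> 0 \<Longrightarrow> expn R e w \<Longrightarrow> U n (x + w) \<le> U n x + q n \<bullet> w + e / eps * norm w"
      by metis
    obtain l r where r: "strict_mono (r :: nat \<Rightarrow> nat)" "(\<lambda>n. q (r n)) \<longlonglongrightarrow> l" "norm l \<le> K"
      using bounded_subseq[of q K, OF q(1)] by blast
    have "v (x + w) \<le> v x + l \<bullet> w + e / eps * norm w" if e: "e \<ge> 0" "expn R e w" for e w
    proof (rule LIMSEQ_le_const)
      have "(\<lambda>n. inverse (real (Suc (r n)))) \<longlonglongrightarrow> 0"
        using LIMSEQ_subseq_LIMSEQ[OF LIMSEQ_inverse_real_of_nat r(1)] by (simp add: o_def)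
      then have "(\<lambda>n. v x + inverse (real (Suc (r n))) + q (r n) \<bullet> w + e / eps * norm w) \<longlonglongrightarrow>
        v x + 0 + l \<bullet> w + e / eps * norm w"
        by (intro tendsto_intros r(2))
      then show "(\<lambda>n. v x + inverse (real (Suc (r n))) + q (r n) \<bullet> w + e / eps * norm w) \<longlonglongrightarrow>
        v x + l \<bullet> w + e / eps * norm w" by simp
      show "\<exists>N. \<forall>n\<ge>N. v (x + w) \<le> v x + inverse (real (Suc (r n))) + q (r n) \<bullet> w + e / eps * norm w"
      proof (intro exI allI impI)
        fix n
        show "v (x + w) \<le> v x + inverse (real (Suc (r n))) + q (r n) \<bullet> w + e / eps * norm w"
          using vle[OF U(1)[of "r n"], of "x + w"] q(2)[OF e, of "r n"] U(2)[of "r n"] by linarith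
      qed
    qed
    then show "\<exists>q. norm q \<le> K \<and> (\<forall>e w. e \<ge> 0 \<longrightarrow> expn R e w \<longrightarrow> v (x + w) \<le> v x + q \<bullet> w + e / eps * norm w)"
      using r(3) by blast
  qed
  have Tv: "T v x \<le> v x" for x
    using T_mono[OF admv Zd(1) vle] Zd(2) by (intro gev) (meson order_trans)
  \<comment> \<open>\<open>T v\<close> is again a member of Z, so minimality of v gives v \<le>
    \<open>T v\<close>, the inequality still missing.\<close>
  then have "T (T v) x \<le> T v x" for x
    by (intro T_mono adm_T admv)
  then have "T v \<in> Z" using adm_T[OF admv] by (simp add: Z_def)
  then have "T v = v" using Tv vle by (intro ext antisym) auto
  then show ?thesis using admv by blast
qed

end

context discounted
begin

text \<open>A derivative-free calibration: for a smooth curve the inequality for all p is the integrated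
  Fenchel inequality, and \<open>D p\<close> absorbs the second-order error of freezing the end point. In this
  form calibration passes to pointwise limits.\<close>

definition calib :: "real \<Rightarrow> (real^'n \<Rightarrow> real) \<Rightarrow> (real^'n \<Rightarrow> real) \<Rightarrow> real set \<Rightarrow> (real \<Rightarrow> real^'n) \<Rightarrow> bool" where
  "calib R D v I \<gamma> \<longleftrightarrow> (\<forall>s\<in>I. \<forall>t\<in>I. norm (\<gamma> t - \<gamma> s) \<le> R * \<bar>t - s\<bar>) \<and>
    (\<forall>s\<in>I. \<forall>t\<in>I. s \<le> t \<longrightarrow> (\<forall>p. v (\<gamma> t) - v (\<gamma> s) \<ge>
       (p - c) \<bullet> (\<gamma> t - \<gamma> s) + (t - s) * (a - H (\<gamma> t) p - eps * v (\<gamma> t)) - D p * (t - s)\<^sup>2))"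

text \<open>What is kept of the scheme in the limit: domination along segments with the running cost
  frozen at x, at the price C t^2; a calibrated backward curve from every point, with one D for all
  points; a modulus d of semiconcavity common to all points. R bounds the velocities in the
  domination clause and the speed of the curves.\<close>

definition weak_sol :: "real \<Rightarrow> (real^'n \<Rightarrow> real) \<Rightarrow> bool" where
  "weak_sol R v \<longleftrightarrow> periodic_fun v \<and> (\<forall>x. v x \<ge> - B0) \<and>
    (\<exists>K>0. \<forall>x y. \<bar>v x - v y\<bar> \<le> K * norm (x - y)) \<and>
    (\<exists>C\<ge>0. \<forall>x \<xi> t. norm \<xi> \<le> R \<longrightarrow> 0 \<le> t \<longrightarrow>
       v x - v (x - t *\<^sub>R \<xi>) \<le> t * (ell x \<xi> - eps * v x) + C * t\<^sup>2) \<and>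
    (\<exists>D. \<forall>x. \<exists>\<gamma>. \<gamma> 0 = x \<and> calib R D v {..0} \<gamma>) \<and>
    (\<exists>K d. (\<forall>e>0. d e > 0) \<and> (\<forall>x. \<exists>q. norm q \<le> K \<and>
       (\<forall>e w. e > 0 \<longrightarrow> norm w < d e \<longrightarrow> v (x + w) \<le> v x + q \<bullet> w + e * norm w)))"

end

section \<open>Domination and calibration over many steps of the scheme\<close>

context scheme
begin

text \<open>Induction step for a quadratic error: single-step errors E (k + 1) h^2 add up to at most
  E (k h)^2, because k^2 + (k + 1) \<le> (k + 1)^2.\<close>

lemma square_step: "real k * real k * (h * h) * E + E * (real k + 1) * (h * h) \<le> E * (real (Suc k) * h)\<^sup>2" if "E \<ge> 0"
proof -
  have "real k * real k + (real k + 1) \<le> real (Suc k) * real (Suc k)" by (simp add: algebra_simps)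
  then have "(real k * real k + (real k + 1)) * (E * (h * h)) \<le> (real (Suc k) * real (Suc k)) * (E * (h * h))"
    using that h by (intro mult_right_mono) auto
  then show ?thesis by (simp add: power2_eq_square algebra_simps)
qed

text \<open>The constant velocity \<xi> competes in every step. Points reached after j steps are
  within j h R of x, so freezing running cost and discount term at x costs an error proportional to
  elapsed time, and a quadratic one in total.\<close>

lemma domination_iterate:
  assumes u: "adm u" "T u = u" and \<xi>: "norm \<xi> \<le> R"
  shows "u x - u (x - (real k * h) *\<^sub>R \<xi>) \<le> (real k * h) * (ell x \<xi> - eps * u x) + 2 * eps * K * R * (real k * h)\<^sup>2"
proof (induction k)
  case 0
  then show ?case by simp
next
  case (Suc k)
  define E where "E = 2 * eps * K * R"
  have E: "E \<ge> 0" using eps K R by (simp add: E_def)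
  define y where "y = x - (real k * h) *\<^sub>R \<xi>"
  define z where "z = x - (real (Suc k) * h) *\<^sub>R \<xi>"
  have z: "z = y - h *\<^sub>R \<xi>" by (simp add: y_def z_def algebra_simps)
  have "u y \<le> cost u y \<xi>" using T_le[OF u(1) \<xi>, of y] u(2) by simp
  then have 1: "u y - u z \<le> h * (ell y \<xi> - eps * u z)" by (simp add: cost_def z algebra_simps)
  have "\<bar>ell y \<xi> - ell x \<xi>\<bar> \<le> eps * K * norm (y - x)" by (rule Kx[OF \<xi>])
  also have "\<dots> \<le> eps * K * (real k * h * R)"
    using \<xi> eps K h by (intro mult_left_mono) (auto simp: y_def intro!: mult_left_mono)
  finally have 2: "ell y \<xi> \<le> ell x \<xi> + eps * K * (real k * h * R)" by linarith
  have "\<bar>u x - u z\<bar> \<le> K * norm (x - z)" using u(1) by (simp add: adm_def)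
  also have "\<dots> \<le> K * (real (Suc k) * h * R)"
    using \<xi> eps K h by (intro mult_left_mono) (auto simp: z_def intro!: mult_mono)
  finally have "u x - u z \<le> K * (real (Suc k) * h * R)" by linarith
  then have 3: "eps * (u x - u z) \<le> eps * (K * (real (Suc k) * h * R))"
    using eps by (intro mult_left_mono) auto
  have "eps * K * (real k * h * R) + eps * (K * (real (Suc k) * h * R)) \<le> E * (real k + 1) * h"
  proof -
    have "real k * (eps * K * h * R) \<le> (real k + 1) * (eps * K * h * R)"
      using eps K R h by (intro mult_right_mono) auto
    then show ?thesis by (simp add: E_def algebra_simps)
  qed
  then have "ell y \<xi> - eps * u z \<le> ell x \<xi> - eps * u x + E * (real k + 1) * h"
    using 2 3 by (simp add: algebra_simps)
  then have "h * (ell y \<xi> - eps * u z) \<le> h * (ell x \<xi> - eps * u x + E * (real k + 1) * h)"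
    using h by (intro mult_left_mono) auto
  then have "u y - u z \<le> h * (ell x \<xi> - eps * u x) + E * (real k + 1) * (h * h)"
    using 1 by (simp add: algebra_simps)
  moreover have "u x - u y \<le> (real k * h) * (ell x \<xi> - eps * u x) + real k * real k * (h * h) * E"
    using Suc by (simp add: y_def E_def power2_eq_square algebra_simps)
  ultimately have "u x - u z \<le> (real k * h) * (ell x \<xi> - eps * u x) + h * (ell x \<xi> - eps * u x) + E * (real (Suc k) * h)\<^sup>2"
    using square_step[OF E, of k] by linarith
  moreover have "(real k * h) * (ell x \<xi> - eps * u x) + h * (ell x \<xi> - eps * u x) = (real (Suc k) * h) * (ell x \<xi> - eps * u x)"
    by (simp add: algebra_simps)
  ultimately show ?case by (simp only: z_def E_def)
qed

text \<open>Along an optimal orbit the one-step identity is exact. Replacing \<open>ell\<close> by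
  its Fenchel bound for a fixed p makes it affine in the velocity, so that the velocities add up to
  the displacement and disappear from the statement.\<close>

lemma calibration_iterate:
  assumes u: "adm u"
    and opt: "\<And>y. norm (opt y) \<le> R" "\<And>y. u y = cost u y (opt y)"
    and X: "\<And>j. X (Suc j) = X j - h *\<^sub>R opt (X j)"
  shows "norm (X (m + k) - X m) \<le> R * (real k * h)"
    and "C \<ge> 0 \<Longrightarrow> \<forall>x y. \<bar>H y p - H x p\<bar> \<le> C * norm (y - x) \<Longrightarrow>
     u (X m) - u (X (m + k)) \<ge> (p - c) \<bullet> (X m - X (m + k)) + (real k * h) * (a - H (X m) p - eps * u (X m))
       - (C + eps * K) * R * (real k * h)\<^sup>2"
proof -
  have lip: "norm (X (m + k) - X m) \<le> R * (real k * h)" for k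
  proof (induction k)
    case (Suc k)
    have "norm (X (m + Suc k) - X m) = norm ((X (m + k) - X m) - h *\<^sub>R opt (X (m + k)))"
      by (simp add: X algebra_simps)
    also have "\<dots> \<le> norm (X (m + k) - X m) + h * norm (opt (X (m + k)))"
      using norm_triangle_ineq4[of "X (m + k) - X m" "h *\<^sub>R opt (X (m + k))"] h by simp
    also have "\<dots> \<le> R * (real k * h) + h * R"
      using Suc opt(1) h by (intro add_mono mult_left_mono) auto
    finally show ?case by (simp add: algebra_simps)
  qed simp
  then show "norm (X (m + k) - X m) \<le> R * (real k * h)" .
  assume C: "C \<ge> 0" and HC: "\<forall>x y. \<bar>H y p - H x p\<bar> \<le> C * norm (y - x)"
  show "u (X m) - u (X (m + k)) \<ge> (p - c) \<bullet> (X m - X (m + k)) + (real k * h) * (a - H (X m) p - eps * u (X m))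
       - (C + eps * K) * R * (real k * h)\<^sup>2"
  proof (induction k)
    case 0
    then show ?case by simp
  next
    case (Suc k)
    define E where "E = (C + eps * K) * R"
    have E: "E \<ge> 0" using eps K R C by (simp add: E_def)
    define y where "y = X (m + k)"
    define z where "z = X (m + Suc k)"
    define \<xi> where "\<xi> = opt y"
    have z: "z = y - h *\<^sub>R \<xi>" by (simp add: y_def z_def \<xi>_def X)
    have 1: "u y - u z = h * (ell y \<xi> - eps * u z)"
      using opt(2)[of y] by (simp add: cost_def z \<xi>_def algebra_simps)
    have "\<bar>H y p - H (X m) p\<bar> \<le> C * norm (y - X m)" using HC by blast
    also have "\<dots> \<le> C * (R * (real k * h))" using lip[of k] C by (intro mult_left_mono) (auto simp: y_def)
    also have "\<dots> \<le> C * (R * ((real k + 1) * h))" using C R h by (intro mult_left_mono mult_right_mono) auto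
    finally have 2: "H y p \<le> H (X m) p + C * (R * ((real k + 1) * h))" by linarith
    have "\<bar>u z - u (X m)\<bar> \<le> K * norm (z - X m)" using u(1) by (simp add: adm_def)
    also have "\<dots> \<le> K * (R * ((real k + 1) * h))"
      using lip[of "Suc k"] K by (intro mult_left_mono) (auto simp: z_def algebra_simps)
    finally have "u z - u (X m) \<le> K * (R * ((real k + 1) * h))" by linarith
    then have 3: "eps * (u z - u (X m)) \<le> eps * (K * (R * ((real k + 1) * h)))"
      using eps by (intro mult_left_mono) auto
    have "ell y \<xi> \<ge> (p - c) \<bullet> \<xi> + (a - H y p)" by (rule ell_ge)
    then have "ell y \<xi> - eps * u z \<ge> (p - c) \<bullet> \<xi> + (a - H (X m) p - eps * u (X m)) - E * (real k + 1) * h"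
      using 2 3 by (simp add: E_def algebra_simps)
    then have "h * (ell y \<xi> - eps * u z) \<ge> h * ((p - c) \<bullet> \<xi> + (a - H (X m) p - eps * u (X m)) - E * (real k + 1) * h)"
      using h by (intro mult_left_mono) auto
    moreover have "h * ((p - c) \<bullet> \<xi>) = (p - c) \<bullet> (y - z)" by (simp add: z)
    ultimately have "u y - u z \<ge> (p - c) \<bullet> (y - z) + h * (a - H (X m) p - eps * u (X m)) - E * (real k + 1) * (h * h)"
      unfolding 1 by (simp add: algebra_simps)
    moreover have "u (X m) - u y \<ge> (p - c) \<bullet> (X m - y) + (real k * h) * (a - H (X m) p - eps * u (X m)) - real k * real k * (h * h) * E"
      using Suc by (simp add: y_def E_def power2_eq_square algebra_simps)
    moreover have "(p - c) \<bullet> (X m - z) = (p - c) \<bullet> (y - z) + (p - c) \<bullet> (X m - y)"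
      by (simp add: inner_diff_right)
    moreover have "(real k * h) * (a - H (X m) p - eps * u (X m)) + h * (a - H (X m) p - eps * u (X m))
        = (real (Suc k) * h) * (a - H (X m) p - eps * u (X m))"
      by (simp add: algebra_simps)
    ultimately have "u (X m) - u z \<ge> (p - c) \<bullet> (X m - z) + (real (Suc k) * h) * (a - H (X m) p - eps * u (X m)) - E * (real (Suc k) * h)\<^sup>2"
      using square_step[OF E, of k] by linarith
    then show ?case by (simp only: z_def E_def)
  qed
qed

text \<open>Stated without the operator and the invariant class, so that solutions for different
  steps h can be compared outside the locale.\<close>

lemma scheme_result:
  "\<exists>u. (\<forall>x y. \<bar>u x - u y\<bar> \<le> K * norm (x - y)) \<and> periodic_fun u \<and> (\<forall>x. u x \<ge> - B0) \<and>
    (\<forall>x. \<exists>q. norm q \<le> K \<and> (\<forall>e w. e \<ge> 0 \<longrightarrow> expn R e w \<longrightarrow> u (x + w) \<le> u x + q \<bullet> w + e / eps * norm w)) \<and>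
    (\<forall>x \<xi> k. norm \<xi> \<le> R \<longrightarrow> u x - u (x - (real k * h) *\<^sub>R \<xi>) \<le>
       (real k * h) * (ell x \<xi> - eps * u x) + 2 * eps * K * R * (real k * h)\<^sup>2) \<and>
    (\<forall>x. \<exists>X. X 0 = x \<and> (\<forall>m k. norm (X (m + k) - X m) \<le> R * (real k * h)) \<and>
       (\<forall>p C m k. C \<ge> 0 \<longrightarrow> (\<forall>x y. \<bar>H y p - H x p\<bar> \<le> C * norm (y - x)) \<longrightarrow>
          u (X m) - u (X (m + k)) \<ge> (p - c) \<bullet> (X m - X (m + k)) + (real k * h) * (a - H (X m) p - eps * u (X m))
            - (C + eps * K) * R * (real k * h)\<^sup>2))"
proof -
  obtain u where u: "adm u" "T u = u" using discrete_solution by blast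
  have "\<forall>y. \<exists>\<xi>. norm \<xi> \<le> R \<and> u y = cost u y \<xi>" using T_attained[OF u(1)] u(2) by metis
  then obtain opt where opt: "\<And>y. norm (opt y) \<le> R" "\<And>y. u y = cost u y (opt y)" by metis
  have "\<exists>X. X 0 = x \<and> (\<forall>m k. norm (X (m + k) - X m) \<le> R * (real k * h)) \<and>
       (\<forall>p C m k. C \<ge> 0 \<longrightarrow> (\<forall>x y. \<bar>H y p - H x p\<bar> \<le> C * norm (y - x)) \<longrightarrow>
          u (X m) - u (X (m + k)) \<ge> (p - c) \<bullet> (X m - X (m + k)) + (real k * h) * (a - H (X m) p - eps * u (X m))
            - (C + eps * K) * R * (real k * h)\<^sup>2)" for x
  proof -
    define X where "X = (\<lambda>j. ((\<lambda>y. y - h *\<^sub>R opt y) ^^ j) x)"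
    have X: "X (Suc j) = X j - h *\<^sub>R opt (X j)" for j by (simp add: X_def)
    show ?thesis
      using calibration_iterate[of u opt X, OF u(1) opt(1) opt(2) X] by (intro exI[of _ X]) (simp add: X_def)
  qed
  then show ?thesis
    using u(1) domination_iterate[OF u] unfolding adm_def by (intro exI[of _ u]) simp
qed

end

section \<open>Vanishing time step\<close>

context discounted
begin

theorem weak_sol_ex:
  assumes R: "R > 0"
  shows "\<exists>v. weak_sol R v"
proof -
  obtain C where C: "C > 0" "\<And>x y \<xi>. norm \<xi> \<le> R \<Longrightarrow> \<bar>ell y \<xi> - ell x \<xi>\<bar> \<le> C * norm (y - x)"
     "\<And>x \<xi>. norm \<xi> \<le> R \<Longrightarrow> norm (Hx H x (mom x \<xi>)) \<le> C"
    using ell_const[of R] by blast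
  \<comment> \<open>The bound C of the data divided by the discount rate: the bound that the scheme
    reproduces.\<close>
  define K where "K = C / eps"
  have K: "K > 0" "eps * K = C" using C(1) eps by (auto simp: K_def)
  \<comment> \<open>The factor 1 + eps secures both \<open>eps * h n < 1\<close> and
    \<open>h n \<le> 1\<close>.\<close>
  define h where "h = (\<lambda>n. inverse ((1 + eps) * real (Suc n)))"
  have h0: "h n > 0" for n using eps by (simp add: h_def)
  have h1: "(1 + eps) * h n \<le> 1" for n
    using eps by (simp add: h_def divide_simps)
  then have h2: "eps * h n < 1" for n using h0[of n] by (simp add: algebra_simps) (smt (verit) h1 h0 distrib_right mult_1)
  have hle: "h n \<le> 1" for n using h1[of n] h0[of n] eps by (simp add: algebra_simps) (smt (verit) mult_pos_pos)
  have hlim: "h \<longlonglongrightarrow> 0"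
  proof -
    have "(\<lambda>n. inverse (1 + eps) * inverse (real (Suc n))) \<longlonglongrightarrow> inverse (1 + eps) * 0"
      by (intro tendsto_mult tendsto_const LIMSEQ_inverse_real_of_nat)
    then show ?thesis by (simp add: h_def[abs_def] nonzero_inverse_mult_distrib mult.commute)
  qed
  have sch: "scheme H c a eps R K (h n)" for n
    by unfold_locales (use R K h0 h2 C in auto)
  obtain u where u: "\<And>n x y. \<bar>u n x - u n y\<bar> \<le> K * norm (x - y)" "\<And>n. periodic_fun (u n)" "\<And>n x. u n x \<ge> - B0"
    "\<And>n x. \<exists>q. norm q \<le> K \<and> (\<forall>e w. e \<ge> 0 \<longrightarrow> expn R e w \<longrightarrow> u n (x + w) \<le> u n x + q \<bullet> w + e / eps * norm w)"
    "\<And>n x \<xi> k. norm \<xi> \<le> R \<Longrightarrow> u n x - u n (x - (real k * h n) *\<^sub>R \<xi>) \<le>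
       (real k * h n) * (ell x \<xi> - eps * u n x) + 2 * eps * K * R * (real k * h n)\<^sup>2"
    "\<And>n x. \<exists>X. X 0 = x \<and> (\<forall>m k. norm (X (m + k) - X m) \<le> R * (real k * h n)) \<and>
       (\<forall>p C m k. C \<ge> 0 \<longrightarrow> (\<forall>x y. \<bar>H y p - H x p\<bar> \<le> C * norm (y - x)) \<longrightarrow>
          u n (X m) - u n (X (m + k)) \<ge> (p - c) \<bullet> (X m - X (m + k)) + (real k * h n) * (a - H (X m) p - eps * u n (X m))
            - (C + eps * K) * R * (real k * h n)\<^sup>2)"
    using scheme.scheme_result[OF sch] by metis
  define E where "E = 2 * eps * K * R"
  have E: "E \<ge> 0" using eps K R by (simp add: E_def)
  \<comment> \<open>The upper bound at 0 comes from domination over one step with velocity 0, the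
    lower bound is -B0.\<close>
  have ub: "\<bar>u n 0\<bar> \<le> B0 + (\<bar>ell 0 0\<bar> + E) / eps" for n
  proof -
    have "0 \<le> h n * (ell 0 0 - eps * u n 0) + E * (h n)\<^sup>2"
      using u(5)[of 0 n 0 1] R by (simp add: E_def)
    then have "0 \<le> h n * (ell 0 0 - eps * u n 0 + E * h n)" by (simp add: power2_eq_square algebra_simps)
    then have "0 \<le> ell 0 0 - eps * u n 0 + E * h n" using h0[of n] by (simp add: zero_le_mult_iff)
    moreover have "E * h n \<le> E" using E hle[of n] by (intro mult_left_le) auto
    ultimately have "eps * u n 0 \<le> \<bar>ell 0 0\<bar> + E" by linarith
    then have "u n 0 \<le> (\<bar>ell 0 0\<bar> + E) / eps" using eps by (simp add: pos_le_divide_eq mult.commute)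
    moreover have "(\<bar>ell 0 0\<bar> + E) / eps \<ge> 0" using E eps by simp
    ultimately show ?thesis using u(3)[of n 0] B0(1) by linarith
  qed
  obtain r v where r: "strict_mono (r :: nat \<Rightarrow> nat)" and v: "\<And>x. (\<lambda>n. u (r n) x) \<longlonglongrightarrow> v x"
    "\<And>x y. norm (v x - v y) \<le> K * norm (x - y)"
  proof -
    have "\<exists>r g. strict_mono (r :: nat \<Rightarrow> nat) \<and> (\<forall>x. (\<lambda>n. u (r n) x) \<longlonglongrightarrow> g x) \<and>
        (\<forall>x y. norm (g x - g y) \<le> K * norm (x - y))"
      by (rule Lipschitz_compactness[of u K "\<lambda>_. 0" "B0 + (\<bar>ell 0 0\<bar> + E) / eps"]) (use u(1) ub K in auto)
    then show ?thesis using that by blast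
  qed
  have hr: "(\<lambda>n. h (r n)) \<longlonglongrightarrow> 0"
    using LIMSEQ_subseq_LIMSEQ[OF hlim r] by (simp add: o_def)
  have floor: "(\<lambda>n. real (nat \<lfloor>t / h (r n)\<rfloor>) * h (r n)) \<longlonglongrightarrow> t" if t: "t \<ge> 0" for t
  proof (rule tendsto_sandwich)
    have *: "real (nat \<lfloor>t / h n\<rfloor>) = of_int \<lfloor>t / h n\<rfloor>" for n
      using t h0[of n] by simp
    show "eventually (\<lambda>n. t - h (r n) \<le> real (nat \<lfloor>t / h (r n)\<rfloor>) * h (r n)) sequentially"
    proof (rule always_eventually, rule allI)
      fix n
      have "t / h (r n) - 1 \<le> of_int \<lfloor>t / h (r n)\<rfloor>" by linarith
      then have "(t / h (r n) - 1) * h (r n) \<le> of_int \<lfloor>t / h (r n)\<rfloor> * h (r n)"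
        using h0 by (intro mult_right_mono) (auto intro: less_imp_le)
      then show "t - h (r n) \<le> real (nat \<lfloor>t / h (r n)\<rfloor>) * h (r n)"
        unfolding * using h0[of "r n"] by (simp add: algebra_simps)
    qed
    show "eventually (\<lambda>n. real (nat \<lfloor>t / h (r n)\<rfloor>) * h (r n) \<le> t) sequentially"
    proof (rule always_eventually, rule allI)
      fix n
      have "of_int \<lfloor>t / h (r n)\<rfloor> * h (r n) \<le> (t / h (r n)) * h (r n)"
        using h0 by (intro mult_right_mono) (auto intro: less_imp_le)
      then show "real (nat \<lfloor>t / h (r n)\<rfloor>) * h (r n) \<le> t"
        unfolding * using h0[of "r n"] by simp
    qed
    show "(\<lambda>n. t - h (r n)) \<longlonglongrightarrow> t" using tendsto_diff[OF tendsto_const hr, of t] by simp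
  qed simp
  have ulip: "norm (u (r n) x - u (r n) y) \<le> K * norm (x - y)" for n x y using u(1) by simp
  have "weak_sol R v"
    unfolding weak_sol_def
  proof (intro conjI)
    show "periodic_fun v"
      unfolding periodic_fun_def
    proof (intro allI impI)
      fix x k :: "real^'n" assume "int_vec k"
      then have "(\<lambda>n. u (r n) (x + k)) = (\<lambda>n. u (r n) x)" using u(2) by (simp add: periodic_fun_def)
      then show "v (x + k) = v x" using v(1)[of x] v(1)[of "x + k"] LIMSEQ_unique by metis
    qed
    show "\<forall>x. - B0 \<le> v x"
      using u(3) v(1) by (meson LIMSEQ_le_const)
    show "\<exists>K>0. \<forall>x y. \<bar>v x - v y\<bar> \<le> K * norm (x - y)"
      using K(1) v(2) by auto
    show "\<exists>C\<ge>0. \<forall>x \<xi> t. norm \<xi> \<le> R \<longrightarrow> 0 \<le> t \<longrightarrow> v x - v (x - t *\<^sub>R \<xi>) \<le> t * (ell x \<xi> - eps * v x) + C * t\<^sup>2"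
    proof (intro exI[of _ E] conjI allI impI E)
      fix x \<xi> :: "real^'n" and t :: real assume \<xi>: "norm \<xi> \<le> R" and t: "0 \<le> t"
      let ?k = "\<lambda>n. real (nat \<lfloor>t / h (r n)\<rfloor>) * h (r n)"
      have "(\<lambda>n. x - ?k n *\<^sub>R \<xi>) \<longlonglongrightarrow> x - t *\<^sub>R \<xi>" by (intro tendsto_intros floor t)
      then have "(\<lambda>n. u (r n) (x - ?k n *\<^sub>R \<xi>)) \<longlonglongrightarrow> v (x - t *\<^sub>R \<xi>)"
        by (rule tendsto_Lipschitz_args[OF ulip v(1)])
      then have 1: "(\<lambda>n. u (r n) x - u (r n) (x - ?k n *\<^sub>R \<xi>)) \<longlonglongrightarrow> v x - v (x - t *\<^sub>R \<xi>)"
        by (intro tendsto_intros v(1))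
      have 2: "(\<lambda>n. ?k n * (ell x \<xi> - eps * u (r n) x) + E * (?k n)\<^sup>2) \<longlonglongrightarrow> t * (ell x \<xi> - eps * v x) + E * t\<^sup>2"
        by (intro tendsto_intros v(1) floor t)
      show "v x - v (x - t *\<^sub>R \<xi>) \<le> t * (ell x \<xi> - eps * v x) + E * t\<^sup>2"
        by (rule LIMSEQ_le[OF 1 2]) (use u(5)[OF \<xi>] in \<open>auto simp: E_def\<close>)
    qed
    have "\<exists>Cp. \<forall>p. Cp p \<ge> 0 \<and> (\<forall>x y. \<bar>H y p - H x p\<bar> \<le> Cp p * norm (y - x))"
    proof -
      have "\<forall>p. \<exists>Cp. Cp \<ge> 0 \<and> (\<forall>x y. \<bar>H y p - H x p\<bar> \<le> Cp * norm (y - x))"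
        using H_Lipschitz_x by (meson less_imp_le order_refl)
      then show ?thesis by metis
    qed
    then obtain Cp where Cp: "\<And>p. Cp p \<ge> 0" "\<And>p. \<forall>x y. \<bar>H y p - H x p\<bar> \<le> Cp p * norm (y - x)" by metis
    define D where "D = (\<lambda>p. (Cp p + eps * K) * R)"
    have "\<exists>\<gamma>. \<gamma> 0 = x \<and> calib R D v {..0} \<gamma>" for x
    proof -
      have "\<forall>n. \<exists>X. X 0 = x \<and> (\<forall>m k. norm (X (m + k) - X m) \<le> R * (real k * h (r n))) \<and>
       (\<forall>p C m k. C \<ge> 0 \<longrightarrow> (\<forall>x y. \<bar>H y p - H x p\<bar> \<le> C * norm (y - x)) \<longrightarrow>
          u (r n) (X m) - u (r n) (X (m + k)) \<ge> (p - c) \<bullet> (X m - X (m + k)) + (real k * h (r n)) * (a - H (X m) p - eps * u (r n) (X m))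
            - (C + eps * K) * R * (real k * h (r n))\<^sup>2)"
        using u(6) by blast
      then obtain X where X: "\<And>n. X n 0 = x" "\<And>n m k. norm (X n (m + k) - X n m) \<le> R * (real k * h (r n))"
        "\<And>n p C m k. C \<ge> 0 \<Longrightarrow> (\<forall>x y. \<bar>H y p - H x p\<bar> \<le> C * norm (y - x)) \<Longrightarrow>
          u (r n) (X n m) - u (r n) (X n (m + k)) \<ge> (p - c) \<bullet> (X n m - X n (m + k)) + (real k * h (r n)) * (a - H (X n m) p - eps * u (r n) (X n m))
            - (C + eps * K) * R * (real k * h (r n))\<^sup>2"
        by metis
      \<comment> \<open>Discrete orbits run backwards, so time s corresponds to the index -s/h. For
        s > 0 the index is 0 by truncation, which makes the step curve constant there and defined on
        the whole line.\<close>
      define J where "J = (\<lambda>n s. nat \<lfloor>(- s) / h (r n)\<rfloor>)"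
      define Y where "Y = (\<lambda>n s. X n (J n s))"
      have Jmono: "J n t \<le> J n s" if "s \<le> t" for n s t
        unfolding J_def using that h0[of "r n"] by (intro nat_mono floor_mono divide_right_mono) auto
      have Jd: "real (J n s - J n t) * h (r n) \<le> (t - s) + h (r n)" if "s \<le> t" for n s t
      proof -
        have "real (J n s) - real (J n t) \<le> (t - s) / h (r n) + 1"
        proof (cases "s \<le> 0")
          case True
          have "real (J n s) \<le> (- s) / h (r n)"
            unfolding J_def using True h0[of "r n"] by (simp add: divide_nonpos_pos)
          moreover have "real (J n t) \<ge> (- t) / h (r n) - 1"
            unfolding J_def by linarith
          ultimately show ?thesis by (simp add: diff_divide_distrib)
        next
          case False
          then have "(- s) / h (r n) \<le> 0" using h0[of "r n"] by (simp add: divide_nonpos_pos)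
          then have "J n s = 0" unfolding J_def using floor_mono[of "(- s) / h (r n)" 0] by simp
          moreover have "(t - s) / h (r n) \<ge> 0" using that h0[of "r n"] by (simp add: less_imp_le)
          ultimately show ?thesis by simp
        qed
        then have "(real (J n s) - real (J n t)) * h (r n) \<le> ((t - s) / h (r n) + 1) * h (r n)"
          using h0[of "r n"] by (intro mult_right_mono) auto
        also have "((t - s) / h (r n) + 1) * h (r n) = (t - s) + h (r n)"
          using h0[of "r n"] by (simp add: distrib_right)
        finally show ?thesis using Jmono[OF that, of n] by (simp add: of_nat_diff)
      qed
      \<comment> \<open>The jumps of the step curve cause the additive defect R h, which tends to 0
        as \<open>Lipschitz_compactness\<close> demands.\<close>
      have Yl: "norm (Y n s - Y n t) \<le> R * norm (s - t) + R * h (r n)" for n s t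
      proof -
        have *: "norm (Y n s - Y n t) \<le> R * (t - s) + R * h (r n)" if "s \<le> t" for s t
        proof -
          have "norm (X n (J n t + (J n s - J n t)) - X n (J n t)) \<le> R * (real (J n s - J n t) * h (r n))"
            by (rule X(2))
          also have "\<dots> \<le> R * ((t - s) + h (r n))"
            using R Jd[OF that] by (intro mult_left_mono) auto
          finally show ?thesis using Jmono[OF that, of n] by (simp add: Y_def algebra_simps)
        qed
        show ?thesis using *[of s t] *[of t s] by (cases "s \<le> t") (auto simp: norm_minus_commute)
      qed
      have "(\<lambda>n. R * h (r n)) \<longlonglongrightarrow> 0" using tendsto_mult_right_zero[OF hr] by simp
      moreover have "norm (Y n 0) \<le> norm x" for n by (simp add: Y_def J_def X)
      ultimately have "\<exists>r' \<gamma>. strict_mono (r' :: nat \<Rightarrow> nat) \<and> (\<forall>s. (\<lambda>n. Y (r' n) s) \<longlonglongrightarrow> \<gamma> s) \<and>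
        (\<forall>s t. norm (\<gamma> s - \<gamma> t) \<le> R * norm (s - t))"
        by (intro Lipschitz_compactness[of Y R "\<lambda>n. R * h (r n)" "norm x"] Yl) (use R in auto)
      then obtain r' \<gamma> where r': "strict_mono (r' :: nat \<Rightarrow> nat)" and \<gamma>: "\<And>s. (\<lambda>n. Y (r' n) s) \<longlonglongrightarrow> \<gamma> s"
        "\<And>s t. norm (\<gamma> s - \<gamma> t) \<le> R * norm (s - t)"
        by blast
      have "\<gamma> 0 = x"
        using \<gamma>(1)[of 0] by (simp add: Y_def J_def X LIMSEQ_const_iff)
      moreover have "calib R D v {..0} \<gamma>"
        unfolding calib_def
      proof (intro conjI ballI impI allI)
        show "norm (\<gamma> t - \<gamma> s) \<le> R * \<bar>t - s\<bar>" for s t using \<gamma>(2)[of t s] by simp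
        fix s t :: real and p assume s: "s \<in> {..0}" and t: "t \<in> {..0}" and st: "s \<le> t"
        have kr: "(\<lambda>n. real (J n s) * h (r n)) \<longlonglongrightarrow> - s" if "s \<le> 0" for s
          unfolding J_def using floor[of "- s"] that by simp
        have "(\<lambda>n. real (J n s) * h (r n) - real (J n t) * h (r n)) \<longlonglongrightarrow> - s - - t"
          using s t by (intro tendsto_diff kr) auto
        then have "(\<lambda>n. real (J n s - J n t) * h (r n)) \<longlonglongrightarrow> t - s"
          using Jmono[OF st] by (simp add: of_nat_diff algebra_simps)
        from LIMSEQ_subseq_LIMSEQ[OF this r']
        have k: "(\<lambda>n. real (J (r' n) s - J (r' n) t) * h (r (r' n))) \<longlonglongrightarrow> t - s" by (simp add: o_def)
        have uu: "(\<lambda>n. u (r (r' n)) x) \<longlonglongrightarrow> v x" for x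
          using LIMSEQ_subseq_LIMSEQ[OF v(1) r', of x] by (simp add: o_def)
        have uY: "(\<lambda>n. u (r (r' n)) (Y (r' n) s)) \<longlonglongrightarrow> v (\<gamma> s)" for s
          by (rule tendsto_Lipschitz_args[OF ulip uu \<gamma>(1)])
        have HY: "(\<lambda>n. H (Y (r' n) t) p) \<longlonglongrightarrow> H (\<gamma> t) p"
          by (rule tendsto_Lipschitz_args[of "\<lambda>_ y. H y p" "Cp p"]) (use Cp(2) \<gamma>(1) in auto)
        have 1: "(\<lambda>n. u (r (r' n)) (Y (r' n) t) - u (r (r' n)) (Y (r' n) s)) \<longlonglongrightarrow> v (\<gamma> t) - v (\<gamma> s)"
          by (intro tendsto_diff uY)
        have 2: "(\<lambda>n. (p - c) \<bullet> (Y (r' n) t - Y (r' n) s) + (real (J (r' n) s - J (r' n) t) * h (r (r' n))) *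
            (a - H (Y (r' n) t) p - eps * u (r (r' n)) (Y (r' n) t)) - D p * (real (J (r' n) s - J (r' n) t) * h (r (r' n)))\<^sup>2)
          \<longlonglongrightarrow> (p - c) \<bullet> (\<gamma> t - \<gamma> s) + (t - s) * (a - H (\<gamma> t) p - eps * v (\<gamma> t)) - D p * (t - s)\<^sup>2"
          by (intro tendsto_intros \<gamma>(1) k HY uY)
        show "(p - c) \<bullet> (\<gamma> t - \<gamma> s) + (t - s) * (a - H (\<gamma> t) p - eps * v (\<gamma> t)) - D p * (t - s)\<^sup>2 \<le> v (\<gamma> t) - v (\<gamma> s)"
        proof (rule LIMSEQ_le[OF 2 1], intro exI allI impI)
          fix n
          have "J (r' n) t + (J (r' n) s - J (r' n) t) = J (r' n) s" using Jmono[OF st] by simp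
          then show "(p - c) \<bullet> (Y (r' n) t - Y (r' n) s) + (real (J (r' n) s - J (r' n) t) * h (r (r' n))) *
            (a - H (Y (r' n) t) p - eps * u (r (r' n)) (Y (r' n) t)) - D p * (real (J (r' n) s - J (r' n) t) * h (r (r' n)))\<^sup>2
            \<le> u (r (r' n)) (Y (r' n) t) - u (r (r' n)) (Y (r' n) s)"
            using X(3)[OF Cp(1)[of p] Cp(2), of "r' n" "J (r' n) t" "J (r' n) s - J (r' n) t"]
            unfolding Y_def D_def by simp
        qed
      qed
      ultimately show ?thesis by blast
    qed
    then show "\<exists>D. \<forall>x. \<exists>\<gamma>. \<gamma> 0 = x \<and> calib R D v {..0} \<gamma>" by blast
    \<comment> \<open>An expansion error eps * e becomes the error e of the solution, hence the
      factor eps.\<close>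
    have "\<forall>e. \<exists>d. e > 0 \<longrightarrow> d > 0 \<and> (\<forall>w. norm w < d \<longrightarrow> expn R (eps * e) w)"
      using expn_ex eps by (meson mult_pos_pos)
    then obtain d where d: "\<And>e. e > 0 \<Longrightarrow> d e > (0::real)" "\<And>e w. e > 0 \<Longrightarrow> norm w < d e \<Longrightarrow> expn R (eps * e) w" by metis
    have "\<exists>q. norm q \<le> K \<and> (\<forall>e w. e > 0 \<longrightarrow> norm w < d e \<longrightarrow> v (x + w) \<le> v x + q \<bullet> w + e * norm w)" for x
    proof -
      have "\<forall>n. \<exists>q. norm q \<le> K \<and> (\<forall>e w. e \<ge> 0 \<longrightarrow> expn R e w \<longrightarrow> u (r n) (x + w) \<le> u (r n) x + q \<bullet> w + e / eps * norm w)"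
        using u(4) by blast
      then obtain q where q: "\<And>n. norm (q n) \<le> K" "\<And>n e w. e \<ge> 0 \<Longrightarrow> expn R e w \<Longrightarrow> u (r n) (x + w) \<le> u (r n) x + q n \<bullet> w + e / eps * norm w"
        by metis
      obtain l r' where r': "strict_mono (r' :: nat \<Rightarrow> nat)" "(\<lambda>n. q (r' n)) \<longlonglongrightarrow> l" "norm l \<le> K"
        using bounded_subseq[of q K, OF q(1)] by blast
      have uu: "(\<lambda>n. u (r (r' n)) x) \<longlonglongrightarrow> v x" for x
        using LIMSEQ_subseq_LIMSEQ[OF v(1) r'(1), of x] by (simp add: o_def)
      have "v (x + w) \<le> v x + l \<bullet> w + e * norm w" if e: "e > 0" "norm w < d e" for e w
      proof (rule LIMSEQ_le[OF uu])
        show "(\<lambda>n. u (r (r' n)) x + q (r' n) \<bullet> w + e * norm w) \<longlonglongrightarrow> v x + l \<bullet> w + e * norm w"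
          by (intro tendsto_intros uu r'(2))
        show "\<exists>N. \<forall>n\<ge>N. u (r (r' n)) (x + w) \<le> u (r (r' n)) x + q (r' n) \<bullet> w + e * norm w"
          using q(2)[of "eps * e" w] d(2)[OF e] e(1) eps by simp
      qed
      then show ?thesis using r'(3) by blast
    qed
    then show "\<exists>K d. (\<forall>e>0. d e > 0) \<and> (\<forall>x. \<exists>q. norm q \<le> K \<and>
       (\<forall>e w. e > 0 \<longrightarrow> norm w < d e \<longrightarrow> v (x + w) \<le> v x + q \<bullet> w + e * norm w))"
      using d(1) by (intro exI[of _ K] exI[of _ d]) blast
  qed
  then show ?thesis by blast
qed

end

section \<open>Viscosity solutions\<close>

text \<open>The way in which estimates with a frozen point are used: their quadratic remainder
  disappears in a one-sided derivative.\<close>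

lemma right_derivative_le:
  fixes g :: "real \<Rightarrow> real"
  assumes d: "(g has_real_derivative d) (at 0 within {0..})" and "\<delta> > 0"
    and le: "\<And>t. 0 < t \<Longrightarrow> t < \<delta> \<Longrightarrow> g t - g 0 \<le> A * t + C * t\<^sup>2"
  shows "d \<le> A"
proof -
  have "((\<lambda>t. (g t - g 0) / (t - 0)) \<longlongrightarrow> d) (at 0 within {0..})"
    using d by (simp add: has_field_derivative_iff)
  then have 1: "((\<lambda>t. (g t - g 0) / t) \<longlongrightarrow> d) (at_right 0)"
    by (auto elim!: tendsto_within_subset)
  have "((\<lambda>t. A + C * t) \<longlongrightarrow> A + C * 0) (at_right 0)" by (intro tendsto_intros)
  then have 2: "((\<lambda>t. A + C * t) \<longlongrightarrow> A) (at_right 0)" by simp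
  have "eventually (\<lambda>t. t \<in> {0<..<\<delta>}) (at_right (0::real))"
    using \<open>\<delta> > 0\<close> by (intro eventually_at_right_real)
  then have "eventually (\<lambda>t. (g t - g 0) / t \<le> A + C * t) (at_right 0)"
  proof eventually_elim
    case (elim t)
    then have "g t - g 0 \<le> (A + C * t) * t" using le[of t] by (simp add: algebra_simps power2_eq_square)
    then show ?case using elim by (simp add: pos_divide_le_eq)
  qed
  then show ?thesis by (rule tendsto_le[OF trivial_limit_at_right_real 2 1])
qed

lemma le_zero_if_le_eps:
  fixes A R :: real
  assumes "\<And>e. e > 0 \<Longrightarrow> A \<le> e * R"
  shows "A \<le> 0"
proof (rule ccontr)
  assume "\<not> A \<le> 0"
  then have "A / (2 * (\<bar>R\<bar> + 1)) > 0" by simp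
  from assms[OF this] have "A \<le> A * (R / (2 * (\<bar>R\<bar> + 1)))" by simp
  also have "\<dots> \<le> A * (1 / 2)"
    using \<open>\<not> A \<le> 0\<close> by (intro mult_left_mono) (auto simp: divide_simps)
  finally show False using \<open>\<not> A \<le> 0\<close> by simp
qed

lemma C1_fun_grad:
  fixes \<phi> :: "real^'n \<Rightarrow> real"
  assumes "C1_fun \<phi>"
  shows "(\<phi> has_derivative (\<lambda>h. grad \<phi> x \<bullet> h)) (at x)"
  using assms unfolding C1_fun_def by (intro grad_works) (auto simp: differentiable_def)

lemma C1_fun_square:
  fixes y :: "real^'n"
  shows "C1_fun (\<lambda>x. k / 2 * ((x - y) \<bullet> (x - y)))"
    and "grad (\<lambda>x. k / 2 * ((x - y) \<bullet> (x - y))) x = k *\<^sub>R (x - y)"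
proof -
  have D: "((\<lambda>x. k / 2 * ((x - y) \<bullet> (x - y))) has_derivative (\<lambda>h. (k *\<^sub>R (z - y)) \<bullet> h)) (at z)" for z
    by (auto intro!: derivative_eq_intros simp: inner_commute algebra_simps)
  then show "grad (\<lambda>x. k / 2 * ((x - y) \<bullet> (x - y))) x = k *\<^sub>R (x - y)" by (rule grad_eqI)
  show "C1_fun (\<lambda>x. k / 2 * ((x - y) \<bullet> (x - y)))"
    unfolding C1_fun_def
  proof (intro exI[of _ "\<lambda>z. blinfun_inner_right (k *\<^sub>R (z - y))"] conjI allI)
    show "((\<lambda>x. k / 2 * ((x - y) \<bullet> (x - y))) has_derivative blinfun_apply (blinfun_inner_right (k *\<^sub>R (z - y)))) (at z)" for z
      unfolding blinfun_inner_right.rep_eq by (rule D)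
    show "continuous_on UNIV (\<lambda>z. blinfun_inner_right (k *\<^sub>R (z - y)))"
      by (intro bounded_linear.continuous_on[OF bounded_linear_blinfun_inner_right] continuous_intros)
  qed
qed

text \<open>The Frechet superdifferential; here the radius may depend on x and q, unlike in
  \<open>sg\<close> below.\<close>

definition supdiff :: "(real^'n \<Rightarrow> real) \<Rightarrow> real^'n \<Rightarrow> real^'n \<Rightarrow> bool" where
  "supdiff v q x \<longleftrightarrow> (\<forall>e>0. \<exists>d>0. \<forall>w. norm w < d \<longrightarrow> v (x + w) \<le> v x + q \<bullet> w + e * norm w)"

lemma supdiff_test_function:
  fixes v \<phi> :: "real^'n \<Rightarrow> real"
  assumes \<phi>: "(\<phi> has_derivative (\<lambda>h. q \<bullet> h)) (at x)" and e: "e > 0"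
    and max: "\<And>y. dist y x < e \<Longrightarrow> v y - \<phi> y \<le> v x - \<phi> x"
  shows "supdiff v q x"
  unfolding supdiff_def
proof (intro allI impI)
  fix e' :: real assume "e' > 0"
  then obtain d where d: "d > 0" "\<And>y. norm (y - x) < d \<Longrightarrow> norm (\<phi> y - \<phi> x - q \<bullet> (y - x)) \<le> e' * norm (y - x)"
    using \<phi> unfolding has_derivative_at_alt by blast
  have "v (x + w) \<le> v x + q \<bullet> w + e' * norm w" if "norm w < min d e" for w
    using d(2)[of "x + w"] max[of "x + w"] that by (simp add: dist_norm abs_le_iff)
  then show "\<exists>d>0. \<forall>w. norm w < d \<longrightarrow> v (x + w) \<le> v x + q \<bullet> w + e' * norm w"
    using d(1) e by (intro exI[of _ "min d e"]) auto
qed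

context discounted
begin

text \<open>With p = c + grad \<phi> x the linear term in the calibration of the backward curve from
  x cancels against the expansion of \<phi>; division by t leaves the claim up to an error e'
  R.\<close>

lemma weak_sol_supersolution:
  assumes v: "weak_sol R v" and R: "R > 0" and \<phi>: "C1_fun \<phi>" and e: "e > 0"
    and min: "\<And>y. dist y x < e \<Longrightarrow> v y - \<phi> y \<ge> v x - \<phi> x"
  shows "eps * v x + H x (c + grad \<phi> x) \<ge> a"
proof -
  obtain D where "\<forall>x. \<exists>\<gamma>. \<gamma> 0 = x \<and> calib R D v {..0} \<gamma>" using v unfolding weak_sol_def by blast
  then obtain \<gamma> where \<gamma>: "\<gamma> 0 = x" "calib R D v {..0} \<gamma>" by blast
  define p where "p = c + grad \<phi> x"
  have lip: "norm (x - \<gamma> (- t)) \<le> R * t" if "t \<ge> 0" for t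
    using \<gamma> that unfolding calib_def by (metis abs_of_nonneg atMost_iff diff_minus_eq_add add_0 neg_le_0_iff_le order_refl)
  have cal: "v x - v (\<gamma> (- t)) \<ge> (p - c) \<bullet> (x - \<gamma> (- t)) + t * (a - H x p - eps * v x) - D p * t\<^sup>2" if "t \<ge> 0" for t
  proof -
    have "v (\<gamma> 0) - v (\<gamma> (- t)) \<ge> (p - c) \<bullet> (\<gamma> 0 - \<gamma> (- t)) + (0 - - t) * (a - H (\<gamma> 0) p - eps * v (\<gamma> 0)) - D p * (0 - - t)\<^sup>2"
      using \<gamma>(2) that unfolding calib_def by (metis atMost_iff neg_le_0_iff_le order_refl)
    then show ?thesis using \<gamma>(1) by simp
  qed
  have "a - H x p - eps * v x \<le> e' * R" if e': "e' > 0" for e'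
  proof -
    obtain d where d: "d > 0" "\<And>y. norm (y - x) < d \<Longrightarrow> norm (\<phi> y - \<phi> x - grad \<phi> x \<bullet> (y - x)) \<le> e' * norm (y - x)"
      using C1_fun_grad[OF \<phi>, of x] e' unfolding has_derivative_at_alt by blast
    have le: "t * (a - H x p - eps * v x) \<le> (e' * R) * t + D p * t\<^sup>2" if t: "0 < t" "t < min d e / R" for t
    proof -
      have n: "norm (\<gamma> (- t) - x) \<le> R * t" using lip[of t] t by (simp add: norm_minus_commute)
      also have "\<dots> < min d e" using t R by (simp add: pos_less_divide_eq mult.commute)
      finally have n': "norm (\<gamma> (- t) - x) < d" "norm (\<gamma> (- t) - x) < e" by auto
      have "v x - v (\<gamma> (- t)) \<le> \<phi> x - \<phi> (\<gamma> (- t))"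
        using min[of "\<gamma> (- t)"] n' by (simp add: dist_norm)
      moreover have "\<phi> x - \<phi> (\<gamma> (- t)) \<le> e' * norm (\<gamma> (- t) - x) - grad \<phi> x \<bullet> (\<gamma> (- t) - x)"
        using d(2)[OF n'(1)] by simp
      moreover have "e' * norm (\<gamma> (- t) - x) \<le> e' * (R * t)" using n e' by (intro mult_left_mono) auto
      moreover have "(p - c) \<bullet> (x - \<gamma> (- t)) = - (grad \<phi> x \<bullet> (\<gamma> (- t) - x))"
        by (simp add: p_def inner_diff_right)
      ultimately show ?thesis using cal[of t] t by (simp add: mult.assoc)
    qed
    have pos: "min d e / R > 0" using d e R by simp
    have der: "((\<lambda>t. t * (a - H x p - eps * v x)) has_real_derivative (a - H x p - eps * v x)) (at 0 within {0..})"
      by (auto intro!: derivative_eq_intros)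
    show ?thesis
      by (rule right_derivative_le[OF der pos, where C = "D p"]) (use le in simp)
  qed
  then have "a - H x p - eps * v x \<le> 0" by (rule le_zero_if_le_eps)
  then show ?thesis by (simp add: p_def)
qed

text \<open>Along x - t \<xi> the drop of v is at least t q . \<xi> up to o(t) by the supergradient
  and at most t (ell - eps v) up to O(t^2) by domination.\<close>

lemma weak_sol_subgradient:
  assumes v: "weak_sol R v" and q: "supdiff v q x" and \<xi>: "norm \<xi> \<le> R"
  shows "q \<bullet> \<xi> \<le> ell x \<xi> - eps * v x"
proof -
  obtain C where C: "\<And>x \<xi> t. norm \<xi> \<le> R \<Longrightarrow> 0 \<le> t \<Longrightarrow>
       v x - v (x - t *\<^sub>R \<xi>) \<le> t * (ell x \<xi> - eps * v x) + C * t\<^sup>2"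
    using v unfolding weak_sol_def by blast
  have "q \<bullet> \<xi> - (ell x \<xi> - eps * v x) \<le> e * norm \<xi>" if "e > 0" for e
  proof -
    obtain d where d: "d > 0" "\<And>w. norm w < d \<Longrightarrow> v (x + w) \<le> v x + q \<bullet> w + e * norm w"
      using q \<open>e > 0\<close> unfolding supdiff_def by blast
    have le: "(q \<bullet> \<xi>) * t - (q \<bullet> \<xi>) * 0 \<le> (ell x \<xi> - eps * v x + e * norm \<xi>) * t + C * t\<^sup>2"
      if t: "0 < t" "t < d / (norm \<xi> + 1)" for t
    proof -
      have "t * norm \<xi> \<le> t * (norm \<xi> + 1)" using t by simp
      also have "\<dots> < d" using t by (simp add: pos_less_divide_eq add_nonneg_pos)
      finally have "v (x + - (t *\<^sub>R \<xi>)) \<le> v x + q \<bullet> (- (t *\<^sub>R \<xi>)) + e * norm (- (t *\<^sub>R \<xi>))"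
        using t by (intro d(2)) simp
      then show ?thesis using C[OF \<xi>, of t x] t by (simp add: algebra_simps)
    qed
    have pos: "d / (norm \<xi> + 1) > 0" using d(1) by (simp add: add_nonneg_pos)
    have der: "((\<lambda>t. (q \<bullet> \<xi>) * t) has_real_derivative q \<bullet> \<xi>) (at 0 within {0..})"
      by (auto intro!: derivative_eq_intros)
    have "q \<bullet> \<xi> \<le> ell x \<xi> - eps * v x + e * norm \<xi>"
      by (rule right_derivative_le[OF der pos, where C = C]) (rule le)
    then show ?thesis by simp
  qed
  then have "q \<bullet> \<xi> - (ell x \<xi> - eps * v x) \<le> 0" by (rule le_zero_if_le_eps)
  then show ?thesis by simp
qed

text \<open>Bounds c + q for every supergradient q. Only velocities of norm at most 1 are tested, so
  the bound does not depend on the truncation R.\<close>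

definition P0 :: real where
  "P0 = (SOME C. C > 0 \<and> (\<forall>x \<xi>. norm \<xi> \<le> 1 \<longrightarrow> lagr H x \<xi> + a + eps * B0 \<le> C))"

lemma P0: "P0 > 0" "norm \<xi> \<le> 1 \<Longrightarrow> lagr H x \<xi> + a + eps * B0 \<le> P0"
proof -
  obtain C where C: "C > 0" "\<And>x \<xi>. norm \<xi> \<le> 1 \<Longrightarrow> \<bar>lagr H x \<xi>\<bar> \<le> C"
    using lagr_bounded[of 1] by blast
  have "lagr H x \<xi> + a + eps * B0 \<le> C + \<bar>a\<bar> + eps * B0" if "norm \<xi> \<le> 1" for x \<xi>
    using C(2)[OF that, of x] by linarith
  moreover have "C + \<bar>a\<bar> + eps * B0 > 0" using C(1) B0(1) eps by (simp add: add_pos_nonneg)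
  ultimately have "\<exists>C. C > 0 \<and> (\<forall>x \<xi>. norm \<xi> \<le> 1 \<longrightarrow> lagr H x \<xi> + a + eps * B0 \<le> C)" by blast
  from someI_ex[OF this, folded P0_def] show "P0 > 0" "norm \<xi> \<le> 1 \<Longrightarrow> lagr H x \<xi> + a + eps * B0 \<le> P0" by auto
qed

text \<open>The velocity realizing Fenchel's equality for a momentum of norm at most P0 has norm at
  most R0; hence truncation at R \<ge> R0 loses nothing in the subsolution inequality.\<close>

definition R0 :: real where
  "R0 = (SOME R. R \<ge> 1 \<and> (\<forall>x p. norm p \<le> P0 \<longrightarrow> norm (Hp H x p) \<le> R))"

lemma R0: "R0 \<ge> 1" "norm p \<le> P0 \<Longrightarrow> norm (Hp H x p) \<le> R0"
proof -
  obtain C where C: "C > 0" "\<And>x p. norm p \<le> P0 \<Longrightarrow> norm (Hp H x p) \<le> C"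
    using Hp_bounded[of P0] by blast
  have "\<exists>R. R \<ge> 1 \<and> (\<forall>x p. norm p \<le> P0 \<longrightarrow> norm (Hp H x p) \<le> R)"
    using C(2) by (intro exI[of _ "max C 1"]) (auto simp: le_max_iff_disj)
  from someI_ex[OF this, folded R0_def] show "R0 \<ge> 1" "norm p \<le> P0 \<Longrightarrow> norm (Hp H x p) \<le> R0" by auto
qed

lemma weak_sol_subsolution:
  assumes v: "weak_sol R v" and R: "R \<ge> R0" and q: "supdiff v q x"
  shows "norm (c + q) \<le> P0" "eps * v x + H x (c + q) \<le> a"
proof -
  note sub = weak_sol_subgradient[OF v q]
  have vB: "v x \<ge> - B0" using v unfolding weak_sol_def by blast
  show 1: "norm (c + q) \<le> P0"
  proof -
    have s: "norm (sgn (c + q)) \<le> 1" by (simp add: norm_sgn)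
    have "q \<bullet> sgn (c + q) \<le> ell x (sgn (c + q)) - eps * v x"
      using s R R0(1) by (intro sub) auto
    moreover have "(c + q) \<bullet> sgn (c + q) = norm (c + q)"
      by (cases "c + q = 0") (simp_all add: sgn_div_norm dot_square_norm power2_eq_square)
    moreover have "eps * v x \<ge> - (eps * B0)" using vB eps mult_left_mono[of "- B0" "v x" eps] by simp
    ultimately show ?thesis using P0(2)[OF s, of x] by (simp add: ell_def inner_add_left)
  qed
  have "q \<bullet> Hp H x (c + q) \<le> ell x (Hp H x (c + q)) - eps * v x"
    using R0(2)[OF 1, of x] R by (intro sub) auto
  then show "eps * v x + H x (c + q) \<le> a"
    using Fenchel_eq[of x "c + q"] by (simp add: ell_def inner_commute[of _ "c + q"] inner_add_left)
qed

theorem weak_sol_visc: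
  assumes v: "weak_sol R v" and R: "R \<ge> R0"
  shows "visc_sol H c eps a v"
  unfolding visc_sol_def
proof (intro conjI allI impI; (elim conjE exE)?)
  obtain K where "K > 0" "\<And>x y. \<bar>v x - v y\<bar> \<le> K * norm (x - y)" using v unfolding weak_sol_def by blast
  then have "K-lipschitz_on UNIV v" by (intro lipschitz_onI) (auto simp: dist_norm)
  then show "continuous_on UNIV v" by (rule lipschitz_on_continuous_on)
  show "periodic_fun v" using v by (simp add: weak_sol_def)
  show "eps * v x + H x (c + grad \<phi> x) \<le> a"
    if "C1_fun \<phi>" "e > 0" "\<forall>y. dist y x < e \<longrightarrow> v y - \<phi> y \<le> v x - \<phi> x" for x \<phi> e
    using weak_sol_subsolution(2)[OF v R supdiff_test_function[OF C1_fun_grad[OF that(1)] that(2)]] that(3) by blast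
  show "a \<le> eps * v x + H x (c + grad \<phi> x)"
    if "C1_fun \<phi>" "e > 0" "\<forall>y. dist y x < e \<longrightarrow> v x - \<phi> x \<le> v y - \<phi> y" for x \<phi> e
    using weak_sol_supersolution[OF v _ that(1,2)] that(3) R R0(1) by force
qed

text \<open>Doubling of variables: at a maximum of u x - w y - k/2 |x - y|^2 the two points are
  O(k^(-1/2)) apart and coercivity bounds the common gradient.\<close>

lemma visc_comparison:
  assumes u: "visc_sol H c eps a u" and w: "visc_sol H c eps a w"
  shows "u z \<le> w z"
proof -
  have bnd: "\<exists>B>0. \<forall>x. \<bar>f x\<bar> \<le> B" if "continuous_on UNIV f" "periodic_fun f" for f :: "real^'n \<Rightarrow> real"
  proof -
    have "continuous_on UNIV (\<lambda>z::(real^'n) \<times> real. f (fst z))"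
      by (rule continuous_on_compose2[OF that(1)]) (auto intro: continuous_intros)
    then have "\<exists>B>0. \<forall>x (p::real). norm p \<le> 1 \<longrightarrow> norm (f x) \<le> B"
      by (rule periodic_bounded[where g = "\<lambda>x p. f x"]) (rule that(2))
    then show ?thesis by (metis norm_zero real_norm_def zero_le_one)
  qed
  have uc: "continuous_on UNIV u" "periodic_fun u" and wc: "continuous_on UNIV w" "periodic_fun w"
    using u w by (auto simp: visc_sol_def)
  obtain Bu Bw where Bu: "Bu > 0" "\<And>x. \<bar>u x\<bar> \<le> Bu" and Bw: "Bw > 0" "\<And>x. \<bar>w x\<bar> \<le> Bw"
    using bnd[OF uc] bnd[OF wc] by blast
  define B where "B = max Bu Bw"
  have B: "B > 0" "\<And>x. \<bar>u x\<bar> \<le> B" "\<And>x. \<bar>w x\<bar> \<le> B"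
    using Bu Bw by (auto simp: B_def le_max_iff_disj)
  obtain R1 where R1: "R1 > 0" "\<And>x p. norm p \<ge> R1 \<Longrightarrow> H x p \<ge> 1 * norm p" using H_superlinear[of 1] by blast
  \<comment> \<open>The subsolution inequality and coercivity keep the common gradient c + p below
    M; on such momenta H is Lipschitz in x.\<close>
  define M where "M = max R1 (a + eps * B)"
  obtain C where C: "C > 0" "\<And>x y p. norm p \<le> M \<Longrightarrow> \<bar>H y p - H x p\<bar> \<le> C * norm (y - x)"
    using H_Lipschitz_x[of M] by blast
  have key: "eps * (u z - w z) \<le> C * \<rho>" if \<rho>: "\<rho> > 0" for \<rho>
  proof -
    \<comment> \<open>At distance \<rho> the penalty equals 4 B, which is the largest possible
      variation of u x - w y; so pairs farther apart cannot beat the diagonal.\<close>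
    define k where "k = 8 * B / \<rho>\<^sup>2"
    have k: "k > 0" "k / 2 * \<rho>\<^sup>2 = 4 * B" using B(1) \<rho> by (auto simp: k_def)
    define \<Phi> where "\<Phi> = (\<lambda>z. u (fst z) - w (snd z) - k / 2 * ((fst z - snd z) \<bullet> (fst z - snd z)))"
    \<comment> \<open>A compact window for the maximum: translating x and y by the same integer
      vector leaves \<Phi> unchanged, so x may be taken in the unit cell.\<close>
    define S where "S = (\<lambda>(x, y). (x, x + y)) ` (cbox (0::real^'n) 1 \<times> cball 0 \<rho>)"
    have "compact S" unfolding S_def
      by (intro compact_continuous_image compact_Times) (auto intro!: continuous_intros simp: case_prod_beta)
    moreover have "S \<noteq> {}"
    proof -
      have "(0, 0) \<in> cbox (0::real^'n) 1 \<times> cball (0::real^'n) \<rho>" using \<rho> by (auto simp: mem_box_cart)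
      then show ?thesis unfolding S_def by blast
    qed
    moreover have "continuous_on S \<Phi>"
      unfolding \<Phi>_def
      by (intro continuous_intros continuous_on_compose2[OF uc(1)] continuous_on_compose2[OF wc(1)]) auto
    ultimately obtain m where m: "m \<in> S" "\<And>z. z \<in> S \<Longrightarrow> \<Phi> z \<le> \<Phi> m"
      using continuous_attains_sup[of S \<Phi>] by blast
    have gmax: "\<Phi> (x, y) \<le> \<Phi> m" for x y
    proof -
      obtain l where l: "int_vec l" "x - l \<in> cbox 0 1" using int_vec_reduce by blast
      have eq: "\<Phi> (x, y) = \<Phi> (x - l, y - l)"
        using periodic_fun_diff[OF uc(2) l(1)] periodic_fun_diff[OF wc(2) l(1)] by (simp add: \<Phi>_def)
      show ?thesis
      proof (cases "norm (y - x) \<le> \<rho>")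
        case True
        then have "(x - l, y - x) \<in> cbox 0 1 \<times> cball 0 \<rho>" using l by auto
        then have "(x - l, y - l) \<in> S" unfolding S_def by force
        then show ?thesis using m(2) eq by simp
      next
        case False
        then have "\<rho>\<^sup>2 \<le> (norm (x - y))\<^sup>2" using \<rho> by (intro power_mono) (auto simp: norm_minus_commute)
        then have "k / 2 * \<rho>\<^sup>2 \<le> k / 2 * ((x - y) \<bullet> (x - y))"
          using k(1) by (intro mult_left_mono) (auto simp: dot_square_norm)
        then have "\<Phi> (x, y) \<le> 2 * B - 4 * B"
          using B(2)[of x] B(3)[of y] k(2) by (simp add: \<Phi>_def abs_le_iff)
        also have "\<dots> \<le> \<Phi> (x - l, x - l)"
          using B(2)[of "x - l"] B(3)[of "x - l"] by (simp add: \<Phi>_def abs_le_iff)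
        also have "\<dots> \<le> \<Phi> m"
        proof (rule m(2))
          have "(x - l, 0) \<in> cbox 0 1 \<times> cball (0::real^'n) \<rho>" using l \<rho> by auto
          then show "(x - l, x - l) \<in> S" unfolding S_def by force
        qed
        finally show ?thesis .
      qed
    qed
    obtain x0 y0 where xy: "m = (x0, y0)" by (cases m)
    have dist: "norm (y0 - x0) \<le> \<rho>" using m(1) by (auto simp: S_def xy)
    define p where "p = k *\<^sub>R (x0 - y0)"
    have s1: "eps * u x0 + H x0 (c + p) \<le> a"
    proof -
      let ?\<phi> = "\<lambda>x. k / 2 * ((x - y0) \<bullet> (x - y0))"
      have "u x - ?\<phi> x \<le> u x0 - ?\<phi> x0" for x using gmax[of x y0] by (simp add: \<Phi>_def xy)
      then have "eps * u x0 + H x0 (c + grad ?\<phi> x0) \<le> a"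
        using u C1_fun_square(1)[of k y0] unfolding visc_sol_def by (meson zero_less_one)
      then show ?thesis unfolding C1_fun_square(2) p_def .
    qed
    have s2: "eps * w y0 + H y0 (c + p) \<ge> a"
    proof -
      \<comment> \<open>Seen from y the penalty changes sign and so does x - y, hence its gradient
        is the same p.\<close>
      let ?\<phi> = "\<lambda>y. (- k) / 2 * ((y - x0) \<bullet> (y - x0))"
      have "w y - ?\<phi> y \<ge> w y0 - ?\<phi> y0" for y
      proof -
        have "(x0 - y) \<bullet> (x0 - y) = (y - x0) \<bullet> (y - x0)" for y
          by (simp add: dot_square_norm norm_minus_commute)
        then show ?thesis using gmax[of x0 y] by (simp add: \<Phi>_def xy)
      qed
      then have "eps * w y0 + H y0 (c + grad ?\<phi> y0) \<ge> a"
        using w C1_fun_square(1)[of "- k" x0] unfolding visc_sol_def by (meson zero_less_one)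
      then show ?thesis unfolding C1_fun_square(2) p_def by (simp add: scaleR_diff_right)
    qed
    have "norm (c + p) \<le> M"
    proof (cases "norm (c + p) \<ge> R1")
      case True
      have "norm (c + p) \<le> H x0 (c + p)" using R1(2)[OF True, of x0] by simp
      also have "\<dots> \<le> a + eps * B"
        using s1 B(2)[of x0] mult_left_mono[of "- B" "u x0" eps] eps by (simp add: abs_le_iff)
      finally show ?thesis by (simp add: M_def)
    qed (simp add: M_def)
    then have "H y0 (c + p) - H x0 (c + p) \<le> C * norm (y0 - x0)" using C(2)[of "c + p" y0 x0] by (simp add: abs_le_iff)
    also have "\<dots> \<le> C * \<rho>" using dist C(1) by (intro mult_left_mono) auto
    finally have "eps * (u x0 - w y0) \<le> C * \<rho>" using s1 s2 by (simp add: algebra_simps)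
    moreover have "u z - w z \<le> u x0 - w y0"
    proof -
      have "k / 2 * ((x0 - y0) \<bullet> (x0 - y0)) \<ge> 0" using k(1) by simp
      then show ?thesis using gmax[of z z] by (simp add: \<Phi>_def xy)
    qed
    ultimately show ?thesis using eps mult_left_mono[of "u z - w z" "u x0 - w y0" eps] by linarith
  qed
  have "eps * (u z - w z) \<le> 0"
    by (rule le_zero_if_le_eps[of _ C]) (use key in \<open>simp add: mult.commute\<close>)
  then show ?thesis using eps by (simp add: mult_le_0_iff)
qed

theorem visc_sol_unique: "visc_sol H c eps a u \<Longrightarrow> visc_sol H c eps a w \<Longrightarrow> u = w"
  using visc_comparison by (intro ext antisym) auto

text \<open>The scheme yields one solution for each R; all are viscosity solutions of the same
  equation, hence equal. So a single v is dominated along segments of arbitrary speed.\<close>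

theorem visc_sol_exists: "\<exists>v. visc_sol H c eps a v \<and> (\<forall>R\<ge>R0. weak_sol R v)"
proof -
  obtain v where v: "weak_sol R0 v" using weak_sol_ex[of R0] R0(1) by auto
  have "weak_sol R v" if "R \<ge> R0" for R
  proof -
    obtain w where "weak_sol R w" using weak_sol_ex[of R] R0(1) \<open>R \<ge> R0\<close> by auto
    moreover have "w = v"
      using weak_sol_visc[OF \<open>weak_sol R w\<close> \<open>R \<ge> R0\<close>] weak_sol_visc[OF v order_refl] by (rule visc_sol_unique)
    ultimately show ?thesis by simp
  qed
  then show ?thesis using weak_sol_visc[OF v order_refl] by blast
qed

end

section \<open>Calibrated curves\<close>

lemma bounded_unique_limit:
  fixes q :: "nat \<Rightarrow> 'a::euclidean_space"
  assumes bnd: "\<And>n. norm (q n) \<le> K"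
    and lim: "\<And>r l. strict_mono (r :: nat \<Rightarrow> nat) \<Longrightarrow> (\<lambda>n. q (r n)) \<longlonglongrightarrow> l \<Longrightarrow> l = L"
  shows "q \<longlonglongrightarrow> L"
proof (rule ccontr)
  assume "\<not> q \<longlonglongrightarrow> L"
  then obtain e where e: "e > 0" "\<not> eventually (\<lambda>n. dist (q n) L < e) sequentially"
    unfolding tendsto_iff by blast
  then have "infinite {n. dist (q n) L \<ge> e}"
    unfolding eventually_sequentially infinite_nat_iff_unbounded_le by (auto simp: not_less)
  then obtain r :: "nat \<Rightarrow> nat" where r: "strict_mono r" "\<And>n. dist (q (r n)) L \<ge> e"
    using infinite_enumerate by blast
  obtain l r' where r': "strict_mono (r' :: nat \<Rightarrow> nat)" "(\<lambda>n. q (r (r' n))) \<longlonglongrightarrow> l"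
    using bounded_subseq[of "\<lambda>n. q (r n)" K] bnd by blast
  have "l = L" using lim[of "\<lambda>n. r (r' n)" l] strict_mono_o[OF r(1) r'(1)] r'(2) by (simp add: o_def)
  then have "eventually (\<lambda>n. dist (q (r (r' n))) L < e) sequentially"
    using r'(2) e(1) by (simp add: tendsto_iff)
  then obtain N where "dist (q (r (r' N))) L < e" by (auto simp: eventually_sequentially)
  then show False using r(2)[of "r' N"] by simp
qed

lemma has_vector_derivative_quotient:
  fixes \<gamma> :: "real \<Rightarrow> 'a::real_normed_vector"
  assumes "((\<lambda>h. (\<gamma> (s + h) - \<gamma> s) /\<^sub>R h) \<longlongrightarrow> d) (at 0)"
  shows "(\<gamma> has_vector_derivative d) (at s)"
  unfolding has_vector_derivative_def has_derivative_at
proof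
  show "bounded_linear (\<lambda>x. x *\<^sub>R d)" by (rule bounded_linear_scaleR_left)
  have "((\<lambda>h. norm ((\<gamma> (s + h) - \<gamma> s) /\<^sub>R h - d)) \<longlongrightarrow> norm (d - d)) (at 0)"
    by (intro tendsto_intros assms)
  moreover have "eventually (\<lambda>h. norm ((\<gamma> (s + h) - \<gamma> s) /\<^sub>R h - d) = norm (\<gamma> (s + h) - \<gamma> s - h *\<^sub>R d) / norm h) (at 0)"
  proof (rule eventually_mono[OF eventually_at_filter[THEN iffD2]])
    show "\<forall>\<^sub>F h in nhds 0. h \<noteq> 0 \<longrightarrow> h \<in> UNIV \<longrightarrow> h \<noteq> (0::real)" by simp
    fix h :: real assume "h \<noteq> 0"
    then have "(\<gamma> (s + h) - \<gamma> s) /\<^sub>R h - d = (\<gamma> (s + h) - \<gamma> s - h *\<^sub>R d) /\<^sub>R h"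
      by (simp add: scaleR_diff_right)
    then show "norm ((\<gamma> (s + h) - \<gamma> s) /\<^sub>R h - d) = norm (\<gamma> (s + h) - \<gamma> s - h *\<^sub>R d) / norm h"
      by (simp add: divide_inverse mult.commute)
  qed
  ultimately show "((\<lambda>h. norm (\<gamma> (s + h) - \<gamma> s - h *\<^sub>R d) / norm h) \<longlongrightarrow> 0) (at 0)"
    by (simp add: tendsto_cong)
qed

lemma supdiff_has_derivative:
  fixes v :: "real^'n \<Rightarrow> real"
  assumes "(v has_derivative (\<lambda>h. m \<bullet> h)) (at x)"
  shows "supdiff v m x"
  by (rule supdiff_test_function[OF assms zero_less_one]) simp

text \<open>Both expansions are compared on a short vector in the direction of m - q.\<close>

lemma supdiff_unique:
  fixes v :: "real^'n \<Rightarrow> real"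
  assumes v: "(v has_derivative (\<lambda>h. m \<bullet> h)) (at x)" and q: "supdiff v q x"
  shows "q = m"
proof -
  have "norm (m - q) \<le> e * 2" if e: "e > 0" for e
  proof (cases "m = q")
    case False
    obtain d1 where d1: "d1 > 0" "\<And>y. norm (y - x) < d1 \<Longrightarrow> norm (v y - v x - m \<bullet> (y - x)) \<le> e * norm (y - x)"
      using v e unfolding has_derivative_at_alt by blast
    obtain d2 where d2: "d2 > 0" "\<And>w. norm w < d2 \<Longrightarrow> v (x + w) \<le> v x + q \<bullet> w + e * norm w"
      using q e unfolding supdiff_def by blast
    define r where "r = min d1 d2 / 2"
    have r: "r > 0" "r < d1" "r < d2" using d1 d2 by (auto simp: r_def)
    define w where "w = (r / norm (m - q)) *\<^sub>R (m - q)"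
    have nw: "norm w = r" using r False by (simp add: w_def)
    have "(m - q) \<bullet> w \<le> 2 * e * r"
      using d1(2)[of "x + w"] d2(2)[of w] nw r by (simp add: inner_diff_left abs_le_iff)
    moreover have "(m - q) \<bullet> w = r * norm (m - q)"
      using False by (simp add: w_def dot_square_norm power2_eq_square)
    ultimately show ?thesis using r(1) by (simp add: mult.commute)
  qed (use e in simp)
  then have "norm (m - q) \<le> 0" by (rule le_zero_if_le_eps)
  then show ?thesis by simp
qed

lemma quotient_inequality:
  fixes t A C e :: real and p q w :: "real^'n"
  assumes t: "t > 0" and le: "p \<bullet> w + t * A - C * t\<^sup>2 \<le> q \<bullet> w + e * t"
  shows "p \<bullet> (w /\<^sub>R t) + (A - C * t) \<le> q \<bullet> (w /\<^sub>R t) + e"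
proof -
  have "t * (p \<bullet> (w /\<^sub>R t) + (A - C * t)) = p \<bullet> w + t * A - C * t\<^sup>2"
    using t by (simp add: algebra_simps power2_eq_square)
  moreover have "t * (q \<bullet> (w /\<^sub>R t) + e) = q \<bullet> w + e * t"
    using t by (simp add: algebra_simps)
  ultimately have "t * (p \<bullet> (w /\<^sub>R t) + (A - C * t)) \<le> t * (q \<bullet> (w /\<^sub>R t) + e)"
    using le by simp
  then show ?thesis using t by simp
qed

section \<open>Supergradients of the solution and velocities of calibrated curves\<close>

locale kam = discounted H c a eps for H :: "real^'n \<Rightarrow> real^'n \<Rightarrow> real" and c a eps +
  fixes v :: "real^'n \<Rightarrow> real"
  assumes weak: "\<And>R. R \<ge> R0 \<Longrightarrow> weak_sol R v"
begin

lemma v_periodic: "int_vec k \<Longrightarrow> v (x + k) = v x"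
  using weak[OF order_refl] by (simp add: weak_sol_def periodic_fun_def)

definition Lv :: real where "Lv = (SOME K. K > 0 \<and> (\<forall>x y. \<bar>v x - v y\<bar> \<le> K * norm (x - y)))"

lemma Lv: "Lv > 0" "\<bar>v x - v y\<bar> \<le> Lv * norm (x - y)"
proof -
  have "\<exists>K. K > 0 \<and> (\<forall>x y. \<bar>v x - v y\<bar> \<le> K * norm (x - y))"
    using weak[OF order_refl] unfolding weak_sol_def by blast
  from someI_ex[OF this, folded Lv_def] show "Lv > 0" "\<bar>v x - v y\<bar> \<le> Lv * norm (x - y)" by auto
qed

lemma v_continuous: "continuous_on UNIV v"
proof -
  have "Lv-lipschitz_on UNIV v" using Lv by (intro lipschitz_onI) (auto simp: dist_norm less_imp_le)
  then show ?thesis by (rule lipschitz_on_continuous_on)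
qed

lemma v_tendsto: "(f \<longlongrightarrow> x) F \<Longrightarrow> ((\<lambda>n. v (f n)) \<longlongrightarrow> v x) F"
  using continuous_on_tendsto_compose[OF v_continuous, of f x F] by simp

lemma v_bounded: "\<exists>B>0. \<forall>x. \<bar>v x\<bar> \<le> B"
proof -
  have "continuous_on UNIV (\<lambda>z::(real^'n) \<times> real. v (fst z))"
    by (rule continuous_on_compose2[OF v_continuous]) (auto intro: continuous_intros)
  then have "\<exists>B>0. \<forall>x (p::real). norm p \<le> 1 \<longrightarrow> norm (v x) \<le> B"
    by (rule periodic_bounded[where g = "\<lambda>x p. v x"]) (simp add: periodic_fun_def v_periodic)
  then show ?thesis by (metis norm_zero real_norm_def zero_le_one)
qed

text \<open>\<open>dm\<close> is a modulus of semiconcavity common to all points; \<open>sg\<close> is the set of supergradients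
  with this modulus, which unlike \<open>supdiff\<close> has closed graph.\<close>

definition dm :: "real \<Rightarrow> real" where
  "dm = (SOME d. (\<forall>e>0. d e > 0) \<and> (\<exists>K. \<forall>x. \<exists>q. norm q \<le> K \<and>
       (\<forall>e w. e > 0 \<longrightarrow> norm w < d e \<longrightarrow> v (x + w) \<le> v x + q \<bullet> w + e * norm w)))"

definition sg :: "real^'n \<Rightarrow> real^'n \<Rightarrow> bool" where
  "sg q x \<longleftrightarrow> (\<forall>e w. e > 0 \<longrightarrow> norm w < dm e \<longrightarrow> v (x + w) \<le> v x + q \<bullet> w + e * norm w)"

lemma dm: "e > 0 \<Longrightarrow> dm e > 0" and sg_ex: "\<exists>q. sg q x"
proof -
  have "\<exists>d. (\<forall>e>0. d e > 0) \<and> (\<exists>K. \<forall>x. \<exists>q. norm q \<le> K \<and>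
       (\<forall>e w. e > 0 \<longrightarrow> norm w < d e \<longrightarrow> v (x + w) \<le> v x + q \<bullet> w + e * norm w))"
    using weak[OF order_refl] unfolding weak_sol_def by blast
  from someI_ex[OF this, folded dm_def] show "e > 0 \<Longrightarrow> dm e > 0" "\<exists>q. sg q x"
    unfolding sg_def by blast+
qed

lemma sg_supdiff: "sg q x \<Longrightarrow> supdiff v q x"
  unfolding sg_def supdiff_def using dm by blast

lemma supdiff_sub:
  assumes "supdiff v q x" shows "norm (c + q) \<le> P0" "eps * v x + H x (c + q) \<le> a"
  using weak_sol_subsolution[OF weak[OF order_refl] order_refl assms] by auto

lemma sg_bounded: "sg q x \<Longrightarrow> norm q \<le> P0 + norm c"
  using supdiff_sub(1)[OF sg_supdiff, of q x] norm_triangle_ineq4[of "c + q" c] by simp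

lemma sg_closed:
  assumes "\<And>n. sg (q n) (x n)" "q \<longlonglongrightarrow> q'" "x \<longlonglongrightarrow> x'"
  shows "sg q' x'"
  unfolding sg_def
proof (intro allI impI)
  fix e :: real and w :: "real^'n" assume e: "e > 0" "norm w < dm e"
  show "v (x' + w) \<le> v x' + q' \<bullet> w + e * norm w"
  proof (rule LIMSEQ_le)
    show "(\<lambda>n. v (x n + w)) \<longlonglongrightarrow> v (x' + w)" by (intro v_tendsto tendsto_intros assms)
    show "(\<lambda>n. v (x n) + q n \<bullet> w + e * norm w) \<longlonglongrightarrow> v x' + q' \<bullet> w + e * norm w"
      by (intro v_tendsto tendsto_intros assms)
    show "\<exists>N. \<forall>n\<ge>N. v (x n + w) \<le> v (x n) + q n \<bullet> w + e * norm w"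
      using assms(1) e unfolding sg_def by blast
  qed
qed

text \<open>By boundedness and closed graph, supergradients at nearby points tend to q. The lower
  estimate at x + w comes from a supergradient q' taken there and used with displacement -w.\<close>

lemma sg_unique_differentiable:
  assumes q: "sg q x" and uniq: "\<And>q'. sg q' x \<Longrightarrow> q' = q"
  shows "(v has_derivative (\<lambda>h. q \<bullet> h)) (at x)"
proof -
  have near: "\<exists>d>0. \<forall>w q'. norm w < d \<longrightarrow> sg q' (x + w) \<longrightarrow> norm (q' - q) < e" if e: "e > 0" for e
  proof (rule ccontr)
    assume "\<not> (\<exists>d>0. \<forall>w q'. norm w < d \<longrightarrow> sg q' (x + w) \<longrightarrow> norm (q' - q) < e)"
    then have "\<forall>n::nat. \<exists>w q'. norm w < inverse (real (Suc n)) \<and> sg q' (x + w) \<and> norm (q' - q) \<ge> e"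
      by (metis inverse_positive_iff_positive linorder_not_less of_nat_0_less_iff zero_less_Suc)
    then obtain W Q where WQ: "\<And>n::nat. norm (W n) < inverse (real (Suc n))" "\<And>n. sg (Q n) (x + W n)" "\<And>n. norm (Q n - q) \<ge> e"
      by metis
    have W0: "W \<longlonglongrightarrow> 0"
      by (rule Lim_null_comparison[OF _ LIMSEQ_inverse_real_of_nat])
        (use WQ(1) in \<open>auto intro!: always_eventually less_imp_le\<close>)
    obtain l r where r: "strict_mono (r :: nat \<Rightarrow> nat)" "(\<lambda>n. Q (r n)) \<longlonglongrightarrow> l"
      using bounded_subseq[of Q "P0 + norm c"] sg_bounded[OF WQ(2)] by blast
    have "(\<lambda>n. x + W (r n)) \<longlonglongrightarrow> x + 0"
      using LIMSEQ_subseq_LIMSEQ[OF W0 r(1)] by (intro tendsto_intros) (simp add: o_def)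
    then have "sg l x" using sg_closed[of "\<lambda>n. Q (r n)" "\<lambda>n. x + W (r n)" l x] WQ(2) r(2) by simp
    then have "l = q" by (rule uniq)
    have "(\<lambda>n. norm (Q (r n) - q)) \<longlonglongrightarrow> norm (l - q)" by (intro tendsto_intros r(2))
    then have "norm (l - q) \<ge> e" using WQ(3) by (meson LIMSEQ_le_const)
    then show False using \<open>l = q\<close> e by simp
  qed
  show ?thesis
    unfolding has_derivative_at_alt
  proof (intro conjI allI impI)
    show "bounded_linear (\<lambda>h. q \<bullet> h)" by (rule bounded_linear_inner_right)
    fix e :: real assume "e > 0"
    then have e2: "e / 2 > 0" by simp
    obtain d where d: "d > 0" "\<And>w q'. norm w < d \<Longrightarrow> sg q' (x + w) \<Longrightarrow> norm (q' - q) < e / 2"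
      using near[OF e2] by blast
    show "\<exists>d>0. \<forall>y. norm (y - x) < d \<longrightarrow> norm (v y - v x - q \<bullet> (y - x)) \<le> e * norm (y - x)"
    proof (intro exI[of _ "min d (dm (e / 2))"] conjI allI impI)
      show "min d (dm (e / 2)) > 0" using d(1) dm[OF e2] by simp
      fix y assume y: "norm (y - x) < min d (dm (e / 2))"
      define w where "w = y - x"
      have yw: "y = x + w" by (simp add: w_def)
      have nw: "norm w < d" "norm w < dm (e / 2)" using y by (auto simp: w_def)
      have up: "v y \<le> v x + q \<bullet> w + e / 2 * norm w"
        using q nw(2) e2 unfolding sg_def yw by blast
      obtain q' where q': "sg q' (x + w)" using sg_ex by blast
      have "v (x + w + - w) \<le> v (x + w) + q' \<bullet> (- w) + e / 2 * norm (- w)"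
        using q' nw(2) e2 unfolding sg_def by (metis norm_minus_cancel)
      then have lo: "v x \<le> v y - q' \<bullet> w + e / 2 * norm w" by (simp add: yw)
      have "(q - q') \<bullet> w \<le> norm (q - q') * norm w" by (rule norm_cauchy_schwarz)
      also have "\<dots> \<le> e / 2 * norm w"
        using d(2)[OF nw(1) q'] by (intro mult_right_mono) (auto simp: norm_minus_commute)
      finally have "(q - q') \<bullet> w \<le> e / 2 * norm w" .
      then have "\<bar>v y - v x - q \<bullet> w\<bar> \<le> e * norm w"
        using up lo e2 by (simp add: abs_le_iff inner_diff_left)
      then show "norm (v y - v x - q \<bullet> (y - x)) \<le> e * norm (y - x)" by (simp add: w_def)
    qed
  qed
qed

text \<open>f stands for a difference quotient of the curve. At a subsequential limit \<zeta> the
  inequality with p = mom x \<zeta> becomes the reverse of Fenchel's inequality at c + q, and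
  equality determines \<zeta>. The term \<open>A p\<close> is left abstract because calibration
  freezes the later point: the moving one for forward quotients, the fixed one for backward
  ones.\<close>

lemma velocity_limit:
  fixes f :: "real \<Rightarrow> real^'n"
  assumes sub: "eps * v x + H x (c + q) \<le> a" and bnd: "\<And>t. 0 < t \<Longrightarrow> t < \<delta> \<Longrightarrow> norm (f t) \<le> R" and \<delta>: "\<delta> > 0"
    and A: "\<And>p. (A p \<longlongrightarrow> a - H x p - eps * v x) (at_right 0)"
    and ev: "\<And>p e. e > 0 \<Longrightarrow> eventually (\<lambda>t. q \<bullet> f t + e \<ge> (p - c) \<bullet> f t + A p t) (at_right 0)"
  shows "(f \<longlongrightarrow> Hp H x (c + q)) (at_right 0)"
proof (rule tendsto_at_right_sequentially[OF \<delta>])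
  fix S :: "nat \<Rightarrow> real" assume S: "\<And>n. 0 < S n" "\<And>n. S n < \<delta>" "S \<longlonglongrightarrow> 0"
  have SF: "filterlim S (at_right 0) sequentially"
  proof -
    have "S n \<noteq> 0" for n using S(1)[of n] by simp
    then show ?thesis using S by (auto simp: filterlim_at intro!: always_eventually)
  qed
  show "(\<lambda>n. f (S n)) \<longlonglongrightarrow> Hp H x (c + q)"
  proof (rule bounded_unique_limit)
    show "norm (f (S n)) \<le> R" for n using S by (intro bnd) auto
    fix r :: "nat \<Rightarrow> nat" and \<zeta> assume r: "strict_mono r" and \<zeta>: "(\<lambda>n. f (S (r n))) \<longlonglongrightarrow> \<zeta>"
    have SrF: "filterlim (\<lambda>n. S (r n)) (at_right 0) sequentially"
      using filterlim_compose[OF SF filterlim_subseq[OF r]] .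
    define p where "p = mom x \<zeta>"
    have "(p - c) \<bullet> \<zeta> + (a - H x p - eps * v x) - q \<bullet> \<zeta> \<le> e * 1" if e: "e > 0" for e
    proof -
      have "eventually (\<lambda>n. q \<bullet> f (S (r n)) + e \<ge> (p - c) \<bullet> f (S (r n)) + A p (S (r n))) sequentially"
        using eventually_compose_filterlim[OF ev[OF e] SrF] .
      moreover have "(\<lambda>n. q \<bullet> f (S (r n)) + e) \<longlonglongrightarrow> q \<bullet> \<zeta> + e" by (intro tendsto_intros \<zeta>)
      moreover have "(\<lambda>n. (p - c) \<bullet> f (S (r n)) + A p (S (r n))) \<longlonglongrightarrow> (p - c) \<bullet> \<zeta> + (a - H x p - eps * v x)"
        by (intro tendsto_intros \<zeta> filterlim_compose[OF A SrF])
      ultimately have "(p - c) \<bullet> \<zeta> + (a - H x p - eps * v x) \<le> q \<bullet> \<zeta> + e"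
        by (intro tendsto_le[OF sequentially_bot])
      then show ?thesis by simp
    qed
    then have "(p - c) \<bullet> \<zeta> + (a - H x p - eps * v x) - q \<bullet> \<zeta> \<le> 0" by (rule le_zero_if_le_eps)
    then have "lagr H x \<zeta> + H x (c + q) \<le> \<zeta> \<bullet> (c + q)"
      using sub lagr_eq[of x \<zeta>] by (simp add: p_def inner_diff_left inner_add_right inner_commute[of \<zeta>])
    then show "\<zeta> = Hp H x (c + q)" by (rule Fenchel_equality_imp)
  qed
qed

lemma calibD:
  assumes "calib R D v I \<gamma>" "s \<in> I" "t \<in> I"
  shows "norm (\<gamma> t - \<gamma> s) \<le> R * \<bar>t - s\<bar>"
    and "s \<le> t \<Longrightarrow> v (\<gamma> t) - v (\<gamma> s) \<ge>
       (p - c) \<bullet> (\<gamma> t - \<gamma> s) + (t - s) * (a - H (\<gamma> t) p - eps * v (\<gamma> t)) - D p * (t - s)\<^sup>2"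
  using assms unfolding calib_def by blast+

lemma H_tendsto: "(f \<longlongrightarrow> x) F \<Longrightarrow> ((\<lambda>t. H (f t) p) \<longlongrightarrow> H x p) F"
  using continuous_on_tendsto_compose[OF H_continuous, of "\<lambda>t. (f t, p)" "(x, p)" F]
  by (simp add: tendsto_Pair)

text \<open>Forward quotients call for an upper bound of v at the later point, which any
  supergradient provides.\<close>

lemma calib_right_velocity:
  assumes cal: "calib R D v I \<gamma>" and \<delta>: "\<delta> > 0" "{s..s + \<delta>} \<subseteq> I" and q: "supdiff v q (\<gamma> s)"
  shows "((\<lambda>t. (\<gamma> (s + t) - \<gamma> s) /\<^sub>R t) \<longlongrightarrow> Hp H (\<gamma> s) (c + q)) (at_right 0)"
proof (rule velocity_limit[OF supdiff_sub(2)[OF q], where \<delta> = \<delta> and R = R and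
      A = "\<lambda>p t. a - H (\<gamma> (s + t)) p - eps * v (\<gamma> (s + t)) - D p * t"])
  have sI: "s \<in> I" using \<delta> by auto
  have lip: "norm (\<gamma> (s + t) - \<gamma> s) \<le> R * t" if "0 \<le> t" "t \<le> \<delta>" for t
    using calibD(1)[OF cal sI, of "s + t"] \<delta> that by (auto simp: subset_iff)
  then show "norm ((\<gamma> (s + t) - \<gamma> s) /\<^sub>R t) \<le> R" if "0 < t" "t < \<delta>" for t
  proof -
    have "norm (\<gamma> (s + t) - \<gamma> s) / t \<le> R" using that lip[of t] by (simp add: pos_divide_le_eq)
    then show ?thesis using that by (simp add: divide_inverse_commute)
  qed
  have evd: "eventually (\<lambda>t. t \<in> {0<..<\<delta>}) (at_right (0::real))"
    using \<delta>(1) by (intro eventually_at_right_real)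
  have "((\<lambda>t. \<gamma> (s + t) - \<gamma> s) \<longlongrightarrow> 0) (at_right 0)"
  proof (rule Lim_null_comparison)
    show "eventually (\<lambda>t. norm (\<gamma> (s + t) - \<gamma> s) \<le> R * t) (at_right 0)"
      using evd by eventually_elim (auto intro: lip)
    have "((\<lambda>t. R * t) \<longlongrightarrow> R * 0) (at_right 0)" by (intro tendsto_intros)
    then show "((\<lambda>t. R * t) \<longlongrightarrow> 0) (at_right 0)" by simp
  qed
  from tendsto_add[OF this tendsto_const, of "\<gamma> s"]
  have g: "((\<lambda>t. \<gamma> (s + t)) \<longlongrightarrow> \<gamma> s) (at_right 0)" by simp
  show "((\<lambda>t. a - H (\<gamma> (s + t)) p - eps * v (\<gamma> (s + t)) - D p * t) \<longlongrightarrow> a - H (\<gamma> s) p - eps * v (\<gamma> s)) (at_right 0)" for p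
  proof -
    have "((\<lambda>t. a - H (\<gamma> (s + t)) p - eps * v (\<gamma> (s + t)) - D p * t) \<longlongrightarrow> a - H (\<gamma> s) p - eps * v (\<gamma> s) - D p * 0) (at_right 0)"
      by (intro tendsto_diff tendsto_mult tendsto_const H_tendsto v_tendsto g tendsto_ident_at)
    then show ?thesis by simp
  qed
  show "eventually (\<lambda>t. q \<bullet> ((\<gamma> (s + t) - \<gamma> s) /\<^sub>R t) + e \<ge> (p - c) \<bullet> ((\<gamma> (s + t) - \<gamma> s) /\<^sub>R t) +
      (a - H (\<gamma> (s + t)) p - eps * v (\<gamma> (s + t)) - D p * t)) (at_right 0)" if e: "e > 0" for p e
  proof -
    define R' where "R' = \<bar>R\<bar> + 1"
    have R': "R' > 0" "R \<le> R'" by (auto simp: R'_def)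
    have "e / R' > 0" using e R' by simp
    then obtain d where d: "d > 0" "\<And>w. norm w < d \<Longrightarrow> v (\<gamma> s + w) \<le> v (\<gamma> s) + q \<bullet> w + e / R' * norm w"
      using q unfolding supdiff_def by blast
    have "d / R' > 0" using d(1) R' by simp
    then have "eventually (\<lambda>t. t \<in> {0<..<d / R'}) (at_right (0::real))"
      by (intro eventually_at_right_real)
    with evd show ?thesis
    proof eventually_elim
      case (elim t)
      define w where "w = \<gamma> (s + t) - \<gamma> s"
      have t: "0 < t" "t < \<delta>" "t < d / R'" using elim by auto
      have nw: "norm w \<le> R' * t"
      proof -
        have "R * t \<le> R' * t" using t R' by (intro mult_right_mono) auto
        moreover have "norm w \<le> R * t" using lip[of t] t by (simp add: w_def)
        ultimately show ?thesis by linarith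
      qed
      also have "\<dots> < d" using t R' by (simp add: pos_less_divide_eq mult.commute)
      finally have "v (\<gamma> s + w) \<le> v (\<gamma> s) + q \<bullet> w + e / R' * norm w" by (rule d(2))
      moreover have "e / R' * norm w \<le> e / R' * (R' * t)" using nw e R' by (intro mult_left_mono) auto
      moreover have "v (\<gamma> (s + t)) - v (\<gamma> s) \<ge> (p - c) \<bullet> w + t * (a - H (\<gamma> (s + t)) p - eps * v (\<gamma> (s + t))) - D p * t\<^sup>2"
      proof -
        have "s + t \<in> I" using \<delta>(2) t by auto
        from calibD(2)[OF cal sI this, of p] show ?thesis using t by (simp add: w_def)
      qed
      ultimately have "(p - c) \<bullet> w + t * (a - H (\<gamma> (s + t)) p - eps * v (\<gamma> (s + t))) - D p * t\<^sup>2 \<le> q \<bullet> w + e * t"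
        using R' by (simp add: w_def)
      then show ?case unfolding w_def[symmetric] by (rule quotient_inequality[OF t(1)])
    qed
  qed
qed (rule \<delta>(1))

end

lemma backward_derivative:
  fixes f :: "real \<Rightarrow> real"
  assumes "(f has_real_derivative b) (at s)"
  shows "((\<lambda>t. f s - f (s - t)) has_real_derivative b) (at 0 within {0..})"
proof -
  have "((\<lambda>t. s - t) has_real_derivative -1) (at (0::real))"
    by (auto intro!: derivative_eq_intros)
  moreover have "(f has_real_derivative b) (at (s - 0))" using assms by simp
  ultimately have "((\<lambda>t. f (s - t)) has_real_derivative b * -1) (at 0)"
    by (rule DERIV_chain2[rotated])
  then have "((\<lambda>t. f s - f (s - t)) has_real_derivative 0 - b * -1) (at 0)"
    by (intro derivative_intros)
  then show ?thesis by (auto intro: has_field_derivative_at_within)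
qed

context kam
begin

text \<open>Backward quotients call for a lower bound of v at the earlier point, hence for a
  derivative instead of a supergradient.\<close>

lemma calib_left_velocity:
  assumes cal: "calib R D v I \<gamma>" and \<delta>: "\<delta> > 0" "{s - \<delta>..s} \<subseteq> I"
    and q: "(v has_derivative (\<lambda>h. q \<bullet> h)) (at (\<gamma> s))"
  shows "((\<lambda>t. (\<gamma> s - \<gamma> (s - t)) /\<^sub>R t) \<longlongrightarrow> Hp H (\<gamma> s) (c + q)) (at_right 0)"
proof (rule velocity_limit[OF supdiff_sub(2)[OF supdiff_has_derivative[OF q]], where \<delta> = \<delta> and R = R and
      A = "\<lambda>p t. a - H (\<gamma> s) p - eps * v (\<gamma> s) - D p * t"])
  have sI: "s \<in> I" using \<delta> by auto
  have lip: "norm (\<gamma> s - \<gamma> (s - t)) \<le> R * t" if "0 \<le> t" "t \<le> \<delta>" for t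
    using calibD(1)[OF cal, of "s - t" s] \<delta> that by (auto simp: subset_iff)
  then show "norm ((\<gamma> s - \<gamma> (s - t)) /\<^sub>R t) \<le> R" if "0 < t" "t < \<delta>" for t
  proof -
    have "norm (\<gamma> s - \<gamma> (s - t)) / t \<le> R" using that lip[of t] by (simp add: pos_divide_le_eq)
    then show ?thesis using that by (simp add: divide_inverse_commute)
  qed
  have evd: "eventually (\<lambda>t. t \<in> {0<..<\<delta>}) (at_right (0::real))"
    using \<delta>(1) by (intro eventually_at_right_real)
  show "((\<lambda>t. a - H (\<gamma> s) p - eps * v (\<gamma> s) - D p * t) \<longlongrightarrow> a - H (\<gamma> s) p - eps * v (\<gamma> s)) (at_right 0)" for p
  proof -
    have "((\<lambda>t. a - H (\<gamma> s) p - eps * v (\<gamma> s) - D p * t) \<longlongrightarrow> a - H (\<gamma> s) p - eps * v (\<gamma> s) - D p * 0) (at_right 0)"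
      by (intro tendsto_diff tendsto_mult tendsto_const tendsto_ident_at)
    then show ?thesis by simp
  qed
  show "eventually (\<lambda>t. q \<bullet> ((\<gamma> s - \<gamma> (s - t)) /\<^sub>R t) + e \<ge> (p - c) \<bullet> ((\<gamma> s - \<gamma> (s - t)) /\<^sub>R t) +
      (a - H (\<gamma> s) p - eps * v (\<gamma> s) - D p * t)) (at_right 0)" if e: "e > 0" for p e
  proof -
    define R' where "R' = \<bar>R\<bar> + 1"
    have R': "R' > 0" "R \<le> R'" by (auto simp: R'_def)
    have "e / R' > 0" using e R' by simp
    then obtain d where d: "d > 0" "\<And>y. norm (y - \<gamma> s) < d \<Longrightarrow> norm (v y - v (\<gamma> s) - q \<bullet> (y - \<gamma> s)) \<le> e / R' * norm (y - \<gamma> s)"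
      using q unfolding has_derivative_at_alt by blast
    have "d / R' > 0" using d(1) R' by simp
    then have "eventually (\<lambda>t. t \<in> {0<..<d / R'}) (at_right (0::real))"
      by (intro eventually_at_right_real)
    with evd show ?thesis
    proof eventually_elim
      case (elim t)
      define w where "w = \<gamma> s - \<gamma> (s - t)"
      have t: "0 < t" "t < \<delta>" "t < d / R'" using elim by auto
      have nw: "norm w \<le> R' * t"
      proof -
        have "R * t \<le> R' * t" using t R' by (intro mult_right_mono) auto
        moreover have "norm w \<le> R * t" using lip[of t] t by (simp add: w_def)
        ultimately show ?thesis by linarith
      qed
      also have "\<dots> < d" using t R' by (simp add: pos_less_divide_eq mult.commute)
      finally have nwd: "norm (\<gamma> (s - t) - \<gamma> s) < d" by (simp add: w_def norm_minus_commute)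
      have "\<gamma> (s - t) - \<gamma> s = - w" by (simp add: w_def)
      then have "v (\<gamma> s) - v (\<gamma> (s - t)) \<le> q \<bullet> w + e / R' * norm w"
        using d(2)[OF nwd] by (simp add: abs_le_iff)
      moreover have "e / R' * norm w \<le> e / R' * (R' * t)" using nw e R' by (intro mult_left_mono) auto
      moreover have "v (\<gamma> s) - v (\<gamma> (s - t)) \<ge> (p - c) \<bullet> w + t * (a - H (\<gamma> s) p - eps * v (\<gamma> s)) - D p * t\<^sup>2"
      proof -
        have "s - t \<in> I" using \<delta>(2) t by auto
        from calibD(2)[OF cal this sI, of p] show ?thesis using t by (simp add: w_def)
      qed
      ultimately have "(p - c) \<bullet> w + t * (a - H (\<gamma> s) p - eps * v (\<gamma> s)) - D p * t\<^sup>2 \<le> q \<bullet> w + e * t"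
        using R' by simp
      then show ?case unfolding w_def[symmetric] by (rule quotient_inequality[OF t(1)])
    qed
  qed
qed (rule \<delta>(1))

text \<open>A calibrated curve that can be continued determines its forward velocity from every
  supergradient, and the Legendre map is injective: hence a single supergradient.\<close>

lemma calib_differentiable:
  assumes cal: "calib R D v I \<gamma>" and \<delta>: "\<delta> > 0" "{s..s + \<delta>} \<subseteq> I"
  shows "(v has_derivative (\<lambda>h. grad v (\<gamma> s) \<bullet> h)) (at (\<gamma> s))" "sg (grad v (\<gamma> s)) (\<gamma> s)"
proof -
  obtain q where q: "sg q (\<gamma> s)" using sg_ex by blast
  have uniq: "q' = q" if "sg q' (\<gamma> s)" for q'
  proof -
    have "Hp H (\<gamma> s) (c + q') = Hp H (\<gamma> s) (c + q)"
      using calib_right_velocity[OF cal \<delta> sg_supdiff[OF that]] calib_right_velocity[OF cal \<delta> sg_supdiff[OF q]]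
      by (rule tendsto_unique[OF trivial_limit_at_right_real])
    then have "c + q' = c + q" by (rule Hp_inj)
    then show ?thesis by simp
  qed
  have D: "(v has_derivative (\<lambda>h. q \<bullet> h)) (at (\<gamma> s))"
    using q uniq by (rule sg_unique_differentiable)
  then have "grad v (\<gamma> s) = q" by (rule grad_eqI)
  then show "(v has_derivative (\<lambda>h. grad v (\<gamma> s) \<bullet> h)) (at (\<gamma> s))" "sg (grad v (\<gamma> s)) (\<gamma> s)"
    using D q by auto
qed

lemma calib_velocity:
  assumes cal: "calib R D v I \<gamma>" and \<delta>: "\<delta> > 0" "{s - \<delta>..s + \<delta>} \<subseteq> I"
  shows "(\<gamma> has_vector_derivative Hp H (\<gamma> s) (c + grad v (\<gamma> s))) (at s)"
proof (rule has_vector_derivative_quotient, rule filterlim_split_at)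
  have 1: "{s..s + \<delta>} \<subseteq> I" "{s - \<delta>..s} \<subseteq> I" using \<delta> by (auto simp: subset_iff)
  note D = calib_differentiable(1)[OF cal \<delta>(1) 1(1)]
  show "((\<lambda>h. (\<gamma> (s + h) - \<gamma> s) /\<^sub>R h) \<longlongrightarrow> Hp H (\<gamma> s) (c + grad v (\<gamma> s))) (at_right 0)"
    by (rule calib_right_velocity[OF cal \<delta>(1) 1(1) supdiff_has_derivative[OF D]])
  have "((\<lambda>t. (\<gamma> s - \<gamma> (s - t)) /\<^sub>R t) \<longlongrightarrow> Hp H (\<gamma> s) (c + grad v (\<gamma> s))) (at_right 0)"
    by (rule calib_left_velocity[OF cal \<delta>(1) 1(2) D])
  moreover have "(\<gamma> s - \<gamma> (s - t)) /\<^sub>R t = (\<gamma> (s + - t) - \<gamma> s) /\<^sub>R (- t)" for t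
    by (simp add: scaleR_diff_right)
  ultimately have "((\<lambda>t. (\<gamma> (s + - t) - \<gamma> s) /\<^sub>R (- t)) \<longlongrightarrow> Hp H (\<gamma> s) (c + grad v (\<gamma> s))) (at_right 0)"
    by simp
  then show "((\<lambda>h. (\<gamma> (s + h) - \<gamma> s) /\<^sub>R h) \<longlongrightarrow> Hp H (\<gamma> s) (c + grad v (\<gamma> s))) (at_left 0)"
    by (subst at_left_minus) (simp add: filterlim_filtermap)
qed

lemma calib_velocity_bounded:
  assumes "(v has_derivative (\<lambda>h. q \<bullet> h)) (at x)"
  shows "norm (c + q) \<le> P0" "norm (Hp H x (c + q)) \<le> R0"
  using supdiff_sub(1)[OF supdiff_has_derivative[OF assms]] R0(2) by auto

text \<open>Limits of supergradients are supergradients by closed graph, and the derivative at x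
  admits only one.\<close>

lemma sg_grad_tendsto:
  assumes x: "X \<longlonglongrightarrow> x" and sg: "\<And>n. sg (Q n) (X n)"
    and D: "(v has_derivative (\<lambda>h. q \<bullet> h)) (at x)"
  shows "Q \<longlonglongrightarrow> q"
proof (rule bounded_unique_limit)
  show "norm (Q n) \<le> P0 + norm c" for n by (rule sg_bounded[OF sg])
  fix r l assume r: "strict_mono (r :: nat \<Rightarrow> nat)" "(\<lambda>n. Q (r n)) \<longlonglongrightarrow> l"
  have "(\<lambda>n. X (r n)) \<longlonglongrightarrow> x" using LIMSEQ_subseq_LIMSEQ[OF x r(1)] by (simp add: o_def)
  then have "sg l x" using sg_closed[of "\<lambda>n. Q (r n)" "\<lambda>n. X (r n)"] sg r(2) by simp
  then show "l = q" using supdiff_unique[OF D sg_supdiff] by simp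
qed

lemma calib_continuous:
  assumes "calib R D v I \<gamma>" shows "continuous_on I \<gamma>"
proof -
  have "\<bar>R\<bar>-lipschitz_on I \<gamma>"
  proof (rule lipschitz_onI)
    fix s t assume "s \<in> I" "t \<in> I"
    then have "norm (\<gamma> s - \<gamma> t) \<le> R * \<bar>s - t\<bar>" by (intro calibD(1)[OF assms])
    also have "\<dots> \<le> \<bar>R\<bar> * \<bar>s - t\<bar>" by (intro mult_right_mono) auto
    finally show "dist (\<gamma> s) (\<gamma> t) \<le> \<bar>R\<bar> * dist s t" by (simp add: dist_norm)
  qed simp
  then show ?thesis by (rule lipschitz_on_continuous_on)
qed

lemma calib_grad_continuous:
  assumes cal: "calib R D v I \<gamma>" and J: "\<And>s. s \<in> J \<Longrightarrow> s \<in> I \<and> (\<exists>\<delta>>0. {s..s + \<delta>} \<subseteq> I)"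
  shows "continuous_on J (\<lambda>s. grad v (\<gamma> s))"
  unfolding continuous_on_sequentially comp_def
proof (intro allI ballI impI)
  fix S :: "nat \<Rightarrow> real" and s assume s: "s \<in> J" and S: "(\<forall>n. S n \<in> J) \<and> S \<longlonglongrightarrow> s"
  have "continuous_on J \<gamma>" using calib_continuous[OF cal] J by (meson continuous_on_subset subsetI)
  then have "(\<lambda>n. \<gamma> (S n)) \<longlonglongrightarrow> \<gamma> s" using S s by (auto simp: continuous_on_sequentially comp_def)
  moreover have "sg (grad v (\<gamma> (S n))) (\<gamma> (S n))" for n
    using J[of "S n"] S calib_differentiable(2)[OF cal] by blast
  moreover have "(v has_derivative (\<lambda>h. grad v (\<gamma> s) \<bullet> h)) (at (\<gamma> s))"
    using J[OF s] calib_differentiable(1)[OF cal] by blast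
  ultimately show "(\<lambda>n. grad v (\<gamma> (S n))) \<longlonglongrightarrow> grad v (\<gamma> s)" by (rule sg_grad_tendsto)
qed

section \<open>Domination along absolutely continuous curves\<close>

text \<open>The truncation max R0 |\<xi>| admits the given velocity. The constant depends on \<xi>,
  which is harmless where one velocity is considered at one point.\<close>

lemma domination_const:
  "\<exists>C\<ge>0. \<forall>x t. 0 \<le> t \<longrightarrow> v x - v (x - t *\<^sub>R \<xi>) \<le> t * (ell x \<xi> - eps * v x) + C * t\<^sup>2"
proof -
  have "weak_sol (max R0 (norm \<xi>)) v" by (intro weak) simp
  then obtain C where "C \<ge> 0" "\<forall>x \<xi>' t. norm \<xi>' \<le> max R0 (norm \<xi>) \<longrightarrow> 0 \<le> t \<longrightarrow>
       v x - v (x - t *\<^sub>R \<xi>') \<le> t * (ell x \<xi>' - eps * v x) + C * t\<^sup>2"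
    unfolding weak_sol_def by blast
  then show ?thesis by (intro exI[of _ C]) auto
qed

text \<open>Near s the curve deviates from its tangent segment by at most e t; Lipschitz continuity
  of v makes this an error e Lv t, and the segment is dominated.\<close>

lemma derivative_along_le:
  assumes \<eta>: "(\<eta> has_vector_derivative \<xi>) (at s)" and b: "((\<lambda>t. v (\<eta> t)) has_real_derivative b) (at s)"
  shows "b \<le> ell (\<eta> s) \<xi> - eps * v (\<eta> s)"
proof -
  obtain C where C: "\<And>x t. 0 \<le> t \<Longrightarrow> v x - v (x - t *\<^sub>R \<xi>) \<le> t * (ell x \<xi> - eps * v x) + C * t\<^sup>2"
    using domination_const[of \<xi>] by blast
  have "b - (ell (\<eta> s) \<xi> - eps * v (\<eta> s)) \<le> e * Lv" if e: "e > 0" for e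
  proof -
    obtain d where d: "d > 0" "\<And>y. norm (y - s) < d \<Longrightarrow> norm (\<eta> y - \<eta> s - (y - s) *\<^sub>R \<xi>) \<le> e * norm (y - s)"
      using \<eta> e unfolding has_vector_derivative_def has_derivative_at_alt by blast
    have le: "(v (\<eta> s) - v (\<eta> (s - t))) - (v (\<eta> s) - v (\<eta> (s - 0))) \<le> (ell (\<eta> s) \<xi> - eps * v (\<eta> s) + e * Lv) * t + C * t\<^sup>2"
      if t: "0 < t" "t < d" for t
    proof -
      have "\<bar>v (\<eta> s - t *\<^sub>R \<xi>) - v (\<eta> (s - t))\<bar> \<le> Lv * norm (\<eta> s - t *\<^sub>R \<xi> - \<eta> (s - t))" by (rule Lv(2))
      also have "norm (\<eta> s - t *\<^sub>R \<xi> - \<eta> (s - t)) = norm (\<eta> (s - t) - \<eta> s - ((s - t) - s) *\<^sub>R \<xi>)"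
        by (subst norm_minus_commute) (simp add: algebra_simps)
      also have "Lv * \<dots> \<le> Lv * (e * t)" using d(2)[of "s - t"] t Lv(1) by (intro mult_left_mono) auto
      finally have "v (\<eta> s - t *\<^sub>R \<xi>) - v (\<eta> (s - t)) \<le> Lv * (e * t)" by linarith
      then show ?thesis using C[of t "\<eta> s"] t by (simp add: algebra_simps)
    qed
    have "b \<le> ell (\<eta> s) \<xi> - eps * v (\<eta> s) + e * Lv"
      by (rule right_derivative_le[OF backward_derivative[OF b] d(1), where C = C]) (rule le)
    then show ?thesis by simp
  qed
  then have "b - (ell (\<eta> s) \<xi> - eps * v (\<eta> s)) \<le> 0" by (rule le_zero_if_le_eps)
  then show ?thesis by simp
qed

text \<open>The reverse inequality is calibration with p = mom (\<eta> s) \<xi>, the momentum for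
  which Fenchel's inequality is an equality.\<close>

lemma derivative_along_calib:
  assumes cal: "calib R D v I \<eta>" and \<delta>: "\<delta> > 0" "{s - \<delta>..s} \<subseteq> I"
    and \<eta>: "(\<eta> has_vector_derivative \<xi>) (at s)" and b: "((\<lambda>t. v (\<eta> t)) has_real_derivative b) (at s)"
  shows "b = ell (\<eta> s) \<xi> - eps * v (\<eta> s)"
proof (rule antisym)
  show "b \<le> ell (\<eta> s) \<xi> - eps * v (\<eta> s)" by (rule derivative_along_le[OF \<eta> b])
  define p where "p = mom (\<eta> s) \<xi>"
  have e: "ell (\<eta> s) \<xi> = (p - c) \<bullet> \<xi> + (a - H (\<eta> s) p)"
    unfolding ell_def lagr_eq p_def[symmetric] by (simp add: inner_diff_left inner_commute[of \<xi> p])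
  have "((\<lambda>t. (p - c) \<bullet> \<eta> t) has_derivative (\<lambda>h. (p - c) \<bullet> (h *\<^sub>R \<xi>))) (at s)"
    using \<eta> unfolding has_vector_derivative_def by (rule has_derivative_inner_right)
  then have "((\<lambda>t. (p - c) \<bullet> \<eta> t) has_real_derivative (p - c) \<bullet> \<xi>) (at s)"
    by (simp add: has_field_derivative_def mult_commute_abs)
  then have "((\<lambda>t. (p - c) \<bullet> \<eta> t - v (\<eta> t)) has_real_derivative (p - c) \<bullet> \<xi> - b) (at s)"
    using b by (intro derivative_intros)
  from backward_derivative[OF this]
  have der: "((\<lambda>t. ((p - c) \<bullet> \<eta> s - v (\<eta> s)) - ((p - c) \<bullet> \<eta> (s - t) - v (\<eta> (s - t)))) has_real_derivative (p - c) \<bullet> \<xi> - b) (at 0 within {0..})" .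
  have "(p - c) \<bullet> \<xi> - b \<le> - (a - H (\<eta> s) p - eps * v (\<eta> s))"
  proof (rule right_derivative_le[OF der \<delta>(1), where C = "D p"])
    fix t assume t: "0 < t" "t < \<delta>"
    have "v (\<eta> s) - v (\<eta> (s - t)) \<ge> (p - c) \<bullet> (\<eta> s - \<eta> (s - t)) + t * (a - H (\<eta> s) p - eps * v (\<eta> s)) - D p * t\<^sup>2"
    proof -
      have "s - t \<in> I" "s \<in> I" using \<delta> t by auto
      from calibD(2)[OF cal this, of p] show ?thesis using t by simp
    qed
    then show "((p - c) \<bullet> \<eta> s - v (\<eta> s)) - ((p - c) \<bullet> \<eta> (s - t) - v (\<eta> (s - t))) - (((p - c) \<bullet> \<eta> s - v (\<eta> s)) - ((p - c) \<bullet> \<eta> (s - 0) - v (\<eta> (s - 0))))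
        \<le> - (a - H (\<eta> s) p - eps * v (\<eta> s)) * t + D p * t\<^sup>2"
      by (simp add: inner_diff_right algebra_simps)
  qed
  then show "ell (\<eta> s) \<xi> - eps * v (\<eta> s) \<le> b" unfolding e by simp
qed

lemma abs_cont_on_v:
  assumes "abs_cont_on lo hi \<eta>"
  shows "abs_cont_on lo hi (\<lambda>s. v (\<eta> s))"
  using assms by (rule abs_cont_on_dominated[of lo hi \<eta> Lv 0]) (use Lv in \<open>auto intro: less_imp_le\<close>)

text \<open>With the discount factor the term eps v is absorbed: domination and calibration compare
  the derivative of \<open>disc \<eta>\<close> with the running cost of the action.\<close>

definition disc :: "(real \<Rightarrow> real^'n) \<Rightarrow> real \<Rightarrow> real" where
  "disc \<eta> s = exp (eps * s) * v (\<eta> s)"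

lemma abs_cont_on_disc:
  assumes ac: "abs_cont_on lo hi \<eta>"
  shows "abs_cont_on lo hi (disc \<eta>)"
proof -
  obtain B where B: "B > 0" "\<And>x. \<bar>v x\<bar> \<le> B" using v_bounded by blast
  have E: "exp (eps * t) - exp (eps * s) \<le> eps * exp (eps * hi) * (t - s)" if "s \<le> t" "t \<le> hi" for s t
  proof -
    have "1 + eps * (s - t) \<le> exp (eps * (s - t))" by (rule exp_ge_add_one_self)
    then have "exp (eps * t) * (1 + eps * (s - t)) \<le> exp (eps * t) * exp (eps * (s - t))"
      by (intro mult_left_mono) auto
    also have "\<dots> = exp (eps * s)" by (simp add: exp_add[symmetric] algebra_simps)
    finally have "exp (eps * t) - exp (eps * s) \<le> exp (eps * t) * (eps * (t - s))" by (simp add: algebra_simps)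
    also have "\<dots> \<le> exp (eps * hi) * (eps * (t - s))" using that eps by (intro mult_right_mono) auto
    finally show ?thesis by (simp add: algebra_simps)
  qed
  show ?thesis
  proof (rule abs_cont_on_dominated[OF ac, of "exp (eps * hi) * Lv" "B * (eps * exp (eps * hi))"])
    fix s t assume st: "lo \<le> s" "s \<le> t" "t \<le> hi"
    have "disc \<eta> t - disc \<eta> s = exp (eps * t) * (v (\<eta> t) - v (\<eta> s)) + (exp (eps * t) - exp (eps * s)) * v (\<eta> s)"
      by (simp add: disc_def algebra_simps)
    then have "norm (disc \<eta> t - disc \<eta> s) \<le> exp (eps * t) * \<bar>v (\<eta> t) - v (\<eta> s)\<bar> + \<bar>exp (eps * t) - exp (eps * s)\<bar> * \<bar>v (\<eta> s)\<bar>"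
      using abs_triangle_ineq[of "exp (eps * t) * (v (\<eta> t) - v (\<eta> s))" "(exp (eps * t) - exp (eps * s)) * v (\<eta> s)"]
      by (simp add: abs_mult)
    also have "\<dots> \<le> exp (eps * hi) * (Lv * norm (\<eta> t - \<eta> s)) + (eps * exp (eps * hi) * (t - s)) * B"
    proof (intro add_mono mult_mono)
      show "\<bar>exp (eps * t) - exp (eps * s)\<bar> \<le> eps * exp (eps * hi) * (t - s)" using E[OF st(2,3)] eps st by simp
    qed (use st eps B Lv(2)[of "\<eta> t" "\<eta> s"] in auto)
    finally show "norm (disc \<eta> t - disc \<eta> s) \<le> exp (eps * hi) * Lv * norm (\<eta> t - \<eta> s) + B * (eps * exp (eps * hi)) * (t - s)"
      by (simp add: algebra_simps)
  qed (use Lv(1) B(1) eps in auto)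
qed

lemma disc_derivative:
  assumes "((\<lambda>t. v (\<eta> t)) has_real_derivative b) (at s)"
  shows "(disc \<eta> has_real_derivative exp (eps * s) * (b + eps * v (\<eta> s))) (at s)"
  unfolding disc_def by (auto intro!: derivative_eq_intros assms simp: algebra_simps)

lemma curve_AE:
  assumes ac: "abs_cont_on lo hi \<eta>"
  obtains N b where "negligible N" "\<And>s. s \<in> {lo<..<hi} - N \<Longrightarrow>
    (\<eta> has_vector_derivative vector_derivative \<eta> (at s)) (at s) \<and> ((\<lambda>t. v (\<eta> t)) has_real_derivative b s) (at s)"
proof -
  define N where "N = {s \<in> {lo<..<hi}. \<not> \<eta> differentiable (at s)} \<union> {s \<in> {lo<..<hi}. \<not> (\<lambda>t. v (\<eta> t)) differentiable (at s)}"
  have "negligible N"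
    unfolding N_def using abs_cont_on_differentiable_AE[OF ac] abs_cont_on_differentiable_AE_real[OF abs_cont_on_v[OF ac]]
    by (rule negligible_Un)
  moreover have "(\<eta> has_vector_derivative vector_derivative \<eta> (at s)) (at s) \<and>
      ((\<lambda>t. v (\<eta> t)) has_real_derivative deriv (\<lambda>t. v (\<eta> t)) s) (at s)" if "s \<in> {lo<..<hi} - N" for s
    using that unfolding N_def
    by (auto simp: vector_derivative_works[symmetric] DERIV_deriv_iff_real_differentiable)
  ultimately show ?thesis by (rule that)
qed

text \<open>\<open>derivative_along_le\<close> holds at almost every time and integrates by
  \<open>abs_cont_on_has_integral\<close>. The open interval in \<open>Feq\<close> leaves aside the
  endpoints, where \<open>integrand\<close> uses one-sided derivatives.\<close>

theorem domination:
  assumes ac: "abs_cont_on lo hi \<eta>" and lohi: "lo \<le> hi" and N: "negligible N"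
    and F: "F integrable_on {lo..hi}"
    and Feq: "\<And>s. s \<in> {lo<..<hi} - N \<Longrightarrow> F s = exp (eps * s) * ell (\<eta> s) (vector_derivative \<eta> (at s))"
  shows "disc \<eta> hi - disc \<eta> lo \<le> integral {lo..hi} F"
proof -
  obtain N1 b where N1: "negligible N1" and D: "\<And>s. s \<in> {lo<..<hi} - N1 \<Longrightarrow>
    (\<eta> has_vector_derivative vector_derivative \<eta> (at s)) (at s) \<and> ((\<lambda>t. v (\<eta> t)) has_real_derivative b s) (at s)"
    using curve_AE[OF ac] by blast
  define g where "g = (\<lambda>s. exp (eps * s) * (b s + eps * v (\<eta> s)))"
  have "(g has_integral (disc \<eta> hi - disc \<eta> lo)) {lo..hi}"
    unfolding g_def
    by (rule abs_cont_on_has_integral[OF abs_cont_on_disc[OF ac] lohi N1]) (use D disc_derivative in blast)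
  then have 1: "((\<lambda>s. if s \<in> N \<union> N1 \<union> {lo, hi} then F s else g s) has_integral (disc \<eta> hi - disc \<eta> lo)) {lo..hi}"
  proof (rule has_integral_spike[of "N \<union> N1 \<union> {lo, hi}" "{lo..hi}" _ g, rotated 2])
    show "negligible (N \<union> N1 \<union> {lo, hi})" by (intro negligible_Un N N1) auto
  qed simp
  show ?thesis
  proof (rule has_integral_le[OF 1 integrable_integral[OF F]])
    fix s assume s: "s \<in> {lo..hi}"
    show "(if s \<in> N \<union> N1 \<union> {lo, hi} then F s else g s) \<le> F s"
    proof (cases "s \<in> N \<union> N1 \<union> {lo, hi}")
      case False
      then have s': "s \<in> {lo<..<hi} - N" "s \<in> {lo<..<hi} - N1" using s by auto
      have "b s \<le> ell (\<eta> s) (vector_derivative \<eta> (at s)) - eps * v (\<eta> s)"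
        using D[OF s'(2)] by (intro derivative_along_le) auto
      then have "g s \<le> F s" unfolding g_def Feq[OF s'(1)] by (intro mult_left_mono) auto
      then show ?thesis using False by simp
    qed simp
  qed
qed

end

section \<open>Minimizing curves are calibrated\<close>

lemma nonneg_integral_zero_negligible:
  fixes h :: "real \<Rightarrow> real"
  assumes int: "(h has_integral 0) {a..b}" and nn: "\<And>x. x \<in> {a..b} \<Longrightarrow> h x \<ge> 0"
  shows "negligible {x \<in> {a..b}. h x \<noteq> 0}"
proof -
  have ai: "h absolutely_integrable_on {a..b}"
    using int nn by (intro nonnegative_absolutely_integrable_1) (auto simp: integrable_on_def)
  then have i: "integrable lebesgue (\<lambda>x. indicator {a..b} x *\<^sub>R h x)" by (simp add: set_integrable_def)
  have "integral\<^sup>L lebesgue (\<lambda>x. indicator {a..b} x *\<^sub>R h x) = 0"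
    using set_lebesgue_integral_eq_integral(2)[OF ai] int by (simp add: set_lebesgue_integral_def integral_unique)
  then have "AE x in lebesgue. indicator {a..b} x *\<^sub>R h x = 0"
    using nn by (subst (asm) integral_nonneg_eq_0_iff_AE[OF i]) (auto simp: indicator_def)
  then obtain N where N: "\<And>x. x \<in> space lebesgue - N \<Longrightarrow> indicator {a..b} x *\<^sub>R h x = 0" "N \<in> null_sets lebesgue"
    using AE_E3 by blast
  have "{x \<in> {a..b}. h x \<noteq> 0} \<subseteq> N"
  proof
    fix x assume "x \<in> {x \<in> {a..b}. h x \<noteq> 0}"
    then have "\<not> indicator {a..b} x *\<^sub>R h x = 0" by simp
    then show "x \<in> N" using N(1)[of x] by auto
  qed
  then show ?thesis using N(2) by (meson negligible_iff_null_sets negligible_subset)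
qed

lemma abs_cont_on_le:
  fixes f :: "real \<Rightarrow> real"
  assumes ac: "abs_cont_on a b f" and ab: "a \<le> b" and N: "negligible N"
    and deriv: "\<And>x. x \<in> {a<..<b} - N \<Longrightarrow> (f has_real_derivative f' x) (at x) \<and> f' x \<le> M"
  shows "f b - f a \<le> M * (b - a)"
proof -
  have 1: "(f' has_integral (f b - f a)) {a..b}"
    by (rule abs_cont_on_has_integral[OF ac ab N]) (use deriv in blast)
  have N': "negligible (N \<union> {a, b})" by (intro negligible_Un N) auto
  have 2: "((\<lambda>x. if x \<in> N \<union> {a, b} then M else f' x) has_integral (f b - f a)) {a..b}"
    by (rule has_integral_spike[OF N' _ 1]) simp
  have 3: "((\<lambda>x. M) has_integral (M * (b - a))) {a..b}"
    using has_integral_const_real[of M a b] ab by (simp add: mult.commute)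
  show ?thesis
  proof (rule has_integral_le[OF 2 3])
    fix x assume "x \<in> {a..b}"
    then show "(if x \<in> N \<union> {a, b} then M else f' x) \<le> M"
      using deriv[of x] by (cases "x \<in> N \<union> {a, b}") auto
  qed
qed

locale kam_eps = kam H c "hcrit H c" eps "veps H c eps" for H :: "real^'n \<Rightarrow> real^'n \<Rightarrow> real" and c eps
begin

abbreviation v :: "real^'n \<Rightarrow> real" where "v \<equiv> veps H c eps"

definition vel :: "real^'n \<Rightarrow> real^'n" where "vel x = Hp H x (c + grad v x)"

lemma integrand_eq:
  assumes "- T < s" "s < 0"
  shows "integrand H c eps T \<eta> s = exp (eps * s) * ell (\<eta> s) (vector_derivative \<eta> (at s))"
proof -
  have "at s within {- T..0} = at s"
    using assms by (intro at_within_interior) (auto simp: interior_atLeastAtMost_real)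
  then show ?thesis by (simp add: integrand_def ell_def)
qed

lemma action_ge:
  assumes adm: "admissible H c eps T \<eta>" and T: "T > 0"
  shows "v (\<eta> 0) \<le> action H c eps T \<eta>"
proof -
  have "disc \<eta> 0 - disc \<eta> (- T) \<le> integral {- T..0} (integrand H c eps T \<eta>)"
  proof (rule domination[of _ _ _ "{}"])
    show "abs_cont_on (- T) 0 \<eta>" using adm by (simp add: admissible_def)
    show "integrand H c eps T \<eta> integrable_on {- T..0}"
      using adm by (simp add: admissible_def absolutely_integrable_on_def)
    show "integrand H c eps T \<eta> s = exp (eps * s) * ell (\<eta> s) (vector_derivative \<eta> (at s))" if "s \<in> {- T<..<0} - {}" for s
      using that by (intro integrand_eq) auto
  qed (use T in auto)
  then show ?thesis by (simp add: action_def disc_def)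
qed

lemma calib_disc_derivative:
  assumes cal: "calib R D v I \<gamma>" and \<delta>: "\<delta> > 0" "{s - \<delta>..s + \<delta>} \<subseteq> I"
  shows "(disc \<gamma> has_real_derivative exp (eps * s) * ell (\<gamma> s) (vel (\<gamma> s))) (at s)"
    and "(\<gamma> has_vector_derivative vel (\<gamma> s)) (at s)" "norm (vel (\<gamma> s)) \<le> R0"
    and "mom (\<gamma> s) (vel (\<gamma> s)) = c + grad v (\<gamma> s)"
proof -
  have 1: "{s..s + \<delta>} \<subseteq> I" "{s - \<delta>..s} \<subseteq> I" using \<delta> by (auto simp: subset_iff)
  note D = calib_differentiable(1)[OF cal \<delta>(1) 1(1)]
  show g: "(\<gamma> has_vector_derivative vel (\<gamma> s)) (at s)"
    unfolding vel_def by (rule calib_velocity[OF cal \<delta>])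
  show "norm (vel (\<gamma> s)) \<le> R0" unfolding vel_def by (rule calib_velocity_bounded(2)[OF D])
  show "mom (\<gamma> s) (vel (\<gamma> s)) = c + grad v (\<gamma> s)" by (simp add: vel_def)
  have "((\<lambda>t. v (\<gamma> t)) has_derivative (\<lambda>h. grad v (\<gamma> s) \<bullet> (h *\<^sub>R vel (\<gamma> s)))) (at s)"
    using has_derivative_compose[OF g[unfolded has_vector_derivative_def] D] .
  then have b: "((\<lambda>t. v (\<gamma> t)) has_real_derivative grad v (\<gamma> s) \<bullet> vel (\<gamma> s)) (at s)"
    by (simp add: has_field_derivative_def mult_commute_abs)
  have "grad v (\<gamma> s) \<bullet> vel (\<gamma> s) = ell (\<gamma> s) (vel (\<gamma> s)) - eps * v (\<gamma> s)"
    by (rule derivative_along_calib[OF cal \<delta>(1) 1(2) g b])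
  then show "(disc \<gamma> has_real_derivative exp (eps * s) * ell (\<gamma> s) (vel (\<gamma> s))) (at s)"
    using disc_derivative[OF b] by simp
qed

lemma calib_abs_cont:
  assumes cal: "calib R D v I \<gamma>" and "{lo..hi} \<subseteq> I"
  shows "abs_cont_on lo hi \<gamma>"
proof (rule Lipschitz_abs_cont_on[of "\<bar>R\<bar>"])
  fix s t assume st: "lo \<le> s" "s \<le> t" "t \<le> hi"
  then have "norm (\<gamma> t - \<gamma> s) \<le> R * \<bar>t - s\<bar>" using assms by (intro calibD(1)[OF cal]) auto
  also have "\<dots> \<le> \<bar>R\<bar> * (t - s)" using st by (simp add: mult_right_mono)
  finally show "norm (\<gamma> t - \<gamma> s) \<le> \<bar>R\<bar> * (t - s)" .
qed simp

lemma ell_bounded: "\<exists>C>0. \<forall>x \<xi>. norm \<xi> \<le> R \<longrightarrow> \<bar>ell x \<xi>\<bar> \<le> C"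
proof -
  obtain C where C: "C > 0" "\<And>x \<xi>. norm \<xi> \<le> R \<Longrightarrow> \<bar>lagr H x \<xi>\<bar> \<le> C" using lagr_bounded[of R] by blast
  have "\<bar>ell x \<xi>\<bar> \<le> C + norm c * \<bar>R\<bar> + \<bar>hcrit H c\<bar>" if \<xi>: "norm \<xi> \<le> R" for x \<xi>
  proof -
    have "\<bar>c \<bullet> \<xi>\<bar> \<le> norm c * norm \<xi>" by (rule Cauchy_Schwarz_ineq2)
    also have "\<dots> \<le> norm c * \<bar>R\<bar>" using \<xi> by (intro mult_left_mono) auto
    finally show ?thesis using C(2)[OF \<xi>, of x] unfolding ell_def by linarith
  qed
  moreover have "C + norm c * \<bar>R\<bar> + \<bar>hcrit H c\<bar> > 0"
    using C(1) by (intro add_pos_nonneg) auto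
  ultimately show ?thesis by blast
qed

text \<open>For a calibrated curve the inequality behind \<open>domination\<close> is an equality on
  all of (-T, 0), so its action equals v at the end point, the lower bound in
  \<open>action_ge\<close>.\<close>

lemma calib_minimizing:
  assumes cal: "calib R D v {..0} \<gamma>"
  shows "minimizing H c eps (\<gamma> 0) \<gamma>"
  unfolding minimizing_def
proof (intro conjI allI impI)
  fix T :: real assume T: "T > 0"
  have sub: "{- T..0} \<subseteq> {..0}" by auto
  have ac: "abs_cont_on (- T) 0 \<gamma>" by (rule calib_abs_cont[OF cal sub])
  define g where "g = (\<lambda>s. exp (eps * s) * ell (\<gamma> s) (vel (\<gamma> s)))"
  have D: "(disc \<gamma> has_real_derivative g s) (at s)" "(\<gamma> has_vector_derivative vel (\<gamma> s)) (at s)" "norm (vel (\<gamma> s)) \<le> R0" if "s < 0" for s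
  proof -
    have "- s > 0" "{s - (- s)..s + (- s)} \<subseteq> {..0}" using that by auto
    from calib_disc_derivative(1-3)[OF cal this] show "(disc \<gamma> has_real_derivative g s) (at s)" "(\<gamma> has_vector_derivative vel (\<gamma> s)) (at s)" "norm (vel (\<gamma> s)) \<le> R0"
      by (auto simp: g_def)
  qed
  have 1: "(g has_integral (disc \<gamma> 0 - disc \<gamma> (- T))) {- T..0}"
    by (rule abs_cont_on_has_integral[OF abs_cont_on_disc[OF ac], of "{}"]) (use T D(1) in auto)
  have eq: "integrand H c eps T \<gamma> s = g s" if "s \<in> {- T..0} - {- T, 0}" for s
  proof -
    have s: "- T < s" "s < 0" using that by auto
    then show ?thesis using integrand_eq[OF s, of \<gamma>] vector_derivative_at[OF D(2)[OF s(2)]] by (simp add: g_def)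
  qed
  have neg: "negligible {- T, 0}" by simp
  have 2: "(integrand H c eps T \<gamma> has_integral (disc \<gamma> 0 - disc \<gamma> (- T))) {- T..0}"
    by (rule has_integral_spike[OF neg eq 1])
  obtain C where C: "C > 0" "\<And>x \<xi>. norm \<xi> \<le> R0 \<Longrightarrow> \<bar>ell x \<xi>\<bar> \<le> C" using ell_bounded[of R0] by blast
  have "(\<lambda>s. if s \<in> {- T, 0} then 0 else g s) absolutely_integrable_on {- T..0}"
  proof (rule absolutely_integrable_integrable_bound)
    show "norm (if s \<in> {- T, 0} then 0 else g s) \<le> C" if s: "s \<in> {- T..0}" for s
    proof (cases "s \<in> {- T, 0}")
      case False
      then have "s < 0" using s by auto
      have "norm (g s) \<le> 1 * C"
        unfolding g_def norm_mult using C(2)[OF D(3)[OF \<open>s < 0\<close>]] \<open>s < 0\<close> eps C(1)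
        by (intro mult_mono) (auto simp: mult_nonneg_nonpos)
      then show ?thesis using False by simp
    qed (use C(1) in auto)
    show "(\<lambda>s. if s \<in> {- T, 0} then 0 else g s) integrable_on {- T..0}"
      using has_integral_spike[OF neg _ 1, of "\<lambda>s. if s \<in> {- T, 0} then 0 else g s"] by (auto simp: integrable_on_def)
    show "(\<lambda>s. C) integrable_on {- T..0}" by (simp add: integrable_const_ivl)
  qed
  then have "integrand H c eps T \<gamma> absolutely_integrable_on {- T..0}"
    by (rule absolutely_integrable_spike[OF _ neg]) (use eq in auto)
  then show adm: "admissible H c eps T \<gamma>" using ac by (simp add: admissible_def)
  have act: "action H c eps T \<gamma> = v (\<gamma> 0)"
    using integral_unique[OF 2] by (simp add: action_def disc_def)
  fix \<eta> assume "\<eta> 0 = \<gamma> 0 \<and> admissible H c eps T \<eta>"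
  then show "action H c eps T \<gamma> \<le> action H c eps T \<eta>"
    using action_ge[of T \<eta>] T act by simp
qed simp

lemma minimizing_ex: "\<exists>\<gamma>. minimizing H c eps x \<gamma>"
proof -
  obtain D where "\<forall>x. \<exists>\<gamma>. \<gamma> 0 = x \<and> calib R0 D v {..0} \<gamma>"
    using weak[OF order_refl] unfolding weak_sol_def by blast
  then obtain \<gamma> where "\<gamma> 0 = x" "calib R0 D v {..0} \<gamma>" by blast
  then show ?thesis using calib_minimizing by blast
qed

text \<open>Optimality by itself only compares curves; a calibrated competitor from the same point
  shows that the minimum is v x.\<close>

lemma minimizing_action:
  assumes m: "minimizing H c eps x \<gamma>" and T: "T > 0"
  shows "action H c eps T \<gamma> = v x"
proof -
  obtain D where "\<forall>x. \<exists>\<gamma>. \<gamma> 0 = x \<and> calib R0 D v {..0} \<gamma>"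
    using weak[OF order_refl] unfolding weak_sol_def by blast
  then obtain \<eta> where \<eta>: "\<eta> 0 = x" "calib R0 D v {..0} \<eta>" by blast
  have sub: "{- T..0} \<subseteq> {..0}" by auto
  have ac: "abs_cont_on (- T) 0 \<eta>" by (rule calib_abs_cont[OF \<eta>(2) sub])
  have mg: "\<gamma> 0 = x" "admissible H c eps T \<gamma>" "\<And>\<eta>. \<eta> 0 = x \<Longrightarrow> admissible H c eps T \<eta> \<Longrightarrow> action H c eps T \<gamma> \<le> action H c eps T \<eta>"
    using m T unfolding minimizing_def by blast+
  have me: "minimizing H c eps x \<eta>" using calib_minimizing[OF \<eta>(2)] \<eta>(1) by simp
  then have "admissible H c eps T \<eta>" using T unfolding minimizing_def by blast
  then have "action H c eps T \<gamma> \<le> action H c eps T \<eta>" using mg(3) \<eta>(1) by blast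
  also have "action H c eps T \<eta> \<le> v x"
  proof -
    have "disc \<eta> 0 - disc \<eta> (- T) = integral {- T..0} (integrand H c eps T \<eta>)"
    proof (rule integral_unique[symmetric], rule abs_cont_on_has_integral[OF abs_cont_on_disc[OF ac], of "{}"])
      fix s assume s: "s \<in> {- T<..<0} - {}"
      then have s': "- T < s" "s < 0" by auto
      have "- s > 0" "{s - (- s)..s + (- s)} \<subseteq> {..0}" using s' by auto
      from calib_disc_derivative(1,2)[OF \<eta>(2) this] integrand_eq[OF s', of \<eta>]
      show "(disc \<eta> has_real_derivative integrand H c eps T \<eta> s) (at s)"
        using vector_derivative_at by metis
    qed (use T in auto)
    then show ?thesis using \<eta>(1) by (simp add: action_def disc_def)
  qed
  finally show ?thesis using action_ge[OF mg(2) T] mg(1) by simp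
qed

text \<open>Running cost minus derivative of the discounted value is nonnegative almost everywhere
  with integral 0, so it vanishes almost everywhere.\<close>

lemma minimizing_AE:
  assumes m: "minimizing H c eps x \<gamma>" and T: "T > 0"
  shows "\<exists>N b. negligible N \<and> (\<forall>s\<in>{- T<..<0} - N.
     (\<gamma> has_vector_derivative vector_derivative \<gamma> (at s)) (at s) \<and>
     ((\<lambda>t. v (\<gamma> t)) has_real_derivative b s) (at s) \<and> b s = ell (\<gamma> s) (vector_derivative \<gamma> (at s)) - eps * v (\<gamma> s))"
proof -
  have adm: "admissible H c eps T \<gamma>" using m T unfolding minimizing_def by blast
  then have ac: "abs_cont_on (- T) 0 \<gamma>" and int: "integrand H c eps T \<gamma> integrable_on {- T..0}"
    by (auto simp: admissible_def absolutely_integrable_on_def)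
  obtain N b where N: "negligible N" and D: "\<And>s. s \<in> {- T<..<0} - N \<Longrightarrow>
    (\<gamma> has_vector_derivative vector_derivative \<gamma> (at s)) (at s) \<and> ((\<lambda>t. v (\<gamma> t)) has_real_derivative b s) (at s)"
    using curve_AE[OF ac] by blast
  define g where "g = (\<lambda>s. exp (eps * s) * (b s + eps * v (\<gamma> s)))"
  have T0: "- T \<le> 0" using T by simp
  have 1: "(g has_integral (disc \<gamma> 0 - disc \<gamma> (- T))) {- T..0}"
    unfolding g_def
    by (rule abs_cont_on_has_integral[OF abs_cont_on_disc[OF ac] T0 N]) (use D disc_derivative in blast)
  have "integral {- T..0} (integrand H c eps T \<gamma>) = disc \<gamma> 0 - disc \<gamma> (- T)"
  proof -
    have "\<gamma> 0 = x" using m by (simp add: minimizing_def)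
    then show ?thesis using minimizing_action[OF m T] by (simp add: action_def disc_def)
  qed
  then have 2: "(integrand H c eps T \<gamma> has_integral (disc \<gamma> 0 - disc \<gamma> (- T))) {- T..0}"
    using int by (metis integrable_integral)
  define N' where "N' = N \<union> {- T, 0}"
  have N': "negligible N'" unfolding N'_def by (intro negligible_Un N) auto
  define h where "h = (\<lambda>s. if s \<in> N' then 0 else integrand H c eps T \<gamma> s - g s)"
  have "(h has_integral 0) {- T..0}"
    using has_integral_spike[OF N' _ has_integral_diff[OF 2 1], of h] by (simp add: h_def)
  moreover have in': "- T < s \<and> s < 0 \<and> s \<in> {- T<..<0} - N" if "s \<in> {- T..0}" "s \<notin> N'" for s
    using that by (auto simp: N'_def)
  have le: "b s \<le> ell (\<gamma> s) (vector_derivative \<gamma> (at s)) - eps * v (\<gamma> s)" if "s \<in> {- T<..<0} - N" for s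
    using D[OF that] by (intro derivative_along_le) auto
  have hge: "h s \<ge> 0" if s: "s \<in> {- T..0}" for s
  proof (cases "s \<in> N'")
    case False
    have "g s \<le> exp (eps * s) * ell (\<gamma> s) (vector_derivative \<gamma> (at s))"
      unfolding g_def using le[of s] in'[OF s False] by (intro mult_left_mono) auto
    then show ?thesis using False integrand_eq[of T s \<gamma>] in'[OF s False] by (simp add: h_def)
  qed (simp add: h_def)
  ultimately have neg: "negligible {s \<in> {- T..0}. h s \<noteq> 0}" by (intro nonneg_integral_zero_negligible)
  have "\<forall>s\<in>{- T<..<0} - (N' \<union> {s \<in> {- T..0}. h s \<noteq> 0}).
     (\<gamma> has_vector_derivative vector_derivative \<gamma> (at s)) (at s) \<and>
     ((\<lambda>t. v (\<gamma> t)) has_real_derivative b s) (at s) \<and> b s = ell (\<gamma> s) (vector_derivative \<gamma> (at s)) - eps * v (\<gamma> s)"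
  proof
    fix s assume s: "s \<in> {- T<..<0} - (N' \<union> {s \<in> {- T..0}. h s \<noteq> 0})"
    then have s': "s \<in> {- T..0}" "s \<notin> N'" "h s = 0" by auto
    then have "exp (eps * s) * (ell (\<gamma> s) (vector_derivative \<gamma> (at s)) - (b s + eps * v (\<gamma> s))) = 0"
      using integrand_eq[of T s \<gamma>] in'[OF s'(1,2)] by (simp add: h_def g_def right_diff_distrib)
    then show "(\<gamma> has_vector_derivative vector_derivative \<gamma> (at s)) (at s) \<and>
     ((\<lambda>t. v (\<gamma> t)) has_real_derivative b s) (at s) \<and> b s = ell (\<gamma> s) (vector_derivative \<gamma> (at s)) - eps * v (\<gamma> s)"
      using D[of s] in'[OF s'(1,2)] by auto
  qed
  then show ?thesis using negligible_Un[OF N' neg] by blast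
qed

text \<open>Converse to \<open>calib_minimizing\<close>. The speed of a minimizer is bounded because
  v grows along it at a rate of at most Lv |\<xi>|, while the running cost is superlinear. R and D
  are common to all minimizers, as limits of varying minimizers demand.\<close>

theorem minimizing_calib: "\<exists>R D. \<forall>x \<gamma>. minimizing H c eps x \<gamma> \<longrightarrow> calib R D v {..0} \<gamma>"
proof -
  obtain B where B: "B > 0" "\<And>x. \<bar>v x\<bar> \<le> B" using v_bounded by blast
  \<comment> \<open>Slope Lv + |c| + 1: Lv against the growth of v, |c| against the linear term of
    \<open>ell\<close>, and 1 left over to bound the speed.\<close>
  obtain C where C: "C > 0" "\<And>x \<xi>. lagr H x \<xi> \<ge> (Lv + norm c + 1) * norm \<xi> - C"
    using lagr_superlinear[of "Lv + norm c + 1"] by blast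
  define R where "R = C + \<bar>hcrit H c\<bar> + eps * B"
  have R: "R \<ge> 0" using C(1) B(1) eps by (simp add: R_def)
  have "\<forall>p. \<exists>Cp. Cp \<ge> 0 \<and> (\<forall>x y. \<bar>H y p - H x p\<bar> \<le> Cp * norm (y - x))"
    using H_Lipschitz_x by (meson less_imp_le order_refl)
  then obtain Cp where Cp: "\<And>p. Cp p \<ge> 0" "\<And>p x y. \<bar>H y p - H x p\<bar> \<le> Cp p * norm (y - x)" by metis
  \<comment> \<open>Cost of freezing H and eps v at the later point over a distance of at most R (t
    - s).\<close>
  define D where "D = (\<lambda>p. (Cp p + eps * Lv) * R)"
  have "calib R D v {..0} \<gamma>" if m: "minimizing H c eps x \<gamma>" for x \<gamma>
  proof -
    have acT: "abs_cont_on (- T) 0 \<gamma>" if "T > 0" for T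
      using m that unfolding minimizing_def admissible_def by blast
    have ae: "\<exists>N b. negligible N \<and> (\<forall>s\<in>{- T<..<0} - N.
       (\<gamma> has_vector_derivative vector_derivative \<gamma> (at s)) (at s) \<and>
       ((\<lambda>t. v (\<gamma> t)) has_real_derivative b s) (at s) \<and>
       b s = ell (\<gamma> s) (vector_derivative \<gamma> (at s)) - eps * v (\<gamma> s) \<and> norm (vector_derivative \<gamma> (at s)) \<le> R)" if T: "T > 0" for T
    proof -
      obtain N b where N: "negligible N" and Db: "\<And>s. s\<in>{- T<..<0} - N \<Longrightarrow>
       (\<gamma> has_vector_derivative vector_derivative \<gamma> (at s)) (at s) \<and>
       ((\<lambda>t. v (\<gamma> t)) has_real_derivative b s) (at s) \<and> b s = ell (\<gamma> s) (vector_derivative \<gamma> (at s)) - eps * v (\<gamma> s)"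
        using minimizing_AE[OF m T] by blast
      have "norm (vector_derivative \<gamma> (at s)) \<le> R" if s: "s\<in>{- T<..<0} - N" for s
      proof -
        define \<xi> where "\<xi> = vector_derivative \<gamma> (at s)"
        have g: "(\<gamma> has_vector_derivative \<xi>) (at s)" and b: "((\<lambda>t. v (\<gamma> t)) has_real_derivative b s) (at s)"
          and beq: "b s = ell (\<gamma> s) \<xi> - eps * v (\<gamma> s)"
          using Db[OF s] by (auto simp: \<xi>_def)
        have bl: "b s \<le> Lv * norm \<xi>"
        proof -
          have "b s - Lv * norm \<xi> \<le> e * Lv" if e: "e > 0" for e
          proof -
            obtain d where d: "d > 0" "\<And>y. norm (y - s) < d \<Longrightarrow> norm (\<gamma> y - \<gamma> s - (y - s) *\<^sub>R \<xi>) \<le> e * norm (y - s)"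
              using g e unfolding has_vector_derivative_def has_derivative_at_alt by blast
            have le: "(v (\<gamma> s) - v (\<gamma> (s - t))) - (v (\<gamma> s) - v (\<gamma> (s - 0))) \<le> (Lv * norm \<xi> + e * Lv) * t + 0 * t\<^sup>2"
              if t: "0 < t" "t < d" for t
            proof -
              have "norm (\<gamma> s - \<gamma> (s - t)) = norm (\<gamma> (s - t) - \<gamma> s)" by (rule norm_minus_commute)
              also have "\<dots> \<le> norm (\<gamma> (s - t) - \<gamma> s - ((s - t) - s) *\<^sub>R \<xi>) + norm (((s - t) - s) *\<^sub>R \<xi>)"
                using norm_triangle_ineq[of "\<gamma> (s - t) - \<gamma> s - ((s - t) - s) *\<^sub>R \<xi>" "((s - t) - s) *\<^sub>R \<xi>"] by simp
              also have "\<dots> \<le> e * t + t * norm \<xi>" using d(2)[of "s - t"] t by simp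
              finally have n: "norm (\<gamma> s - \<gamma> (s - t)) \<le> e * t + t * norm \<xi>" .
              have "v (\<gamma> s) - v (\<gamma> (s - t)) \<le> Lv * norm (\<gamma> s - \<gamma> (s - t))"
                using Lv(2)[of "\<gamma> s" "\<gamma> (s - t)"] by linarith
              also have "\<dots> \<le> Lv * (e * t + t * norm \<xi>)" using n Lv(1) by (intro mult_left_mono) auto
              finally show ?thesis by (simp add: algebra_simps)
            qed
            have "b s \<le> Lv * norm \<xi> + e * Lv"
              by (rule right_derivative_le[OF backward_derivative[OF b] d(1), where C = 0]) (rule le)
            then show ?thesis by simp
          qed
          then have "b s - Lv * norm \<xi> \<le> 0" by (rule le_zero_if_le_eps)
          then show ?thesis by simp
        qed
        have "c \<bullet> \<xi> \<le> norm c * norm \<xi>" by (rule norm_cauchy_schwarz)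
        then have "ell (\<gamma> s) \<xi> \<ge> (Lv + 1) * norm \<xi> - C - \<bar>hcrit H c\<bar>"
          using C(2)[of \<xi> "\<gamma> s"] unfolding ell_def by (simp add: algebra_simps)
        moreover have "eps * v (\<gamma> s) \<le> eps * B" using B(2)[of "\<gamma> s"] eps by (intro mult_left_mono) auto
        ultimately have "norm \<xi> \<le> R" using bl beq by (simp add: R_def algebra_simps)
        then show ?thesis by (simp add: \<xi>_def)
      qed
      then show ?thesis using N Db by blast
    qed
    have lip: "norm (\<gamma> t - \<gamma> s) \<le> R * (t - s)" if st: "s \<le> t" "t \<le> 0" for s t
    proof -
      define T where "T = 1 - s"
      have T: "T > 0" "- T < s" using st by (auto simp: T_def)
      obtain N b where N: "negligible N" and Db: "\<forall>s\<in>{- T<..<0} - N.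
       (\<gamma> has_vector_derivative vector_derivative \<gamma> (at s)) (at s) \<and>
       ((\<lambda>t. v (\<gamma> t)) has_real_derivative b s) (at s) \<and>
       b s = ell (\<gamma> s) (vector_derivative \<gamma> (at s)) - eps * v (\<gamma> s) \<and> norm (vector_derivative \<gamma> (at s)) \<le> R"
        using ae[OF T(1)] by (elim exE conjE) (rule that)
      \<comment> \<open>Projection onto the direction of the displacement reduces the mean value
        inequality to a scalar function.\<close>
      define e where "e = sgn (\<gamma> t - \<gamma> s)"
      have e1: "norm e \<le> 1" by (simp add: e_def norm_sgn)
      have "e \<bullet> \<gamma> t - e \<bullet> \<gamma> s \<le> R * (t - s)"
      proof (rule abs_cont_on_le[OF _ st(1) N, where f' = "\<lambda>\<tau>. e \<bullet> vector_derivative \<gamma> (at \<tau>)"])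
        have "abs_cont_on s t \<gamma>" by (rule abs_cont_on_subinterval[OF acT[OF T(1)]]) (use T st in linarith)+
        then show "abs_cont_on s t (\<lambda>\<tau>. e \<bullet> \<gamma> \<tau>)"
        proof (rule abs_cont_on_dominated[of _ _ _ 1 0])
          fix \<tau> \<sigma>
          have "\<bar>e \<bullet> (\<gamma> \<sigma> - \<gamma> \<tau>)\<bar> \<le> norm e * norm (\<gamma> \<sigma> - \<gamma> \<tau>)" by (rule Cauchy_Schwarz_ineq2)
          also have "\<dots> \<le> 1 * norm (\<gamma> \<sigma> - \<gamma> \<tau>)" using e1 by (intro mult_right_mono) auto
          finally show "norm (e \<bullet> \<gamma> \<sigma> - e \<bullet> \<gamma> \<tau>) \<le> 1 * norm (\<gamma> \<sigma> - \<gamma> \<tau>) + 0 * (\<sigma> - \<tau>)"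
            by (simp add: inner_diff_right)
        qed auto
        fix \<tau> assume "\<tau> \<in> {s<..<t} - N"
        then have D: "(\<gamma> has_vector_derivative vector_derivative \<gamma> (at \<tau>)) (at \<tau>)" "norm (vector_derivative \<gamma> (at \<tau>)) \<le> R"
          using bspec[OF Db, of \<tau>] T st by auto
        have "((\<lambda>\<tau>. e \<bullet> \<gamma> \<tau>) has_derivative (\<lambda>h. e \<bullet> (h *\<^sub>R vector_derivative \<gamma> (at \<tau>)))) (at \<tau>)"
          using D(1) unfolding has_vector_derivative_def by (rule has_derivative_inner_right)
        then have "((\<lambda>\<tau>. e \<bullet> \<gamma> \<tau>) has_real_derivative e \<bullet> vector_derivative \<gamma> (at \<tau>)) (at \<tau>)"
          by (simp add: has_field_derivative_def mult_commute_abs)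
        moreover have "e \<bullet> vector_derivative \<gamma> (at \<tau>) \<le> 1 * R"
          using e1 D(2) R by (intro order_trans[OF norm_cauchy_schwarz] mult_mono) auto
        ultimately show "((\<lambda>\<tau>. e \<bullet> \<gamma> \<tau>) has_real_derivative e \<bullet> vector_derivative \<gamma> (at \<tau>)) (at \<tau>) \<and> e \<bullet> vector_derivative \<gamma> (at \<tau>) \<le> R"
          by simp
      qed
      moreover have "e \<bullet> \<gamma> t - e \<bullet> \<gamma> s = norm (\<gamma> t - \<gamma> s)"
        unfolding inner_diff_right[symmetric] e_def
        by (cases "\<gamma> t - \<gamma> s = 0") (simp_all add: sgn_div_norm dot_square_norm power2_eq_square)
      ultimately show ?thesis by simp
    qed
    have cal: "v (\<gamma> t) - v (\<gamma> s) \<ge> (p - c) \<bullet> (\<gamma> t - \<gamma> s) + (t - s) * (hcrit H c - H (\<gamma> t) p - eps * v (\<gamma> t)) - D p * (t - s)\<^sup>2"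
      if st: "s \<le> t" "t \<le> 0" for s t p
    proof -
      define T where "T = 1 - s"
      have T: "T > 0" "- T < s" using st by (auto simp: T_def)
      obtain N b where N: "negligible N" and Db: "\<forall>s\<in>{- T<..<0} - N.
       (\<gamma> has_vector_derivative vector_derivative \<gamma> (at s)) (at s) \<and>
       ((\<lambda>t. v (\<gamma> t)) has_real_derivative b s) (at s) \<and>
       b s = ell (\<gamma> s) (vector_derivative \<gamma> (at s)) - eps * v (\<gamma> s) \<and> norm (vector_derivative \<gamma> (at s)) \<le> R"
        using ae[OF T(1)] by (elim exE conjE) (rule that)
      \<comment> \<open>Fenchel's inequality for p, with H and v frozen at time t, bounds the
        derivative of f by this constant.\<close>
      define M where "M = - (hcrit H c - H (\<gamma> t) p - eps * v (\<gamma> t)) + D p * (t - s)"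
      define f where "f = (\<lambda>\<tau>. (p - c) \<bullet> \<gamma> \<tau> - v (\<gamma> \<tau>))"
      have "f t - f s \<le> M * (t - s)"
      proof (rule abs_cont_on_le[OF _ st(1) N, where f' = "\<lambda>\<tau>. (p - c) \<bullet> vector_derivative \<gamma> (at \<tau>) - b \<tau>"])
        have "abs_cont_on s t \<gamma>" by (rule abs_cont_on_subinterval[OF acT[OF T(1)]]) (use T st in linarith)+
        then show "abs_cont_on s t f"
        proof (rule abs_cont_on_dominated[of _ _ _ "norm (p - c) + Lv" 0])
          fix \<tau> \<sigma>
          have "\<bar>(p - c) \<bullet> (\<gamma> \<sigma> - \<gamma> \<tau>)\<bar> \<le> norm (p - c) * norm (\<gamma> \<sigma> - \<gamma> \<tau>)" by (rule Cauchy_Schwarz_ineq2)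
          then show "norm (f \<sigma> - f \<tau>) \<le> (norm (p - c) + Lv) * norm (\<gamma> \<sigma> - \<gamma> \<tau>) + 0 * (\<sigma> - \<tau>)"
            using Lv(2)[of "\<gamma> \<sigma>" "\<gamma> \<tau>"] by (simp add: f_def inner_diff_right algebra_simps abs_le_iff)
        qed (use Lv(1) in auto)
        fix \<tau> assume "\<tau> \<in> {s<..<t} - N"
        then have \<tau>: "s < \<tau>" "\<tau> < t" and D': "(\<gamma> has_vector_derivative vector_derivative \<gamma> (at \<tau>)) (at \<tau>)"
          "((\<lambda>t. v (\<gamma> t)) has_real_derivative b \<tau>) (at \<tau>)" "b \<tau> = ell (\<gamma> \<tau>) (vector_derivative \<gamma> (at \<tau>)) - eps * v (\<gamma> \<tau>)"
          using bspec[OF Db, of \<tau>] T st by auto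
        have "((\<lambda>\<tau>. (p - c) \<bullet> \<gamma> \<tau>) has_derivative (\<lambda>h. (p - c) \<bullet> (h *\<^sub>R vector_derivative \<gamma> (at \<tau>)))) (at \<tau>)"
          using D'(1) unfolding has_vector_derivative_def by (rule has_derivative_inner_right)
        then have "((\<lambda>\<tau>. (p - c) \<bullet> \<gamma> \<tau>) has_real_derivative (p - c) \<bullet> vector_derivative \<gamma> (at \<tau>)) (at \<tau>)"
          by (simp add: has_field_derivative_def mult_commute_abs)
        then have 1: "(f has_real_derivative (p - c) \<bullet> vector_derivative \<gamma> (at \<tau>) - b \<tau>) (at \<tau>)"
          unfolding f_def using D'(2) by (intro derivative_intros)
        have n: "norm (\<gamma> t - \<gamma> \<tau>) \<le> R * (t - s)"
        proof -
          have "norm (\<gamma> t - \<gamma> \<tau>) \<le> R * (t - \<tau>)" using \<tau> st by (intro lip) auto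
          also have "\<dots> \<le> R * (t - s)" using \<tau> R by (intro mult_left_mono) auto
          finally show ?thesis .
        qed
        have "H (\<gamma> \<tau>) p - H (\<gamma> t) p \<le> Cp p * norm (\<gamma> t - \<gamma> \<tau>)" using Cp(2)[where y = "\<gamma> t" and x = "\<gamma> \<tau>" and p = p] by linarith
        also have "\<dots> \<le> Cp p * (R * (t - s))" using n Cp(1) by (intro mult_left_mono) auto
        finally have h1: "H (\<gamma> \<tau>) p \<le> H (\<gamma> t) p + Cp p * (R * (t - s))" by simp
        have "v (\<gamma> \<tau>) - v (\<gamma> t) \<le> Lv * norm (\<gamma> t - \<gamma> \<tau>)" using Lv(2)[of "\<gamma> t" "\<gamma> \<tau>"] by linarith
        also have "\<dots> \<le> Lv * (R * (t - s))" using n Lv(1) by (intro mult_left_mono) auto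
        finally have "eps * (v (\<gamma> \<tau>) - v (\<gamma> t)) \<le> eps * (Lv * (R * (t - s)))" using eps by (intro mult_left_mono) auto
        then have "(p - c) \<bullet> vector_derivative \<gamma> (at \<tau>) - b \<tau> \<le> M"
          using ell_ge[where p = p and x = "\<gamma> \<tau>" and \<xi> = "vector_derivative \<gamma> (at \<tau>)"] h1
          unfolding D'(3) by (simp add: M_def D_def algebra_simps)
        then show "(f has_real_derivative (p - c) \<bullet> vector_derivative \<gamma> (at \<tau>) - b \<tau>) (at \<tau>) \<and> (p - c) \<bullet> vector_derivative \<gamma> (at \<tau>) - b \<tau> \<le> M"
          using 1 by blast
      qed
      then show ?thesis by (simp add: f_def M_def inner_diff_right algebra_simps power2_eq_square)
    qed
    show ?thesis
      unfolding calib_def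
    proof (intro conjI ballI impI allI)
      fix s t :: real assume "s \<in> {..0}" "t \<in> {..0}"
      then show "norm (\<gamma> t - \<gamma> s) \<le> R * \<bar>t - s\<bar>"
        using lip[of s t] lip[of t s] by (cases "s \<le> t") (auto simp: norm_minus_commute)
    qed (use cal in auto)
  qed
  then show ?thesis by blast
qed

end

section \<open>Calibrated curves solve Hamilton's equations\<close>

text \<open>The assumption makes 0 a supergradient of the linear form, whose derivative is
  Z.\<close>

lemma small_linear_zero:
  fixes Z :: "real^'n"
  assumes "\<And>e. e > 0 \<Longrightarrow> \<exists>d>0. \<forall>w. norm w < d \<longrightarrow> Z \<bullet> w \<le> e * norm w"
  shows "Z = 0"
proof -
  have "((\<lambda>x. Z \<bullet> x) has_derivative (\<lambda>h. Z \<bullet> h)) (at 0)" by (auto intro!: derivative_eq_intros)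
  moreover have "supdiff (\<lambda>x. Z \<bullet> x) 0 0" unfolding supdiff_def using assms by simp
  ultimately have "0 = Z" by (rule supdiff_unique)
  then show ?thesis by simp
qed

text \<open>d exp (- C t) decreases and d exp (C t) increases, so a zero of the nonnegative d
  propagates in both time directions.\<close>

lemma gronwall_zero:
  fixes d d' :: "real \<Rightarrow> real"
  assumes cont: "continuous_on {a..b} d" and der: "\<And>t. a < t \<Longrightarrow> t < b \<Longrightarrow> (d has_real_derivative d' t) (at t)"
    and bnd: "\<And>t. a < t \<Longrightarrow> t < b \<Longrightarrow> \<bar>d' t\<bar> \<le> C * d t" and nn: "\<And>t. d t \<ge> 0"
    and t0: "t0 \<in> {a..b}" "d t0 = 0" and t: "t \<in> {a..b}"
  shows "d t = 0"
proof (cases "t0 \<le> t")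
  case True
  have "d t * exp (- C * t) \<le> d t0 * exp (- C * t0)"
  proof (rule DERIV_nonpos_imp_decreasing_open[OF True])
    fix s assume "t0 < s" "s < t"
    then have s: "a < s" "s < b" using t0 t by auto
    have "((\<lambda>s. d s * exp (- C * s)) has_real_derivative (d' s - C * d s) * exp (- C * s)) (at s)"
      using der[OF s] by (auto intro!: derivative_eq_intros simp: algebra_simps)
    moreover have "(d' s - C * d s) * exp (- C * s) \<le> 0"
      using bnd[OF s] by (intro mult_nonpos_nonneg) auto
    ultimately show "\<exists>y. ((\<lambda>s. d s * exp (- C * s)) has_real_derivative y) (at s) \<and> y \<le> 0" by blast
  qed (use t0 t in \<open>auto intro!: continuous_intros continuous_on_subset[OF cont]\<close>)
  then have "d t * exp (- C * t) \<le> 0" using t0 by simp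
  then have "d t \<le> 0" by (simp add: mult_le_0_iff)
  then show ?thesis using nn[of t] by simp
next
  case False
  then have le: "t \<le> t0" by simp
  have "d t * exp (C * t) \<le> d t0 * exp (C * t0)"
  proof (rule DERIV_nonneg_imp_increasing_open[OF le])
    fix s assume "t < s" "s < t0"
    then have s: "a < s" "s < b" using t0 t by auto
    have "((\<lambda>s. d s * exp (C * s)) has_real_derivative (d' s + C * d s) * exp (C * s)) (at s)"
      using der[OF s] by (auto intro!: derivative_eq_intros simp: algebra_simps)
    moreover have "(d' s + C * d s) * exp (C * s) \<ge> 0"
      using bnd[OF s] by (intro mult_nonneg_nonneg) auto
    ultimately show "\<exists>y. ((\<lambda>s. d s * exp (C * s)) has_real_derivative y) (at s) \<and> y \<ge> 0" by blast
  qed (use t0 t in \<open>auto intro!: continuous_intros continuous_on_subset[OF cont]\<close>)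
  then have "d t * exp (C * t) \<le> 0" using t0 by simp
  then have "d t \<le> 0" by (simp add: mult_le_0_iff)
  then show ?thesis using nn[of t] by simp
qed

context kam_eps
begin

lemma ell_continuous_compose:
  assumes "continuous_on S f" "continuous_on S g"
  shows "continuous_on S (\<lambda>s. ell (f s) (g s))"
proof -
  have "continuous_on S (\<lambda>s. (f s, g s))" using assms by (rule continuous_on_Pair)
  from continuous_on_compose2[OF lagr_continuous this]
  have "continuous_on S (\<lambda>s. lagr H (f s) (g s))" by simp
  then show ?thesis unfolding ell_def using assms(2) by (intro continuous_intros)
qed

lemma Hp_continuous_compose:
  assumes "continuous_on S f" "continuous_on S g"
  shows "continuous_on S (\<lambda>s. Hp H (f s) (g s))"
  using continuous_on_compose2[OF Hp_continuous continuous_on_Pair[OF assms]] by simp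

lemma Hx_continuous_compose:
  assumes "continuous_on S f" "continuous_on S g"
  shows "continuous_on S (\<lambda>s. Hx H (f s) (g s))"
  using continuous_on_compose2[OF Hx_continuous continuous_on_Pair[OF assms]] by simp

text \<open>With the weight exp (eps s) the momentum equation loses its damping term:
  \<open>force\<close> will be the derivative of \<open>dmom\<close>. The term eps c drops out
  because \<open>dmom\<close> carries grad v instead of c + grad v.\<close>

definition force :: "(real \<Rightarrow> real^'n) \<Rightarrow> real \<Rightarrow> real^'n" where
  "force \<gamma> s = exp (eps * s) *\<^sub>R (- Hx H (\<gamma> s) (c + grad v (\<gamma> s)))"

definition dmom :: "(real \<Rightarrow> real^'n) \<Rightarrow> real \<Rightarrow> real^'n" where
  "dmom \<gamma> s = exp (eps * s) *\<^sub>R grad v (\<gamma> s)"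

lemma calib_grad_continuous_Icc:
  assumes cal: "calib R D v I \<gamma>" and \<delta>: "\<delta> > 0" "{lo..hi + \<delta>} \<subseteq> I"
  shows "continuous_on {lo..hi} (\<lambda>s. grad v (\<gamma> s))" "continuous_on {lo..hi} \<gamma>" "continuous_on {lo..hi} (force \<gamma>)"
proof -
  show 1: "continuous_on {lo..hi} (\<lambda>s. grad v (\<gamma> s))"
  proof (rule calib_grad_continuous[OF cal])
    fix s assume "s \<in> {lo..hi}"
    then have "{s..s + \<delta>} \<subseteq> I" "s \<in> I" using \<delta> by (auto simp: subset_iff)
    then show "s \<in> I \<and> (\<exists>\<delta>>0. {s..s + \<delta>} \<subseteq> I)" using \<delta>(1) by blast
  qed
  show 2: "continuous_on {lo..hi} \<gamma>"
    using calib_continuous[OF cal] by (rule continuous_on_subset) (use \<delta> in \<open>auto simp: subset_iff\<close>)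
  show "continuous_on {lo..hi} (force \<gamma>)"
    unfolding force_def by (intro continuous_intros Hx_continuous_compose 1 2)
qed

text \<open>Translating the whole arc by w keeps it admissible; domination of the translate against
  calibration of the arc itself yields the momentum balance to first order in w.\<close>

lemma momentum_balance:
  assumes cal: "calib R D v I \<gamma>" and \<delta>: "\<delta> > 0" "{lo - \<delta>..hi + \<delta>} \<subseteq> I" and lohi: "lo \<le> hi"
  shows "dmom \<gamma> hi - dmom \<gamma> lo = integral {lo..hi} (force \<gamma>)"
proof -
  have sub: "{s - \<delta>..s + \<delta>} \<subseteq> I" if "s \<in> {lo..hi}" for s using that \<delta> by (auto simp: subset_iff)
  have sub': "{lo..hi + \<delta>} \<subseteq> I" using \<delta> by (auto simp: subset_iff)
  note cont = calib_grad_continuous_Icc[OF cal \<delta>(1) sub']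
  have velc: "continuous_on {lo..hi} (\<lambda>s. vel (\<gamma> s))"
    unfolding vel_def by (intro Hp_continuous_compose continuous_intros cont)
  note der = calib_disc_derivative[OF cal \<delta>(1) sub]
  have "{lo..hi} \<subseteq> I" using \<delta> by (auto simp: subset_iff)
  then have ac: "abs_cont_on lo hi \<gamma>" by (rule calib_abs_cont[OF cal])
  define F where "F = (\<lambda>w s. exp (eps * s) * ell (\<gamma> s + w) (vel (\<gamma> s)))"
  have Fi: "F w integrable_on {lo..hi}" for w
    unfolding F_def by (intro integrable_continuous_real continuous_intros ell_continuous_compose cont velc)
  have Gi: "force \<gamma> integrable_on {lo..hi}" by (intro integrable_continuous_real cont)
  have F0: "integral {lo..hi} (F 0) = disc \<gamma> hi - disc \<gamma> lo"
    by (rule integral_unique, rule abs_cont_on_has_integral[OF abs_cont_on_disc[OF ac] lohi, of "{}"])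
      (use der(1) in \<open>auto simp: F_def\<close>)
  define Q where "Q = integral {lo..hi} (force \<gamma>)"
  define Z where "Z = dmom \<gamma> hi - dmom \<gamma> lo - Q"
  \<comment> \<open>Collects the error weights: the expansion of the running cost over [lo, hi] and
    the expansions of v at the two ends.\<close>
  define M where "M = exp (eps * hi) * (hi - lo) + exp (eps * hi) + exp (eps * lo)"
  have M: "M > 0" unfolding M_def using lohi by (intro add_nonneg_pos add_nonneg_nonneg) auto
  have key: "\<exists>d>0. \<forall>w. norm w < d \<longrightarrow> Z \<bullet> w \<le> e * norm w" if e: "e > 0" for e
  proof -
    define e' where "e' = e / M"
    have e': "e' > 0" "M * e' = e" using e M by (auto simp: e'_def)
    have lI: "lo \<in> {lo..hi}" "hi \<in> {lo..hi}" using lohi by auto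
    have fut: "{s..s + \<delta>} \<subseteq> I" if "s \<in> {lo..hi}" for s using sub[OF that] \<delta>(1) by (auto simp: subset_iff)
    note Dlo = calib_differentiable(1)[OF cal \<delta>(1) fut[OF lI(1)]]
    note Dhi = calib_differentiable(1)[OF cal \<delta>(1) fut[OF lI(2)]]
    obtain d0 where d0: "d0 > 0" "\<And>w. norm w < d0 \<Longrightarrow> expn R0 e' w" using expn_ex[OF e'(1)] by blast
    obtain d1 where d1: "d1 > 0" "\<And>y. norm (y - \<gamma> lo) < d1 \<Longrightarrow> norm (v y - v (\<gamma> lo) - grad v (\<gamma> lo) \<bullet> (y - \<gamma> lo)) \<le> e' * norm (y - \<gamma> lo)"
      using Dlo e'(1) unfolding has_derivative_at_alt by blast
    obtain d2 where d2: "d2 > 0" "\<And>y. norm (y - \<gamma> hi) < d2 \<Longrightarrow> norm (v y - v (\<gamma> hi) - grad v (\<gamma> hi) \<bullet> (y - \<gamma> hi)) \<le> e' * norm (y - \<gamma> hi)"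
      using Dhi e'(1) unfolding has_derivative_at_alt by blast
    have "Z \<bullet> w \<le> e * norm w" if w: "norm w < min d0 (min d1 d2)" for w
    proof -
      define \<eta> where "\<eta> = (\<lambda>s. \<gamma> s + w)"
      have ac': "abs_cont_on lo hi \<eta>"
        using ac by (rule abs_cont_on_dominated[of lo hi \<gamma> 1 0]) (auto simp: \<eta>_def)
      have dom: "disc \<eta> hi - disc \<eta> lo \<le> integral {lo..hi} (F w)"
      proof (rule domination[OF ac' lohi negligible_empty Fi])
        fix s assume s: "s \<in> {lo<..<hi} - {}"
        then have "s \<in> {lo..hi}" by auto
        from der(2)[OF this] have "(\<eta> has_vector_derivative vel (\<gamma> s)) (at s)"
          unfolding \<eta>_def by (rule has_vector_derivative_add_const[THEN iffD2])
        then show "F w s = exp (eps * s) * ell (\<eta> s) (vector_derivative \<eta> (at s))"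
          by (simp add: F_def \<eta>_def vector_derivative_at)
      qed
      have "integral {lo..hi} (F w) \<le> integral {lo..hi} (\<lambda>s. F 0 s + force \<gamma> s \<bullet> w + exp (eps * hi) * (e' * norm w))"
      proof (rule integral_le[OF Fi])
        show "(\<lambda>s. F 0 s + force \<gamma> s \<bullet> w + exp (eps * hi) * (e' * norm w)) integrable_on {lo..hi}"
          unfolding F_def by (intro integrable_continuous_real continuous_intros ell_continuous_compose cont velc)
        fix s assume s: "s \<in> {lo..hi}"
        have "ell (\<gamma> s + w) (vel (\<gamma> s)) \<le> ell (\<gamma> s) (vel (\<gamma> s)) - Hx H (\<gamma> s) (c + grad v (\<gamma> s)) \<bullet> w + e' * norm w"
          using d0(2)[of w] w der(3)[OF s] der(4)[OF s] unfolding expn_def by (metis min_less_iff_conj)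
        then have "F w s \<le> exp (eps * s) * (ell (\<gamma> s) (vel (\<gamma> s)) - Hx H (\<gamma> s) (c + grad v (\<gamma> s)) \<bullet> w + e' * norm w)"
          unfolding F_def by (intro mult_left_mono) auto
        also have "\<dots> = F 0 s + force \<gamma> s \<bullet> w + exp (eps * s) * (e' * norm w)"
          by (simp add: F_def force_def algebra_simps)
        also have "exp (eps * s) * (e' * norm w) \<le> exp (eps * hi) * (e' * norm w)"
          using s eps e' by (intro mult_right_mono) auto
        finally show "F w s \<le> F 0 s + force \<gamma> s \<bullet> w + exp (eps * hi) * (e' * norm w)" by simp
      qed
      also have "\<dots> = integral {lo..hi} (F 0) + Q \<bullet> w + (exp (eps * hi) * (e' * norm w)) * (hi - lo)"
      proof -
        have 1: "((\<lambda>s. force \<gamma> s \<bullet> w) has_integral Q \<bullet> w) {lo..hi}"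
          using has_integral_linear[OF integrable_integral[OF Gi] bounded_linear_inner_left[of w]]
          by (simp add: Q_def o_def)
        have 2: "((\<lambda>s. exp (eps * hi) * (e' * norm w)) has_integral (exp (eps * hi) * (e' * norm w)) * (hi - lo)) {lo..hi}"
          using has_integral_const_real[of "exp (eps * hi) * (e' * norm w)" lo hi] lohi by (simp add: mult.commute)
        show ?thesis
          by (rule integral_unique[OF has_integral_add[OF has_integral_add[OF integrable_integral[OF Fi] 1] 2]])
      qed
      finally have up: "disc \<eta> hi - disc \<eta> lo \<le> disc \<gamma> hi - disc \<gamma> lo + Q \<bullet> w + (exp (eps * hi) * (e' * norm w)) * (hi - lo)"
        using dom F0 by simp
      have "v (\<gamma> hi + w) \<ge> v (\<gamma> hi) + grad v (\<gamma> hi) \<bullet> w - e' * norm w"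
        using d2(2)[of "\<gamma> hi + w"] w by (simp add: abs_le_iff)
      then have "disc \<eta> hi \<ge> exp (eps * hi) * (v (\<gamma> hi) + grad v (\<gamma> hi) \<bullet> w - e' * norm w)"
        unfolding disc_def \<eta>_def by (intro mult_left_mono) auto
      moreover have "v (\<gamma> lo + w) \<le> v (\<gamma> lo) + grad v (\<gamma> lo) \<bullet> w + e' * norm w"
        using d1(2)[of "\<gamma> lo + w"] w by (simp add: abs_le_iff)
      then have "disc \<eta> lo \<le> exp (eps * lo) * (v (\<gamma> lo) + grad v (\<gamma> lo) \<bullet> w + e' * norm w)"
        unfolding disc_def \<eta>_def by (intro mult_left_mono) auto
      ultimately have "Z \<bullet> w \<le> M * e' * norm w"
        using up unfolding Z_def M_def dmom_def disc_def by (simp add: inner_diff_left algebra_simps)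
      then show ?thesis using e'(2) by simp
    qed
    then show ?thesis using d0(1) d1(1) d2(1) by (intro exI[of _ "min d0 (min d1 d2)"]) auto
  qed
  \<comment> \<open>The one-sided inequality is available for w and for -w, so the linear part must
    vanish.\<close>
  then have "Z = 0" by (rule small_linear_zero)
  then show ?thesis by (simp add: Z_def Q_def)
qed

definition vf :: "(real^'n) \<times> (real^'n) \<Rightarrow> (real^'n) \<times> (real^'n)" where
  "vf z = (Hp H (fst z) (snd z), - Hx H (fst z) (snd z) + eps *\<^sub>R c - eps *\<^sub>R snd z)"

lemma H_traj_vf: "H_traj H c eps I \<Gamma> \<longleftrightarrow> (\<forall>t\<in>I. (\<Gamma> has_vector_derivative vf (\<Gamma> t)) (at t within I))"
  by (simp add: H_traj_def vf_def)

definition lift :: "(real \<Rightarrow> real^'n) \<Rightarrow> real \<Rightarrow> (real^'n) \<times> (real^'n)" where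
  "lift \<gamma> s = (\<gamma> s, c + grad v (\<gamma> s))"

text \<open>Near s the momentum balance makes \<open>dmom\<close> an indefinite integral of the
  continuous \<open>force\<close>; removing the weight exp (eps s) restores the damping
  term.\<close>

lemma calib_lift_derivative:
  assumes cal: "calib R D v I \<gamma>" and \<delta>: "\<delta> > 0" "{s - \<delta>..s + \<delta>} \<subseteq> I"
  shows "(lift \<gamma> has_vector_derivative vf (lift \<gamma> s)) (at s)"
proof -
  define \<kappa> where "\<kappa> = \<delta> / 2"
  define lo where "lo = s - \<kappa>"
  define hi where "hi = s + \<kappa>"
  have k: "\<kappa> > 0" "lo < s" "s < hi" using \<delta> by (auto simp: \<kappa>_def lo_def hi_def)
  have sub: "{lo - \<kappa>..t + \<kappa>} \<subseteq> I" if "t \<le> hi" for t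
    using \<delta> that by (auto simp: subset_iff \<kappa>_def lo_def hi_def)
  have sub': "{lo..hi + \<kappa>} \<subseteq> I" using sub[of hi] k by (auto simp: subset_iff)
  note cont = calib_grad_continuous_Icc[OF cal k(1) sub']
  have sI: "s \<in> {lo..hi}" using k by auto
  have "((\<lambda>t. dmom \<gamma> lo + integral {lo..t} (force \<gamma>)) has_vector_derivative 0 + force \<gamma> s) (at s within {lo..hi})"
    by (intro has_vector_derivative_add has_vector_derivative_const integral_has_vector_derivative cont sI)
  then have A: "((\<lambda>t. dmom \<gamma> lo + integral {lo..t} (force \<gamma>)) has_vector_derivative force \<gamma> s) (at s within {lo..hi})"
    by simp
  have "(dmom \<gamma> has_vector_derivative force \<gamma> s) (at s within {lo..hi})"
  proof (rule has_vector_derivative_transform[OF sI _ A])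
    fix t assume "t \<in> {lo..hi}"
    then show "dmom \<gamma> t = dmom \<gamma> lo + integral {lo..t} (force \<gamma>)"
      using momentum_balance[OF cal k(1) sub[of t]] by (simp add: diff_eq_eq add.commute)
  qed
  then have 1: "(dmom \<gamma> has_vector_derivative force \<gamma> s) (at s)"
    using at_within_interior[of s "{lo..hi}"] k by (simp add: interior_atLeastAtMost_real)
  have "((\<lambda>t. exp (- (eps * t))) has_real_derivative - eps * exp (- (eps * s))) (at s)"
    by (auto intro!: derivative_eq_intros)
  then have "((\<lambda>t. exp (- (eps * t)) *\<^sub>R dmom \<gamma> t) has_vector_derivative
      exp (- (eps * s)) *\<^sub>R force \<gamma> s + (- eps * exp (- (eps * s))) *\<^sub>R dmom \<gamma> s) (at s)"
    using 1 by (intro has_vector_derivative_scaleR)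
  moreover have "(\<lambda>t. exp (- (eps * t)) *\<^sub>R dmom \<gamma> t) = (\<lambda>t. grad v (\<gamma> t))"
    by (simp add: dmom_def exp_minus fun_eq_iff)
  moreover have "exp (- (eps * s)) *\<^sub>R force \<gamma> s + (- eps * exp (- (eps * s))) *\<^sub>R dmom \<gamma> s =
      - Hx H (\<gamma> s) (c + grad v (\<gamma> s)) - eps *\<^sub>R grad v (\<gamma> s)"
    by (simp add: force_def dmom_def exp_minus)
  ultimately have "((\<lambda>t. grad v (\<gamma> t)) has_vector_derivative - Hx H (\<gamma> s) (c + grad v (\<gamma> s)) - eps *\<^sub>R grad v (\<gamma> s)) (at s)"
    by simp
  then have "((\<lambda>t. c + grad v (\<gamma> t)) has_vector_derivative 0 + (- Hx H (\<gamma> s) (c + grad v (\<gamma> s)) - eps *\<^sub>R grad v (\<gamma> s))) (at s)"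
    by (intro has_vector_derivative_add has_vector_derivative_const)
  from has_vector_derivative_Pair[OF calib_velocity[OF cal \<delta>] this]
  show ?thesis by (simp add: lift_def[abs_def] vf_def scaleR_add_right)
qed

lemma calib_H_traj:
  assumes "calib R D v UNIV \<gamma>"
  shows "H_traj H c eps I (lift \<gamma>)"
  unfolding H_traj_vf
  using calib_lift_derivative[OF assms zero_less_one] by (auto intro: has_vector_derivative_at_within)

lemma vf_continuous: "continuous_on UNIV vf"
  unfolding vf_def by (intro continuous_intros Hp_continuous Hx_continuous)

text \<open>Up to the end point of a backward calibrated curve the momentum converges, and its
  limit is a supergradient there, although v need not be differentiable at that point.\<close>

lemma calib_backward_H_traj:
  assumes cal: "calib R D v {..0} \<gamma>"
  shows "\<exists>\<Gamma>. H_traj H c eps {..0} \<Gamma> \<and> (\<forall>s<0. \<Gamma> s = lift \<gamma> s) \<and>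
    fst (\<Gamma> 0) = \<gamma> 0 \<and> sg (snd (\<Gamma> 0) - c) (\<gamma> 0)"
proof -
  have fut: "{s..s + - s} \<subseteq> {..0::real}" "{s - - s..s + - s} \<subseteq> {..0::real}" "- s > 0" if "s < 0" for s using that by auto
  have dif: "(v has_derivative (\<lambda>h. grad v (\<gamma> s) \<bullet> h)) (at (\<gamma> s))" "sg (grad v (\<gamma> s)) (\<gamma> s)" if "s < 0" for s
    using calib_differentiable[OF cal fut(3)[OF that] fut(1)[OF that]] .
  obtain C where C: "C > 0" "\<And>x p. norm p \<le> P0 \<Longrightarrow> norm (Hx H x p) \<le> C" using Hx_bounded[of P0] by blast
  have fb: "norm (force \<gamma> s) \<le> C" if "s < 0" for s
  proof -
    have "norm (force \<gamma> s) \<le> 1 * C"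
      unfolding force_def norm_scaleR norm_minus_cancel using that eps C
        calib_velocity_bounded(1)[OF dif(1)[OF that]]
      by (intro mult_mono) (auto simp: mult_nonneg_nonpos)
    then show ?thesis by simp
  qed
  have dl: "norm (dmom \<gamma> t - dmom \<gamma> s) \<le> C * (t - s)" if st: "s \<le> t" "t < 0" for s t
  proof -
    have d: "- t > 0" "{s - - t..t + - t} \<subseteq> {..0}" "{s..t + - t} \<subseteq> {..0}" using st by auto
    have "norm (integral {s..t} (force \<gamma>)) \<le> C * (t - s)"
      using st fb calib_grad_continuous_Icc(3)[OF cal d(1,3)] by (intro integral_bound) auto
    then show ?thesis using momentum_balance[OF cal d(1,2) st(1)] by simp
  qed
  define S where "S = (\<lambda>n::nat. - inverse (real (Suc n)))"
  have S: "S n < 0" for n by (simp add: S_def)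
  have S0: "S \<longlonglongrightarrow> 0" unfolding S_def using tendsto_minus[OF LIMSEQ_inverse_real_of_nat] by simp
  have gb: "norm (grad v (\<gamma> (S n))) \<le> P0 + norm c" for n by (rule sg_bounded[OF dif(2)[OF S]])
  obtain q r where r: "strict_mono (r :: nat \<Rightarrow> nat)" "(\<lambda>n. grad v (\<gamma> (S (r n)))) \<longlonglongrightarrow> q"
    using bounded_subseq[of "\<lambda>n. grad v (\<gamma> (S n))", OF gb] by blast
  have Sr: "(\<lambda>n. S (r n)) \<longlonglongrightarrow> 0" using LIMSEQ_subseq_LIMSEQ[OF S0 r(1)] by (simp add: o_def)
  have "(\<lambda>n. \<gamma> (S (r n))) \<longlonglongrightarrow> \<gamma> 0"
    using calib_continuous[OF cal] Sr S by (auto simp: continuous_on_sequentially comp_def less_imp_le)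
  then have sgq: "sg q (\<gamma> 0)"
    using sg_closed[of "\<lambda>n. grad v (\<gamma> (S (r n)))" "\<lambda>n. \<gamma> (S (r n))"] dif(2)[OF S] r(2) by blast
  have "(\<lambda>n. exp (eps * S (r n)) *\<^sub>R grad v (\<gamma> (S (r n)))) \<longlonglongrightarrow> exp (eps * 0) *\<^sub>R q"
    by (intro tendsto_intros Sr r(2))
  then have dq: "(\<lambda>n. dmom \<gamma> (S (r n))) \<longlonglongrightarrow> q" by (simp add: dmom_def)
  \<comment> \<open>\<open>dmom\<close> is Lipschitz on negative times, so the limit found along a
    subsequence is the limit as s tends to 0 through all times.\<close>
  have near: "norm (dmom \<gamma> s - q) \<le> C * (- s)" if s: "s < 0" for s
  proof (rule LIMSEQ_le)
    show "(\<lambda>n. norm (dmom \<gamma> s - dmom \<gamma> (S (r n)))) \<longlonglongrightarrow> norm (dmom \<gamma> s - q)" by (intro tendsto_intros dq)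
    have "(\<lambda>n. C * (S (r n) - s)) \<longlonglongrightarrow> C * (0 - s)" by (intro tendsto_intros Sr)
    then show "(\<lambda>n. C * (S (r n) - s)) \<longlonglongrightarrow> C * (- s)" by simp
    have "eventually (\<lambda>n. S (r n) > s) sequentially" using Sr s by (intro order_tendstoD(1)[of _ 0])
    then obtain N where N: "\<And>n. n \<ge> N \<Longrightarrow> S (r n) > s" by (auto simp: eventually_sequentially)
    show "\<exists>N. \<forall>n\<ge>N. norm (dmom \<gamma> s - dmom \<gamma> (S (r n))) \<le> C * (S (r n) - s)"
      using dl[OF less_imp_le[OF N] S] by (intro exI[of _ N]) (auto simp: norm_minus_commute)
  qed
  define m where "m = (\<lambda>s. if s < 0 then grad v (\<gamma> s) else q)"
  define \<Gamma> where "\<Gamma> = (\<lambda>s. (\<gamma> s, c + m s))"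
  have \<Gamma>l: "\<Gamma> s = lift \<gamma> s" if "s < 0" for s using that by (simp add: \<Gamma>_def m_def lift_def)
  have hd: "(\<Gamma> has_vector_derivative vf (\<Gamma> s)) (at s)" if s: "s < 0" for s
  proof -
    have "(lift \<gamma> has_vector_derivative vf (\<Gamma> s)) (at s)"
      using calib_lift_derivative[OF cal fut(3)[OF s] fut(2)[OF s]] \<Gamma>l[OF s] by simp
    then show ?thesis
      by (rule has_vector_derivative_transform_within_open[where S = "{..<0}"]) (use s \<Gamma>l in auto)
  qed
  have mc: "(m \<longlongrightarrow> q) (at 0 within {..0})"
  proof -
    have "((\<lambda>s. C * (- s)) \<longlongrightarrow> C * (- 0)) (at 0 within {..0})" by (intro tendsto_intros)
    then have lim0: "((\<lambda>s. C * (- s)) \<longlongrightarrow> 0) (at 0 within {..0})" by simp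
    have "((\<lambda>s. dmom \<gamma> s - q) \<longlongrightarrow> 0) (at 0 within {..0})"
    proof (rule Lim_null_comparison[OF _ lim0])
      show "eventually (\<lambda>s. norm (dmom \<gamma> s - q) \<le> C * (- s)) (at 0 within {..0})"
        unfolding eventually_at_filter using near by (intro always_eventually) auto
    qed
    then have "(dmom \<gamma> \<longlongrightarrow> q) (at 0 within {..0})" by (simp add: LIM_zero_iff)
    then have "((\<lambda>s. exp (- (eps * s)) *\<^sub>R dmom \<gamma> s) \<longlongrightarrow> exp (- (eps * 0)) *\<^sub>R q) (at 0 within {..0})"
      by (intro tendsto_intros)
    moreover have "eventually (\<lambda>s. exp (- (eps * s)) *\<^sub>R dmom \<gamma> s = m s) (at 0 within {..0})"
      unfolding eventually_at_filter by (intro always_eventually) (auto simp: m_def dmom_def exp_minus)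
    ultimately show ?thesis by (simp add: tendsto_cong)
  qed
  have \<Gamma>c: "continuous_on {..0} \<Gamma>"
    unfolding continuous_on_eq_continuous_within
  proof
    fix s :: real assume s: "s \<in> {..0}"
    show "continuous (at s within {..0}) \<Gamma>"
    proof (cases "s < 0")
      case True
      then show ?thesis using has_vector_derivative_continuous[OF hd] continuous_at_imp_continuous_within by blast
    next
      case False
      then have "s = 0" using s by simp
      have "(\<gamma> \<longlongrightarrow> \<gamma> 0) (at 0 within {..0})" using calib_continuous[OF cal] by (simp add: continuous_on_def)
      then have "(\<Gamma> \<longlongrightarrow> (\<gamma> 0, c + q)) (at 0 within {..0})"
        unfolding \<Gamma>_def by (intro tendsto_intros mc)
      then show ?thesis unfolding \<open>s = 0\<close> continuous_within by (simp add: \<Gamma>_def m_def)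
    qed
  qed
  have \<Gamma>c1: "continuous_on {-1..0} \<Gamma>" by (rule continuous_on_subset[OF \<Gamma>c]) auto
  have vc: "continuous_on {-1..0} (\<lambda>s. vf (\<Gamma> s))"
    by (rule continuous_on_compose2[OF vf_continuous \<Gamma>c1]) auto
  \<comment> \<open>Calibration gives no derivative at the end point 0; it follows from the integral
    form of the equation, whose integrand is continuous up to 0.\<close>
  have "((\<lambda>t. \<Gamma> (-1) + integral {-1..t} (\<lambda>s. vf (\<Gamma> s))) has_vector_derivative 0 + vf (\<Gamma> 0)) (at 0 within {-1..0})"
    by (intro has_vector_derivative_add has_vector_derivative_const integral_has_vector_derivative vc) auto
  then have A: "((\<lambda>t. \<Gamma> (-1) + integral {-1..t} (\<lambda>s. vf (\<Gamma> s))) has_vector_derivative vf (\<Gamma> 0)) (at 0 within {-1..0})"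
    by simp
  have "(\<Gamma> has_vector_derivative vf (\<Gamma> 0)) (at 0 within {-1..0})"
  proof (rule has_vector_derivative_transform[OF _ _ A])
    fix t :: real assume t: "t \<in> {-1..0}"
    have "((\<lambda>s. vf (\<Gamma> s)) has_integral (\<Gamma> t - \<Gamma> (-1))) {-1..t}"
      using t hd by (intro fundamental_theorem_of_calculus_interior continuous_on_subset[OF \<Gamma>c1]) auto
    then show "\<Gamma> t = \<Gamma> (-1) + integral {-1..t} (\<lambda>s. vf (\<Gamma> s))" by (simp add: integral_unique)
  qed auto
  moreover have "at (0::real) within {-1..0} = at 0 within {..0}"
    by (rule at_within_nhd[of _ "{-1<..}"]) auto
  ultimately have "(\<Gamma> has_vector_derivative vf (\<Gamma> 0)) (at 0 within {..0})" by simp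
  then have "H_traj H c eps {..0} \<Gamma>"
    unfolding H_traj_vf using hd
    by (metis antisym_conv2 atMost_iff has_vector_derivative_at_within)
  moreover have "fst (\<Gamma> 0) = \<gamma> 0" "sg (snd (\<Gamma> 0) - c) (\<gamma> 0)" using sgq by (auto simp: \<Gamma>_def m_def)
  ultimately show ?thesis using \<Gamma>l by blast
qed

section \<open>Uniqueness of trajectories\<close>

lemma vf_Lipschitz: "\<exists>C. \<forall>z z'. norm z \<le> \<rho> \<longrightarrow> norm z' \<le> \<rho> \<longrightarrow> norm (vf z' - vf z) \<le> C * norm (z' - z)"
proof (rule Hx_Hp_local_Lipschitz[of \<rho>])
  fix B assume B: "B > 0" "\<And>z z'. norm z \<le> \<rho> \<Longrightarrow> norm z' \<le> \<rho> \<Longrightarrow>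
    norm (Hp H (fst z') (snd z') - Hp H (fst z) (snd z)) \<le> B * norm (z' - z) \<and>
    norm (Hx H (fst z') (snd z') - Hx H (fst z) (snd z)) \<le> B * norm (z' - z)"
  show ?thesis
  proof (intro exI[of _ "2 * B + eps"] allI impI)
    fix z z' :: "(real^'n) \<times> (real^'n)" assume z: "norm z \<le> \<rho>" "norm z' \<le> \<rho>"
    have "vf z' - vf z = (Hp H (fst z') (snd z') - Hp H (fst z) (snd z),
        - (Hx H (fst z') (snd z') - Hx H (fst z) (snd z)) - eps *\<^sub>R (snd z' - snd z))"
      by (simp add: vf_def algebra_simps)
    then have "norm (vf z' - vf z) \<le> norm (Hp H (fst z') (snd z') - Hp H (fst z) (snd z)) +
        norm (- (Hx H (fst z') (snd z') - Hx H (fst z) (snd z)) - eps *\<^sub>R (snd z' - snd z))"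
      by (metis norm_Pair_le)
    also have "norm (- (Hx H (fst z') (snd z') - Hx H (fst z) (snd z)) - eps *\<^sub>R (snd z' - snd z)) \<le>
        norm (Hx H (fst z') (snd z') - Hx H (fst z) (snd z)) + eps * norm (snd z' - snd z)"
      using norm_triangle_ineq4[of "- (Hx H (fst z') (snd z') - Hx H (fst z) (snd z))" "eps *\<^sub>R (snd z' - snd z)"] eps
      by (simp add: norm_minus_commute)
    also have "eps * norm (snd z' - snd z) \<le> eps * norm (z' - z)"
    proof -
      have "norm (snd (z' - z)) \<le> norm (z' - z)" by (metis norm_snd_le prod.collapse)
      then show ?thesis using eps by (intro mult_left_mono) auto
    qed
    finally show "norm (vf z' - vf z) \<le> (2 * B + eps) * norm (z' - z)"
      using B(2)[OF z] by (simp add: algebra_simps)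
  qed
qed

text \<open>Gronwall for the squared distance, with a Lipschitz constant of the field on a ball
  containing both arcs.\<close>

lemma H_traj_unique_Icc:
  assumes 1: "H_traj H c eps {a..b} \<Gamma>1" and 2: "H_traj H c eps {a..b} \<Gamma>2"
    and 0: "t0 \<in> {a..b}" "\<Gamma>1 t0 = \<Gamma>2 t0" and t: "t \<in> {a..b}"
  shows "\<Gamma>1 t = \<Gamma>2 t"
proof -
  have c1: "continuous_on {a..b} \<Gamma>1" and c2: "continuous_on {a..b} \<Gamma>2"
    using 1 2 unfolding H_traj_vf continuous_on_eq_continuous_within by (auto intro: has_vector_derivative_continuous)
  have "bounded (\<Gamma>1 ` {a..b} \<union> \<Gamma>2 ` {a..b})"
    using c1 c2 by (intro bounded_Un[THEN iffD2] conjI compact_imp_bounded compact_continuous_image) auto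
  then obtain \<rho> where \<rho>: "\<And>s. s \<in> {a..b} \<Longrightarrow> norm (\<Gamma>1 s) \<le> \<rho> \<and> norm (\<Gamma>2 s) \<le> \<rho>"
    unfolding bounded_iff by blast
  obtain C where C: "\<And>z z'. norm z \<le> \<rho> \<Longrightarrow> norm z' \<le> \<rho> \<Longrightarrow> norm (vf z' - vf z) \<le> C * norm (z' - z)"
    using vf_Lipschitz[of \<rho>] by blast
  define \<Delta> where "\<Delta> = (\<lambda>s. \<Gamma>1 s - \<Gamma>2 s)"
  define d where "d = (\<lambda>s. \<Delta> s \<bullet> \<Delta> s)"
  define d' where "d' = (\<lambda>s. 2 * (\<Delta> s \<bullet> (vf (\<Gamma>1 s) - vf (\<Gamma>2 s))))"
  have "d t = 0"
  proof (rule gronwall_zero[of a b d d' "2 * C" t0 t])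
    show "continuous_on {a..b} d" unfolding d_def \<Delta>_def by (intro continuous_intros c1 c2)
    fix s assume s: "a < s" "s < b"
    then have sI: "s \<in> {a..b}" "at s within {a..b} = at s" by (auto intro: at_within_interior simp: interior_atLeastAtMost_real)
    have "(\<Gamma>1 has_vector_derivative vf (\<Gamma>1 s)) (at s)" "(\<Gamma>2 has_vector_derivative vf (\<Gamma>2 s)) (at s)"
      using 1 2 sI unfolding H_traj_vf by (metis)+
    then have "(\<Delta> has_vector_derivative vf (\<Gamma>1 s) - vf (\<Gamma>2 s)) (at s)"
      unfolding \<Delta>_def by (rule has_vector_derivative_diff)
    then have D: "(\<Delta> has_derivative (\<lambda>h. h *\<^sub>R (vf (\<Gamma>1 s) - vf (\<Gamma>2 s)))) (at s)"
      by (simp add: has_vector_derivative_def)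
    have "(d has_derivative (\<lambda>h. \<Delta> s \<bullet> (h *\<^sub>R (vf (\<Gamma>1 s) - vf (\<Gamma>2 s))) + (h *\<^sub>R (vf (\<Gamma>1 s) - vf (\<Gamma>2 s))) \<bullet> \<Delta> s)) (at s)"
      unfolding d_def by (rule has_derivative_inner[OF D D])
    then show "(d has_real_derivative d' s) (at s)"
      unfolding has_field_derivative_def d'_def
      by (rule has_derivative_eq_rhs) (auto simp: fun_eq_iff inner_commute[of "vf (\<Gamma>1 s) - vf (\<Gamma>2 s)"])
    have "\<bar>\<Delta> s \<bullet> (vf (\<Gamma>1 s) - vf (\<Gamma>2 s))\<bar> \<le> norm (\<Delta> s) * norm (vf (\<Gamma>1 s) - vf (\<Gamma>2 s))"
      by (rule Cauchy_Schwarz_ineq2)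
    also have "\<dots> \<le> norm (\<Delta> s) * (C * norm (\<Delta> s))"
      using C[of "\<Gamma>2 s" "\<Gamma>1 s"] \<rho>[OF sI(1)] by (intro mult_left_mono) (auto simp: \<Delta>_def)
    finally have "\<bar>\<Delta> s \<bullet> (vf (\<Gamma>1 s) - vf (\<Gamma>2 s))\<bar> \<le> C * d s"
      by (simp add: d_def dot_square_norm power2_eq_square algebra_simps)
    then show "\<bar>d' s\<bar> \<le> 2 * C * d s" by (simp add: d'_def abs_mult)
  qed (use 0 t in \<open>auto simp: d_def \<Delta>_def\<close>)
  then show ?thesis by (simp add: d_def \<Delta>_def)
qed

lemma H_traj_subset: "H_traj H c eps I \<Gamma> \<Longrightarrow> J \<subseteq> I \<Longrightarrow> H_traj H c eps J \<Gamma>"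
  unfolding H_traj_vf by (meson has_vector_derivative_within_subset subsetD)

lemma H_traj_unique_backward:
  assumes "H_traj H c eps {..0} \<Gamma>1" "H_traj H c eps {..0} \<Gamma>2" "\<Gamma>1 0 = \<Gamma>2 0" "s \<le> 0"
  shows "\<Gamma>1 s = \<Gamma>2 s"
proof -
  have "{s..0} \<subseteq> {..0}" by auto
  then show ?thesis
    using H_traj_unique_Icc[OF H_traj_subset[OF assms(1)] H_traj_subset[OF assms(2)], of s 0 0 s] assms(3,4) by auto
qed

end

section \<open>Limits of calibrated curves and the set of limit points\<close>

context kam_eps
begin

lemma calib_shift:
  assumes cal: "calib R D v I \<gamma>" and k: "int_vec k" and J: "\<And>s. s \<in> J \<Longrightarrow> s + \<tau> \<in> I"
  shows "calib R D v J (\<lambda>s. \<gamma> (s + \<tau>) + k)"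
  unfolding calib_def
proof (intro conjI ballI allI impI)
  fix s t assume "s \<in> J" "t \<in> J"
  then have st: "s + \<tau> \<in> I" "t + \<tau> \<in> I" using J by auto
  show "norm (\<gamma> (t + \<tau>) + k - (\<gamma> (s + \<tau>) + k)) \<le> R * \<bar>t - s\<bar>"
    using calibD(1)[OF cal st] by simp
  fix p assume "s \<le> t"
  then show "v (\<gamma> (t + \<tau>) + k) - v (\<gamma> (s + \<tau>) + k) \<ge> (p - c) \<bullet> (\<gamma> (t + \<tau>) + k - (\<gamma> (s + \<tau>) + k)) +
      (t - s) * (hcrit H c - H (\<gamma> (t + \<tau>) + k) p - eps * v (\<gamma> (t + \<tau>) + k)) - D p * (t - s)\<^sup>2"
    using calibD(2)[OF cal st, of p] by (simp add: v_periodic[OF k] H_periodic[OF k])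
qed

lemma calib_limit:
  assumes cal: "\<And>n. calib R D v (I n) (\<gamma> n)" and ev: "\<And>s. eventually (\<lambda>n. s \<in> I n) sequentially"
    and lim: "\<And>s. (\<lambda>n. \<gamma> n s) \<longlonglongrightarrow> \<eta> s"
  shows "calib R D v UNIV \<eta>"
  unfolding calib_def
proof (intro conjI ballI allI impI)
  fix s t :: real
  have both: "eventually (\<lambda>n. s \<in> I n \<and> t \<in> I n) sequentially" using ev by (intro eventually_conj)
  have "(\<lambda>n. norm (\<gamma> n t - \<gamma> n s)) \<longlonglongrightarrow> norm (\<eta> t - \<eta> s)" by (intro tendsto_intros lim)
  then show "norm (\<eta> t - \<eta> s) \<le> R * \<bar>t - s\<bar>"
    by (rule tendsto_upperbound) (use both in \<open>auto elim!: eventually_mono intro: calibD(1)[OF cal]\<close>)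
  fix p assume st: "s \<le> t"
  have 1: "(\<lambda>n. v (\<gamma> n t) - v (\<gamma> n s)) \<longlonglongrightarrow> v (\<eta> t) - v (\<eta> s)" by (intro tendsto_intros v_tendsto lim)
  have 2: "(\<lambda>n. (p - c) \<bullet> (\<gamma> n t - \<gamma> n s) + (t - s) * (hcrit H c - H (\<gamma> n t) p - eps * v (\<gamma> n t)) - D p * (t - s)\<^sup>2)
    \<longlonglongrightarrow> (p - c) \<bullet> (\<eta> t - \<eta> s) + (t - s) * (hcrit H c - H (\<eta> t) p - eps * v (\<eta> t)) - D p * (t - s)\<^sup>2"
    by (intro tendsto_intros v_tendsto H_tendsto lim)
  show "v (\<eta> t) - v (\<eta> s) \<ge> (p - c) \<bullet> (\<eta> t - \<eta> s) + (t - s) * (hcrit H c - H (\<eta> t) p - eps * v (\<eta> t)) - D p * (t - s)\<^sup>2"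
    by (rule tendsto_le[OF sequentially_bot 1 2])
      (use both st in \<open>auto elim!: eventually_mono intro: calibD(2)[OF cal]\<close>)
qed

text \<open>Compactness uses the Lipschitz bound on the whole line; since every time eventually
  belongs to the domains I n, the limit is calibrated everywhere.\<close>

lemma calib_compact:
  assumes cal: "\<And>n. calib R D v (I n) (\<gamma> n)" and ev: "\<And>s. eventually (\<lambda>n. s \<in> I n) sequentially"
    and lip: "\<And>n s t. norm (\<gamma> n s - \<gamma> n t) \<le> R * \<bar>s - t\<bar>" and R: "R \<ge> 0" and y: "(\<lambda>n. \<gamma> n 0) \<longlonglongrightarrow> y"
  shows "\<exists>r \<eta>. strict_mono (r :: nat \<Rightarrow> nat) \<and> (\<forall>s. (\<lambda>n. \<gamma> (r n) s) \<longlonglongrightarrow> \<eta> s) \<and> calib R D v UNIV \<eta> \<and> \<eta> 0 = y"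
proof -
  obtain B where B: "\<And>n. norm (\<gamma> n 0) \<le> B"
    using convergent_imp_bounded[OF y] unfolding bounded_iff by auto
  have "\<exists>r \<eta>. strict_mono (r :: nat \<Rightarrow> nat) \<and> (\<forall>s. (\<lambda>n. \<gamma> (r n) s) \<longlonglongrightarrow> \<eta> s) \<and>
      (\<forall>s t. norm (\<eta> s - \<eta> t) \<le> R * norm (s - t))"
    by (rule Lipschitz_compactness[of \<gamma> R "\<lambda>_. 0" B]) (use lip R B in auto)
  then obtain r \<eta> where r: "strict_mono (r :: nat \<Rightarrow> nat)" and \<eta>: "\<And>s. (\<lambda>n. \<gamma> (r n) s) \<longlonglongrightarrow> \<eta> s" by blast
  have "calib R D v UNIV \<eta>"
    by (rule calib_limit[of R D "\<lambda>n. I (r n)" "\<lambda>n. \<gamma> (r n)"])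
      (use cal \<eta> eventually_subseq[OF r ev] in auto)
  moreover have "\<eta> 0 = y"
    using LIMSEQ_unique[OF \<eta>[of 0]] LIMSEQ_subseq_LIMSEQ[OF y r] by (simp add: o_def)
  ultimately show ?thesis using r \<eta> by blast
qed

text \<open>One pair of constants valid for every minimizer, so that limits of different minimizers
  stay calibrated with the same constants.\<close>

definition RD :: "real \<times> (real^'n \<Rightarrow> real)" where
  "RD = (SOME RD. fst RD \<ge> 0 \<and> (\<forall>x \<gamma>. minimizing H c eps x \<gamma> \<longrightarrow> calib (fst RD) (snd RD) v {..0} \<gamma>))"

abbreviation "RM \<equiv> fst RD"
abbreviation "DM \<equiv> snd RD"

lemma RM: "RM \<ge> 0" and minimizing_calib_RD: "minimizing H c eps x \<gamma> \<Longrightarrow> calib RM DM v {..0} \<gamma>"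
proof -
  obtain R D where RD: "\<And>x \<gamma>. minimizing H c eps x \<gamma> \<Longrightarrow> calib R D v {..0} \<gamma>"
    using minimizing_calib by blast
  \<comment> \<open>The sign of R is read off from the speed bound of some minimizer.\<close>
  obtain \<eta> where "minimizing H c eps 0 \<eta>" using minimizing_ex by blast
  from calibD(1)[OF RD[OF this], of "-1" 0] have "norm (\<eta> 0 - \<eta> (- 1)) \<le> R" by simp
  then have "R \<ge> 0" by (rule order_trans[OF norm_ge_zero])
  then have "\<exists>RD. fst RD \<ge> 0 \<and> (\<forall>x \<gamma>. minimizing H c eps x \<gamma> \<longrightarrow> calib (fst RD) (snd RD) v {..0} \<gamma>)"
    using RD by (intro exI[of _ "(R, D)"]) auto
  from someI_ex[OF this, folded RD_def]
  show "RM \<ge> 0" "minimizing H c eps x \<gamma> \<Longrightarrow> calib RM DM v {..0} \<gamma>" by auto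
qed

text \<open>With time \<tau> n moved to 0, the curves are calibrated on {..- \<tau> n}, and these
  half-lines exhaust the line. The limit curve at time s is a limit along the times s + \<tau> n,
  again tending to minus infinity, so it consists of limit points of the same \<gamma>.\<close>

lemma alpha_limit_curve:
  assumes m: "minimizing H c eps x \<gamma>" and y: "y \<in> alpha_limits \<gamma>"
  shows "\<exists>\<eta>. calib RM DM v UNIV \<eta> \<and> \<eta> 0 = y \<and> (\<forall>s. \<eta> s \<in> alpha_limits \<gamma>)"
proof -
  note cal = minimizing_calib_RD[OF m]
  obtain \<tau> k where \<tau>: "filterlim \<tau> at_bot sequentially" and k: "\<And>j. int_vec (k j)"
    and lim: "(\<lambda>j. \<gamma> (\<tau> j) + k j) \<longlonglongrightarrow> y"
    using y unfolding alpha_limits_def by blast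
  have ev: "eventually (\<lambda>n. s \<le> - \<tau> n) sequentially" for s
    using \<tau>[unfolded filterlim_at_bot, rule_format, of "- s"] by eventually_elim simp
  \<comment> \<open>The minimum stops the curve at its end point, which makes the shifted curves
    Lipschitz on the whole line.\<close>
  define \<gamma>' where "\<gamma>' = (\<lambda>n s. \<gamma> (min 0 (s + \<tau> n)) + k n)"
  have c': "calib RM DM v {..- \<tau> n} (\<gamma>' n)" for n
  proof -
    have "calib RM DM v {..- \<tau> n} (\<lambda>s. \<gamma> (s + \<tau> n) + k n)"
      by (rule calib_shift[OF cal k]) auto
    moreover have "\<gamma>' n s = \<gamma> (s + \<tau> n) + k n" if "s \<in> {..- \<tau> n}" for s
      using that by (simp add: \<gamma>'_def min_absorb2)
    ultimately show ?thesis unfolding calib_def by (metis (no_types, lifting))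
  qed
  have l': "norm (\<gamma>' n s - \<gamma>' n t) \<le> RM * \<bar>s - t\<bar>" for n s t
  proof -
    have "norm (\<gamma>' n s - \<gamma>' n t) \<le> RM * \<bar>min 0 (s + \<tau> n) - min 0 (t + \<tau> n)\<bar>"
      unfolding \<gamma>'_def using calibD(1)[OF cal, of "min 0 (t + \<tau> n)" "min 0 (s + \<tau> n)"] by simp
    also have "\<dots> \<le> RM * \<bar>s - t\<bar>" using RM by (intro mult_left_mono) auto
    finally show ?thesis .
  qed
  have "eventually (\<lambda>n. \<gamma> (\<tau> n) + k n = \<gamma>' n 0) sequentially"
    using ev[of 0] by eventually_elim (simp add: \<gamma>'_def min_absorb2)
  then have y': "(\<lambda>n. \<gamma>' n 0) \<longlonglongrightarrow> y" using lim by (simp add: tendsto_cong)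
  obtain r \<eta> where r: "strict_mono (r :: nat \<Rightarrow> nat)" and \<eta>: "\<And>s. (\<lambda>n. \<gamma>' (r n) s) \<longlonglongrightarrow> \<eta> s"
    and c\<eta>: "calib RM DM v UNIV \<eta>" "\<eta> 0 = y"
    using calib_compact[of RM DM "\<lambda>n. {..- \<tau> n}" \<gamma>' y] c' l' y' ev RM by auto
  have "\<eta> s \<in> alpha_limits \<gamma>" for s
    unfolding alpha_limits_def mem_Collect_eq
  proof (intro exI conjI allI)
    show "filterlim (\<lambda>n. s + \<tau> (r n)) at_bot sequentially"
      unfolding filterlim_at_bot
    proof
      fix Z
      show "eventually (\<lambda>n. s + \<tau> (r n) \<le> Z) sequentially"
        using eventually_subseq[OF r ev[of "s - Z"]] by eventually_elim simp
    qed
    show "int_vec (k (r n))" for n by (rule k)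
    have "eventually (\<lambda>n. \<gamma>' (r n) s = \<gamma> (s + \<tau> (r n)) + k (r n)) sequentially"
      using eventually_subseq[OF r ev[of s]] by eventually_elim (simp add: \<gamma>'_def min_absorb2)
    then show "(\<lambda>n. \<gamma> (s + \<tau> (r n)) + k (r n)) \<longlonglongrightarrow> \<eta> s" using \<eta>[of s] by (simp add: tendsto_cong)
  qed
  then show ?thesis using c\<eta> by blast
qed

text \<open>Limit points carry such curves by \<open>alpha_limit_curve\<close>; the closure is
  reached by a further limit, for which the constants must not depend on the curve.\<close>

theorem Malpha_curve:
  assumes "y \<in> Malpha H c eps"
  shows "\<exists>\<eta>. calib RM DM v UNIV \<eta> \<and> \<eta> 0 = y \<and> (\<forall>s. \<eta> s \<in> Malpha H c eps)"
proof -
  define A where "A = (\<Union>x. \<Union>{alpha_limits \<gamma> | \<gamma>. minimizing H c eps x \<gamma>})"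
  have MA: "Malpha H c eps = closure A" by (simp add: Malpha_def A_def)
  have curve: "\<exists>\<eta>. calib RM DM v UNIV \<eta> \<and> \<eta> 0 = z \<and> (\<forall>s. \<eta> s \<in> A)" if z: "z \<in> A" for z
  proof -
    obtain x \<gamma> where g: "minimizing H c eps x \<gamma>" "z \<in> alpha_limits \<gamma>" using z unfolding A_def by blast
    then obtain \<eta> where \<eta>: "calib RM DM v UNIV \<eta>" "\<eta> 0 = z" "\<And>s. \<eta> s \<in> alpha_limits \<gamma>"
      using alpha_limit_curve by blast
    have "alpha_limits \<gamma> \<subseteq> A" unfolding A_def using g(1) by blast
    then show ?thesis using \<eta> by blast
  qed
  obtain Y where Y: "\<And>n. Y n \<in> A" "Y \<longlonglongrightarrow> y"
    using assms unfolding MA closure_sequential by blast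
  have "\<forall>n. \<exists>\<eta>. calib RM DM v UNIV \<eta> \<and> \<eta> 0 = Y n \<and> (\<forall>s. \<eta> s \<in> A)" using curve[OF Y(1)] by blast
  then obtain \<eta> where \<eta>: "\<And>n. calib RM DM v UNIV (\<eta> n)" "\<And>n. \<eta> n 0 = Y n" "\<And>n s. \<eta> n s \<in> A" by metis
  have lip: "norm (\<eta> n s - \<eta> n t) \<le> RM * \<bar>s - t\<bar>" for n s t using calibD(1)[OF \<eta>(1), of t s n] by simp
  obtain r \<zeta> where "strict_mono (r :: nat \<Rightarrow> nat)" and \<zeta>: "\<And>s. (\<lambda>n. \<eta> (r n) s) \<longlonglongrightarrow> \<zeta> s"
    and c\<zeta>: "calib RM DM v UNIV \<zeta>" "\<zeta> 0 = y"
    using calib_compact[of RM DM "\<lambda>_. UNIV" \<eta> y] \<eta> lip RM Y(2) by auto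
  have "\<zeta> s \<in> closure A" for s
    unfolding closure_sequential
    by (intro exI[of _ "\<lambda>n. \<eta> (r n) s"] conjI allI \<eta>(3) \<zeta>)
  then show ?thesis unfolding MA using c\<zeta> by blast
qed

text \<open>A calibrated curve passes through y and continues beyond it, which forces
  differentiability there.\<close>

lemma Malpha_differentiable:
  assumes "y \<in> Malpha H c eps"
  shows "(v has_derivative (\<lambda>h. grad v y \<bullet> h)) (at y)"
proof -
  obtain \<eta> where \<eta>: "calib RM DM v UNIV \<eta>" "\<eta> 0 = y" using Malpha_curve[OF assms] by blast
  show ?thesis using calib_differentiable(1)[OF \<eta>(1) zero_less_one, of 0] \<eta>(2) by simp
qed

lemma sg_periodic:
  assumes "sg q x" "int_vec k"
  shows "sg q (x + k)"
proof -
  have "v (x + k + w) = v (x + w)" for w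
    using v_periodic[OF assms(2), of "x + w"] by (simp add: add.assoc add.commute[of w k])
  then show ?thesis using assms(1) unfolding sg_def v_periodic[OF assms(2)] by simp
qed

lemma Malpha_star_subset_graph: "Malpha_star H c eps \<subseteq> graph_grad H c eps"
  unfolding Malpha_star_def graph_grad_def using Malpha_differentiable by (auto simp: differentiable_def)

text \<open>Both inclusions follow lifted calibrated curves: uniqueness identifies an arbitrary
  trajectory with such a lift, and a time shift by s produces one that ends at a prescribed
  point.\<close>

lemma Malpha_star_flow: "flow_image (H_traj H c eps) s (Malpha_star H c eps) = Malpha_star H c eps"
proof
  have lift_in: "lift \<eta> t \<in> Malpha_star H c eps" if "\<eta> t \<in> Malpha H c eps" for \<eta> t
    using that unfolding Malpha_star_def lift_def by blast
  show "flow_image (H_traj H c eps) s (Malpha_star H c eps) \<subseteq> Malpha_star H c eps"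
  proof
    fix z assume "z \<in> flow_image (H_traj H c eps) s (Malpha_star H c eps)"
    then obtain \<Gamma> where \<Gamma>: "H_traj H c eps {min 0 s..max 0 s} \<Gamma>" "\<Gamma> 0 \<in> Malpha_star H c eps" "z = \<Gamma> s"
      unfolding flow_image_def by blast
    obtain y where y: "y \<in> Malpha H c eps" "\<Gamma> 0 = (y, c + grad v y)" using \<Gamma>(2) unfolding Malpha_star_def by blast
    obtain \<eta> where \<eta>: "calib RM DM v UNIV \<eta>" "\<eta> 0 = y" "\<And>s. \<eta> s \<in> Malpha H c eps" using Malpha_curve[OF y(1)] by blast
    have "\<Gamma> s = lift \<eta> s"
      by (rule H_traj_unique_Icc[OF \<Gamma>(1) calib_H_traj[OF \<eta>(1)], of 0]) (use y \<eta>(2) in \<open>auto simp: lift_def\<close>)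
    then show "z \<in> Malpha_star H c eps" using lift_in[OF \<eta>(3)] \<Gamma>(3) by simp
  qed
  show "Malpha_star H c eps \<subseteq> flow_image (H_traj H c eps) s (Malpha_star H c eps)"
  proof
    fix z assume "z \<in> Malpha_star H c eps"
    then obtain y where y: "y \<in> Malpha H c eps" "z = (y, c + grad v y)" unfolding Malpha_star_def by blast
    obtain \<eta> where \<eta>: "calib RM DM v UNIV \<eta>" "\<eta> 0 = y" "\<And>s. \<eta> s \<in> Malpha H c eps" using Malpha_curve[OF y(1)] by blast
    define \<zeta> where "\<zeta> = (\<lambda>t. \<eta> (t - s))"
    have "calib RM DM v UNIV (\<lambda>t. \<eta> (t + - s) + 0)"
      by (rule calib_shift[OF \<eta>(1)]) (auto simp: int_vec_def)
    then have "calib RM DM v UNIV \<zeta>" by (simp add: \<zeta>_def)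
    then have "H_traj H c eps {min 0 s..max 0 s} (lift \<zeta>)" by (rule calib_H_traj)
    moreover have "lift \<zeta> 0 \<in> Malpha_star H c eps" by (rule lift_in) (simp add: \<zeta>_def \<eta>(3))
    moreover have "z = lift \<zeta> s" by (simp add: lift_def \<zeta>_def \<eta>(2) y(2))
    ultimately show "z \<in> flow_image (H_traj H c eps) s (Malpha_star H c eps)"
      unfolding flow_image_def by blast
  qed
qed

text \<open>q is the limiting momentum at the end of a minimizing curve from x. Recording that it is
  a supergradient identifies it with the gradient wherever that exists. Uniqueness extends the claim
  from the lift to every trajectory with this initial value.\<close>

lemma backward_orbit_H:
  "\<exists>q. sg q x \<and> backward_orbit_prop (H_traj H c eps) (x, c + q)
    (\<lambda>\<Gamma>. (\<forall>s<0. \<Gamma> s \<in> graph_grad H c eps) \<and> alpha_acc \<Gamma> \<subseteq> Malpha_star H c eps)"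
proof -
  obtain \<gamma> where m: "minimizing H c eps x \<gamma>" using minimizing_ex by blast
  have g0: "\<gamma> 0 = x" using m by (simp add: minimizing_def)
  note cal = minimizing_calib_RD[OF m]
  obtain \<Gamma> where \<Gamma>: "H_traj H c eps {..0} \<Gamma>" "\<forall>s<0. \<Gamma> s = lift \<gamma> s" "fst (\<Gamma> 0) = \<gamma> 0" "sg (snd (\<Gamma> 0) - c) (\<gamma> 0)"
    using calib_backward_H_traj[OF cal] by blast
  define q where "q = snd (\<Gamma> 0) - c"
  have \<Gamma>0: "\<Gamma> 0 = (x, c + q)" using \<Gamma>(3) g0 by (simp add: q_def prod_eq_iff)
  have dif: "(v has_derivative (\<lambda>h. grad v (\<gamma> s) \<bullet> h)) (at (\<gamma> s))" "sg (grad v (\<gamma> s)) (\<gamma> s)" if s: "s < 0" for s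
  proof -
    have "- s > 0" "{s..s + - s} \<subseteq> {..0}" using s by auto
    from calib_differentiable[OF cal this]
    show "(v has_derivative (\<lambda>h. grad v (\<gamma> s) \<bullet> h)) (at (\<gamma> s))" "sg (grad v (\<gamma> s)) (\<gamma> s)" by auto
  qed
  have orbit: "(\<forall>s<0. \<Gamma>' s \<in> graph_grad H c eps) \<and> alpha_acc \<Gamma>' \<subseteq> Malpha_star H c eps"
    if \<Gamma>': "H_traj H c eps {..0} \<Gamma>'" "\<Gamma>' 0 = (x, c + q)" for \<Gamma>'
  proof
    have eq: "\<Gamma>' s = lift \<gamma> s" if "s < 0" for s
      using H_traj_unique_backward[OF \<Gamma>'(1) \<Gamma>(1), of s] \<Gamma>'(2) \<Gamma>0 \<Gamma>(2) that by simp
    show "\<forall>s<0. \<Gamma>' s \<in> graph_grad H c eps"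
      using eq dif(1) unfolding graph_grad_def lift_def differentiable_def by blast
    show "alpha_acc \<Gamma>' \<subseteq> Malpha_star H c eps"
    proof
      fix w assume "w \<in> alpha_acc \<Gamma>'"
      then obtain \<tau> k where \<tau>: "filterlim \<tau> at_bot sequentially" and k: "\<And>j. int_vec (k j)"
        and lim: "(\<lambda>j. (fst (\<Gamma>' (\<tau> j)) + k j, snd (\<Gamma>' (\<tau> j)))) \<longlonglongrightarrow> w"
        unfolding alpha_acc_def by blast
      have "eventually (\<lambda>n. \<tau> n \<le> -1) sequentially" using \<tau>[unfolded filterlim_at_bot] by blast
      then obtain N where N: "\<And>n. n \<ge> N \<Longrightarrow> \<tau> n \<le> -1" by (auto simp: eventually_sequentially)
      \<comment> \<open>Discarding finitely many terms makes all times negative, where \<Gamma>'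
        coincides with the lift.\<close>
      define \<sigma> where "\<sigma> = (\<lambda>n. \<tau> (n + N))"
      define l where "l = (\<lambda>n. k (n + N))"
      have \<sigma>0: "\<sigma> n < 0" for n using N[of "n + N"] by (simp add: \<sigma>_def)
      have \<sigma>: "filterlim \<sigma> at_bot sequentially"
        unfolding \<sigma>_def using filterlim_compose[OF \<tau> filterlim_add_const_nat_at_top[of N]] by simp
      have "(\<lambda>n. (fst (\<Gamma>' (\<sigma> n)) + l n, snd (\<Gamma>' (\<sigma> n)))) \<longlonglongrightarrow> w"
        unfolding \<sigma>_def l_def using LIMSEQ_ignore_initial_segment[OF lim, of N] by simp
      then have lim': "(\<lambda>n. (\<gamma> (\<sigma> n) + l n, c + grad v (\<gamma> (\<sigma> n)))) \<longlonglongrightarrow> w"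
        using eq[OF \<sigma>0] by (simp add: lift_def)
      from tendsto_fst[OF lim'] have 1: "(\<lambda>n. \<gamma> (\<sigma> n) + l n) \<longlonglongrightarrow> fst w" by simp
      from tendsto_snd[OF lim'] have 2: "(\<lambda>n. c + grad v (\<gamma> (\<sigma> n))) \<longlonglongrightarrow> snd w" by simp
      have "fst w \<in> alpha_limits \<gamma>"
        unfolding alpha_limits_def using \<sigma> 1 k by (auto simp: l_def intro!: exI[of _ \<sigma>] exI[of _ l])
      then have M: "fst w \<in> Malpha H c eps"
        unfolding Malpha_def using m by (intro subsetD[OF closure_subset]) blast
      \<comment> \<open>Integer translation preserves supergradients; the translated points converge
        to \<open>fst w\<close>, where v is differentiable, and this identifies the limit
        momentum.\<close>
      have "sg (grad v (\<gamma> (\<sigma> n))) (\<gamma> (\<sigma> n) + l n)" for n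
        using dif(2)[OF \<sigma>0] k by (intro sg_periodic) (auto simp: l_def)
      then have "(\<lambda>n. grad v (\<gamma> (\<sigma> n))) \<longlonglongrightarrow> grad v (fst w)"
        by (intro sg_grad_tendsto[OF 1 _ Malpha_differentiable[OF M]])
      then have "(\<lambda>n. c + grad v (\<gamma> (\<sigma> n))) \<longlonglongrightarrow> c + grad v (fst w)" by (intro tendsto_intros)
      then have "snd w = c + grad v (fst w)" using 2 LIMSEQ_unique by blast
      then show "w \<in> Malpha_star H c eps" using M unfolding Malpha_star_def by (metis (mono_tags, lifting) mem_Collect_eq prod.collapse)
    qed
  qed
  have "sg q x" using \<Gamma>(4) g0 by (simp add: q_def)
  moreover have "backward_orbit_prop (H_traj H c eps) (x, c + q)
    (\<lambda>\<Gamma>. (\<forall>s<0. \<Gamma> s \<in> graph_grad H c eps) \<and> alpha_acc \<Gamma> \<subseteq> Malpha_star H c eps)"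
    unfolding backward_orbit_prop_def using orbit \<Gamma>(1) \<Gamma>0 by blast
  ultimately show ?thesis by blast
qed

section \<open>Transfer to the Euler--Lagrange flow\<close>

text \<open>By \<open>Lxi_eq\<close> and \<open>Lx_eq\<close> the Euler-Lagrange equation is the
  momentum equation for p = mom x \<xi>, while \<open>Hp_mom\<close> gives x' = Hp.\<close>

lemma EL_to_H:
  assumes "EL_traj H c eps I \<Gamma>"
  shows "H_traj H c eps I (\<lambda>s. (fst (\<Gamma> s), mom (fst (\<Gamma> s)) (snd (\<Gamma> s))))"
  unfolding H_traj_def
proof
  fix t assume t: "t \<in> I"
  then have 1: "((\<lambda>s. fst (\<Gamma> s)) has_vector_derivative snd (\<Gamma> t)) (at t within I)"
    and 2: "((\<lambda>s. mom (fst (\<Gamma> s)) (snd (\<Gamma> s))) has_vector_derivative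
      (- Hx H (fst (\<Gamma> t)) (mom (fst (\<Gamma> t)) (snd (\<Gamma> t))) - eps *\<^sub>R mom (fst (\<Gamma> t)) (snd (\<Gamma> t)) + eps *\<^sub>R c)) (at t within I)"
    using assms unfolding EL_traj_def Lxi_eq Lx_eq by auto
  from has_vector_derivative_Pair[OF 1 2]
  show "((\<lambda>s. (fst (\<Gamma> s), mom (fst (\<Gamma> s)) (snd (\<Gamma> s)))) has_vector_derivative
     (Hp H (fst (fst (\<Gamma> t), mom (fst (\<Gamma> t)) (snd (\<Gamma> t)))) (snd (fst (\<Gamma> t), mom (fst (\<Gamma> t)) (snd (\<Gamma> t)))),
      - Hx H (fst (fst (\<Gamma> t), mom (fst (\<Gamma> t)) (snd (\<Gamma> t)))) (snd (fst (\<Gamma> t), mom (fst (\<Gamma> t)) (snd (\<Gamma> t)))) + eps *\<^sub>R c -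
      eps *\<^sub>R snd (fst (\<Gamma> t), mom (fst (\<Gamma> t)) (snd (\<Gamma> t))))) (at t within I)"
    by (simp add: algebra_simps)
qed

lemma H_to_EL:
  assumes "H_traj H c eps I \<Gamma>"
  shows "EL_traj H c eps I (\<lambda>s. (fst (\<Gamma> s), Hp H (fst (\<Gamma> s)) (snd (\<Gamma> s))))"
  unfolding EL_traj_def
proof (intro conjI ballI)
  have "continuous_on I \<Gamma>"
    using assms unfolding H_traj_def continuous_on_eq_continuous_within by (auto intro: has_vector_derivative_continuous)
  then show "continuous_on I (\<lambda>s. (fst (\<Gamma> s), Hp H (fst (\<Gamma> s)) (snd (\<Gamma> s))))"
    by (intro continuous_intros Hp_continuous_compose)
  fix t assume t: "t \<in> I"
  have D: "(\<Gamma> has_vector_derivative (Hp H (fst (\<Gamma> t)) (snd (\<Gamma> t)), - Hx H (fst (\<Gamma> t)) (snd (\<Gamma> t)) + eps *\<^sub>R c - eps *\<^sub>R snd (\<Gamma> t))) (at t within I)"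
    using assms t unfolding H_traj_def by blast
  show "((\<lambda>s. fst (fst (\<Gamma> s), Hp H (fst (\<Gamma> s)) (snd (\<Gamma> s)))) has_vector_derivative
      snd (fst (\<Gamma> t), Hp H (fst (\<Gamma> t)) (snd (\<Gamma> t)))) (at t within I)"
    using bounded_linear.has_vector_derivative[OF bounded_linear_fst D] by simp
  show "((\<lambda>s. Lxi H (fst (fst (\<Gamma> s), Hp H (fst (\<Gamma> s)) (snd (\<Gamma> s)))) (snd (fst (\<Gamma> s), Hp H (fst (\<Gamma> s)) (snd (\<Gamma> s))))) has_vector_derivative
      Lx H (fst (fst (\<Gamma> t), Hp H (fst (\<Gamma> t)) (snd (\<Gamma> t)))) (snd (fst (\<Gamma> t), Hp H (fst (\<Gamma> t)) (snd (\<Gamma> t)))) -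
      eps *\<^sub>R Lxi H (fst (fst (\<Gamma> t), Hp H (fst (\<Gamma> t)) (snd (\<Gamma> t)))) (snd (fst (\<Gamma> t), Hp H (fst (\<Gamma> t)) (snd (\<Gamma> t)))) + eps *\<^sub>R c) (at t within I)"
    using bounded_linear.has_vector_derivative[OF bounded_linear_snd D] by (simp add: Lxi_eq Lx_eq algebra_simps)
qed

lemma Malpha_tilde_iff: "(x, \<xi>) \<in> Malpha_tilde H c eps \<longleftrightarrow> (x, mom x \<xi>) \<in> Malpha_star H c eps"
proof -
  have "\<xi> = Hp H x (c + grad v x) \<longleftrightarrow> mom x \<xi> = c + grad v x" by (metis Hp_mom mom_Hp)
  then show ?thesis unfolding Malpha_tilde_def Malpha_star_def by auto
qed

lemma Malpha_tilde_flow: "flow_image (EL_traj H c eps) s (Malpha_tilde H c eps) = Malpha_tilde H c eps"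
proof
  show "flow_image (EL_traj H c eps) s (Malpha_tilde H c eps) \<subseteq> Malpha_tilde H c eps"
  proof
    fix z assume "z \<in> flow_image (EL_traj H c eps) s (Malpha_tilde H c eps)"
    then obtain \<Gamma> where \<Gamma>: "EL_traj H c eps {min 0 s..max 0 s} \<Gamma>" "\<Gamma> 0 \<in> Malpha_tilde H c eps" "z = \<Gamma> s"
      unfolding flow_image_def by blast
    have "(fst (\<Gamma> 0), mom (fst (\<Gamma> 0)) (snd (\<Gamma> 0))) \<in> Malpha_star H c eps"
      using \<Gamma>(2) Malpha_tilde_iff[of "fst (\<Gamma> 0)" "snd (\<Gamma> 0)"] by simp
    then have "(fst (\<Gamma> s), mom (fst (\<Gamma> s)) (snd (\<Gamma> s))) \<in> flow_image (H_traj H c eps) s (Malpha_star H c eps)"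
      unfolding flow_image_def mem_Collect_eq using EL_to_H[OF \<Gamma>(1)]
      by (intro exI[of _ "\<lambda>s. (fst (\<Gamma> s), mom (fst (\<Gamma> s)) (snd (\<Gamma> s)))"]) simp
    then show "z \<in> Malpha_tilde H c eps"
      using Malpha_tilde_iff[of "fst (\<Gamma> s)" "snd (\<Gamma> s)"] \<Gamma>(3) by (simp add: Malpha_star_flow)
  qed
  show "Malpha_tilde H c eps \<subseteq> flow_image (EL_traj H c eps) s (Malpha_tilde H c eps)"
  proof
    fix z assume z: "z \<in> Malpha_tilde H c eps"
    then have "(fst z, mom (fst z) (snd z)) \<in> flow_image (H_traj H c eps) s (Malpha_star H c eps)"
      using Malpha_tilde_iff[of "fst z" "snd z"] by (simp add: Malpha_star_flow)
    then obtain \<Gamma> where \<Gamma>: "H_traj H c eps {min 0 s..max 0 s} \<Gamma>" "\<Gamma> 0 \<in> Malpha_star H c eps" "(fst z, mom (fst z) (snd z)) = \<Gamma> s"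
      unfolding flow_image_def by blast
    let ?\<Gamma> = "\<lambda>s. (fst (\<Gamma> s), Hp H (fst (\<Gamma> s)) (snd (\<Gamma> s)))"
    have "?\<Gamma> 0 \<in> Malpha_tilde H c eps" using \<Gamma>(2) by (simp add: Malpha_tilde_iff)
    moreover have "z = ?\<Gamma> s" using \<Gamma>(3)[symmetric] by simp
    ultimately show "z \<in> flow_image (EL_traj H c eps) s (Malpha_tilde H c eps)"
      unfolding flow_image_def mem_Collect_eq using H_to_EL[OF \<Gamma>(1)]
      by (intro exI[of _ ?\<Gamma>]) simp
  qed
qed

text \<open>The Legendre transform in the fibre is continuous and commutes with integer
  translations, so it carries accumulation points to accumulation points.\<close>

lemma backward_orbit_EL:
  assumes "backward_orbit_prop (H_traj H c eps) (x, p) (\<lambda>\<Gamma>. P \<Gamma> \<and> alpha_acc \<Gamma> \<subseteq> Malpha_star H c eps)"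
  shows "backward_orbit_prop (EL_traj H c eps) (x, Hp H x p) (\<lambda>\<Gamma>. alpha_acc \<Gamma> \<subseteq> Malpha_tilde H c eps)"
  unfolding backward_orbit_prop_def
proof (intro conjI allI impI)
  obtain \<Gamma> where "H_traj H c eps {..0} \<Gamma>" "\<Gamma> 0 = (x, p)" using assms unfolding backward_orbit_prop_def by blast
  then show "\<exists>\<Gamma>. EL_traj H c eps {..0} \<Gamma> \<and> \<Gamma> 0 = (x, Hp H x p)"
    using H_to_EL by (intro exI[of _ "\<lambda>s. (fst (\<Gamma> s), Hp H (fst (\<Gamma> s)) (snd (\<Gamma> s)))"]) simp
  fix \<Gamma> assume \<Gamma>: "EL_traj H c eps {..0} \<Gamma> \<and> \<Gamma> 0 = (x, Hp H x p)"
  let ?\<Gamma> = "\<lambda>s. (fst (\<Gamma> s), mom (fst (\<Gamma> s)) (snd (\<Gamma> s)))"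
  have "H_traj H c eps {..0} ?\<Gamma>" "?\<Gamma> 0 = (x, p)" using \<Gamma> EL_to_H by auto
  then have acc: "alpha_acc ?\<Gamma> \<subseteq> Malpha_star H c eps" using assms unfolding backward_orbit_prop_def by blast
  show "alpha_acc \<Gamma> \<subseteq> Malpha_tilde H c eps"
  proof
    fix w assume "w \<in> alpha_acc \<Gamma>"
    then obtain \<tau> k where \<tau>: "filterlim \<tau> at_bot sequentially" and k: "\<forall>j. int_vec (k j)"
      and lim: "(\<lambda>j. (fst (\<Gamma> (\<tau> j)) + k j, snd (\<Gamma> (\<tau> j)))) \<longlonglongrightarrow> w"
      unfolding alpha_acc_def by blast
    have "(\<lambda>j. mom (fst (\<Gamma> (\<tau> j)) + k j) (snd (\<Gamma> (\<tau> j)))) \<longlonglongrightarrow> mom (fst w) (snd w)"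
      using continuous_on_tendsto_compose[OF mom_continuous lim] by simp
    then have "(\<lambda>j. mom (fst (\<Gamma> (\<tau> j))) (snd (\<Gamma> (\<tau> j)))) \<longlonglongrightarrow> mom (fst w) (snd w)"
      using k by (simp add: mom_periodic)
    with tendsto_fst[OF lim] have "(\<lambda>j. (fst (?\<Gamma> (\<tau> j)) + k j, snd (?\<Gamma> (\<tau> j)))) \<longlonglongrightarrow> (fst w, mom (fst w) (snd w))"
      by (intro tendsto_Pair) simp_all
    then have "(fst w, mom (fst w) (snd w)) \<in> alpha_acc ?\<Gamma>"
      unfolding alpha_acc_def using \<tau> k by blast
    then show "w \<in> Malpha_tilde H c eps" using acc Malpha_tilde_iff[of "fst w" "snd w"] by auto
  qed
qed

text \<open>A derivative is the only supergradient, so the q of \<open>backward_orbit_H\<close> is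
  grad v x.\<close>

lemma backward_orbit_H_grad:
  assumes "v differentiable (at x)"
  shows "backward_orbit_prop (H_traj H c eps) (x, c + grad v x)
    (\<lambda>\<Gamma>. (\<forall>s<0. \<Gamma> s \<in> graph_grad H c eps) \<and> alpha_acc \<Gamma> \<subseteq> Malpha_star H c eps)"
proof -
  obtain q where q: "sg q x" "backward_orbit_prop (H_traj H c eps) (x, c + q)
    (\<lambda>\<Gamma>. (\<forall>s<0. \<Gamma> s \<in> graph_grad H c eps) \<and> alpha_acc \<Gamma> \<subseteq> Malpha_star H c eps)"
    using backward_orbit_H by blast
  have "q = grad v x" by (rule supdiff_unique[OF grad_works[OF assms] sg_supdiff[OF q(1)]])
  then show ?thesis using q(2) by simp
qed

end

text \<open>Unique solvability identifies \<open>veps\<close>, a definite description, with the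
  solution built by the scheme for the constant \<open>hcrit H c\<close>.\<close>

lemma kam_epsI:
  fixes H :: "real^'n \<Rightarrow> real^'n \<Rightarrow> real"
  assumes "tonelli_ham H" "eps > 0"
  shows "kam_eps H c eps"
proof -
  interpret discounted H c "hcrit H c" eps by unfold_locales (use assms in auto)
  obtain w where w: "visc_sol H c eps (hcrit H c) w" "\<forall>R\<ge>R0. weak_sol R w"
    using visc_sol_exists by blast
  have "veps H c eps = w"
    unfolding veps_def by (rule the_equality[of "visc_sol H c eps (hcrit H c)", OF w(1)]) (rule visc_sol_unique[OF _ w(1)])
  then have "\<forall>R\<ge>R0. weak_sol R (veps H c eps)" using w(2) by simp
  then show ?thesis by unfold_locales blast
qed

theorem theorem3p6:
  fixes H :: "real^'n \<Rightarrow> real^'n \<Rightarrow> real" and c :: "real^'n" and eps :: real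
  assumes "tonelli_ham H" and "eps > 0"
  defines "v \<equiv> veps H c eps"
  shows
    "\<comment> \<open>(i)\<close>
    ((\<forall>x. \<exists>\<xi>. backward_orbit_prop (EL_traj H c eps) (x, \<xi>)
              (\<lambda>\<Gamma>. alpha_acc \<Gamma> \<subseteq> Malpha_tilde H c eps)) \<and>
     (\<forall>x. v differentiable (at x) \<longrightarrow>
          backward_orbit_prop (EL_traj H c eps) (x, Hp H x (c + grad v x))
              (\<lambda>\<Gamma>. alpha_acc \<Gamma> \<subseteq> Malpha_tilde H c eps))) \<and>
    \<comment> \<open>(ii)\<close>
    (\<forall>s. flow_image (EL_traj H c eps) s (Malpha_tilde H c eps) = Malpha_tilde H c eps) \<and>
    \<comment> \<open>(iii)\<close>
    ((\<forall>x. \<exists>p. backward_orbit_prop (H_traj H c eps) (x, p)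
              (\<lambda>\<Gamma>. (\<forall>s<0. \<Gamma> s \<in> graph_grad H c eps) \<and> alpha_acc \<Gamma> \<subseteq> Malpha_star H c eps)) \<and>
     (\<forall>x. v differentiable (at x) \<longrightarrow>
          backward_orbit_prop (H_traj H c eps) (x, c + grad v x)
              (\<lambda>\<Gamma>. (\<forall>s<0. \<Gamma> s \<in> graph_grad H c eps) \<and> alpha_acc \<Gamma> \<subseteq> Malpha_star H c eps))) \<and>
    \<comment> \<open>(iv)\<close>
    (Malpha_star H c eps \<subseteq> graph_grad H c eps \<and>
     (\<forall>s. flow_image (H_traj H c eps) s (Malpha_star H c eps) = Malpha_star H c eps))"
  proof -
  interpret kam_eps H c eps by (rule kam_epsI[OF assms(1,2)])
  show ?thesis
    unfolding assms(3)
  proof (intro conjI allI impI)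
    fix x
    obtain q where q: "backward_orbit_prop (H_traj H c eps) (x, c + q)
        (\<lambda>\<Gamma>. (\<forall>s<0. \<Gamma> s \<in> graph_grad H c eps) \<and> alpha_acc \<Gamma> \<subseteq> Malpha_star H c eps)"
      using backward_orbit_H by blast
    then show "\<exists>p. backward_orbit_prop (H_traj H c eps) (x, p)
        (\<lambda>\<Gamma>. (\<forall>s<0. \<Gamma> s \<in> graph_grad H c eps) \<and> alpha_acc \<Gamma> \<subseteq> Malpha_star H c eps)"
      by blast
    show "\<exists>\<xi>. backward_orbit_prop (EL_traj H c eps) (x, \<xi>) (\<lambda>\<Gamma>. alpha_acc \<Gamma> \<subseteq> Malpha_tilde H c eps)"
      using backward_orbit_EL[OF q] by blast
  next
    fix x assume x: "veps H c eps differentiable (at x)"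
    show H: "backward_orbit_prop (H_traj H c eps) (x, c + grad (veps H c eps) x)
        (\<lambda>\<Gamma>. (\<forall>s<0. \<Gamma> s \<in> graph_grad H c eps) \<and> alpha_acc \<Gamma> \<subseteq> Malpha_star H c eps)"
      by (rule backward_orbit_H_grad[OF x])
    show "backward_orbit_prop (EL_traj H c eps) (x, Hp H x (c + grad (veps H c eps) x))
        (\<lambda>\<Gamma>. alpha_acc \<Gamma> \<subseteq> Malpha_tilde H c eps)"
      by (rule backward_orbit_EL[OF H])
  qed (rule Malpha_tilde_flow Malpha_star_subset_graph Malpha_star_flow)+
qed

end
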